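(* Let $p$ be an odd prime not dividing $d$, which splits in $K=\mathbb{Q}(\sqrt{-d})$, $-d=d_Kf^2$, with $(p)=\mathfrak{p}\mathfrak{p}'$ in $R_K$. (i) If $d_K\ne-3,-4$, then the degree $n$ over $K$ of the prime divisors of $\mathfrak{p}$ in $F_{\mathfrak{p}'}=\Sigma_{\mathfrak{p}'}\Omega_f$ is the smallest positive integer $n$ for which $$\mathfrak{p}^n=\left(\frac{x+y\sqrt{-d}}{2}\right),\quad \frac{x+y\sqrt{-d}}{2}\in\mathsf{R}_{-d},\quad x\equiv\pm1\pmod p,$$ and $\alpha=\frac{x+y\sqrt{-d}}{2}\equiv\pm1\pmod{\mathfrak{p}'}$. (ii) If $d_K=-3$ or $-4$ and $n$ is the degree over $K$ of the prime divisors of $\mathfrak{p}$ in the inertia field $\mathsf{K}_T$ of $\mathfrak{p}$ in $L_{\mathcal{O},p}/K$, then $\mathfrak{p}^n=\left(\frac{x+y\sqrt{-d}}{2}\right)$ for some $\frac{x+y\sqrt{-d}}{2}\in\mathsf{R}_{-d}$ ($x,y\in\mathbb{Z}$) with $x\equiv\zeta\pmod{\mathfrak{p}'}$ for some $\zeta=\pm\rho^r$ (if $d_K=-3$) or $\zeta=i^r$ (if $d_K=-4$), $r\in\mathbb{Z}$.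
   Context: $R_K$ is the ring of integers of $K$, $\mathsf{R}_{-d}$ the order of discriminant $-d$; $x,y\in\mathbb{Z}$. $\Omega_f$ is the ring class field of $K$ of conductor $f$, $\Sigma_{\mathfrak{m}}$ the ray class field of $K$ of conductor $\mathfrak{m}$, $\rho=\frac{-1+\sqrt{-3}}{2}$. $L_{\mathcal{O},p}=\Sigma_p\Omega_{pf}$ is the extended ring class field of $\mathcal{O}=\mathsf{R}_{-d}$ with modulus $p$ (class field of the principal ideals $(\alpha)$ with $\alpha\equiv a\pmod{fp}$, $a\in\mathbb{Z}$, $(a,f)=1$, $a\equiv1\pmod p$), and $\mathsf{K}_T$ is the inertia field of $\mathfrak{p}$ in $L_{\mathcal{O},p}/K$. *)

theory Defs
  imports
    Complex_Main
    "HOL-Algebra.Algebra"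
    "HOL-Algebra.Algebraic_Closure_Type"
    "HOL-Computational_Algebra.Polynomial"
    "HOL-Number_Theory.Cong"
begin

text \<open>All number fields are subfields of the complex numbers, given by their carrier sets.\<close>

abbreviation complex_ring :: "complex ring" where
  "complex_ring \<equiv> ring_of_type_algebra"

definition integer_ring :: "complex set \<Rightarrow> complex ring" where
  "integer_ring K = complex_ring\<lparr>carrier := {z \<in> K. algebraic_int z}\<rparr>"

definition imag_quadratic_field :: "nat \<Rightarrow> complex set" where
  "imag_quadratic_field d = generate_field complex_ring {csqrt (- of_nat d)}"

definition compositum :: "complex set \<Rightarrow> complex set \<Rightarrow> complex set" where
  "compositum L M = generate_field complex_ring (L \<union> M)"

definition int_basis :: "complex \<Rightarrow> complex \<Rightarrow> complex set \<Rightarrow> bool" where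
  "int_basis a b M \<longleftrightarrow>
     M = {of_int m * a + of_int n * b | m n. True} \<and>
     (\<forall>m n. of_int m * a + of_int n * b = 0 \<longrightarrow> m = 0 \<and> n = 0)"

text \<open>The conjugates of an element of an imaginary quadratic field are the element itself and its
  complex conjugate, so the discriminant of a basis is the square of a 2 by 2 determinant.\<close>

definition has_discriminant :: "complex set \<Rightarrow> int \<Rightarrow> bool" where
  "has_discriminant M D \<longleftrightarrow>
     (\<exists>a b. int_basis a b M \<and> (a * cnj b - b * cnj a)\<^sup>2 = of_int D)"

definition quadratic_order :: "complex set \<Rightarrow> complex set \<Rightarrow> bool" where
  "quadratic_order K R \<longleftrightarrow> subring R complex_ring \<and> R \<subseteq> K \<and> (\<exists>a b. int_basis a b R)"

definition prime_of :: "complex set \<Rightarrow> complex set \<Rightarrow> bool" where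
  "prime_of K \<qq> \<longleftrightarrow> primeideal \<qq> (integer_ring K) \<and> \<qq> \<noteq> {0}"

definition prime_above :: "complex set \<Rightarrow> complex set \<Rightarrow> complex set \<Rightarrow> complex set \<Rightarrow> bool" where
  "prime_above K L \<qq> \<QQ> \<longleftrightarrow> prime_of L \<QQ> \<and> \<QQ> \<inter> carrier (integer_ring K) = \<qq>"

definition ideal_power :: "complex set \<Rightarrow> complex set \<Rightarrow> nat \<Rightarrow> complex set" where
  "ideal_power K \<aa> n = \<aa> [^]\<^bsub>ideals_set (integer_ring K)\<^esub> n"

definition ideal_norm :: "complex set \<Rightarrow> complex set \<Rightarrow> nat" where
  "ideal_norm K \<aa> = card (carrier (integer_ring K Quot \<aa>))"

definition residue_degree :: "complex set \<Rightarrow> complex set \<Rightarrow> complex set \<Rightarrow> nat" where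
  "residue_degree K L \<QQ> =
     (let k = integer_ring L Quot \<QQ>
      in ring.dim k ((\<lambda>a. \<QQ> +>\<^bsub>integer_ring L\<^esub> a) ` carrier (integer_ring K)) (carrier k))"

text \<open>Residue fields are finite, hence perfect, so being unramified only concerns the exponents
  of the primes in the factorisation of the extended ideal.\<close>

definition unramified :: "complex set \<Rightarrow> complex set \<Rightarrow> complex set \<Rightarrow> bool" where
  "unramified K L \<qq> \<longleftrightarrow> (\<forall>\<QQ>. prime_above K L \<qq> \<QQ> \<longrightarrow> \<not> \<qq> \<subseteq> ideal_power L \<QQ> 2)"

definition gal_group :: "complex set \<Rightarrow> complex set \<Rightarrow> (complex \<Rightarrow> complex) monoid" where
  "gal_group K L = BijGroup L
     \<lparr>carrier := {\<sigma> \<in> Bij L.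
        \<sigma> \<in> ring_hom (complex_ring\<lparr>carrier := L\<rparr>) (complex_ring\<lparr>carrier := L\<rparr>) \<and>
        (\<forall>x\<in>K. \<sigma> x = x)}\<rparr>"

definition fixed_field :: "complex set \<Rightarrow> (complex \<Rightarrow> complex) set \<Rightarrow> complex set" where
  "fixed_field L H = {x \<in> L. \<forall>\<sigma>\<in>H. \<sigma> x = x}"

definition abelian_extension :: "complex set \<Rightarrow> complex set \<Rightarrow> bool" where
  "abelian_extension K L \<longleftrightarrow>
     subfield K complex_ring \<and> subfield L complex_ring \<and> K \<subseteq> L \<and>
     ring.finite_dimension complex_ring K L \<and>
     fixed_field L (carrier (gal_group K L)) = K \<and>
     comm_group (gal_group K L)"

definition inertia_group ::
  "complex set \<Rightarrow> complex set \<Rightarrow> complex set \<Rightarrow> (complex \<Rightarrow> complex) set" where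
  "inertia_group K L \<QQ> =
     {\<sigma> \<in> carrier (gal_group K L). \<forall>x \<in> carrier (integer_ring L). \<sigma> x - x \<in> \<QQ>}"

definition inertia_field :: "complex set \<Rightarrow> complex set \<Rightarrow> complex set \<Rightarrow> complex set" where
  "inertia_field K L \<QQ> = fixed_field L (inertia_group K L \<QQ>)"

text \<open>In an abelian extension the Frobenius automorphism is the same for all primes above
  a given unramified prime.\<close>

definition frobenius :: "complex set \<Rightarrow> complex set \<Rightarrow> complex set \<Rightarrow> complex \<Rightarrow> complex" where
  "frobenius K L \<qq> =
     (THE \<sigma>. \<sigma> \<in> carrier (gal_group K L) \<and>
        (\<forall>\<QQ>. prime_above K L \<qq> \<QQ> \<longrightarrow>
           (\<forall>x \<in> carrier (integer_ring L). \<sigma> x - x ^ ideal_norm K \<qq> \<in> \<QQ>)))"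

definition ideal_valuation :: "complex set \<Rightarrow> complex set \<Rightarrow> complex set \<Rightarrow> nat" where
  "ideal_valuation K \<qq> \<aa> = (GREATEST n. \<aa> \<subseteq> ideal_power K \<qq> n)"

definition artin_symbol :: "complex set \<Rightarrow> complex set \<Rightarrow> complex set \<Rightarrow> complex \<Rightarrow> complex" where
  "artin_symbol K L \<aa> =
     finprod (gal_group K L)
       (\<lambda>\<qq>. frobenius K L \<qq> [^]\<^bsub>gal_group K L\<^esub> ideal_valuation K \<qq> \<aa>)
       {\<qq>. prime_of K \<qq> \<and> \<aa> \<subseteq> \<qq>}"

definition coprime_ideal :: "complex set \<Rightarrow> complex set \<Rightarrow> complex set \<Rightarrow> bool" where
  "coprime_ideal K \<mm> \<aa> \<longleftrightarrow>
     ideal \<aa> (integer_ring K) \<and> \<aa> \<noteq> {0} \<and> \<aa> <+>\<^bsub>integer_ring K\<^esub> \<mm> = carrier (integer_ring K)"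

text \<open>Fractional ideals prime to \<open>\<mm>\<close> are written as quotients of integral ideals \<open>\<aa>\<close>, \<open>\<bb>\<close>
  prime to \<open>\<mm>\<close>. For a multiplicatively closed set \<open>S\<close> of nonzero integers, the subgroup generated
  by the principal ideals of members of \<open>S\<close> consists of the quotients of two such ideals. The last
  condition says that this subgroup is the kernel of the Artin map on the fractional ideals
  prime to \<open>\<mm>\<close>.\<close>

definition artin_kernel_field ::
  "complex set \<Rightarrow> complex set \<Rightarrow> complex set \<Rightarrow> complex set \<Rightarrow> bool" where
  "artin_kernel_field K \<mm> S L \<longleftrightarrow>
     abelian_extension K L \<and>
     (\<forall>\<qq>. prime_of K \<qq> \<and> \<not> \<mm> \<subseteq> \<qq> \<longrightarrow> unramified K L \<qq>) \<and>
     (\<forall>\<aa> \<bb>. coprime_ideal K \<mm> \<aa> \<and> coprime_ideal K \<mm> \<bb> \<longrightarrow>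
        (artin_symbol K L \<aa> = artin_symbol K L \<bb> \<longleftrightarrow>
         (\<exists>\<alpha>\<in>S. \<exists>\<beta>\<in>S. (PIdl\<^bsub>integer_ring K\<^esub> \<beta>) \<cdot>\<^bsub>integer_ring K\<^esub> \<aa> = (PIdl\<^bsub>integer_ring K\<^esub> \<alpha>) \<cdot>\<^bsub>integer_ring K\<^esub> \<bb>)))"

text \<open>The class field of an ideal group is the unique abelian extension that is unramified outside
  the modulus and whose Artin map has the ideal group as its kernel.\<close>

definition class_field ::
  "complex set \<Rightarrow> complex set \<Rightarrow> complex set \<Rightarrow> complex set \<Rightarrow> bool" where
  "class_field K \<mm> S L \<longleftrightarrow>
     artin_kernel_field K \<mm> S L \<and> (\<forall>L'. artin_kernel_field K \<mm> S L' \<longrightarrow> L' = L)"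

text \<open>No conditions at infinite places are needed below, since the base field is imaginary.\<close>

definition ray_class_field :: "complex set \<Rightarrow> complex set \<Rightarrow> complex set \<Rightarrow> bool" where
  "ray_class_field K \<mm> L \<longleftrightarrow>
     class_field K \<mm> {\<alpha> \<in> carrier (integer_ring K). \<alpha> \<noteq> 0 \<and> \<alpha> - 1 \<in> \<mm>} L"

definition ring_class_field :: "complex set \<Rightarrow> nat \<Rightarrow> complex set \<Rightarrow> bool" where
  "ring_class_field K f L \<longleftrightarrow>
     class_field K (PIdl\<^bsub>integer_ring K\<^esub> (of_nat f))
       {\<alpha> \<in> carrier (integer_ring K). \<alpha> \<noteq> 0 \<and>
          (\<exists>a::int. coprime a (int f) \<and> \<alpha> - of_int a \<in> PIdl\<^bsub>integer_ring K\<^esub> (of_nat f))} L"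

definition half_elem :: "nat \<Rightarrow> int \<Rightarrow> int \<Rightarrow> complex" where
  "half_elem d x y = (of_int x + of_int y * csqrt (- of_nat d)) / 2"

definition \<rho> :: complex where
  "\<rho> = (-1 + csqrt (-3)) / 2"

end

theory Submission
  imports Defs "Jordan_Normal_Form.Char_Poly"
begin

text \<open>
  By the defining property of the Artin map, \<open>\<pp>\<^sup>n\<close> has trivial Frobenius in the ray class field
  of \<open>\<pp>'\<close> iff it has a generator \<open>\<gamma> \<equiv> 1 (mod \<pp>')\<close>, and in the ring class field of conductor \<open>f\<close> iff it
  has a generator \<open>\<delta> \<in> R\<close>. Two generators differ by a unit \<open>\<zeta>\<close>, so \<open>\<delta> \<equiv> \<zeta> (mod \<pp>')\<close>; since \<open>\<delta> \<in> \<pp>\<close>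
  has its conjugate in \<open>\<pp>'\<close>, the trace \<open>x = \<delta> + cnj \<delta>\<close> satisfies \<open>x \<equiv> \<delta> \<equiv> \<zeta>\<close>. In the unramified
  compositum the residue degree is the least \<open>n\<close> for which both Frobenius powers vanish. In the
  exceptional cases both class fields are unramified at \<open>\<pp>\<close> and contained in the extended ring class
  field, hence in its inertia field, whose residue degree therefore kills both Frobenius elements.

  The required theory of Frobenius elements over an arbitrary base field avoids ideal factorization:
  at a prime \<open>Q\<close> one only needs a local uniformizer, that is, \<open>y \<in> Q\<close> and \<open>s \<notin> Q\<close> with \<open>s * Q \<subseteq> (y)\<close>,
  and Dedekind independence of automorphisms, used also modulo primary ideals.
\<close>

section \<open>Algebraic integers\<close>

text \<open>The class fields enter only through a predicate: unramified outside the modulus,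
  prescribed Artin kernel, unique with these properties. An inclusion between them must therefore
  come from the uniqueness clause: the compositum of two class fields has the smaller of the two
  Artin kernels, so it equals the larger field. Two quantities of different nature are compared, a
  dimension over a residue field and the order of a Frobenius automorphism. They meet in one
  congruence, x^(N^m) = x modulo Q for all integers x of the field: counting roots in the residue
  field bounds the residue degree by any such m > 0, while an automorphism congruent to the identity
  modulo Q is an inertia element and hence trivial. Ramification is defined through exponents of
  primes but passes to a compositum only through inertia groups; this is why both implications
  between the two notions are proved. Everything local rests on finiteness of the residue rings. It
  is obtained from sets independent modulo a rational prime, without an integral basis; pigeonhole
  on the powers of an element then yields inverses modulo Q.\<close>

interpretation ZM: Modules.module "\<lambda>(k::int) (z::complex). of_int k * z"
  by standard (simp_all add: algebra_simps)

interpretation QV: Vector_Spaces.vector_space "\<lambda>(q::rat) (z::complex). of_rat q * z"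
  by standard (simp_all add: algebra_simps of_rat_add of_rat_mult)

text \<open>The characteristic polynomial is monic with integer coefficients and has the eigenvalue
  as a root.\<close>

lemma algebraic_int_eigenvalue:
  fixes z :: complex and A :: "int mat"
  assumes A: "A \<in> carrier_mat n n"
    and "eigenvalue (map_mat of_int A :: complex mat) z"
  shows "algebraic_int z"
proof -
  have A': "(map_mat of_int A :: complex mat) \<in> carrier_mat n n" using A by simp
  have "poly (char_poly (map_mat of_int A :: complex mat)) z = 0"
    using assms(2) eigenvalue_root_char_poly[OF A'] by blast
  then have "poly (map_poly of_int (char_poly A)) z = 0"
    by (simp add: of_int_hom.char_poly_hom[OF A])
  moreover have "lead_coeff (char_poly A) = 1"
    using degree_monic_char_poly[OF A] by simp
  ultimately show ?thesis
    unfolding algebraic_int_altdef_ipoly by blast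
qed

text \<open>The determinant trick: the matrix of multiplication by \<open>z\<close> on the
  generators has the vector of generators itself as an eigenvector. The generators may be dependent;
  \<open>w0\<close> ensures that this vector is nonzero.\<close>

lemma algebraic_int_of_stable_module:
  fixes z :: complex
  assumes fin: "finite W" and w0: "w0 \<in> W" "w0 \<noteq> 0"
    and stable: "\<And>w. w \<in> W \<Longrightarrow> z * w \<in> ZM.span W"
  shows "algebraic_int z"
proof -
  define n where "n = card W"
  obtain h where h: "bij_betw h {0..<n} W"
    using ex_bij_betw_nat_finite[OF fin] n_def by blast
  have "\<exists>u. z * w = (\<Sum>v\<in>W. of_int (u v :: int) * v)" if "w \<in> W" for w
    using stable[OF that] unfolding ZM.span_finite[OF fin] by auto
  then obtain c where c: "\<And>w. w \<in> W \<Longrightarrow> z * w = (\<Sum>v\<in>W. of_int (c w v :: int) * v)"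
    by metis
  define A where "A = mat n n (\<lambda>(i,j). c (h i) (h j))"
  define v where "v = vec n h"
  have A: "A \<in> carrier_mat n n" by (simp add: A_def)
  have hW: "h i \<in> W" if "i < n" for i using h that by (auto simp: bij_betw_def)
  have "map_mat of_int A *\<^sub>v v = z \<cdot>\<^sub>v v"
  proof (rule eq_vecI)
    fix i assume "i < dim_vec (z \<cdot>\<^sub>v v)"
    then have i: "i < n" by (simp add: v_def)
    have "(map_mat of_int A *\<^sub>v v) $ i = (\<Sum>j = 0..<n. of_int (c (h i) (h j)) * h j)"
      using i by (simp add: A_def v_def scalar_prod_def)
    also have "\<dots> = (\<Sum>v\<in>W. of_int (c (h i) v) * v)"
      by (rule sum.reindex_bij_betw[OF h])
    also have "\<dots> = z * h i" using c[OF hW[OF i]] by simp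
    finally show "(map_mat of_int A *\<^sub>v v) $ i = (z \<cdot>\<^sub>v v) $ i"
      using i by (simp add: v_def)
  qed (simp add: A_def v_def)
  moreover have "v \<noteq> 0\<^sub>v n"
  proof
    assume v0: "v = 0\<^sub>v n"
    obtain i where i: "i < n" "h i = w0" using h w0 by (auto simp: bij_betw_def)
    have "v $ i = w0" using i by (simp add: v_def)
    with v0 i w0 show False by simp
  qed
  ultimately have "eigenvector (map_mat of_int A :: complex mat) v z"
    unfolding eigenvector_def by (simp add: A_def v_def)
  then show ?thesis
    using algebraic_int_eigenvalue[OF A] unfolding eigenvalue_def by blast
qed

lemma algebraic_int_power_reduction:
  fixes x :: complex
  assumes "algebraic_int x"
  obtains m where "m > 0" "\<exists>c::nat \<Rightarrow> int. x ^ m = (\<Sum>i<m. of_int (c i) * x ^ i)"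
proof -
  from assms obtain p where p: "poly (map_poly of_int p) x = 0" "lead_coeff p = 1"
    unfolding algebraic_int_altdef_ipoly by blast
  define m where "m = Polynomial.degree p"
  have eq: "(\<Sum>i\<le>m. of_int (Polynomial.coeff p i) * x ^ i) = 0"
    using p(1) by (simp add: poly_altdef m_def degree_map_poly coeff_map_poly)
  have m: "m > 0"
  proof (rule ccontr)
    assume "\<not> m > 0"
    then have "of_int (lead_coeff p) = (0::complex)" using eq by (simp add: m_def)
    then show False using p(2) by simp
  qed
  have "x ^ m = (\<Sum>i<m. of_int (- Polynomial.coeff p i) * x ^ i)"
    using eq p(2) by (simp add: lessThan_Suc_atMost[symmetric] m_def sum_negf add_eq_0_iff)
  then show ?thesis using m that by metis
qed

text \<open>One module serves both claims: the products x^i * y^j below the two degrees span a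
  module stable under \<open>x\<close> and under \<open>y\<close>, hence under their sum and
  product. The monic relations are needed only at the top exponents.\<close>

lemma algebraic_int_plus_times:
  fixes x y :: complex
  assumes "algebraic_int x" "algebraic_int y"
  shows "algebraic_int (x + y) \<and> algebraic_int (x * y)"
proof -
  obtain m c where m: "m > 0" and c: "x ^ m = (\<Sum>i<m. of_int (c i :: int) * x ^ i)"
    using algebraic_int_power_reduction[OF assms(1)] by metis
  obtain n e where n: "n > 0" and e: "y ^ n = (\<Sum>i<n. of_int (e i :: int) * y ^ i)"
    using algebraic_int_power_reduction[OF assms(2)] by metis
  define W where "W = (\<lambda>(i,j). x ^ i * y ^ j) ` ({..<m} \<times> {..<n})"
  have fin: "finite W" by (simp add: W_def)
  have W: "x ^ i * y ^ j \<in> ZM.span W" if "i < m" "j < n" for i j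
    by (rule ZM.span_base) (use that in \<open>auto simp: W_def\<close>)
  have sx: "x * w \<in> ZM.span W" if w: "w \<in> W" for w
  proof -
    obtain i j where ij: "i < m" "j < n" "w = x ^ i * y ^ j" using w unfolding W_def by auto
    show ?thesis
    proof (cases "Suc i < m")
      case True
      then show ?thesis using W[of "Suc i" j] ij by (simp add: mult.assoc)
    next
      case False
      then have "Suc i = m" using ij by simp
      then have "x * w = x ^ m * y ^ j" using ij by auto
      also have "\<dots> = (\<Sum>i<m. of_int (c i) * (x ^ i * y ^ j))"
        by (simp add: c sum_distrib_right mult.assoc)
      also have "\<dots> \<in> ZM.span W"
        by (intro ZM.span_sum ZM.span_scale W) (use ij in auto)
      finally show ?thesis .
    qed
  qed
  have sy: "y * w \<in> ZM.span W" if w: "w \<in> W" for w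
  proof -
    obtain i j where ij: "i < m" "j < n" "w = x ^ i * y ^ j" using w unfolding W_def by auto
    show ?thesis
    proof (cases "Suc j < n")
      case True
      then show ?thesis using W[of i "Suc j"] ij by (simp add: mult_ac)
    next
      case False
      then have "Suc j = n" using ij by simp
      then have "y * w = x ^ i * y ^ n" using ij by (auto simp: mult_ac)
      also have "\<dots> = (\<Sum>j<n. of_int (e j) * (x ^ i * y ^ j))"
        by (simp add: e sum_distrib_left mult_ac)
      also have "\<dots> \<in> ZM.span W"
        by (intro ZM.span_sum ZM.span_scale W) (use ij in auto)
      finally show ?thesis .
    qed
  qed
  \<comment> \<open>For the product, \<open>x\<close> is applied to \<open>y * w\<close>, which is a
    combination of generators and no longer a generator.\<close>
  have sx': "x * w \<in> ZM.span W" if "w \<in> ZM.span W" for w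
    using that
  proof (induction rule: ZM.span_induct_alt)
    case base
    then show ?case by (simp add: ZM.span_zero)
  next
    case (step k a b)
    have "x * (of_int k * a + b) = of_int k * (x * a) + x * b" by (simp add: algebra_simps)
    then show ?case using ZM.span_add[OF ZM.span_scale[OF sx[OF step(1)], of k] step(2)] by simp
  qed
  have "(\<lambda>(i,j). x ^ i * y ^ j) (0,0) \<in> W"
    unfolding W_def by (rule imageI) (use m n in simp)
  then have w0: "1 \<in> W" by simp
  have "algebraic_int (x + y)"
    by (rule algebraic_int_of_stable_module[OF fin w0])
       (auto simp: distrib_right intro: ZM.span_add sx sy)
  moreover have "algebraic_int (x * y)"
    by (rule algebraic_int_of_stable_module[OF fin w0])
       (auto simp: mult.assoc intro: sx' sy)
  ultimately show ?thesis by blast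
qed

lemma algebraic_int_plus: "algebraic_int x \<Longrightarrow> algebraic_int y \<Longrightarrow> algebraic_int (x + y)"
  and algebraic_int_times: "algebraic_int x \<Longrightarrow> algebraic_int y \<Longrightarrow> algebraic_int (x * y)"
  for x y :: complex
  using algebraic_int_plus_times by blast+

lemma algebraic_int_diff: "algebraic_int x \<Longrightarrow> algebraic_int y \<Longrightarrow> algebraic_int (x - y)"
  for x y :: complex
  using algebraic_int_plus[of x "- y"] by auto

lemma algebraic_int_multiple:
  fixes x :: complex
  assumes "algebraic x"
  obtains N :: int where "N \<noteq> 0" "algebraic_int (of_int N * x)"
proof -
  obtain p where p: "p \<noteq> 0" "poly (map_poly of_int p) x = 0"
    using assms by (erule algebraicE')
  define m where "m = Polynomial.degree p"
  define N where "N = lead_coeff p"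
  have N0: "N \<noteq> 0" using p(1) by (simp add: N_def)
  have eq: "(\<Sum>i\<le>m. of_int (Polynomial.coeff p i) * x ^ i) = 0"
    using p(2) by (simp add: poly_altdef m_def degree_map_poly coeff_map_poly)
  show thesis
  proof (cases "m = 0")
    case True
    then have "of_int N = (0::complex)" using eq by (simp add: N_def m_def)
    then show thesis using N0 by simp
  next
    case False
    \<comment> \<open>The generators are the powers of N*x below the degree, where \<open>N\<close>
      is the leading coefficient; scaling by powers of \<open>N\<close> makes the relation for N*x
      monic.\<close>
    define W where "W = (\<lambda>i. of_int (N ^ i) * x ^ i) ` {..<m}"
    have mem: "of_int (N ^ i) * x ^ i \<in> ZM.span W" if "i < m" for i
      using that by (intro ZM.span_base) (auto simp: W_def)
    have "algebraic_int (of_int N * x)"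
    proof (rule algebraic_int_of_stable_module[of W 1])
      show "finite W" by (simp add: W_def)
      show "1 \<in> W" using False by (auto simp: W_def image_iff intro!: bexI[of _ 0])
    next
      fix w assume "w \<in> W"
      then obtain i where i: "i < m" "w = of_int (N ^ i) * x ^ i" by (auto simp: W_def)
      have w: "of_int N * x * w = of_int (N ^ Suc i) * x ^ Suc i" using i by (simp add: mult_ac)
      show "of_int N * x * w \<in> ZM.span W"
      proof (cases "Suc i < m")
        case True
        then show ?thesis unfolding w by (rule mem)
      next
        case F: False
        then have m: "m = Suc i" using i by simp
        have "(\<Sum>j<m. of_int (Polynomial.coeff p j) * x ^ j) + of_int N * x ^ m = 0"
          using eq by (simp add: lessThan_Suc_atMost[symmetric] N_def m_def)
        then have "of_int N * x ^ m = - (\<Sum>j<m. of_int (Polynomial.coeff p j) * x ^ j)"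
          by (simp add: eq_neg_iff_add_eq_0 add.commute)
        \<comment> \<open>With m = i + 1, multiplication by N^i turns the top term into (N*x)^m, and
          in each lower term N^i splits as N^(i-j) * N^j.\<close>
        then have "of_int (N ^ i) * (of_int N * x ^ m) = of_int (N ^ i) * (- (\<Sum>j<m. of_int (Polynomial.coeff p j) * x ^ j))"
          by simp
        also have "\<dots> = (\<Sum>j<m. of_int (- Polynomial.coeff p j * N ^ (i - j)) * (of_int (N ^ j) * x ^ j))"
          unfolding sum_negf[symmetric] sum_distrib_left
        proof (rule sum.cong[OF refl])
          fix j assume "j \<in> {..<m}"
          then have "N ^ i = N ^ (i - j) * N ^ j" by (simp add: m power_add[symmetric])
          then show "of_int (N ^ i) * - (of_int (Polynomial.coeff p j) * x ^ j) =
            of_int (- Polynomial.coeff p j * N ^ (i - j)) * (of_int (N ^ j) * x ^ j)" by simp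
        qed
        also have "\<dots> \<in> ZM.span W"
          by (intro ZM.span_sum ZM.span_scale mem) auto
        finally show ?thesis unfolding w m by (simp add: mult_ac)
      qed
    qed auto
    then show thesis using N0 that by blast
  qed
qed

text \<open>A monic relation of least degree has a nonzero constant term, since otherwise
  \<open>x\<close> could be cancelled. Solving for that constant exhibits it as a multiple of
  \<open>x\<close>; this is how nonzero ideals are seen to contain nonzero rational
  integers.\<close>

lemma algebraic_int_divides_int:
  fixes x :: complex
  assumes x: "algebraic_int x" "x \<noteq> 0"
  obtains k :: int and n and c :: "nat \<Rightarrow> int"
    where "k \<noteq> 0" "of_int k = x * (\<Sum>i<n. of_int (c i) * x ^ i)"
proof -
  define P where "P m \<longleftrightarrow> m > 0 \<and> (\<exists>c::nat \<Rightarrow> int. x ^ m = (\<Sum>i<m. of_int (c i) * x ^ i))" for m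
  have ex: "\<exists>m. P m" using algebraic_int_power_reduction[OF x(1)] unfolding P_def by metis
  define m where "m = (LEAST m. P m)"
  have "P m" unfolding m_def using ex by (rule LeastI_ex)
  then obtain n c where n: "m = Suc n" and c: "x ^ m = (\<Sum>i<m. of_int (c i :: int) * x ^ i)"
    unfolding P_def by (metis gr0_implies_Suc)
  have split: "x ^ m = of_int (c 0) + x * (\<Sum>i<n. of_int (c (Suc i)) * x ^ i)"
    using c unfolding n by (simp add: sum.lessThan_Suc_shift sum_distrib_left mult_ac del: sum.lessThan_Suc)
  have c0: "c 0 \<noteq> 0"
  proof
    assume "c 0 = 0"
    then have "x * x ^ n = x * (\<Sum>i<n. of_int (c (Suc i)) * x ^ i)" using split n by simp
    then have eq: "x ^ n = (\<Sum>i<n. of_int (c (Suc i)) * x ^ i)" using x(2) by simp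
    have "n > 0" using eq by (cases n) auto
    then have "P n" unfolding P_def using eq by (auto intro!: exI[of _ "\<lambda>i. c (Suc i)"])
    then have "m \<le> n" unfolding m_def by (rule Least_le)
    then show False using n by simp
  qed
  define e where "e i = (if i = n then 1 else - c (Suc i))" for i
  have "x * (\<Sum>i<Suc n. of_int (e i) * x ^ i) = x * (x ^ n - (\<Sum>i<n. of_int (c (Suc i)) * x ^ i))"
    by (simp add: e_def sum_negf)
  also have "\<dots> = of_int (c 0)" using split n by (simp add: algebra_simps)
  finally show thesis using c0 that[of "c 0" e "Suc n"] by simp
qed

section \<open>Number fields and their rings of integers\<close>

lemma complex_ring_simps [simp]:
  "carrier complex_ring = UNIV" "x \<otimes>\<^bsub>complex_ring\<^esub> y = x * y" "x \<oplus>\<^bsub>complex_ring\<^esub> y = x + y"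
  "\<one>\<^bsub>complex_ring\<^esub> = 1" "\<zero>\<^bsub>complex_ring\<^esub> = 0"
  by (simp_all add: ring_of_type_algebra_def)

lemma field_complex_ring: "Ring.field complex_ring"
  by (rule field_from_type_algebra)

interpretation CR: cring complex_ring
  by (rule cring_from_type_algebra)

lemma complex_ring_a_inv [simp]: "\<ominus>\<^bsub>complex_ring\<^esub> x = - x"
  by (rule CR.minus_equality) simp_all

lemma complex_ring_m_inv [simp]: "x \<noteq> 0 \<Longrightarrow> inv\<^bsub>complex_ring\<^esub> x = inverse x"
  by (rule CR.comm_inv_char) simp_all

text \<open>Names the carrier of \<open>integer_ring\<close>, so that the ring operations on it can
  be simplified to plain complex arithmetic.\<close>

definition OI :: "complex set \<Rightarrow> complex set" where
  "OI L = {z \<in> L. algebraic_int z}"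

lemma integer_ring_simps [simp]:
  "carrier (integer_ring L) = OI L" "x \<otimes>\<^bsub>integer_ring L\<^esub> y = x * y"
  "x \<oplus>\<^bsub>integer_ring L\<^esub> y = x + y" "\<one>\<^bsub>integer_ring L\<^esub> = 1" "\<zero>\<^bsub>integer_ring L\<^esub> = 0"
  by (simp_all add: integer_ring_def OI_def)

locale cfield =
  fixes L :: "complex set"
  assumes subfield: "subfield L complex_ring"
begin

lemma zero_in [simp]: "0 \<in> L" and one_in [simp]: "1 \<in> L"
  and neg_in: "x \<in> L \<Longrightarrow> - x \<in> L" 
  and mult_in: "x \<in> L \<Longrightarrow> y \<in> L \<Longrightarrow> x * y \<in> L"
  and add_in: "x \<in> L \<Longrightarrow> y \<in> L \<Longrightarrow> x + y \<in> L"
  using subringE[OF subfieldE(1)[OF subfield]] by simp_all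

lemma diff_in: "x \<in> L \<Longrightarrow> y \<in> L \<Longrightarrow> x - y \<in> L"
  using add_in[of x "- y"] neg_in by simp

lemma inverse_in: "x \<in> L \<Longrightarrow> inverse x \<in> L"
  using CR.subfield_m_inv(1)[OF subfield, of x] by (cases "x = 0") auto

lemma divide_in: "x \<in> L \<Longrightarrow> y \<in> L \<Longrightarrow> x / y \<in> L"
  by (simp add: divide_inverse mult_in inverse_in)

lemma power_in: "x \<in> L \<Longrightarrow> x ^ n \<in> L"
  by (induction n) (auto intro: mult_in)

lemma of_nat_in [simp]: "of_nat n \<in> L"
  by (induction n) (auto intro: add_in)

lemma of_int_in [simp]: "of_int n \<in> L"
  by (cases n) (auto intro: neg_in simp del: of_nat_Suc)

lemma of_rat_in [simp]: "of_rat q \<in> L"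
  by (cases q) (auto simp: of_rat_rat intro: divide_in)

lemma sum_in: "(\<And>i. i \<in> A \<Longrightarrow> g i \<in> L) \<Longrightarrow> sum g A \<in> L"
  by (induction A rule: infinite_finite_induct) (auto intro: add_in)

lemma prod_in: "(\<And>i. i \<in> A \<Longrightarrow> g i \<in> L) \<Longrightarrow> prod g A \<in> L"
  by (induction A rule: infinite_finite_induct) (auto intro: mult_in)

lemma OI_subset: "x \<in> OI L \<Longrightarrow> x \<in> L" by (simp add: OI_def)

lemma OI_zero [simp]: "0 \<in> OI L" and OI_one [simp]: "1 \<in> OI L"
  and OI_of_nat [simp]: "of_nat n \<in> OI L" and OI_of_int [simp]: "of_int k \<in> OI L"
  and OI_neg: "x \<in> OI L \<Longrightarrow> - x \<in> OI L" 
  and OI_mult: "x \<in> OI L \<Longrightarrow> y \<in> OI L \<Longrightarrow> x * y \<in> OI L"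
  and OI_add: "x \<in> OI L \<Longrightarrow> y \<in> OI L \<Longrightarrow> x + y \<in> OI L"
  and OI_diff: "x \<in> OI L \<Longrightarrow> y \<in> OI L \<Longrightarrow> x - y \<in> OI L"
  by (simp_all add: OI_def neg_in mult_in add_in diff_in algebraic_int_plus algebraic_int_times
      algebraic_int_diff)

lemma OI_power: "x \<in> OI L \<Longrightarrow> x ^ n \<in> OI L"
  by (induction n) (auto intro: OI_mult)

lemma OI_sum: "(\<And>i. i \<in> A \<Longrightarrow> g i \<in> OI L) \<Longrightarrow> sum g A \<in> OI L"
  by (induction A rule: infinite_finite_induct) (auto intro: OI_add)

lemma OI_prod: "(\<And>i. i \<in> A \<Longrightarrow> g i \<in> OI L) \<Longrightarrow> prod g A \<in> OI L"
  by (induction A rule: infinite_finite_induct) (auto intro: OI_mult)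

lemmas OI_closed = OI_neg OI_mult OI_add OI_diff OI_power OI_sum OI_prod

lemma cring_integer_ring: "cring (integer_ring L)"
proof -
  have "subring (OI L) complex_ring"
    by (rule CR.subringI) (auto intro: OI_closed)
  then have "subcring (OI L) complex_ring"
    by (rule CR.subcringI')
  then show ?thesis
    using CR.subcring_iff[of "OI L"] by (simp add: integer_ring_def OI_def)
qed

sublocale R: cring "integer_ring L" by (rule cring_integer_ring)

lemma OI_divides_int:
  assumes "x \<in> OI L" "x \<noteq> 0"
  obtains k :: nat and y where "k > 0" "y \<in> OI L" "of_nat k = x * y"
proof -
  obtain k :: int and n and c :: "nat \<Rightarrow> int"
    where k: "k \<noteq> 0" "of_int k = x * (\<Sum>i<n. of_int (c i) * x ^ i)"
    by (rule algebraic_int_divides_int[of x]) (use assms in \<open>auto simp: OI_def\<close>)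
  have "(\<Sum>i<n. of_int (c i) * x ^ i) \<in> OI L" using assms by (intro OI_closed) auto
  then have "of_int (sgn k) * (\<Sum>i<n. of_int (c i) * x ^ i) \<in> OI L" by (rule OI_mult[OF OI_of_int])
  moreover have "of_nat (nat \<bar>k\<bar>) = x * (of_int (sgn k) * (\<Sum>i<n. of_int (c i) * x ^ i))"
  proof -
    have "(of_nat (nat \<bar>k\<bar>) :: complex) = of_int \<bar>k\<bar>" by simp
    also have "\<dots> = of_int (sgn k * k)" by (simp only: abs_sgn mult.commute[of k "sgn k"])
    also have "\<dots> = of_int (sgn k) * of_int k" by (rule of_int_mult)
    also have "\<dots> = x * (of_int (sgn k) * (\<Sum>i<n. of_int (c i) * x ^ i))"
      unfolding k(2) by (rule mult.left_commute)
    finally show ?thesis .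
  qed
  moreover have "nat \<bar>k\<bar> > 0" using k by simp
  ultimately show thesis using that by blast
qed

end

lemma cfieldI:
  assumes "1 \<in> L" "\<And>x. x \<in> L \<Longrightarrow> - x \<in> L" "\<And>x y. x \<in> L \<Longrightarrow> y \<in> L \<Longrightarrow> x * y \<in> L"
    "\<And>x y. x \<in> L \<Longrightarrow> y \<in> L \<Longrightarrow> x + y \<in> L" "\<And>x. x \<in> L \<Longrightarrow> x \<noteq> 0 \<Longrightarrow> inverse x \<in> L"
  shows "cfield L"
proof (rule cfield.intro)
  have sr: "subring L complex_ring"
    by (rule CR.subringI) (use assms in auto)
  have "\<And>k. k \<in> L - {0} \<Longrightarrow> inv\<^bsub>complex_ring\<^esub> k \<in> L" using assms(5) by simp
  then show "subfield L complex_ring"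
    using field.subfieldI'[OF field_complex_ring sr] by simp
qed

text \<open>An integral multiple N*z divides a nonzero integer k with a cofactor that is an integer
  polynomial in N*z; dividing by k leaves a rational polynomial in \<open>z\<close>.\<close>

lemma algebraic_inverse_eq_sum:
  fixes z :: complex
  assumes "algebraic z" "z \<noteq> 0"
  obtains n and c :: "nat \<Rightarrow> rat" where "inverse z = (\<Sum>i<n. of_rat (c i) * z ^ i)"
proof -
  obtain N :: int where N: "N \<noteq> 0" "algebraic_int (of_int N * z)"
    using algebraic_int_multiple[OF assms(1)] by blast
  obtain k :: int and n and c :: "nat \<Rightarrow> int" where k: "k \<noteq> 0"
    "of_int k = of_int N * z * (\<Sum>i<n. of_int (c i) * (of_int N * z) ^ i)"
    by (rule algebraic_int_divides_int[OF N(2)]) (use N(1) assms(2) in auto)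
  have "inverse z = of_int N / of_int k * (\<Sum>i<n. of_int (c i) * (of_int N * z) ^ i)"
  proof (rule inverse_unique)
    have "z * (of_int N / of_int k * (\<Sum>i<n. of_int (c i) * (of_int N * z) ^ i))
      = of_int N * z * (\<Sum>i<n. of_int (c i) * (of_int N * z) ^ i) / of_int k" by simp
    also have "\<dots> = 1" unfolding k(2)[symmetric] using k(1) by simp
    finally show "z * (of_int N / of_int k * (\<Sum>i<n. of_int (c i) * (of_int N * z) ^ i)) = 1" .
  qed
  also have "\<dots> = (\<Sum>i<n. of_rat (of_int N / of_int k * of_int (c i) * of_int N ^ i) * z ^ i)"
    unfolding sum_distrib_left
    by (rule sum.cong) (simp_all add: of_rat_mult of_rat_divide of_rat_power power_mult_distrib)
  finally show thesis by (rule that)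
qed

text \<open>Closure under inverses comes for free, the inverse of an algebraic number being a
  rational polynomial in it. Adjunctions, composita and quadratic fields are recognised as fields in
  this way.\<close>

lemma cfield_of_algebraic_ring:
  assumes one: "1 \<in> L" and mult: "\<And>x y. x \<in> L \<Longrightarrow> y \<in> L \<Longrightarrow> x * y \<in> L"
    and add: "\<And>x y. x \<in> L \<Longrightarrow> y \<in> L \<Longrightarrow> x + y \<in> L"
    and rat: "\<And>q x. x \<in> L \<Longrightarrow> of_rat q * x \<in> L"
    and alg: "\<And>x. x \<in> L \<Longrightarrow> algebraic x"
  shows "cfield L"
proof (rule cfieldI)
  show "- x \<in> L" if "x \<in> L" for x using rat[OF that, of "-1"] by simp
next
  fix x assume x: "x \<in> L" "x \<noteq> 0"
  obtain n and c :: "nat \<Rightarrow> rat" where c: "inverse x = (\<Sum>i<n. of_rat (c i) * x ^ i)"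
    using algebraic_inverse_eq_sum[OF alg[OF x(1)] x(2)] .
  have pow: "x ^ i \<in> L" for i by (induction i) (auto intro: one mult x)
  have zero: "0 \<in> L" using rat[OF one, of 0] by simp
  have "(\<Sum>i<n. of_rat (c i) * x ^ i) \<in> L" for n
    by (induction n) (auto intro: zero add rat pow)
  then show "inverse x \<in> L" using c by simp
qed (use assms in auto)

text \<open>card C + 1 distinct powers in the span of \<open>C\<close> are dependent over the
  rationals. If two powers coincide, the set of powers is too small for this count, and a difference
  of two monomials serves instead.\<close>

lemma algebraic_of_powers_in_span:
  assumes C: "finite C" and x: "\<And>i. x ^ i \<in> QV.span C"
  shows "algebraic x"
proof (cases "inj (\<lambda>i::nat. x ^ i)")
  case False
  then obtain i j :: nat where ij: "i \<noteq> j" "x ^ i = x ^ j" by (auto simp: inj_def)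
  show ?thesis
  proof (rule algebraicI)
    show "poly (Polynomial.monom 1 i - Polynomial.monom 1 j) x = 0"
      using ij by (simp add: poly_monom)
    have "Polynomial.coeff (Polynomial.monom 1 i - Polynomial.monom 1 j :: complex poly) i = 1"
      using ij by simp
    then show "Polynomial.monom 1 i - Polynomial.monom 1 j \<noteq> (0 :: complex poly)"
      by (metis coeff_0 zero_neq_one)
  qed auto
next
  case inj: True
  let ?Xs = "(\<lambda>i. x ^ i) ` {..card C}"
  have "card ?Xs = Suc (card C)"
    using inj by (subst card_image) (auto intro: inj_on_subset)
  then have "QV.dependent ?Xs"
    using QV.independent_span_bound[OF C, of ?Xs] x by force
  then obtain u where u: "\<exists>v\<in>?Xs. u v \<noteq> 0" "(\<Sum>v\<in>?Xs. of_rat (u v) * v) = 0"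
    by (subst (asm) QV.dependent_finite) auto
  define p :: "complex poly" where "p = (\<Sum>i\<le>card C. Polynomial.monom (of_rat (u (x ^ i))) i)"
  have cp: "Polynomial.coeff p i = (if i \<le> card C then of_rat (u (x ^ i)) else 0)" for i
    by (simp add: p_def coeff_sum sum.If_cases if_distrib cong: if_cong)
  show ?thesis
  proof (rule algebraicI')
    show "Polynomial.coeff p i \<in> \<rat>" for i by (simp add: cp)
    show "p \<noteq> 0"
    proof
      assume "p = 0"
      then have "of_rat (u (x ^ i)) = (0 :: complex)" if "i \<le> card C" for i
        using cp[of i] that by simp
      then show False using u(1) by auto
    qed
    have "poly p x = (\<Sum>i\<le>card C. of_rat (u (x ^ i)) * x ^ i)"
      by (simp add: p_def poly_sum poly_monom)
    also have "\<dots> = (\<Sum>v\<in>?Xs. of_rat (u v) * v)"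
      using inj by (subst sum.reindex) (auto intro: inj_on_subset)
    finally show "poly p x = 0" using u by simp
  qed
qed

text \<open>Finiteness is containment in the span of some finite set of complex numbers, not
  existence of a basis, so that subfields inherit it with the same set.\<close>

locale number_field = cfield +
  assumes finite_over_Q: "\<exists>B. finite B \<and> L \<subseteq> QV.span B"
begin

lemma subspace_L: "QV.subspace L"
  by (rule QV.subspaceI) (auto intro: add_in mult_in)

lemma span_subset: "B \<subseteq> L \<Longrightarrow> QV.span B \<subseteq> L"
  using QV.span_minimal subspace_L by blast

lemma exists_basis:
  obtains B where "finite B" "B \<subseteq> L" "QV.independent B" "QV.span B = L"
proof -
  obtain C where C: "finite C" "L \<subseteq> QV.span C" using finite_over_Q by blast
  obtain B where B: "B \<subseteq> L" "QV.independent B" "L \<subseteq> QV.span B"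
    using QV.maximal_independent_subset by metis
  have "finite B" using QV.independent_span_bound[OF C(1) B(2)] B(1) C(2) by blast
  moreover have "QV.span B = L" using B span_subset by blast
  ultimately show thesis using that B by blast
qed

lemma independent_bound:
  obtains n where "\<And>Xs. QV.independent Xs \<Longrightarrow> Xs \<subseteq> L \<Longrightarrow> finite Xs \<and> card Xs \<le> n"
proof -
  obtain C where C: "finite C" "L \<subseteq> QV.span C" using finite_over_Q by blast
  show thesis
    by (rule that[of "card C"]) (use QV.independent_span_bound[OF C(1)] C(2) in blast)
qed

lemma L_algebraic: assumes x: "x \<in> L" shows "algebraic x"
proof -
  obtain C where "finite C" "L \<subseteq> QV.span C" using finite_over_Q by blast
  then show ?thesis using algebraic_of_powers_in_span[of C x] power_in[OF x] by blast
qed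

lemma L_multiple_in_OI:
  assumes "x \<in> L"
  obtains N :: int where "N \<noteq> 0" "of_int N * x \<in> OI L"
  using algebraic_int_multiple[OF L_algebraic[OF assms]] assms mult_in[of "of_int _" x]
  by (metis (mono_tags, lifting) OI_def mem_Collect_eq of_int_in)

section \<open>Finiteness of residue rings\<close>

lemma common_denominator:
  fixes u :: "'a \<Rightarrow> rat"
  assumes "finite Xs"
  shows "\<exists>D::int. D > 0 \<and> (\<forall>v\<in>Xs. \<exists>a::int. of_int a = of_int D * u v)"
  using assms
proof induction
  case (insert w Xs)
  then obtain D :: int where D: "D > 0" "\<forall>v\<in>Xs. \<exists>a::int. of_int a = of_int D * u v" by blast
  obtain n d where nd: "u w = Rat.Fract n d" "d > 0" by (cases "u w") auto
  have "\<exists>a::int. of_int a = of_int (D * d) * u v" if v: "v \<in> insert w Xs" for v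
  proof (cases "v = w")
    case True
    then have "of_int (D * n) = of_int (D * d) * u v" using nd by (simp add: Fract_of_int_quotient)
    then show ?thesis by blast
  next
    case False
    then obtain a where "of_int a = of_int D * u v" using D v by blast
    then have "of_int (a * d) = of_int (D * d) * u v" by (simp add: mult_ac)
    then show ?thesis by blast
  qed
  then show ?case using D(1) nd(2) by (intro exI[of _ "D * d"]) simp
qed (auto intro: exI[of _ 1])

text \<open>A set independent modulo \<open>p\<close> is independent over the rationals, so its size
  is bounded by the degree. A largest such set generates the integers modulo \<open>p\<close>, and
  its combinations with coefficients 0, ..., p-1 are the representatives.\<close>

lemma finite_residues_prime:
  assumes p: "Factorial_Ring.prime (p::nat)"
  shows "\<exists>T. finite T \<and> T \<subseteq> OI L \<and> (\<forall>x\<in>OI L. \<exists>t\<in>T. \<exists>y\<in>OI L. x = t + of_nat p * y)"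
proof -
  define indp where "indp Xs \<longleftrightarrow> finite Xs \<and> Xs \<subseteq> OI L \<and>
    (\<forall>c::complex \<Rightarrow> int. (\<exists>y\<in>OI L. (\<Sum>x\<in>Xs. of_int (c x) * x) = of_nat p * y) \<longrightarrow> (\<forall>x\<in>Xs. int p dvd c x))" for Xs
  \<comment> \<open>Infinite descent: in an integral relation all coefficients are divisible by
    \<open>p\<close>, and dividing by \<open>p\<close> gives a relation with a smaller sum of
    absolute values.\<close>
  have rel0: "\<forall>x\<in>Xs. c x = 0" if "indp Xs" "(\<Sum>x\<in>Xs. of_int (c x) * x) = 0"
    for Xs and c :: "complex \<Rightarrow> int"
    using that(2)
  proof (induction "nat (\<Sum>x\<in>Xs. \<bar>c x\<bar>)" arbitrary: c rule: less_induct)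
    case less
    have fin: "finite Xs" using that(1) by (simp add: indp_def)
    have "\<forall>x\<in>Xs. int p dvd c x"
      using that(1) less.prems unfolding indp_def by (metis OI_zero mult_zero_right)
    then obtain e where e: "\<And>x. x \<in> Xs \<Longrightarrow> c x = int p * e x"
      unfolding dvd_def by metis
    have "of_nat p * (\<Sum>x\<in>Xs. of_int (e x) * x) = (\<Sum>x\<in>Xs. of_int (c x) * x)"
      by (simp add: sum_distrib_left e mult_ac)
    then have e0: "(\<Sum>x\<in>Xs. of_int (e x) * x) = 0" using less.prems p by auto
    show ?case
    proof (rule ccontr)
      assume "\<not> (\<forall>x\<in>Xs. c x = 0)"
      then obtain x0 where x0: "x0 \<in> Xs" "c x0 \<noteq> 0" by blast
      have "1 < int p" using p prime_gt_1_nat by simp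
      have le: "\<bar>e x\<bar> \<le> \<bar>c x\<bar>" if "x \<in> Xs" for x
        using e[OF that] \<open>1 < int p\<close> by (simp add: abs_mult mult_le_cancel_right1)
      have "\<bar>e x0\<bar> < \<bar>c x0\<bar>"
        using e[OF x0(1)] \<open>1 < int p\<close> x0(2) by (simp add: abs_mult)
      then have "(\<Sum>x\<in>Xs. \<bar>e x\<bar>) < (\<Sum>x\<in>Xs. \<bar>c x\<bar>)"
        using fin le x0 by (intro sum_strict_mono_ex1) auto
      moreover have "0 \<le> (\<Sum>x\<in>Xs. \<bar>e x\<bar>)" by (simp add: sum_nonneg)
      ultimately have "nat (\<Sum>x\<in>Xs. \<bar>e x\<bar>) < nat (\<Sum>x\<in>Xs. \<bar>c x\<bar>)"
        using nat_less_eq_zless by blast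
      then have "\<forall>x\<in>Xs. e x = 0" using less.hyps e0 by blast
      then show False using x0 e by simp
    qed
  qed
  have indep: "QV.independent Xs" if Xs: "indp Xs" for Xs
  proof
    assume "QV.dependent Xs"
    then obtain u where u: "\<exists>v\<in>Xs. u v \<noteq> 0" "(\<Sum>v\<in>Xs. of_rat (u v) * v) = 0"
      using Xs by (subst (asm) QV.dependent_finite) (auto simp: indp_def)
    have fin: "finite Xs" using Xs by (simp add: indp_def)
    obtain D :: int where D: "D > 0" "\<forall>v\<in>Xs. \<exists>a::int. of_int a = of_int D * u v"
      using common_denominator[OF fin] by blast
    then obtain a :: "complex \<Rightarrow> int" where a: "\<And>v. v \<in> Xs \<Longrightarrow> of_int (a v) = of_int D * u v"
      by metis
    have a': "of_int (a v) = (of_int D * of_rat (u v) :: complex)" if "v \<in> Xs" for v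
      using arg_cong[OF a[OF that], of "of_rat :: rat \<Rightarrow> complex"] by (simp add: of_rat_mult)
    have "(\<Sum>x\<in>Xs. of_int (a x) * x) = of_int D * (\<Sum>v\<in>Xs. of_rat (u v) * v)"
      by (simp add: a' sum_distrib_left mult_ac)
    then have "\<forall>x\<in>Xs. a x = 0" using rel0[OF Xs] u by simp
    then show False using u(1) a D(1) by force
  qed
  obtain n where n: "\<And>Xs. QV.independent Xs \<Longrightarrow> Xs \<subseteq> L \<Longrightarrow> finite Xs \<and> card Xs \<le> n"
    using independent_bound by blast
  have bd: "\<forall>Xs. indp Xs \<longrightarrow> card Xs < Suc n"
    using n indep OI_subset unfolding indp_def less_Suc_eq_le by blast
  have "indp {}" by (simp add: indp_def)
  from ex_has_greatest_nat[of indp, OF this bd] obtain Xs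
    where Xs: "indp Xs" "\<And>Y. indp Y \<Longrightarrow> card Y \<le> card Xs"
    by auto
  have fin: "finite Xs" and XO: "Xs \<subseteq> OI L" using Xs(1) by (auto simp: indp_def)
  have rep: "\<exists>c::complex \<Rightarrow> int. \<exists>z\<in>OI L. y = (\<Sum>x\<in>Xs. of_int (c x) * x) + of_nat p * z" if y: "y \<in> OI L" for y
  proof (cases "y \<in> Xs")
    case True
    have "(\<Sum>x\<in>Xs. of_int (if x = y then 1 else 0) * x) = (\<Sum>x\<in>Xs. if x = y then x else 0)"
      by (rule sum.cong) auto
    also have "\<dots> = y" using True fin by simp
    finally show ?thesis by (intro exI[of _ "\<lambda>x. if x = y then 1 else 0"] bexI[of _ 0]) auto
  next
    case False
    then have "card (insert y Xs) > card Xs" using fin by simp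
    then have "\<not> indp (insert y Xs)" using Xs(2) by fastforce
    then obtain c :: "complex \<Rightarrow> int" and z where c: "z \<in> OI L"
      "(\<Sum>x\<in>insert y Xs. of_int (c x) * x) = of_nat p * z" "\<exists>x\<in>insert y Xs. \<not> int p dvd c x"
      using fin XO y unfolding indp_def by auto
    have c2: "of_int (c y) * y + (\<Sum>x\<in>Xs. of_int (c x) * x) = of_nat p * z"
      using c(2) fin False by simp
    \<comment> \<open>Otherwise the term with \<open>y\<close> could be moved to the multiples of
      \<open>p\<close>, and independence of \<open>Xs\<close> would make every coefficient
      divisible, contrary to the choice of \<open>c\<close>. So the coefficient of \<open>y\<close>
      is invertible modulo \<open>p\<close>, and Bezout solves for \<open>y\<close>.\<close>
    have ndvd: "\<not> int p dvd c y"
    proof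
      assume "int p dvd c y"
      then obtain k where k: "c y = int p * k" by (auto simp: dvd_def)
      have "(\<Sum>x\<in>Xs. of_int (c x) * x) = of_nat p * (z - of_int k * y)"
        using c2 k by (simp add: algebra_simps)
      moreover have "z - of_int k * y \<in> OI L" using c(1) y by (intro OI_closed) auto
      ultimately have "\<forall>x\<in>Xs. int p dvd c x" using Xs(1) unfolding indp_def by blast
      then show False using c(3) \<open>int p dvd c y\<close> by blast
    qed
    have "Factorial_Ring.prime (int p)" using p by simp
    then have "coprime (c y) (int p)" using ndvd by (simp add: prime_imp_coprime coprime_commute)
    then obtain e k where ek: "e * c y + k * int p = 1"
      by (metis bezout_int coprime_imp_gcd_eq_1)
    have "y = of_int (e * c y + k * int p) * y" using ek by simp
    also have "\<dots> = of_int e * (of_int (c y) * y) + of_nat p * (of_int k * y)"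
      by (simp add: algebra_simps)
    also have "of_int (c y) * y = of_nat p * z - (\<Sum>x\<in>Xs. of_int (c x) * x)"
      using c2 by (simp add: algebra_simps)
    finally have "y = (\<Sum>x\<in>Xs. of_int (- e * c x) * x) + of_nat p * (of_int e * z + of_int k * y)"
      by (simp add: algebra_simps sum_distrib_left sum_negf)
    moreover have "of_int e * z + of_int k * y \<in> OI L" using c(1) y by (intro OI_closed) auto
    ultimately show ?thesis by (intro exI[of _ "\<lambda>x. - e * c x"] bexI)
  qed
  define T where "T = (\<lambda>c::complex \<Rightarrow> int. \<Sum>x\<in>Xs. of_int (c x) * x) ` (Xs \<rightarrow>\<^sub>E {0..<int p})"
  have "finite T" unfolding T_def using fin by (intro finite_imageI finite_PiE) auto
  moreover have "T \<subseteq> OI L" using XO by (auto simp: T_def intro!: OI_closed)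
  moreover have "\<exists>t\<in>T. \<exists>y\<in>OI L. w = t + of_nat p * y" if "w \<in> OI L" for w
  proof -
    obtain c :: "complex \<Rightarrow> int" and z where c: "z \<in> OI L" "w = (\<Sum>x\<in>Xs. of_int (c x) * x) + of_nat p * z"
      using rep[OF \<open>w \<in> OI L\<close>] by blast
    define b where "b = restrict (\<lambda>x. c x mod int p) Xs"
    have "int p > 0" using p prime_gt_0_nat by simp
    then have b: "b \<in> Xs \<rightarrow>\<^sub>E {0..<int p}" by (auto simp: b_def)
    have "(\<Sum>x\<in>Xs. of_int (c x) * x) = (\<Sum>x\<in>Xs. of_int (b x) * x + of_nat p * (of_int (c x div int p) * x))"
    proof (rule sum.cong[OF refl])
      fix x assume "x \<in> Xs"
      have "c x = c x mod int p + int p * (c x div int p)" by simp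
      then have "(of_int (c x) :: complex) = of_int (c x mod int p) + of_nat p * of_int (c x div int p)"
        by (metis of_int_add of_int_mult of_int_of_nat_eq)
      then show "of_int (c x) * x = of_int (b x) * x + of_nat p * (of_int (c x div int p) * x)"
        using \<open>x \<in> Xs\<close> by (simp add: b_def algebra_simps)
    qed
    then have "w = (\<Sum>x\<in>Xs. of_int (b x) * x) + of_nat p * ((\<Sum>x\<in>Xs. of_int (c x div int p) * x) + z)"
      using c(2) by (simp add: sum.distrib sum_distrib_left algebra_simps)
    moreover have "(\<Sum>x\<in>Xs. of_int (c x div int p) * x) + z \<in> OI L"
      using XO c(1) by (intro OI_closed) auto
    ultimately show ?thesis using b unfolding T_def by blast
  qed
  ultimately show ?thesis by blast
qed

text \<open>Digit expansion: t + p*s with \<open>t\<close> a representative modulo \<open>p\<close>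
  and \<open>s\<close> a representative modulo the cofactor.\<close>

lemma finite_residues:
  assumes "N > (0::nat)"
  shows "\<exists>T. finite T \<and> T \<subseteq> OI L \<and> (\<forall>x\<in>OI L. \<exists>t\<in>T. \<exists>y\<in>OI L. x = t + of_nat N * y)"
  using assms
proof (induction N rule: prime_divisors_induct)
  case (unit x)
  then show ?case by (intro exI[of _ "{0}"]) auto
next
  case (factor p x)
  then obtain S where S: "finite S" "S \<subseteq> OI L" "\<forall>z\<in>OI L. \<exists>t\<in>S. \<exists>y\<in>OI L. z = t + of_nat x * y"
    by auto
  obtain T where T: "finite T" "T \<subseteq> OI L" "\<forall>z\<in>OI L. \<exists>t\<in>T. \<exists>y\<in>OI L. z = t + of_nat p * y"
    using finite_residues_prime[OF factor(1)] by blast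
  let ?U = "(\<lambda>(t,s). t + of_nat p * s) ` (T \<times> S)"
  have "\<exists>u\<in>?U. \<exists>y\<in>OI L. z = u + of_nat (p * x) * y" if z: "z \<in> OI L" for z
  proof -
    obtain t y where 1: "t \<in> T" "y \<in> OI L" "z = t + of_nat p * y" using T(3) z by blast
    obtain s w where 2: "s \<in> S" "w \<in> OI L" "y = s + of_nat x * w" using S(3) 1(2) by blast
    have "z = (t + of_nat p * s) + of_nat (p * x) * w" using 1 2 by (simp add: algebra_simps)
    moreover have "t + of_nat p * s \<in> ?U" using 1 2 by force
    ultimately show ?thesis using 2(2) by blast
  qed
  moreover have "finite ?U" using S T by blast
  moreover have "?U \<subseteq> OI L" using S T by (auto intro!: OI_closed)
  ultimately show ?case by blast
qed auto

text \<open>Two powers of \<open>x\<close> fall into the same residue class. This identity later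
  yields inverses modulo a prime ideal, nilpotence modulo \<open>p\<close> and the trivial
  intersection of the powers of a prime ideal.\<close>

lemma power_congruent:
  assumes "N > (0::nat)" "x \<in> OI L"
  obtains m r and y where "r > 0" "y \<in> OI L" "x ^ m * (1 - x ^ r) = of_nat N * y"
proof -
  obtain T where T: "finite T" "T \<subseteq> OI L" "\<forall>x\<in>OI L. \<exists>t\<in>T. \<exists>y\<in>OI L. x = t + of_nat N * y"
    using finite_residues[OF assms(1)] by blast
  have "\<forall>i. \<exists>t\<in>T. \<exists>y\<in>OI L. x ^ i = t + of_nat N * y" using T(3) OI_power[OF assms(2)] by blast
  then obtain t y where ty: "\<And>i::nat. t i \<in> T" "\<And>i. y i \<in> OI L" "\<And>i. x ^ i = t i + of_nat N * y i"
    by metis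
  have "\<not> inj t"
    using T(1) ty(1) by (metis finite_imageD finite_subset image_subsetI infinite_UNIV_nat)
  then obtain i j where ij: "t i = t j" "i < j" unfolding inj_def by (metis linorder_neqE_nat)
  have "x ^ i * (1 - x ^ (j - i)) = x ^ i - x ^ j"
    using ij(2) by (simp add: algebra_simps power_add[symmetric])
  also have "\<dots> = of_nat N * (y i - y j)" using ty(3)[of i] ty(3)[of j] ij(1) by (simp add: algebra_simps)
  finally show thesis using that[of "j - i" "y i - y j" i] ij(2) ty(2) OI_diff by simp
qed

end

section \<open>Prime ideals of the ring of integers\<close>

context cfield
begin

lemma ideal_iff:
  "ideal I (integer_ring L) \<longleftrightarrow> I \<subseteq> OI L \<and> 0 \<in> I \<and> (\<forall>a\<in>I. \<forall>b\<in>I. a + b \<in> I) \<and> (\<forall>r\<in>OI L. \<forall>a\<in>I. r * a \<in> I)"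
proof
  assume "ideal I (integer_ring L)"
  then interpret I: ideal I "integer_ring L" .
  show "I \<subseteq> OI L \<and> 0 \<in> I \<and> (\<forall>a\<in>I. \<forall>b\<in>I. a + b \<in> I) \<and> (\<forall>r\<in>OI L. \<forall>a\<in>I. r * a \<in> I)"
    using I.a_subset I.zero_closed I.a_closed I.I_l_closed by auto
next
  assume I: "I \<subseteq> OI L \<and> 0 \<in> I \<and> (\<forall>a\<in>I. \<forall>b\<in>I. a + b \<in> I) \<and> (\<forall>r\<in>OI L. \<forall>a\<in>I. r * a \<in> I)"
  have neg: "- a \<in> I" if "a \<in> I" for a
    using I that OI_neg[OF OI_one] by (metis mult_minus1)
  have rI: "a * x \<in> I" if "a \<in> I" "x \<in> OI L" for a x
    using I that by (simp add: mult.commute[of a x])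
  have ai: "\<ominus>\<^bsub>integer_ring L\<^esub> a = - a" if "a \<in> OI L" for a
    by (rule R.minus_equality) (use that OI_neg in auto)
  show "ideal I (integer_ring L)"
  proof (rule idealI)
    show "ring (integer_ring L)" by (rule R.ring_axioms)
    show "subgroup I (add_monoid (integer_ring L))"
    proof (rule R.add.subgroupI)
      show "\<And>a. a \<in> I \<Longrightarrow> \<ominus>\<^bsub>integer_ring L\<^esub> a \<in> I" using ai neg I by auto
    qed (use I in auto)
  qed (use I rI in auto)
qed

lemma idealD:
  assumes "ideal I (integer_ring L)"
  shows "a \<in> I \<Longrightarrow> a \<in> OI L" "0 \<in> I" "a \<in> I \<Longrightarrow> b \<in> I \<Longrightarrow> a + b \<in> I"
    "r \<in> OI L \<Longrightarrow> a \<in> I \<Longrightarrow> r * a \<in> I" "r \<in> OI L \<Longrightarrow> a \<in> I \<Longrightarrow> a * r \<in> I"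
    "a \<in> I \<Longrightarrow> - a \<in> I" "a \<in> I \<Longrightarrow> b \<in> I \<Longrightarrow> a - b \<in> I"
proof -
  show *: "a \<in> I \<Longrightarrow> a \<in> OI L" "0 \<in> I" "a \<in> I \<Longrightarrow> b \<in> I \<Longrightarrow> a + b \<in> I"
    "r \<in> OI L \<Longrightarrow> a \<in> I \<Longrightarrow> r * a \<in> I" "r \<in> OI L \<Longrightarrow> a \<in> I \<Longrightarrow> a * r \<in> I" for a b r
    using assms unfolding ideal_iff by (auto simp: mult.commute)
  show neg: "a \<in> I \<Longrightarrow> - a \<in> I" for a
    using *(4)[of "-1" a] OI_neg[OF OI_one] by simp
  show "a \<in> I \<Longrightarrow> b \<in> I \<Longrightarrow> a - b \<in> I"
    using *(3)[of a "- b"] neg by simp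
qed

lemma ideal_sum_in:
  assumes "ideal I (integer_ring L)" "\<And>i. i \<in> A \<Longrightarrow> g i \<in> I"
  shows "sum g A \<in> I"
  using assms(2) by (induction A rule: infinite_finite_induct) (auto intro: idealD[OF assms(1)])

lemma ideal_diff_iff:
  assumes "ideal I (integer_ring L)" "a - b \<in> I"
  shows "a \<in> I \<longleftrightarrow> b \<in> I"
  using idealD(3)[OF assms(1,2), of b] idealD(7)[OF assms(1) _ assms(2), of a] by auto

lemma ideal_eq_OI: "ideal I (integer_ring L) \<Longrightarrow> 1 \<in> I \<Longrightarrow> I = OI L"
  using idealD(1,4)[of I] by fastforce

lemma ideal_OI: "ideal (OI L) (integer_ring L)"
  unfolding ideal_iff by (auto intro: OI_closed)

lemma prime_of_iff:
  "prime_of L Q \<longleftrightarrow> ideal Q (integer_ring L) \<and> 1 \<notin> Q \<and> Q \<noteq> {0} \<and>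
     (\<forall>a\<in>OI L. \<forall>b\<in>OI L. a * b \<in> Q \<longrightarrow> a \<in> Q \<or> b \<in> Q)"
proof
  assume "prime_of L Q"
  then interpret P: primeideal Q "integer_ring L" by (simp add: prime_of_def)
  have "1 \<notin> Q" using P.I_notcarr ideal_eq_OI[OF P.is_ideal] by auto
  then show "ideal Q (integer_ring L) \<and> 1 \<notin> Q \<and> Q \<noteq> {0} \<and>
     (\<forall>a\<in>OI L. \<forall>b\<in>OI L. a * b \<in> Q \<longrightarrow> a \<in> Q \<or> b \<in> Q)"
    using P.I_prime P.is_ideal \<open>prime_of L Q\<close> by (auto simp: prime_of_def)
next
  assume *: "ideal Q (integer_ring L) \<and> 1 \<notin> Q \<and> Q \<noteq> {0} \<and>
     (\<forall>a\<in>OI L. \<forall>b\<in>OI L. a * b \<in> Q \<longrightarrow> a \<in> Q \<or> b \<in> Q)"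
  have "primeideal Q (integer_ring L)"
    by (rule primeidealI) (use * cring_integer_ring in auto)
  then show "prime_of L Q" using * by (simp add: prime_of_def)
qed

lemma PIdl_eq: "PIdl\<^bsub>integer_ring L\<^esub> a = {r * a | r. r \<in> OI L}"
  by (simp add: cgenideal_def)

lemma ideal_PIdl: "a \<in> OI L \<Longrightarrow> ideal (PIdl\<^bsub>integer_ring L\<^esub> a) (integer_ring L)"
  using R.cgenideal_ideal[of a] by simp

lemma mem_PIdl_self: "a \<in> PIdl\<^bsub>integer_ring L\<^esub> a"
  unfolding PIdl_eq using OI_one by force

lemma ideal_prod_memI: "a \<in> I \<Longrightarrow> b \<in> J \<Longrightarrow> a * b \<in> I \<cdot>\<^bsub>integer_ring L\<^esub> J"
  using ideal_prod.prod[of a I b J "integer_ring L"] by simp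

lemma ideal_prod_subsetI:
  assumes "\<And>a b. a \<in> I \<Longrightarrow> b \<in> J \<Longrightarrow> a * b \<in> M" "\<And>a b. a \<in> M \<Longrightarrow> b \<in> M \<Longrightarrow> a + b \<in> M"
  shows "I \<cdot>\<^bsub>integer_ring L\<^esub> J \<subseteq> M"
proof
  fix x assume "x \<in> I \<cdot>\<^bsub>integer_ring L\<^esub> J"
  then show "x \<in> M" by induction (use assms in auto)
qed

lemma PIdl_prod:
  assumes "ideal I (integer_ring L)"
  shows "(PIdl\<^bsub>integer_ring L\<^esub> b) \<cdot>\<^bsub>integer_ring L\<^esub> I = {b * z | z. z \<in> I}"
proof (rule subset_antisym)
  show "(PIdl\<^bsub>integer_ring L\<^esub> b) \<cdot>\<^bsub>integer_ring L\<^esub> I \<subseteq> {b * z | z. z \<in> I}"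
  proof (rule ideal_prod_subsetI)
    fix x y assume "x \<in> PIdl\<^bsub>integer_ring L\<^esub> b" "y \<in> I"
    then obtain r where "r \<in> OI L" "x = r * b" by (auto simp: PIdl_eq)
    then have "x * y = b * (r * y)" "r * y \<in> I" using idealD(4)[OF assms] \<open>y \<in> I\<close> by auto
    then show "x * y \<in> {b * z | z. z \<in> I}" by blast
  next
    fix x y assume "x \<in> {b * z | z. z \<in> I}" "y \<in> {b * z | z. z \<in> I}"
    then obtain u v where "x = b * u" "y = b * v" "u \<in> I" "v \<in> I" by blast
    then have "x + y = b * (u + v)" "u + v \<in> I" using idealD(3)[OF assms] by (auto simp: distrib_left)
    then show "x + y \<in> {b * z | z. z \<in> I}" by blast
  qed
  show "{b * z | z. z \<in> I} \<subseteq> (PIdl\<^bsub>integer_ring L\<^esub> b) \<cdot>\<^bsub>integer_ring L\<^esub> I"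
    using ideal_prod_memI[OF mem_PIdl_self] by blast
qed

end

locale number_field_prime = number_field +
  fixes Q :: "complex set"
  assumes prime: "prime_of L Q"
begin

lemma ideal_Q: "ideal Q (integer_ring L)"
  and one_notin: "1 \<notin> Q"
  and Q_nonzero: "Q \<noteq> {0}"
  and prime_cases: "a \<in> OI L \<Longrightarrow> b \<in> OI L \<Longrightarrow> a * b \<in> Q \<Longrightarrow> a \<in> Q \<or> b \<in> Q"
  using prime unfolding prime_of_iff by auto

lemmas Q_closed = idealD[OF ideal_Q]
lemmas Q_OI = Q_closed(1)
lemmas Q_sum = ideal_sum_in[OF ideal_Q]

lemma prime_power: "a \<in> OI L \<Longrightarrow> a ^ n \<in> Q \<Longrightarrow> a \<in> Q"
  by (induction n) (use one_notin prime_cases OI_power in auto)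

lemma prime_prod:
  "finite A \<Longrightarrow> (\<And>i. i \<in> A \<Longrightarrow> g i \<in> OI L) \<Longrightarrow> prod g A \<in> Q \<Longrightarrow> \<exists>i\<in>A. g i \<in> Q"
proof (induction A rule: finite_induct)
  case (insert x F)
  then have "g x * prod g F \<in> Q" "g x \<in> OI L" "prod g F \<in> OI L" by (auto intro: OI_prod)
  then show ?case using insert prime_cases by auto
qed (use one_notin in auto)

text \<open>A nonzero element of \<open>Q\<close> divides a positive integer, which then lies in
  \<open>Q\<close>; primality of \<open>Q\<close> singles out one of its prime factors.\<close>

lemma exists_rational_prime:
  obtains p :: nat where "Factorial_Ring.prime p" "of_nat p \<in> Q"
proof -
  obtain a where a: "a \<in> Q" "a \<noteq> 0" using Q_nonzero Q_closed(2) by blast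
  obtain k :: nat and y where k: "k > 0" "y \<in> OI L" "of_nat k = a * y"
    using OI_divides_int[OF Q_OI[OF a(1)] a(2)] .
  have "of_nat k \<in> Q" using k a Q_closed by simp
  with k(1) have "\<exists>p. Factorial_Ring.prime p \<and> of_nat p \<in> Q"
  proof (induction k rule: prime_divisors_induct)
    case (unit x)
    then show ?case using one_notin by simp
  next
    case (factor p x)
    then have "of_nat p * of_nat x \<in> Q" by simp
    then have "of_nat p \<in> Q \<or> of_nat x \<in> Q" by (intro prime_cases) auto
    then show ?case using factor by auto
  qed auto
  then show thesis using that by blast
qed

text \<open>The product x^m * (1 - x^r) is a multiple of a rational prime in \<open>Q\<close> and
  its first factor is outside \<open>Q\<close>; so x^r is 1 modulo \<open>Q\<close>, and x^(r-1) is
  the inverse. In other words, \<open>Q\<close> is maximal.\<close>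

lemma unit_mod:
  assumes x: "x \<in> OI L" "x \<notin> Q"
  shows "\<exists>y\<in>OI L. x * y - 1 \<in> Q"
proof -
  obtain p where p: "Factorial_Ring.prime p" "of_nat p \<in> Q" by (rule exists_rational_prime)
  obtain m r y where m: "r > 0" "y \<in> OI L" "x ^ m * (1 - x ^ r) = of_nat p * y"
    using power_congruent[OF prime_gt_0_nat[OF p(1)] x(1)] .
  have "x ^ m * (1 - x ^ r) \<in> Q" unfolding m(3) using p(2) m(2) Q_closed by simp
  then have "1 - x ^ r \<in> Q" using prime_cases prime_power x OI_power OI_diff OI_one by metis
  then have "- (1 - x ^ r) \<in> Q" using Q_closed by blast
  moreover have "- (1 - x ^ r) = x * x ^ (r - 1) - 1" using m(1) by (cases r) auto
  ultimately show ?thesis using OI_power[OF x(1)] by metis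
qed

text \<open>The element \<open>b\<close> spans a minimal ideal of \<open>OI L / p\<close> on which \<open>Q\<close> acts nilpotently,
  so that \<open>b / p\<close> lies in the inverse of \<open>Q\<close> but is not integral.\<close>

lemma exists_socle_element:
  assumes p: "Factorial_Ring.prime (p::nat)" "of_nat p \<in> Q"
  obtains b where "b \<in> OI L" "b \<notin> PIdl\<^bsub>integer_ring L\<^esub> (of_nat p)"
    "\<forall>y\<in>Q. y * b \<in> PIdl\<^bsub>integer_ring L\<^esub> (of_nat p)"
proof -
  define I where "I = PIdl\<^bsub>integer_ring L\<^esub> (of_nat p)"
  have I: "ideal I (integer_ring L)" unfolding I_def by (rule ideal_PIdl) simp
  note Icl = idealD[OF I]
  have pI: "of_nat p * y \<in> I" if "y \<in> OI L" for y
    using that unfolding I_def PIdl_eq by (auto simp: mult.commute)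
  have IQ: "I \<subseteq> Q" using Q_closed(4)[OF _ p(2)] unfolding I_def PIdl_eq by auto
  obtain T where T: "finite T" "T \<subseteq> OI L" "\<forall>x\<in>OI L. \<exists>t\<in>T. \<exists>y\<in>OI L. x = t + of_nat p * y"
    using finite_residues_prime[OF p(1)] by blast
  \<comment> \<open>The product of all representatives outside \<open>Q\<close> is itself outside
    \<open>Q\<close>. For \<open>y\<close> in \<open>Q\<close> it still multiplies some power of
    \<open>y\<close> into (p), because 1 - y^r is congruent to one of its factors.\<close>
  define s where "s = \<Prod>(T - Q)"
  have sO: "s \<in> OI L" unfolding s_def using T by (intro OI_prod) auto
  have sQ: "s \<notin> Q"
    using prime_prod[of "T - Q" "\<lambda>x. x"] T unfolding s_def by auto
  have nil: "\<exists>m. s * y ^ m \<in> I" if y: "y \<in> Q" for y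
  proof -
    have yO: "y \<in> OI L" using y Q_OI by blast
    obtain m r z where m: "r > 0" "z \<in> OI L" "y ^ m * (1 - y ^ r) = of_nat p * z"
      using power_congruent[OF prime_gt_0_nat[OF p(1)] yO] .
    obtain t c where t: "t \<in> T" "c \<in> OI L" "1 - y ^ r = t + of_nat p * c"
      using T(3) yO OI_closed OI_one by metis
    have "y ^ r \<in> Q" using m(1) y yO Q_closed OI_power by (cases r) auto
    moreover have "of_nat p * c \<in> Q" using p t Q_closed by auto
    ultimately have "t \<notin> Q"
      using one_notin t(3) Q_closed(3) by (metis add.commute diff_add_cancel)
    then have "t \<in> T - Q" using t by simp
    then have "s = t * \<Prod>(T - Q - {t})"
      unfolding s_def using T(1) by (intro prod.remove) auto
    moreover have wO: "\<Prod>(T - Q - {t}) \<in> OI L" using T by (intro OI_prod) auto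
    ultimately have "s * y ^ m = \<Prod>(T - Q - {t}) * (y ^ m * (t + of_nat p * c)) - of_nat p * (\<Prod>(T - Q - {t}) * c * y ^ m)"
      by (simp add: algebra_simps)
    also have "\<dots> = of_nat p * (\<Prod>(T - Q - {t}) * z) - of_nat p * (\<Prod>(T - Q - {t}) * c * y ^ m)"
      unfolding t(3)[symmetric] m(3) by (simp add: algebra_simps)
    also have "\<dots> \<in> I" using wO m t yO by (intro Icl(7) pI OI_mult OI_power)
    finally show ?thesis by blast
  qed
  \<comment> \<open>\<open>S b\<close> lists the representatives in the ideal generated by
    \<open>b\<close> and \<open>p\<close>; among the multiples of \<open>s\<close> outside (p), one
    with the fewest representatives generates a minimal such ideal.\<close>
  define S where "S b = {t \<in> T. \<exists>r\<in>OI L. t - r * b \<in> I}" for b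
  define C where "C = {b. (\<exists>c\<in>OI L. b = s * c) \<and> b \<notin> I}"
  have "s \<in> C" unfolding C_def using sQ IQ OI_one by force
  then obtain b where b: "b \<in> C" "\<And>b'. b' \<in> C \<Longrightarrow> card (S b) \<le> card (S b')"
    using ex_has_least_nat[of "\<lambda>b. b \<in> C" s "\<lambda>b. card (S b)"] by blast
  obtain c where c: "c \<in> OI L" "b = s * c" and bI: "b \<notin> I" using b(1) by (auto simp: C_def)
  have bO: "b \<in> OI L" using c sO OI_mult by blast
  have "y * b \<in> I" if y: "y \<in> Q" for y
  proof (rule ccontr)
    assume yb: "y * b \<notin> I"
    have yO: "y \<in> OI L" using y Q_OI by blast
    have "y * b = s * (c * y)" using c by simp
    then have "y * b \<in> C" unfolding C_def using yb yO c OI_mult by blast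
    then have le: "card (S b) \<le> card (S (y * b))" by (rule b(2))
    have sub: "S (y * b) \<subseteq> S b"
    proof
      fix t assume "t \<in> S (y * b)"
      then obtain r where r: "t \<in> T" "r \<in> OI L" "t - r * (y * b) \<in> I" by (auto simp: S_def)
      then have "t - (r * y) * b \<in> I" by (simp add: mult.assoc)
      then show "t \<in> S b" using r yO OI_mult unfolding S_def by blast
    qed
    have "finite (S b)" using T(1) by (simp add: S_def)
    then have eq: "S (y * b) = S b" using sub le by (metis card_seteq)
    obtain t d where t: "t \<in> T" "d \<in> OI L" "b = t + of_nat p * d" using T(3) bO by blast
    have "t - 1 * b = of_nat p * (- d)" using t(3) by simp
    then have "t - 1 * b \<in> I" using pI[OF OI_neg[OF t(2)]] by metis
    then have "t \<in> S b" unfolding S_def using t(1) OI_one by blast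
    then have "t \<in> S (y * b)" using eq by simp
    then obtain r where r: "r \<in> OI L" "t - r * (y * b) \<in> I" by (auto simp: S_def)
    define z where "z = r * y"
    have zO: "z \<in> OI L" using r yO OI_mult z_def by blast
    have "b - z * b = (t - r * (y * b)) + of_nat p * d" using t(3) by (simp add: z_def)
    then have bz: "b - z * b \<in> I" using r(2) pI[OF t(2)] Icl(3) by metis
    \<comment> \<open>By minimality y*b and \<open>b\<close> generate the same ideal modulo
      \<open>p\<close>, so b = z*b modulo \<open>p\<close> with \<open>z\<close> in
      \<open>Q\<close>. Iterating brings in a power of \<open>z\<close> that \<open>s\<close>, a
      factor of \<open>b\<close>, sends into (p).\<close>
    have pow: "b - z ^ m * b \<in> I" for m
    proof (induction m)
      case 0
      then show ?case using Icl(2) by simp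
    next
      case (Suc m)
      have "b - z ^ Suc m * b = (b - z * b) + z * (b - z ^ m * b)" by (simp add: algebra_simps)
      then show ?case using bz Suc Icl(3,4) zO by metis
    qed
    have "z \<in> Q" using z_def r y Q_closed by simp
    then obtain m where "s * z ^ m \<in> I" using nil by blast
    then have "c * (s * z ^ m) \<in> I" using c Icl by blast
    moreover have "c * (s * z ^ m) = z ^ m * b" using c by simp
    ultimately have "b \<in> I" using ideal_diff_iff[OF I pow[of m]] by simp
    then show False using bI by blast
  qed
  then show thesis using that[OF bO] bI I_def by simp
qed

text \<open>If all \<open>j * y\<close> lay in \<open>Q\<close>, the powers of \<open>j\<close> would lie in \<open>OI L / p\<close>; two of them are then
  congruent modulo \<open>OI L\<close>, so \<open>j\<close> would be integral.\<close>

lemma exists_uniformizer: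
  obtains y s where "y \<in> Q" "s \<in> OI L" "s \<notin> Q" "y \<noteq> 0" "\<forall>z\<in>Q. \<exists>w\<in>OI L. s * z = y * w"
proof -
  obtain p where p: "Factorial_Ring.prime p" "of_nat p \<in> Q" by (rule exists_rational_prime)
  obtain b where b: "b \<in> OI L" "b \<notin> PIdl\<^bsub>integer_ring L\<^esub> (of_nat p)"
    "\<forall>y\<in>Q. y * b \<in> PIdl\<^bsub>integer_ring L\<^esub> (of_nat p)"
    using exists_socle_element[OF p] .
  have p0: "(of_nat p :: complex) \<noteq> 0" using prime_gt_0_nat[OF p(1)] by simp
  define j where "j = b / of_nat p"
  have jL: "j \<in> L" using b(1) OI_subset by (auto simp: j_def intro: divide_in)
  have jQ: "j * z \<in> OI L" if z: "z \<in> Q" for z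
  proof -
    obtain r where "r \<in> OI L" "z * b = r * of_nat p" using b(3) z by (auto simp: PIdl_eq)
    then have "j * z = r" using p0 by (simp add: j_def field_simps)
    then show ?thesis using \<open>r \<in> OI L\<close> by simp
  qed
  have jn: "j \<notin> OI L"
  proof
    assume "j \<in> OI L"
    then have "b \<in> PIdl\<^bsub>integer_ring L\<^esub> (of_nat p)" using p0 by (auto simp: PIdl_eq j_def intro!: exI[of _ "b / of_nat p"])
    then show False using b by blast
  qed
  have "\<exists>y\<in>Q. j * y \<notin> Q"
  proof (rule ccontr)
    assume "\<not> (\<exists>y\<in>Q. j * y \<notin> Q)"
    then have st: "\<And>y. y \<in> Q \<Longrightarrow> j * y \<in> Q" by blast
    have pw: "j ^ k * of_nat p \<in> Q" for k
      by (induction k) (use p st in \<open>auto simp: mult.assoc\<close>)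
    obtain T where T: "finite T" "T \<subseteq> OI L" "\<forall>x\<in>OI L. \<exists>t\<in>T. \<exists>y\<in>OI L. x = t + of_nat p * y"
      using finite_residues_prime[OF p(1)] by blast
    have "\<forall>k. \<exists>t\<in>T. \<exists>y\<in>OI L. j ^ k * of_nat p = t + of_nat p * y" using T(3) pw Q_OI by blast
    then obtain t y where ty: "\<And>k::nat. t k \<in> T" "\<And>k. y k \<in> OI L" "\<And>k. j ^ k * of_nat p = t k + of_nat p * y k"
      by metis
    have "\<not> inj_on t {1..}"
    proof
      assume "inj_on t {1..}"
      moreover have "finite (t ` {1..})" using T(1) ty(1) by (meson finite_subset image_subsetI)
      ultimately show False using finite_imageD infinite_Ici by blast
    qed
    then obtain k l where kl: "t k = t l" "k < l" unfolding inj_on_def by (metis linorder_neqE_nat)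
    have "of_nat p * (j ^ l - j ^ k) = of_nat p * (y l - y k)"
      using ty(3)[of k] ty(3)[of l] kl(1) by (simp add: algebra_simps)
    then have eq: "j ^ l - j ^ k = y l - y k" using p0 by simp
    let ?f = "Polynomial.monom 1 l - Polynomial.monom 1 k :: complex poly"
    have deg: "Polynomial.degree ?f = l"
    proof (rule antisym)
      show "Polynomial.degree ?f \<le> l"
        using kl(2) by (intro degree_diff_le) (auto simp: degree_monom_eq)
      show "l \<le> Polynomial.degree ?f" using kl(2) by (intro le_degree) auto
    qed
    have "algebraic_int j"
    proof (rule algebraic_int_root)
      show "algebraic_int (y l - y k)" using ty(2)[of l] ty(2)[of k] OI_diff by (auto simp: OI_def)
      show "poly ?f j = y l - y k" using eq by (simp add: poly_monom)
      show "\<forall>i. Polynomial.coeff ?f i \<in> \<int>" by auto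
      show "lead_coeff ?f = 1" unfolding deg using kl(2) by simp
      show "0 < Polynomial.degree ?f" unfolding deg using kl(2) by simp
    qed
    then show False using jn jL by (simp add: OI_def)
  qed
  then obtain y where y: "y \<in> Q" "j * y \<notin> Q" by blast
  \<comment> \<open>The witness is s = j*y: it lies outside \<open>Q\<close> by the choice of
    \<open>y\<close>, and s*z = y*(j*z) with j*z integral for every \<open>z\<close> in
    \<open>Q\<close>.\<close>
  have "y \<noteq> 0" using y Q_closed(2) by auto
  moreover have "\<exists>w\<in>OI L. j * y * z = y * w" if "z \<in> Q" for z
    using jQ[OF that] by (intro bexI[of _ "j * z"]) auto
  ultimately show thesis using that[of y "j * y"] y jQ by blast
qed

section \<open>Powers of a prime ideal\<close>

abbreviation P :: "nat \<Rightarrow> complex set" where "P n \<equiv> ideal_power L Q n"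

lemma P_0: "P 0 = OI L"
  by (simp add: ideal_power_def ideals_set_def)

lemma P_Suc: "P (Suc n) = P n \<cdot>\<^bsub>integer_ring L\<^esub> Q"
  by (simp add: ideal_power_def ideals_set_def)

lemma ideal_P: "ideal (P n) (integer_ring L)"
proof (induction n)
  case 0
  then show ?case by (simp add: P_0 ideal_OI)
next
  case (Suc n)
  then show ?case unfolding P_Suc using R.ideal_prod_is_ideal ideal_Q by blast
qed

lemmas P_closed = idealD[OF ideal_P]
lemma P_Suc_memI: "a \<in> P n \<Longrightarrow> b \<in> Q \<Longrightarrow> a * b \<in> P (Suc n)"
  unfolding P_Suc by (rule ideal_prod_memI)

lemma P_Suc_subset: "P (Suc n) \<subseteq> P n"
  unfolding P_Suc by (rule ideal_prod_subsetI) (use P_closed Q_OI in auto)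

lemma P_antimono: "m \<le> n \<Longrightarrow> P n \<subseteq> P m"
  by (rule lift_Suc_antimono_le[of P, OF P_Suc_subset]) 

lemma P_1: "P 1 = Q"
proof -
  have "OI L \<cdot>\<^bsub>integer_ring L\<^esub> Q \<subseteq> Q" by (rule ideal_prod_subsetI) (use Q_closed in auto)
  moreover have "Q \<subseteq> OI L \<cdot>\<^bsub>integer_ring L\<^esub> Q" using ideal_prod_memI[OF OI_one, of _ Q] by auto
  ultimately show ?thesis using P_Suc[of 0] P_0 by auto
qed

lemma P_subset_Q: "n > 0 \<Longrightarrow> P n \<subseteq> Q"
  using P_antimono[of 1 n] P_1 by simp

lemma P_mult: "a \<in> P m \<Longrightarrow> b \<in> P n \<Longrightarrow> a * b \<in> P (m + n)"
proof (induction n arbitrary: b)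
  case 0
  then show ?case using P_closed P_0 by simp
next
  case (Suc n)
  have "P (Suc n) \<subseteq> {b. a * b \<in> P (m + Suc n)}"
    unfolding P_Suc
  proof (rule ideal_prod_subsetI)
    fix x y assume "x \<in> P n" "y \<in> Q"
    then have "a * x * y \<in> P (Suc (m + n))" using Suc P_Suc_memI by blast
    then show "x * y \<in> {b. a * b \<in> P (m + Suc n)}" by (simp add: mult.assoc)
  qed (use P_closed in \<open>auto simp: distrib_left\<close>)
  then show ?case using Suc.prems by blast
qed

lemma P_power: "a \<in> Q \<Longrightarrow> a ^ n \<in> P n"
proof (induction n)
  case (Suc n)
  then show ?case using P_Suc_memI[of "a ^ n" n a] by (simp add: mult.commute)
qed (simp add: P_0)

text \<open>An element outside \<open>Q\<close> is invertible modulo every power of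
  \<open>Q\<close>: if s*t = 1 - u with \<open>u\<close> in \<open>Q\<close>, then 1 - u^k = s*w for
  some integral \<open>w\<close>, and x = x*u^k + w*(s*x).\<close>

lemma P_primary:
  assumes s: "s \<in> OI L" "s \<notin> Q" and x: "x \<in> OI L" "s * x \<in> P k"
  shows "x \<in> P k"
proof -
  obtain t where t: "t \<in> OI L" "s * t - 1 \<in> Q" using unit_mod[OF s] by blast
  define u where "u = 1 - s * t"
  have u: "u \<in> Q" using t Q_closed(6) unfolding u_def by (metis minus_diff_eq)
  have "\<exists>w\<in>OI L. 1 - u ^ k = s * w" for k
  proof (induction k)
    case 0
    then show ?case using OI_zero by force
  next
    case (Suc k)
    then obtain w where w: "w \<in> OI L" "1 - u ^ k = s * w" by blast
    have "1 - u ^ Suc k = (1 - u) + u * (1 - u ^ k)" by (simp add: algebra_simps)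
    also have "\<dots> = s * (t + u * w)" unfolding w(2) by (simp add: u_def algebra_simps)
    finally show ?case using w t Q_OI[OF u] OI_closed by blast
  qed
  then obtain w where w: "w \<in> OI L" "1 - u ^ k = s * w" by blast
  have "x = x * u ^ k + w * (s * x)" using w(2) by (simp add: algebra_simps) (metis distrib_left mult.commute mult.left_commute mult_1_right)
  moreover have "x * u ^ k \<in> P k" "w * (s * x) \<in> P k" using P_closed P_power u x w by auto
  ultimately show ?thesis using P_closed(3) by metis
qed

text \<open>Locally \<open>P n\<close> is generated by y^n: multiplication by s^n sends it into the
  multiples of y^n. If y^k were one step too deep, cancelling y^k would put a power of
  \<open>s\<close> into \<open>Q\<close>.\<close>

lemma uniformizer_power_notin:
  assumes y: "y \<in> Q" "s \<in> OI L" "s \<notin> Q" "y \<noteq> 0" "\<forall>z\<in>Q. \<exists>w\<in>OI L. s * z = y * w"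
  shows "y ^ k \<notin> P (Suc k)"
proof
  assume yk: "y ^ k \<in> P (Suc k)"
  have "P n \<subseteq> {x. \<exists>w\<in>OI L. s ^ n * x = y ^ n * w}" for n
  proof (induction n)
    case 0
    then show ?case by (auto simp: P_0)
  next
    case (Suc n)
    show ?case unfolding P_Suc
    proof (rule ideal_prod_subsetI)
      fix a b assume ab: "a \<in> P n" "b \<in> Q"
      obtain w v where "w \<in> OI L" "s ^ n * a = y ^ n * w" "v \<in> OI L" "s * b = y * v"
        using Suc ab y(5) by blast
      then have "s ^ Suc n * (a * b) = y ^ Suc n * (w * v)" "w * v \<in> OI L"
        by (auto simp: OI_mult) (metis mult.assoc mult.commute)
      then show "a * b \<in> {x. \<exists>w\<in>OI L. s ^ Suc n * x = y ^ Suc n * w}" by blast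
    next
      fix a b assume "a \<in> {x. \<exists>w\<in>OI L. s ^ Suc n * x = y ^ Suc n * w}" "b \<in> {x. \<exists>w\<in>OI L. s ^ Suc n * x = y ^ Suc n * w}"
      then obtain w v where "w \<in> OI L" "s ^ Suc n * a = y ^ Suc n * w" "v \<in> OI L" "s ^ Suc n * b = y ^ Suc n * v"
        by blast
      then have "s ^ Suc n * (a + b) = y ^ Suc n * (w + v)" "w + v \<in> OI L"
        by (auto simp: OI_add distrib_left)
      then show "a + b \<in> {x. \<exists>w\<in>OI L. s ^ Suc n * x = y ^ Suc n * w}" by blast
    qed
  qed
  then obtain w where w: "w \<in> OI L" "s ^ Suc k * y ^ k = y ^ Suc k * w" using yk by blast
  then have "s ^ Suc k = y * w" using y(4) by simp
  then have "s ^ Suc k \<in> Q" using Q_closed y w by simp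
  then show False using prime_power y by blast
qed

lemma P_strict: obtains x where "x \<in> P k" "x \<notin> P (Suc k)"
proof -
  obtain y s where y: "y \<in> Q" "s \<in> OI L" "s \<notin> Q" "y \<noteq> 0" "\<forall>z\<in>Q. \<exists>w\<in>OI L. s * z = y * w"
    using exists_uniformizer .
  show thesis by (rule that[OF P_power[OF y(1)] uniformizer_power_notin[OF y]])
qed

text \<open>Strict descent of the powers is what lets the \<open>GREATEST\<close> in
  \<open>ideal_valuation\<close> be evaluated on a prime power.\<close>

lemma P_subset_iff: "P m \<subseteq> P n \<longleftrightarrow> n \<le> m"
proof
  assume "P m \<subseteq> P n"
  show "n \<le> m"
  proof (rule ccontr)
    assume "\<not> n \<le> m"
    then have "P n \<subseteq> P (Suc m)" by (intro P_antimono) simp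
    then show False using \<open>P m \<subseteq> P n\<close> P_strict[of m] by blast
  qed
qed (rule P_antimono)

text \<open>A nonzero \<open>x\<close> divides some integer \<open>N\<close>, which would then lie
  in every power of \<open>Q\<close>. But y^m * (1 - y^r) is a multiple of \<open>N\<close> with 1 -
  y^r outside \<open>Q\<close>, so the uniformizer power y^m would lie in
  \<open>P (Suc m)\<close>.\<close>

lemma P_Inter:
  assumes x: "\<And>k. x \<in> P k"
  shows "x = 0"
proof (rule ccontr)
  assume "x \<noteq> 0"
  have xO: "x \<in> OI L" using x[of 0] P_0 by simp
  obtain N v where N: "N > 0" "v \<in> OI L" "of_nat N = x * v" using OI_divides_int[OF xO \<open>x \<noteq> 0\<close>] .
  obtain y s where y: "y \<in> Q" "s \<in> OI L" "s \<notin> Q" "y \<noteq> 0" "\<forall>z\<in>Q. \<exists>w\<in>OI L. s * z = y * w"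
    using exists_uniformizer .
  have yO: "y \<in> OI L" using y Q_OI by blast
  obtain m r w where m: "r > 0" "w \<in> OI L" "y ^ m * (1 - y ^ r) = of_nat N * w"
    using power_congruent[OF N(1) yO] .
  have "of_nat N * w = (v * w) * x" using N(3) by simp
  then have "(1 - y ^ r) * y ^ m \<in> P (Suc m)" using m x P_closed(4) N(2) OI_mult by (metis mult.commute)
  moreover have "y ^ r \<in> Q" using m(1) y yO Q_closed OI_power by (cases r) auto
  then have "1 - y ^ r \<notin> Q" using one_notin Q_closed(3) by (metis diff_add_cancel)
  ultimately have "y ^ m \<in> P (Suc m)" using P_primary yO OI_closed OI_one by metis
  then show False using uniformizer_power_notin[OF y] by blast
qed

text \<open>Any element of \<open>Q\<close> outside its square is as good as the local uniformizer
  \<open>y\<close>: from s*\<pi> = y*u the factor \<open>u\<close> is outside \<open>Q\<close>. This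
  permits a uniformizer taken from the base field.\<close>

lemma uniformizer_divides:
  assumes \<pi>: "\<pi> \<in> Q" "\<pi> \<notin> P 2" and z: "z \<in> Q"
  obtains s w where "s \<in> OI L" "s \<notin> Q" "w \<in> OI L" "s * z = \<pi> * w"
proof -
  obtain y s where y: "y \<in> Q" "s \<in> OI L" "s \<notin> Q" "y \<noteq> 0" "\<forall>z\<in>Q. \<exists>w\<in>OI L. s * z = y * w"
    using exists_uniformizer .
  obtain u where u: "u \<in> OI L" "s * \<pi> = y * u" using y \<pi> by blast
  have uQ: "u \<notin> Q"
  proof
    assume "u \<in> Q"
    then have "y * u \<in> P 2" using P_Suc_memI[of y 1 u] y(1) P_1 by (simp add: numeral_2_eq_2)
    then have "\<pi> \<in> P 2" using P_primary[OF y(2,3) Q_OI[OF \<pi>(1)]] u(2) by simp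
    then show False using \<pi> by blast
  qed
  obtain v where v: "v \<in> OI L" "s * z = y * v" using y z by blast
  have "u * s * z = \<pi> * (s * v)" using u(2) v(2) by (metis mult.assoc mult.commute)
  moreover have "u * s \<notin> Q" using uQ y prime_cases u by blast
  ultimately show thesis using that[of "u * s" "s * v"] u y v OI_mult by blast
qed

end

section \<open>Embeddings and independence of characters\<close>

text \<open>The target is all of the complex numbers, and values outside \<open>L\<close> are
  unconstrained. Whether \<open>L\<close> is mapped onto itself is a separate question, settled for
  Galois extensions.\<close>

definition emb :: "complex set \<Rightarrow> (complex \<Rightarrow> complex) \<Rightarrow> bool" where
  "emb L \<sigma> \<longleftrightarrow> \<sigma> 1 = 1 \<and> (\<forall>x\<in>L. \<forall>y\<in>L. \<sigma> (x + y) = \<sigma> x + \<sigma> y \<and> \<sigma> (x * y) = \<sigma> x * \<sigma> y)"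

context cfield
begin

lemma emb_one: "emb L \<sigma> \<Longrightarrow> \<sigma> 1 = 1"
  and emb_add: "emb L \<sigma> \<Longrightarrow> x \<in> L \<Longrightarrow> y \<in> L \<Longrightarrow> \<sigma> (x + y) = \<sigma> x + \<sigma> y"
  and emb_mult: "emb L \<sigma> \<Longrightarrow> x \<in> L \<Longrightarrow> y \<in> L \<Longrightarrow> \<sigma> (x * y) = \<sigma> x * \<sigma> y"
  by (auto simp: emb_def)

lemma emb_zero: "emb L \<sigma> \<Longrightarrow> \<sigma> 0 = 0"
  using emb_add[of \<sigma> 0 0] by simp

lemma emb_neg: "emb L \<sigma> \<Longrightarrow> x \<in> L \<Longrightarrow> \<sigma> (- x) = - \<sigma> x"
  using emb_add[of \<sigma> x "- x"] emb_zero[of \<sigma>] neg_in[of x] by (simp add: eq_neg_iff_add_eq_0 add.commute)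

lemma emb_diff: "emb L \<sigma> \<Longrightarrow> x \<in> L \<Longrightarrow> y \<in> L \<Longrightarrow> \<sigma> (x - y) = \<sigma> x - \<sigma> y"
  using emb_add[of \<sigma> x "- y"] emb_neg[of \<sigma> y] neg_in[of y] by simp

lemma emb_sum: "emb L \<sigma> \<Longrightarrow> (\<And>i. i \<in> A \<Longrightarrow> g i \<in> L) \<Longrightarrow> \<sigma> (sum g A) = (\<Sum>i\<in>A. \<sigma> (g i))"
  by (induction A rule: infinite_finite_induct) (auto simp: emb_zero emb_add sum_in)

lemma emb_prod: "emb L \<sigma> \<Longrightarrow> (\<And>i. i \<in> A \<Longrightarrow> g i \<in> L) \<Longrightarrow> \<sigma> (prod g A) = (\<Prod>i\<in>A. \<sigma> (g i))"
  by (induction A rule: infinite_finite_induct) (auto simp: emb_one emb_mult prod_in)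

lemma emb_power: "emb L \<sigma> \<Longrightarrow> x \<in> L \<Longrightarrow> \<sigma> (x ^ n) = \<sigma> x ^ n"
  by (induction n) (auto simp: emb_one emb_mult power_in)

lemma emb_of_nat: "emb L \<sigma> \<Longrightarrow> \<sigma> (of_nat n) = of_nat n"
  by (induction n) (auto simp: emb_one emb_zero emb_add)

lemma emb_of_int: "emb L \<sigma> \<Longrightarrow> \<sigma> (of_int n) = of_int n"
  by (cases n) (auto simp: emb_of_nat emb_neg simp del: of_nat_Suc)

lemma emb_inverse:
  assumes "emb L \<sigma>" "x \<in> L" "x \<noteq> 0"
  shows "\<sigma> x * \<sigma> (inverse x) = 1"
  using emb_mult[OF assms(1,2) inverse_in[OF assms(2)]] assms(3) emb_one[OF assms(1)] by simp

lemma emb_inj: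
  assumes "emb L \<sigma>" "x \<in> L" "y \<in> L" "\<sigma> x = \<sigma> y"
  shows "x = y"
proof (rule ccontr)
  assume "x \<noteq> y"
  then have "\<sigma> (x - y) * \<sigma> (inverse (x - y)) = 1" using assms by (intro emb_inverse diff_in) auto
  then show False using assms by (simp add: emb_diff)
qed

lemma emb_inverse_eq:
  assumes "emb L \<sigma>" "x \<in> L"
  shows "\<sigma> (inverse x) = inverse (\<sigma> x)"
  using emb_inverse[OF assms] emb_zero[OF assms(1)] by (cases "x = 0") (auto simp: inverse_unique)

lemma emb_of_rat: "emb L \<sigma> \<Longrightarrow> \<sigma> (of_rat q) = of_rat q"
  by (cases q) (auto simp: of_rat_rat divide_inverse emb_mult inverse_in emb_inverse_eq emb_of_int)

lemma emb_algebraic_int: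
  assumes "emb L \<sigma>" "x \<in> OI L"
  shows "algebraic_int (\<sigma> x)"
proof -
  have x: "x \<in> L" "algebraic_int x" using assms by (auto simp: OI_def)
  then obtain p where p: "poly (map_poly of_int p) x = 0" "lead_coeff p = 1"
    unfolding algebraic_int_altdef_ipoly by blast
  have "poly (map_poly of_int p) (\<sigma> x) = (\<Sum>i\<le>Polynomial.degree p. of_int (Polynomial.coeff p i) * \<sigma> x ^ i)"
    by (simp add: poly_altdef degree_map_poly coeff_map_poly)
  also have "\<dots> = \<sigma> (\<Sum>i\<le>Polynomial.degree p. of_int (Polynomial.coeff p i) * x ^ i)"
    using assms x by (subst emb_sum) (auto simp: emb_mult emb_power emb_of_int power_in mult_in)
  also have "(\<Sum>i\<le>Polynomial.degree p. of_int (Polynomial.coeff p i) * x ^ i) = 0"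
    using p(1) by (simp add: poly_altdef degree_map_poly coeff_map_poly)
  finally have "poly (map_poly of_int p) (\<sigma> x) = 0" using emb_zero assms by simp
  then show ?thesis unfolding algebraic_int_altdef_ipoly using p by blast
qed

end

lemma emb_subset: "emb L \<sigma> \<Longrightarrow> K \<subseteq> L \<Longrightarrow> emb K \<sigma>"
  unfolding emb_def by blast

text \<open>Dedekind's argument, with coefficients taken modulo an ideal \<open>b\<close> that is primary for \<open>q\<close>.\<close>

lemma independence_of_characters:
  fixes \<chi> :: "'i \<Rightarrow> complex \<Rightarrow> complex" and a :: "'i \<Rightarrow> complex"
  assumes fin: "finite I" and A1: "1 \<in> A" and Am: "\<And>x y. x \<in> A \<Longrightarrow> y \<in> A \<Longrightarrow> x * y \<in> A"
    and \<chi>O: "\<And>i x. i \<in> I \<Longrightarrow> x \<in> A \<Longrightarrow> \<chi> i x \<in> S"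
    and \<chi>m: "\<And>i x y. i \<in> I \<Longrightarrow> x \<in> A \<Longrightarrow> y \<in> A \<Longrightarrow> \<chi> i (x * y) = \<chi> i x * \<chi> i y"
    and \<chi>1: "\<And>i. i \<in> I \<Longrightarrow> \<chi> i 1 = 1"
    and Sm: "\<And>x y. x \<in> S \<Longrightarrow> y \<in> S \<Longrightarrow> x * y \<in> S" and Sd: "\<And>x y. x \<in> S \<Longrightarrow> y \<in> S \<Longrightarrow> x - y \<in> S"
    and b0: "0 \<in> b" and ba: "\<And>x y. x \<in> b \<Longrightarrow> y \<in> b \<Longrightarrow> x + y \<in> b" 
    and bd: "\<And>x y. x \<in> b \<Longrightarrow> y \<in> b \<Longrightarrow> x - y \<in> b" 
    and bm: "\<And>c x. c \<in> S \<Longrightarrow> x \<in> b \<Longrightarrow> c * x \<in> b"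
    and prim: "\<And>c x. c \<in> S \<Longrightarrow> c \<notin> q \<Longrightarrow> x \<in> S \<Longrightarrow> c * x \<in> b \<Longrightarrow> x \<in> b"
    and dist: "\<And>i j. i \<in> I \<Longrightarrow> j \<in> I \<Longrightarrow> i \<noteq> j \<Longrightarrow> a i \<notin> b \<Longrightarrow> a j \<notin> b \<Longrightarrow> \<exists>y\<in>A. \<chi> i y - \<chi> j y \<notin> q"
    and aS: "\<And>i. i \<in> I \<Longrightarrow> a i \<in> S"
    and rel: "\<And>x. x \<in> A \<Longrightarrow> (\<Sum>i\<in>I. a i * \<chi> i x) \<in> b"
    and i: "i \<in> I"
  shows "a i \<in> b"
proof -
  have "\<forall>i\<in>I. a i \<in> b"
    using dist aS rel
  \<comment> \<open>The induction counts the coefficients that are nonzero modulo \<open>b\<close>.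
    Distinctness of the characters is demanded only among those, which later lets automorphisms
    outside the decomposition group be discarded.\<close>
  proof (induction "card {i\<in>I. a i \<notin> b}" arbitrary: a rule: less_induct)
    case (less a)
    show ?case
    proof (rule ccontr)
      assume "\<not> (\<forall>i\<in>I. a i \<in> b)"
      then obtain k where k: "k \<in> I" "a k \<notin> b" by blast
      have bsum: "sum f B \<in> b" if "\<And>i. i \<in> B \<Longrightarrow> f i \<in> b" for f and B :: "'i set"
        using that by (induction B rule: infinite_finite_induct) (auto intro: b0 ba)
      show False
      proof (cases "\<exists>l\<in>I. l \<noteq> k \<and> a l \<notin> b")
        case False
        then have "(\<Sum>i\<in>I - {k}. a i) \<in> b" by (intro bsum) auto
        moreover have "(\<Sum>i\<in>I. a i) \<in> b" using less.prems(3)[OF A1] \<chi>1 by simp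
        moreover have "(\<Sum>i\<in>I. a i) = a k + (\<Sum>i\<in>I - {k}. a i)" using fin k by (simp add: sum.remove)
        ultimately have "a k \<in> b" using bd by (metis add_diff_cancel_right')
        then show False using k by blast
      next
        case True
        then obtain l where l: "l \<in> I" "l \<noteq> k" "a l \<notin> b" by blast
        obtain y where y: "y \<in> A" "\<chi> l y - \<chi> k y \<notin> q" using less.prems(1) l k by blast
        \<comment> \<open>Evaluating the relation at x*y and subtracting \<open>\<chi> k y\<close>
          times the relation at \<open>x\<close> kills coefficient \<open>k\<close>. Coefficient
          \<open>l\<close> is multiplied by an element outside \<open>q\<close>, which can be
          cancelled because \<open>b\<close> is primary.\<close>
        define a' where "a' i = (\<chi> i y - \<chi> k y) * a i" for i
        have sub: "a i \<notin> b" if "i \<in> I" "a' i \<notin> b" for i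
          using that bm[of "\<chi> i y - \<chi> k y" "a i"] Sd \<chi>O k y unfolding a'_def by blast
        have "{i\<in>I. a' i \<notin> b} \<subset> {i\<in>I. a i \<notin> b}"
        proof -
          have "a' k \<in> b" using b0 by (simp add: a'_def)
          then show ?thesis using sub k by blast
        qed
        then have "card {i\<in>I. a' i \<notin> b} < card {i\<in>I. a i \<notin> b}"
          using fin by (intro psubset_card_mono) auto
        then have "\<forall>i\<in>I. a' i \<in> b"
        proof (rule less.hyps)
          show "\<exists>y\<in>A. \<chi> i y - \<chi> j y \<notin> q" if "i \<in> I" "j \<in> I" "i \<noteq> j" "a' i \<notin> b" "a' j \<notin> b" for i j
            using that less.prems(1) sub by blast
          show "a' i \<in> S" if "i \<in> I" for i
            using that less.prems(2) Sm Sd \<chi>O k y unfolding a'_def by blast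
          show "(\<Sum>i\<in>I. a' i * \<chi> i x) \<in> b" if x: "x \<in> A" for x
          proof -
            have "(\<Sum>i\<in>I. a' i * \<chi> i x) = (\<Sum>i\<in>I. a i * \<chi> i (x * y)) - \<chi> k y * (\<Sum>i\<in>I. a i * \<chi> i x)"
              unfolding sum_distrib_left sum_subtractf[symmetric]
              by (rule sum.cong) (use x y in \<open>auto simp: a'_def \<chi>m algebra_simps\<close>)
            also have "\<dots> \<in> b"
              by (rule bd[OF less.prems(3)[OF Am[OF x y(1)]] bm[OF \<chi>O[OF k(1) y(1)] less.prems(3)[OF x]]])
            finally show ?thesis .
          qed
        qed
        then have "(\<chi> l y - \<chi> k y) * a l \<in> b" using l by (simp add: a'_def)
        then have "a l \<in> b" using prim y l k less.prems(2) Sd \<chi>O by blast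
        then show False using l by blast
      qed
    qed
  qed
  then show ?thesis using i by blast
qed

subsection \<open>Extension of embeddings\<close>

definition poly_over :: "complex set \<Rightarrow> complex poly \<Rightarrow> bool" where
  "poly_over E p \<longleftrightarrow> (\<forall>i. Polynomial.coeff p i \<in> E)"

context cfield
begin

lemma poly_over_add: "poly_over L p \<Longrightarrow> poly_over L q \<Longrightarrow> poly_over L (p + q)"
  and poly_over_diff: "poly_over L p \<Longrightarrow> poly_over L q \<Longrightarrow> poly_over L (p - q)"
  and poly_over_mult: "poly_over L p \<Longrightarrow> poly_over L q \<Longrightarrow> poly_over L (p * q)"
  and poly_over_monom: "c \<in> L \<Longrightarrow> poly_over L (Polynomial.monom c n)"
  and poly_over_smult: "c \<in> L \<Longrightarrow> poly_over L p \<Longrightarrow> poly_over L (Polynomial.smult c p)"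
  by (auto simp: poly_over_def coeff_mult intro: add_in diff_in mult_in sum_in)

lemma poly_over_pderiv: "poly_over L p \<Longrightarrow> poly_over L (pderiv p)"
proof -
  assume p: "poly_over L p"
  have "Polynomial.coeff (pderiv p) i \<in> L" for i
  proof -
    have "of_nat (Suc i) * Polynomial.coeff p (Suc i) \<in> L"
      using p of_nat_in by (intro mult_in) (auto simp: poly_over_def simp del: of_nat_Suc)
    then show ?thesis by (simp add: coeff_pderiv)
  qed
  then show ?thesis by (simp add: poly_over_def)
qed

context
  fixes \<sigma> assumes \<sigma>: "emb L \<sigma>"
begin

lemma coeff_map_emb: "Polynomial.coeff (map_poly \<sigma> p) i = \<sigma> (Polynomial.coeff p i)"
  by (simp add: coeff_map_poly emb_zero[OF \<sigma>])

lemma map_emb_add: "poly_over L p \<Longrightarrow> poly_over L q \<Longrightarrow> map_poly \<sigma> (p + q) = map_poly \<sigma> p + map_poly \<sigma> q"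
  by (rule poly_eqI) (simp add: coeff_map_emb poly_over_def emb_add[OF \<sigma>])

lemma map_emb_diff: "poly_over L p \<Longrightarrow> poly_over L q \<Longrightarrow> map_poly \<sigma> (p - q) = map_poly \<sigma> p - map_poly \<sigma> q"
  by (rule poly_eqI) (simp add: coeff_map_emb poly_over_def emb_diff[OF \<sigma>])

lemma map_emb_mult: "poly_over L p \<Longrightarrow> poly_over L q \<Longrightarrow> map_poly \<sigma> (p * q) = map_poly \<sigma> p * map_poly \<sigma> q"
  by (rule poly_eqI)
     (simp add: coeff_map_emb poly_over_def emb_mult[OF \<sigma>] coeff_mult emb_sum[OF \<sigma>] mult_in)

end

end

definition adjoin :: "complex set \<Rightarrow> complex \<Rightarrow> complex set" where
  "adjoin E \<theta> = {poly g \<theta> | g. poly_over E g}"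

text \<open>Characterised by least degree and not by irreducibility, the form in which division by
  the monic \<open>h\<close> and comparison with its derivative use it.\<close>

definition min_poly :: "complex set \<Rightarrow> complex \<Rightarrow> complex poly \<Rightarrow> bool" where
  "min_poly E \<theta> h \<longleftrightarrow> lead_coeff h = 1 \<and> poly_over E h \<and> poly h \<theta> = 0 \<and>
     (\<forall>g. poly_over E g \<and> poly g \<theta> = 0 \<and> g \<noteq> 0 \<longrightarrow> Polynomial.degree h \<le> Polynomial.degree g)"

context cfield
begin

lemma exists_min_poly:
  assumes "algebraic \<theta>"
  obtains h where "min_poly L \<theta> h"
proof -
  obtain p where p: "p \<noteq> 0" "poly (map_poly of_int p) \<theta> = 0" using assms by (erule algebraicE')
  define C where "C g \<longleftrightarrow> poly_over L g \<and> poly g \<theta> = 0 \<and> g \<noteq> 0" for g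
  have "(map_poly of_int p :: complex poly) \<noteq> 0" using p(1) by (simp add: map_poly_eq_0_iff)
  then have "C (map_poly of_int p)" unfolding C_def using p by (simp add: poly_over_def coeff_map_poly)
  from ex_has_least_nat[of C, OF this, of Polynomial.degree]
  obtain g where g: "C g" "\<forall>g'. C g' \<longrightarrow> Polynomial.degree g \<le> Polynomial.degree g'" by blast
  define h where "h = Polynomial.smult (inverse (lead_coeff g)) g"
  have lg: "lead_coeff g \<noteq> 0" "lead_coeff g \<in> L" using g by (auto simp: C_def poly_over_def)
  have "Polynomial.degree h = Polynomial.degree g" unfolding h_def using lg by simp
  moreover have "lead_coeff h = 1" unfolding h_def using lg by (simp add: lead_coeff_smult)
  moreover have "poly_over L h" unfolding h_def using g lg by (intro poly_over_smult inverse_in) (auto simp: C_def)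
  moreover have "poly h \<theta> = 0" using g by (simp add: h_def C_def)
  ultimately have "min_poly L \<theta> h" unfolding min_poly_def using g(2) C_def by simp
  then show thesis by (rule that)
qed

text \<open>Division by the monic \<open>h\<close>, one leading term at a time: a nonzero polynomial
  vanishing at \<open>\<theta>\<close> has at least the degree of \<open>h\<close>, so the descent
  ends at zero. This makes sending a polynomial value at \<open>\<theta>\<close> to the transported
  value at \<open>\<theta>'\<close> well defined.\<close>

lemma map_poly_root:
  assumes \<sigma>: "emb L \<sigma>" and h: "min_poly L \<theta> h" and \<theta>': "poly (map_poly \<sigma> h) \<theta>' = 0"
    and g: "poly_over L g" "poly g \<theta> = 0"
  shows "poly (map_poly \<sigma> g) \<theta>' = 0"
  using g
proof (induction "Polynomial.degree g" arbitrary: g rule: less_induct)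
  case less
  show ?case
  proof (cases "g = 0")
    case True
    then show ?thesis by simp
  next
    case False
    have hm: "lead_coeff h = 1" "poly_over L h" "poly h \<theta> = 0" using h by (auto simp: min_poly_def)
    have le: "Polynomial.degree h \<le> Polynomial.degree g" using h less.prems False by (auto simp: min_poly_def)
    define m where "m = Polynomial.monom (lead_coeff g) (Polynomial.degree g - Polynomial.degree h)"
    have m: "poly_over L m" unfolding m_def using less.prems by (intro poly_over_monom) (auto simp: poly_over_def)
    have g': "poly_over L (g - m * h)" "poly (g - m * h) \<theta> = 0"
      using less.prems m hm by (auto intro: poly_over_diff poly_over_mult)
    have cof: "Polynomial.coeff (m * h) (Polynomial.degree g) = lead_coeff g"
      using le hm(1) unfolding m_def by (simp add: coeff_monom_mult)
    have dmh: "Polynomial.degree (m * h) \<le> Polynomial.degree g"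
      using le unfolding m_def by (intro order.trans[OF degree_mult_le]) (auto intro: order.trans[OF add_right_mono[OF degree_monom_le]])
    have "poly (map_poly \<sigma> (g - m * h)) \<theta>' = 0"
    proof (cases "g - m * h = 0")
      case True
      then show ?thesis by simp
    next
      case nz: False
      have "Polynomial.degree (g - m * h) \<le> Polynomial.degree g" using dmh by (intro degree_diff_le) auto
      moreover have "Polynomial.degree (g - m * h) \<noteq> Polynomial.degree g"
      proof
        assume "Polynomial.degree (g - m * h) = Polynomial.degree g"
        then have "lead_coeff (g - m * h) = 0" using cof by simp
        then show False using nz leading_coeff_0_iff by blast
      qed
      ultimately have "Polynomial.degree (g - m * h) < Polynomial.degree g" by simp
      then show ?thesis using less.hyps g' by blast
    qed
    moreover have "map_poly \<sigma> (g - m * h) = map_poly \<sigma> g - map_poly \<sigma> m * map_poly \<sigma> h"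
      using less.prems m hm by (simp add: map_emb_diff[OF \<sigma>] map_emb_mult[OF \<sigma>] poly_over_mult)
    ultimately show ?thesis using \<theta>' by simp
  qed
qed

lemma adjoin_superset: "L \<subseteq> adjoin L \<theta>" "\<theta> \<in> adjoin L \<theta>"
proof -
  show "L \<subseteq> adjoin L \<theta>"
  proof
    fix x assume x: "x \<in> L"
    have "poly_over L [:x:]" using x by (auto simp: poly_over_def coeff_pCons split: nat.splits)
    moreover have "x = poly [:x:] \<theta>" by simp
    ultimately show "x \<in> adjoin L \<theta>" unfolding adjoin_def by blast
  qed
  have "poly_over L [:0, 1:]" by (auto simp: poly_over_def coeff_pCons split: nat.splits)
  moreover have "\<theta> = poly [:0, 1:] \<theta>" by simp
  ultimately show "\<theta> \<in> adjoin L \<theta>" unfolding adjoin_def by blast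
qed

lemma adjoin_subset:
  assumes "cfield F" "L \<subseteq> F" "\<theta> \<in> F"
  shows "adjoin L \<theta> \<subseteq> F"
proof
  interpret F: cfield F by fact
  fix x assume "x \<in> adjoin L \<theta>"
  then obtain g where "poly_over L g" "x = poly g \<theta>" by (auto simp: adjoin_def)
  then show "x \<in> F" using assms unfolding poly_altdef poly_over_def
    by (auto intro!: F.sum_in F.mult_in F.power_in)
qed

lemma cfield_adjoin:
  assumes "number_field F" "L \<subseteq> F" "\<theta> \<in> F"
  shows "cfield (adjoin L \<theta>)"
proof (rule cfield_of_algebraic_ring)
  interpret F: number_field F by fact
  show "1 \<in> adjoin L \<theta>" using adjoin_superset one_in by blast
  show "x * y \<in> adjoin L \<theta>" if xy: "x \<in> adjoin L \<theta>" "y \<in> adjoin L \<theta>" for x y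
  proof -
    obtain f g where "poly_over L f" "x = poly f \<theta>" "poly_over L g" "y = poly g \<theta>"
      using xy unfolding adjoin_def by blast
    then have "poly_over L (f * g)" "x * y = poly (f * g) \<theta>" by (auto intro: poly_over_mult)
    then show ?thesis unfolding adjoin_def by blast
  qed
  show "x + y \<in> adjoin L \<theta>" if xy: "x \<in> adjoin L \<theta>" "y \<in> adjoin L \<theta>" for x y
  proof -
    obtain f g where "poly_over L f" "x = poly f \<theta>" "poly_over L g" "y = poly g \<theta>"
      using xy unfolding adjoin_def by blast
    then have "poly_over L (f + g)" "x + y = poly (f + g) \<theta>" by (auto intro: poly_over_add)
    then show ?thesis unfolding adjoin_def by blast
  qed
  show "of_rat q * x \<in> adjoin L \<theta>" if x: "x \<in> adjoin L \<theta>" for q x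
  proof -
    obtain f where "poly_over L f" "x = poly f \<theta>"
      using x unfolding adjoin_def by blast
    then have "poly_over L (Polynomial.smult (of_rat q) f)" "of_rat q * x = poly (Polynomial.smult (of_rat q) f) \<theta>"
      by (auto intro: poly_over_smult)
    then show ?thesis unfolding adjoin_def by blast
  qed
  show "algebraic x" if "x \<in> adjoin L \<theta>" for x
    using that adjoin_subset[OF F.cfield_axioms assms(2,3)] F.L_algebraic by blast
qed

text \<open>An element of \<open>adjoin L \<theta>\<close> is a polynomial value in many ways; the
  choice made by \<open>SOME\<close> does not matter, since the difference of two choices vanishes
  at \<open>\<theta>\<close> and is transported to a polynomial vanishing at
  \<open>\<theta>'\<close>.\<close>

lemma extend_emb_adjoin:
  assumes \<sigma>: "emb L \<sigma>" and h: "min_poly L \<theta> h" and \<theta>': "poly (map_poly \<sigma> h) \<theta>' = 0"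
  obtains \<tau> where "emb (adjoin L \<theta>) \<tau>" "\<tau> \<theta> = \<theta>'" "\<forall>x\<in>L. \<tau> x = \<sigma> x"
proof -
  define \<tau> where "\<tau> z = poly (map_poly \<sigma> (SOME g. poly_over L g \<and> poly g \<theta> = z)) \<theta>'" for z
  have \<tau>: "\<tau> (poly g \<theta>) = poly (map_poly \<sigma> g) \<theta>'" if g: "poly_over L g" for g
  proof -
    define g0 where "g0 = (SOME g'. poly_over L g' \<and> poly g' \<theta> = poly g \<theta>)"
    have "poly_over L g0 \<and> poly g0 \<theta> = poly g \<theta>" unfolding g0_def by (rule someI[of _ g]) (use g in simp)
    then have g0: "poly_over L g0" "poly g0 \<theta> = poly g \<theta>" by auto
    have "poly (map_poly \<sigma> (g0 - g)) \<theta>' = 0"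
      using g g0 by (intro map_poly_root[OF \<sigma> h \<theta>'] poly_over_diff) auto
    then have "poly (map_poly \<sigma> g0) \<theta>' = poly (map_poly \<sigma> g) \<theta>'"
      using g g0 by (simp add: map_emb_diff[OF \<sigma>])
    then show ?thesis unfolding \<tau>_def g0_def .
  qed
  have const: "poly_over L [:x:]" if "x \<in> L" for x
    using that by (auto simp: poly_over_def coeff_pCons split: nat.splits)
  have lin: "poly_over L [:0, 1:]" by (auto simp: poly_over_def coeff_pCons split: nat.splits)
  have \<tau>L: "\<tau> x = \<sigma> x" if "x \<in> L" for x
  proof -
    have "map_poly \<sigma> [:x:] = [:\<sigma> x:]"
      by (rule poly_eqI) (simp add: coeff_map_emb[OF \<sigma>] coeff_pCons emb_zero[OF \<sigma>] split: nat.splits)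
    then show ?thesis using \<tau>[OF const[OF that]] by simp
  qed
  have "\<tau> \<theta> = \<theta>'"
  proof -
    have "map_poly \<sigma> [:0, 1:] = [:0, 1:]"
      by (rule poly_eqI)
         (simp add: coeff_map_emb[OF \<sigma>] coeff_pCons emb_zero[OF \<sigma>] emb_one[OF \<sigma>] split: nat.splits)
    then show ?thesis using \<tau>[OF lin] by simp
  qed
  moreover have "emb (adjoin L \<theta>) \<tau>"
    unfolding emb_def
  proof (intro conjI ballI)
    show "\<tau> 1 = 1" using \<tau>L[OF one_in] emb_one[OF \<sigma>] by simp
  next
    fix x y assume "x \<in> adjoin L \<theta>" "y \<in> adjoin L \<theta>"
    then obtain f g where fg: "poly_over L f" "x = poly f \<theta>" "poly_over L g" "y = poly g \<theta>"
      unfolding adjoin_def by blast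
    have "x + y = poly (f + g) \<theta>" using fg by simp
    then show "\<tau> (x + y) = \<tau> x + \<tau> y"
      using \<tau>[of "f + g"] fg \<tau> by (simp add: poly_over_add map_emb_add[OF \<sigma>])
    have "x * y = poly (f * g) \<theta>" using fg by simp
    then show "\<tau> (x * y) = \<tau> x * \<tau> y"
      using \<tau>[of "f * g"] fg \<tau> by (simp add: poly_over_mult map_emb_mult[OF \<sigma>])
  qed
  ultimately show thesis using that \<tau>L by blast
qed

text \<open>One adjunction per element of \<open>S\<close>. The transported minimal polynomial
  always has a root because the target is algebraically closed.\<close>

lemma extend_emb_to_finite_set:
  assumes F: "number_field F" "L \<subseteq> F" and \<sigma>: "emb L \<sigma>" and S: "finite S" "S \<subseteq> F"
  shows "\<exists>E \<tau>. cfield E \<and> L \<union> S \<subseteq> E \<and> E \<subseteq> F \<and> emb E \<tau> \<and> (\<forall>x\<in>L. \<tau> x = \<sigma> x)"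
  using S
proof (induction S rule: finite_induct)
  case empty
  then show ?case using F \<sigma> cfield_axioms by blast
next
  case (insert s S)
  then obtain E \<tau> where E: "cfield E" "L \<union> S \<subseteq> E" "E \<subseteq> F" "emb E \<tau>" "\<forall>x\<in>L. \<tau> x = \<sigma> x" by auto
  interpret F: number_field F by fact
  interpret E: cfield E by fact
  have sF: "s \<in> F" using insert by simp
  obtain h where h: "min_poly E s h" using E.exists_min_poly[OF F.L_algebraic[OF sF]] .
  have "\<not> constant (poly (map_poly \<tau> h))"
  proof -
    have "lead_coeff h = 1" "poly h s = 0" using h by (auto simp: min_poly_def)
    have "Polynomial.degree h \<noteq> 0"
    proof
      assume "Polynomial.degree h = 0"
      then obtain c where "h = [:c:]" by (rule degree_eq_zeroE)
      then show False using \<open>lead_coeff h = 1\<close> \<open>poly h s = 0\<close> by simp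
    qed
    moreover have "Polynomial.degree (map_poly \<tau> h) = Polynomial.degree h"
      using \<open>lead_coeff h = 1\<close> by (intro map_poly_degree_eq) (simp add: E.emb_one[OF E(4)])
    ultimately show ?thesis by (simp add: constant_degree)
  qed
  then obtain \<theta>' where "poly (map_poly \<tau> h) \<theta>' = 0" using fundamental_theorem_of_algebra by blast
  then obtain \<tau>' where \<tau>': "emb (adjoin E s) \<tau>'" "\<forall>x\<in>E. \<tau>' x = \<tau> x"
    using E.extend_emb_adjoin[OF E(4) h] by metis
  show ?case
  proof (intro exI conjI)
    show "cfield (adjoin E s)" using E.cfield_adjoin[OF F(1) E(3) sF] .
    show "L \<union> insert s S \<subseteq> adjoin E s" using E(2) E.adjoin_superset[of s] by blast
    show "adjoin E s \<subseteq> F" using E.adjoin_subset[OF F.cfield_axioms E(3) sF] .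
    show "emb (adjoin E s) \<tau>'" by fact
    show "\<forall>x\<in>L. \<tau>' x = \<sigma> x" using \<tau>' E by auto
  qed
qed

lemma extend_emb:
  assumes F: "number_field F" "L \<subseteq> F" and \<sigma>: "emb L \<sigma>"
  obtains \<tau> where "emb F \<tau>" "\<forall>x\<in>L. \<tau> x = \<sigma> x"
proof -
  interpret F: number_field F by fact
  obtain B where B: "finite B" "B \<subseteq> F" "QV.independent B" "QV.span B = F" using F.exists_basis .
  obtain E \<tau> where E: "cfield E" "L \<union> B \<subseteq> E" "E \<subseteq> F" "emb E \<tau>" "\<forall>x\<in>L. \<tau> x = \<sigma> x"
    using extend_emb_to_finite_set[OF F \<sigma> B(1,2)] by blast
  interpret E: cfield E by fact
  have "QV.subspace E" by (rule QV.subspaceI) (auto intro: E.add_in E.mult_in)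
  then have "QV.span B \<subseteq> E" using E(2) by (intro QV.span_minimal) auto
  then have "E = F" using B(4) E(3) by blast
  then show thesis using that E by blast
qed

text \<open>Separability: \<open>x\<close> is a simple root of its minimal polynomial, because the
  derivative has smaller degree. Hence h/(X - x), nonconstant since \<open>x\<close> is not in
  \<open>L\<close>, has a root other than \<open>x\<close>, and \<open>x\<close> can be sent
  there.\<close>

lemma exists_moving_emb:
  assumes F: "number_field F" "L \<subseteq> F" and x: "x \<in> F" "x \<notin> L"
  obtains \<tau> where "emb F \<tau>" "\<forall>y\<in>L. \<tau> y = y" "\<tau> x \<noteq> x"
proof -
  interpret F: number_field F by fact
  obtain h where h: "min_poly L x h" using exists_min_poly[OF F.L_algebraic[OF x(1)]] .
  have hm: "lead_coeff h = 1" "poly_over L h" "poly h x = 0" using h by (auto simp: min_poly_def)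
  have "[:- x, 1:] dvd h" using hm(3) by (simp add: poly_eq_0_iff_dvd)
  then obtain h2 where h2: "h = [:- x, 1:] * h2" by (auto simp: dvd_def)
  have h20: "h2 \<noteq> 0" using h2 hm(1) by auto
  have dh: "Polynomial.degree h = Suc (Polynomial.degree h2)" unfolding h2 using h20 by (subst degree_mult_eq) auto
  have d2: "Polynomial.degree h2 \<noteq> 0"
  proof
    assume "Polynomial.degree h2 = 0"
    then obtain c where c: "h2 = [:c:]" by (auto elim!: degree_eq_zeroE)
    have "c = 1" using hm(1) unfolding h2 c by (auto split: if_splits)
    then have "Polynomial.coeff h 0 = - x" unfolding h2 c by simp
    then have "- x \<in> L" using hm(2) by (metis poly_over_def)
    then show False using x(2) neg_in by force
  qed
  have "poly h2 x \<noteq> 0"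
  proof
    assume "poly h2 x = 0"
    moreover have "pderiv h = [:- x, 1:] * pderiv h2 + h2 * pderiv [:- x, 1:]"
      unfolding h2 by (rule pderiv_mult)
    ultimately have "poly (pderiv h) x = 0" by (simp add: pderiv_pCons)
    moreover have dp: "Polynomial.degree (pderiv h) = Polynomial.degree h - 1" by (rule degree_pderiv)
    moreover have "pderiv h \<noteq> 0" using dp dh d2 by auto
    ultimately have "Polynomial.degree h \<le> Polynomial.degree (pderiv h)"
      using h poly_over_pderiv[OF hm(2)] unfolding min_poly_def by blast
    then show False using dp dh by simp
  qed
  moreover obtain x' where x': "poly h2 x' = 0"
    using fundamental_theorem_of_algebra[of h2] d2 by (auto simp: constant_degree)
  ultimately have ne: "x' \<noteq> x" by auto
  have id: "emb L (\<lambda>z. z)" by (simp add: emb_def)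
  have "poly (map_poly (\<lambda>z. z) h) x' = 0" using x' unfolding h2 by (simp add: map_poly_idI)
  then obtain \<sigma> where \<sigma>: "emb (adjoin L x) \<sigma>" "\<sigma> x = x'" "\<forall>y\<in>L. \<sigma> y = y"
    using extend_emb_adjoin[OF id h] by metis
  interpret A: cfield "adjoin L x" using cfield_adjoin[OF F x(1)] .
  obtain \<tau> where "emb F \<tau>" "\<forall>y\<in>adjoin L x. \<tau> y = \<sigma> y"
    using A.extend_emb[OF F(1) adjoin_subset[OF F.cfield_axioms F(2) x(1)] \<sigma>(1)] .
  moreover have "\<forall>y\<in>L. \<tau> y = y" using \<open>\<forall>y\<in>adjoin L x. \<tau> y = \<sigma> y\<close> \<sigma>(3) adjoin_superset(1)[of x] by auto
  moreover have "\<tau> x \<noteq> x" using \<open>\<forall>y\<in>adjoin L x. \<tau> y = \<sigma> y\<close> \<sigma>(2) ne adjoin_superset(2)[of x] by auto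
  ultimately show thesis using that by blast
qed

end

section \<open>Galois extensions\<close>

locale field_ext = K: cfield K + number_field L for K L +
  assumes KL: "K \<subseteq> L"
begin

abbreviation "G \<equiv> carrier (gal_group K L)"

lemma gal_iff:
  "\<sigma> \<in> G \<longleftrightarrow> \<sigma> \<in> extensional L \<and> bij_betw \<sigma> L L \<and> emb L \<sigma> \<and> (\<forall>x\<in>K. \<sigma> x = x)"
  unfolding gal_group_def Bij_def Ring.ring_hom_def emb_def
  by (auto dest: bij_betwE)

lemma gal_emb: "\<sigma> \<in> G \<Longrightarrow> emb L \<sigma>" and gal_fix: "\<sigma> \<in> G \<Longrightarrow> x \<in> K \<Longrightarrow> \<sigma> x = x"
  and gal_bij: "\<sigma> \<in> G \<Longrightarrow> bij_betw \<sigma> L L" and gal_ext: "\<sigma> \<in> G \<Longrightarrow> \<sigma> \<in> extensional L"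
  by (auto simp: gal_iff)

lemma gal_in: "\<sigma> \<in> G \<Longrightarrow> x \<in> L \<Longrightarrow> \<sigma> x \<in> L"
  using gal_bij bij_betwE by blast

lemma gal_OI: assumes "\<sigma> \<in> G" "x \<in> OI L" shows "\<sigma> x \<in> OI L"
  using emb_algebraic_int[OF gal_emb[OF assms(1)] assms(2)] gal_in[OF assms(1) OI_subset[OF assms(2)]]
  by (simp add: OI_def)

lemma gal_eqI: "\<sigma> \<in> G \<Longrightarrow> \<tau> \<in> G \<Longrightarrow> (\<And>x. x \<in> L \<Longrightarrow> \<sigma> x = \<tau> x) \<Longrightarrow> \<sigma> = \<tau>"
  using gal_ext extensionalityI by blast

lemmas gal_hom = emb_zero[OF gal_emb] emb_one[OF gal_emb] emb_add[OF gal_emb] emb_mult[OF gal_emb]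
  emb_neg[OF gal_emb] emb_diff[OF gal_emb] emb_sum[OF gal_emb] emb_prod[OF gal_emb] emb_power[OF gal_emb]

lemma OI_K_subset: "x \<in> OI K \<Longrightarrow> x \<in> OI L"
  using KL by (auto simp: OI_def)

lemma OI_K_iff: "x \<in> OI K \<longleftrightarrow> x \<in> OI L \<and> x \<in> K"
  using KL by (auto simp: OI_def)

lemma gal_group_mult: "\<sigma> \<in> G \<Longrightarrow> \<tau> \<in> G \<Longrightarrow> \<sigma> \<otimes>\<^bsub>gal_group K L\<^esub> \<tau> = compose L \<sigma> \<tau>"
  by (simp add: gal_group_def BijGroup_def)

lemma gal_group_one: "\<one>\<^bsub>gal_group K L\<^esub> = (\<lambda>x\<in>L. x)"
  by (simp add: gal_group_def BijGroup_def)

lemma mult_apply: "\<sigma> \<in> G \<Longrightarrow> \<tau> \<in> G \<Longrightarrow> x \<in> L \<Longrightarrow> (\<sigma> \<otimes>\<^bsub>gal_group K L\<^esub> \<tau>) x = \<sigma> (\<tau> x)"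
  by (simp add: gal_group_mult compose_eq)

lemma one_apply: "x \<in> L \<Longrightarrow> \<one>\<^bsub>gal_group K L\<^esub> x = x"
  by (simp add: gal_group_one)

lemma compose_gal: assumes "\<sigma> \<in> G" "\<tau> \<in> G" shows "compose L \<sigma> \<tau> \<in> G"
proof -
  have "bij_betw (compose L \<sigma> \<tau>) L L" using assms gal_bij bij_betw_compose by blast
  moreover have "emb L (compose L \<sigma> \<tau>)"
    unfolding emb_def using assms
    by (auto simp: compose_eq gal_hom gal_in add_in mult_in)
  moreover have "\<forall>x\<in>K. compose L \<sigma> \<tau> x = x" 
  proof
    fix x assume "x \<in> K"
    moreover from this have "x \<in> L" using KL by blast
    ultimately show "compose L \<sigma> \<tau> x = x" using gal_fix[OF assms(1)] gal_fix[OF assms(2)] by (simp add: compose_eq)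
  qed
  ultimately show ?thesis using gal_iff by simp
qed

lemma inv_gal: assumes "\<sigma> \<in> G" shows "restrict (inv_into L \<sigma>) L \<in> G"
proof -
  define \<tau> where "\<tau> = restrict (inv_into L \<sigma>) L"
  have \<tau>: "\<tau> y \<in> L" "\<sigma> (\<tau> y) = y" if "y \<in> L" for y
    using that gal_bij[OF assms] unfolding \<tau>_def
    by (auto simp: bij_betw_def inv_into_into f_inv_into_f)
  have inj: "x = y" if "x \<in> L" "y \<in> L" "\<sigma> x = \<sigma> y" for x y
    using that emb_inj gal_emb assms by blast
  have "emb L \<tau>"
    unfolding emb_def
  proof (intro conjI ballI)
    show "\<tau> 1 = 1" by (rule inj) (auto simp: \<tau> gal_hom assms)
    fix x y assume "x \<in> L" "y \<in> L"
    then have xy: "\<tau> x \<in> L" "\<tau> y \<in> L" "x + y \<in> L" "x * y \<in> L" by (auto simp: \<tau> add_in mult_in)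
    show "\<tau> (x + y) = \<tau> x + \<tau> y"
      by (rule inj) (use xy \<open>x \<in> L\<close> \<open>y \<in> L\<close> in \<open>simp_all add: \<tau> emb_add[OF gal_emb[OF assms]] add_in\<close>)
    show "\<tau> (x * y) = \<tau> x * \<tau> y"
      by (rule inj) (use xy \<open>x \<in> L\<close> \<open>y \<in> L\<close> in \<open>simp_all add: \<tau> emb_mult[OF gal_emb[OF assms]] mult_in\<close>)
  qed
  moreover have "bij_betw \<tau> L L"
    using bij_betw_inv_into[OF gal_bij[OF assms]] unfolding \<tau>_def
    by (simp cong: bij_betw_cong)
  moreover have "\<forall>x\<in>K. \<tau> x = x"
  proof
    fix x assume x: "x \<in> K"
    then have "x \<in> L" using KL by blast
    then have "\<sigma> (\<tau> x) = \<sigma> x" using \<tau> gal_fix[OF assms x] by simp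
    then show "\<tau> x = x" using inj[of "\<tau> x" x] \<tau> \<open>x \<in> L\<close> by blast
  qed
  ultimately show ?thesis unfolding gal_iff \<tau>_def[symmetric] by (simp add: \<tau>_def)
qed

lemma one_gal: "(\<lambda>x\<in>L. x) \<in> G"
proof -
  have "emb L (\<lambda>x\<in>L. x)" unfolding emb_def by (auto simp: add_in mult_in)
  moreover have "bij_betw (\<lambda>x\<in>L. x) L L" by (auto simp: bij_betw_def inj_on_def)
  ultimately show ?thesis using KL unfolding gal_iff by auto
qed

lemma group_gal: "group (gal_group K L)"
proof (rule groupI)
  show "\<one>\<^bsub>gal_group K L\<^esub> \<in> G" by (simp add: gal_group_one one_gal)
next
  fix x y assume "x \<in> G" "y \<in> G"
  then show "x \<otimes>\<^bsub>gal_group K L\<^esub> y \<in> G" by (simp add: gal_group_mult compose_gal)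
next
  fix x y z assume xyz: "x \<in> G" "y \<in> G" "z \<in> G"
  show "x \<otimes>\<^bsub>gal_group K L\<^esub> y \<otimes>\<^bsub>gal_group K L\<^esub> z = x \<otimes>\<^bsub>gal_group K L\<^esub> (y \<otimes>\<^bsub>gal_group K L\<^esub> z)"
    by (rule gal_eqI) (use xyz in \<open>auto simp: gal_group_mult compose_gal compose_eq gal_in\<close>)
next
  fix x assume x: "x \<in> G"
  show "\<one>\<^bsub>gal_group K L\<^esub> \<otimes>\<^bsub>gal_group K L\<^esub> x = x"
    by (rule gal_eqI) (use x in \<open>auto simp: gal_group_one gal_group_mult one_gal compose_gal compose_eq gal_in\<close>)
  show "\<exists>y\<in>G. y \<otimes>\<^bsub>gal_group K L\<^esub> x = \<one>\<^bsub>gal_group K L\<^esub>"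
  proof (rule bexI)
    show "restrict (inv_into L x) L \<otimes>\<^bsub>gal_group K L\<^esub> x = \<one>\<^bsub>gal_group K L\<^esub>"
      by (rule gal_eqI)
         (use x inv_gal[OF x] gal_bij[OF x] in \<open>auto simp: gal_group_one gal_group_mult one_gal compose_gal compose_eq gal_in bij_betw_def\<close>)
  qed (rule inv_gal[OF x])
qed

sublocale Gal: group "gal_group K L" by (rule group_gal)

lemma inv_apply:
  assumes "\<sigma> \<in> G" "x \<in> L"
  shows "\<sigma> ((inv\<^bsub>gal_group K L\<^esub> \<sigma>) x) = x" "(inv\<^bsub>gal_group K L\<^esub> \<sigma>) (\<sigma> x) = x"
  using mult_apply[OF assms(1) Gal.inv_closed[OF assms(1)] assms(2)]
    mult_apply[OF Gal.inv_closed[OF assms(1)] assms] one_apply[OF assms(2)]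
    Gal.r_inv[OF assms(1)] Gal.l_inv[OF assms(1)]
  by simp_all

text \<open>An automorphism is determined by its values on a rational basis, and each value is a
  root of a fixed integer polynomial.\<close>

lemma finite_gal: "finite G"
proof -
  obtain B where B: "finite B" "B \<subseteq> L" "QV.independent B" "QV.span B = L" using exists_basis .
  have "\<exists>p::int poly. p \<noteq> 0 \<and> poly (map_poly of_int p) b = 0" if "b \<in> B" for b
    using L_algebraic[of b] B that by (auto elim!: algebraicE')
  then obtain p :: "complex \<Rightarrow> int poly" where p: "\<And>b. b \<in> B \<Longrightarrow> p b \<noteq> 0"
    "\<And>b. b \<in> B \<Longrightarrow> poly (map_poly of_int (p b)) b = 0" by metis
  define R where "R b = {z::complex. poly (map_poly of_int (p b)) z = 0}" for b
  have R: "finite (R b)" if "b \<in> B" for b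
    unfolding R_def using p(1)[OF that] by (intro poly_roots_finite) (simp add: map_poly_eq_0_iff)
  have root: "\<sigma> b \<in> R b" if "\<sigma> \<in> G" "b \<in> B" for \<sigma> b
  proof -
    have bL: "b \<in> L" using B that by blast
    have "poly (map_poly of_int (p b)) (\<sigma> b) = (\<Sum>i\<le>Polynomial.degree (p b). of_int (Polynomial.coeff (p b) i) * \<sigma> b ^ i)"
      by (simp add: poly_altdef degree_map_poly coeff_map_poly)
    also have "\<dots> = \<sigma> (\<Sum>i\<le>Polynomial.degree (p b). of_int (Polynomial.coeff (p b) i) * b ^ i)"
      using that bL by (simp add: gal_hom emb_of_int[OF gal_emb] power_in mult_in)
    also have "(\<Sum>i\<le>Polynomial.degree (p b). of_int (Polynomial.coeff (p b) i) * b ^ i) = 0"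
      using p(2)[OF that(2)] by (simp add: poly_altdef degree_map_poly coeff_map_poly)
    finally show ?thesis using that by (simp add: R_def gal_hom)
  qed
  have "inj_on (\<lambda>\<sigma>. restrict \<sigma> B) G"
  proof (rule inj_onI)
    fix \<sigma> \<tau> assume st: "\<sigma> \<in> G" "\<tau> \<in> G" "restrict \<sigma> B = restrict \<tau> B"
    have eqB: "\<sigma> b = \<tau> b" if "b \<in> B" for b using fun_cong[OF st(3), of b] that by simp
    show "\<sigma> = \<tau>"
    proof (rule gal_eqI[OF st(1,2)])
      fix x assume "x \<in> L"
      then have "x \<in> QV.span B" using B by simp
      then have "x \<in> L \<and> \<sigma> x = \<tau> x"
      proof (induction rule: QV.span_induct_alt)
        case base
        then show ?case by (simp add: gal_hom(1)[OF st(1)] gal_hom(1)[OF st(2)])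
      next
        case (step c b y)
        have bL: "b \<in> L" "y \<in> L" "of_rat c * b \<in> L" using step B mult_in[OF of_rat_in] by blast+
        have hom: "\<mu> (of_rat c * b + y) = of_rat c * \<mu> b + \<mu> y" if "\<mu> \<in> G" for \<mu>
          using bL emb_add[OF gal_emb[OF that]] emb_mult[OF gal_emb[OF that]] emb_of_rat[OF gal_emb[OF that]] by simp
        show ?case using bL step eqB[OF step(1)] add_in hom[OF st(1)] hom[OF st(2)] by simp
      qed
      then show "\<sigma> x = \<tau> x" by blast
    qed
  qed
  moreover have "(\<lambda>\<sigma>. restrict \<sigma> B) ` G \<subseteq> (\<Pi>\<^sub>E b\<in>B. R b)" using root by auto
  moreover have "finite (\<Pi>\<^sub>E b\<in>B. R b)" using B R by (intro finite_PiE) auto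
  ultimately show ?thesis by (meson finite_imageD finite_subset)
qed

lemma bij_left_mult: "\<tau> \<in> G \<Longrightarrow> bij_betw (\<lambda>\<sigma>. \<tau> \<otimes>\<^bsub>gal_group K L\<^esub> \<sigma>) G G"
  unfolding bij_betw_def using Gal.inj_on_cmult Gal.surj_const_mult by blast

section \<open>Traces, norms and normality\<close>

definition tr :: "complex \<Rightarrow> complex" where "tr x = (\<Sum>\<sigma>\<in>G. \<sigma> x)"

definition nm :: "complex \<Rightarrow> complex" where "nm x = (\<Prod>\<sigma>\<in>G. \<sigma> x)"

lemma gal_tr: assumes "\<tau> \<in> G" "x \<in> L" shows "\<tau> (tr x) = tr x"
proof -
  have "\<tau> (tr x) = (\<Sum>\<sigma>\<in>G. (\<tau> \<otimes>\<^bsub>gal_group K L\<^esub> \<sigma>) x)"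
    unfolding tr_def using assms by (subst emb_sum[OF gal_emb[OF assms(1)]]) (auto simp: gal_in mult_apply)
  also have "\<dots> = tr x" unfolding tr_def
    using sum.reindex_bij_betw[OF bij_left_mult[OF assms(1)], of "\<lambda>\<sigma>. \<sigma> x"] .
  finally show ?thesis .
qed

lemma gal_nm: assumes "\<tau> \<in> G" "x \<in> L" shows "\<tau> (nm x) = nm x"
proof -
  have "\<tau> (nm x) = (\<Prod>\<sigma>\<in>G. (\<tau> \<otimes>\<^bsub>gal_group K L\<^esub> \<sigma>) x)"
    unfolding nm_def using assms by (subst emb_prod[OF gal_emb[OF assms(1)]]) (auto simp: gal_in mult_apply)
  also have "\<dots> = nm x" unfolding nm_def
    using prod.reindex_bij_betw[OF bij_left_mult[OF assms(1)], of "\<lambda>\<sigma>. \<sigma> x"] .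
  finally show ?thesis .
qed

lemma tr_in: "x \<in> L \<Longrightarrow> tr x \<in> L"
  unfolding tr_def by (rule sum_in) (rule gal_in)

lemma nm_in: "x \<in> L \<Longrightarrow> nm x \<in> L"
  unfolding nm_def by (rule prod_in) (rule gal_in)

lemma tr_OI: "x \<in> OI L \<Longrightarrow> tr x \<in> OI L"
  unfolding tr_def by (rule OI_sum) (rule gal_OI)

lemma nm_OI: "x \<in> OI L \<Longrightarrow> nm x \<in> OI L"
  unfolding nm_def by (rule OI_prod) (rule gal_OI)

end

locale galois_ext = field_ext +
  assumes fixed: "fixed_field L (carrier (gal_group K L)) = K"
begin

lemma fixed_in_K: "x \<in> L \<Longrightarrow> (\<And>\<sigma>. \<sigma> \<in> G \<Longrightarrow> \<sigma> x = x) \<Longrightarrow> x \<in> K"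
  using fixed by (auto simp: fixed_field_def)

lemma tr_K: "x \<in> L \<Longrightarrow> tr x \<in> K"
  by (rule fixed_in_K[OF tr_in]) (auto intro: gal_tr)

lemma nm_K: "x \<in> L \<Longrightarrow> nm x \<in> K"
  by (rule fixed_in_K[OF nm_in]) (auto intro: gal_nm)

lemma tr_OI_K: "x \<in> OI L \<Longrightarrow> tr x \<in> OI K"
  unfolding OI_K_iff using tr_OI tr_K OI_subset by blast

lemma nm_OI_K: "x \<in> OI L \<Longrightarrow> nm x \<in> OI K"
  unfolding OI_K_iff using nm_OI nm_K OI_subset by blast

text \<open>Otherwise \<open>\<tau> (tr x) = tr x\<close> would be a linear relation between distinct embeddings.\<close>

lemma emb_in_gal:
  assumes \<tau>: "emb L \<tau>" "\<And>x. x \<in> K \<Longrightarrow> \<tau> x = x"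
  shows "\<exists>\<sigma>\<in>G. \<forall>x\<in>L. \<tau> x = \<sigma> x"
proof (rule ccontr)
  assume "\<not> (\<exists>\<sigma>\<in>G. \<forall>x\<in>L. \<tau> x = \<sigma> x)"
  then have no: "\<exists>x\<in>L. \<tau> x \<noteq> \<sigma> x" if "\<sigma> \<in> G" for \<sigma> using that by blast
  \<comment> \<open>The boolean tag separates the two families of characters: all \<sigma>, and all
    composites of \<tau> after \<sigma>. The second family gets coefficient 1, the first -1.\<close>
  define \<chi> where "\<chi> i x = (if fst i then \<tau> (snd i x) else snd i x)" for i :: "bool \<times> (complex \<Rightarrow> complex)" and x
  define a :: "bool \<times> (complex \<Rightarrow> complex) \<Rightarrow> complex" where "a i = (if fst i then 1 else - 1)" for i
  define J where "J = (UNIV :: bool set) \<times> G"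
  have dist: "\<exists>y\<in>L. \<chi> i y - \<chi> j y \<notin> {0}" if ij: "i \<in> J" "j \<in> J" "i \<noteq> j" for i j
  proof -
    have ne: "\<exists>y\<in>L. \<sigma> y \<noteq> \<sigma>' y" if "\<sigma> \<in> G" "\<sigma>' \<in> G" "\<sigma> \<noteq> \<sigma>'" for \<sigma> \<sigma>'
      using gal_eqI that by blast
    have ne2: "\<exists>y\<in>L. \<tau> (\<sigma> y) \<noteq> \<sigma>' y" if st: "\<sigma> \<in> G" "\<sigma>' \<in> G" for \<sigma> \<sigma>'
    proof -
      \<comment> \<open>If \<tau> after \<sigma> agreed with \<sigma>', then \<tau> would agree on
        \<open>L\<close> with \<sigma>' after the inverse of \<sigma>, an element of the
        group.\<close>
      define \<mu> where "\<mu> = \<sigma>' \<otimes>\<^bsub>gal_group K L\<^esub> inv\<^bsub>gal_group K L\<^esub> \<sigma>"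
      have "\<mu> \<in> G" using st by (simp add: \<mu>_def)
      then obtain x where x: "x \<in> L" "\<tau> x \<noteq> \<mu> x" using no by blast
      let ?y = "(inv\<^bsub>gal_group K L\<^esub> \<sigma>) x"
      have "?y \<in> L" "\<sigma> ?y = x" using st x inv_apply gal_in Gal.inv_closed by auto
      moreover have "\<mu> x = \<sigma>' ?y" using st x by (simp add: \<mu>_def mult_apply)
      ultimately show ?thesis using x by metis
    qed
    obtain u \<sigma> v \<sigma>' where [simp]: "i = (u,\<sigma>)" "j = (v,\<sigma>')" by (cases i, cases j)
    have G: "\<sigma> \<in> G" "\<sigma>' \<in> G" using ij by (auto simp: J_def)
    consider "u" "v" | "\<not> u" "\<not> v" | "u" "\<not> v" | "\<not> u" "v" by blast
    then show ?thesis
    proof cases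
      case 1
      then obtain y where y: "y \<in> L" "\<sigma> y \<noteq> \<sigma>' y" using ne G ij by auto
      then have "\<tau> (\<sigma> y) \<noteq> \<tau> (\<sigma>' y)"
        using emb_inj[OF \<tau>(1) gal_in[OF G(1) y(1)] gal_in[OF G(2) y(1)]] by blast
      then show ?thesis using 1 y by (auto simp: \<chi>_def)
    next
      case 2
      then obtain y where "y \<in> L" "\<sigma> y \<noteq> \<sigma>' y" using ne G ij by auto
      then show ?thesis using 2 by (auto simp: \<chi>_def)
    next
      case 3
      then show ?thesis using ne2[OF G] by (auto simp: \<chi>_def)
    next
      case 4
      obtain y where "y \<in> L" "\<tau> (\<sigma>' y) \<noteq> \<sigma> y" using ne2[OF G(2,1)] by blast
      then show ?thesis using 4 by (intro bexI[of _ y]) (auto simp: \<chi>_def)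
    qed
  qed
  have rel: "(\<Sum>i\<in>J. a i * \<chi> i x) \<in> {0}" if x: "x \<in> L" for x
  proof -
    have "(\<Sum>i\<in>J. a i * \<chi> i x) = (\<Sum>u\<in>UNIV. \<Sum>\<sigma>\<in>G. a (u,\<sigma>) * \<chi> (u,\<sigma>) x)"
      unfolding J_def by (simp add: sum.cartesian_product)
    also have "\<dots> = (\<Sum>\<sigma>\<in>G. \<tau> (\<sigma> x)) - (\<Sum>\<sigma>\<in>G. \<sigma> x)"
      by (simp add: UNIV_bool a_def \<chi>_def sum_negf)
    also have "(\<Sum>\<sigma>\<in>G. \<tau> (\<sigma> x)) = \<tau> (tr x)"
      unfolding tr_def using x by (subst emb_sum[OF \<tau>(1)]) (auto simp: gal_in)
    also have "\<dots> = tr x" using \<tau>(2) tr_K x by blast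
    finally show ?thesis by (simp add: tr_def)
  qed
  have mem: "(False, \<one>\<^bsub>gal_group K L\<^esub>) \<in> J" by (simp add: J_def)
  have "a (False, \<one>\<^bsub>gal_group K L\<^esub>) \<in> {0}"
  proof (rule independence_of_characters[where I = J and A = L and S = UNIV and q = "{0}" and b = "{0}" and \<chi> = \<chi> and a = a])
    show "finite J" by (simp add: J_def finite_gal)
    show "\<chi> i (x * y) = \<chi> i x * \<chi> i y" if "i \<in> J" "x \<in> L" "y \<in> L" for i x y
      using that emb_mult[OF \<tau>(1)] by (auto simp: \<chi>_def J_def gal_hom gal_in)
    show "\<chi> i 1 = 1" if "i \<in> J" for i
      using that emb_one[OF \<tau>(1)] by (auto simp: \<chi>_def J_def gal_hom)
  qed (use dist rel mem mult_in in auto)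
  then show False by (simp add: a_def)
qed

lemma emb_image:
  assumes \<tau>: "emb L \<tau>" "\<And>x. x \<in> K \<Longrightarrow> \<tau> x = x"
  shows "x \<in> L \<Longrightarrow> \<tau> x \<in> L" "\<tau> ` L = L"
proof -
  obtain \<sigma> where \<sigma>: "\<sigma> \<in> G" "\<And>x. x \<in> L \<Longrightarrow> \<tau> x = \<sigma> x" using emb_in_gal[OF \<tau>] by blast
  show "x \<in> L \<Longrightarrow> \<tau> x \<in> L" using \<sigma> gal_in by simp
  show "\<tau> ` L = L" using \<sigma> gal_bij[OF \<sigma>(1)] by (simp add: bij_betw_def cong: image_cong)
qed

lemma restrict_gal:
  assumes "field_ext K F" "L \<subseteq> F" "\<sigma> \<in> carrier (gal_group K F)"
  shows "restrict \<sigma> L \<in> G"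
proof -
  interpret F: field_ext K F by fact
  have e: "emb L \<sigma>" using emb_subset F.gal_emb assms by blast
  have "\<And>x. x \<in> K \<Longrightarrow> \<sigma> x = x" using F.gal_fix assms by blast
  with e have im: "\<sigma> ` L = L" using emb_image by blast
  have "emb L (restrict \<sigma> L)" using e by (auto simp: emb_def add_in mult_in)
  moreover have "inj_on \<sigma> L" using emb_inj[OF e] by (auto simp: inj_on_def)
  ultimately show ?thesis
    unfolding gal_iff using im KL F.gal_fix[OF assms(3)] by (auto simp: bij_betw_def inj_on_restrict_eq)
qed

end

locale abelian_ext = galois_ext +
  assumes commute: "\<sigma> \<in> carrier (gal_group K L) \<Longrightarrow> \<tau> \<in> carrier (gal_group K L) \<Longrightarrow>
    \<sigma> \<otimes>\<^bsub>gal_group K L\<^esub> \<tau> = \<tau> \<otimes>\<^bsub>gal_group K L\<^esub> \<sigma>"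
begin

lemma comm_group_gal: "comm_group (gal_group K L)"
  by (rule Gal.group_comm_groupI) (rule commute)

lemma commute_apply: "\<sigma> \<in> G \<Longrightarrow> \<tau> \<in> G \<Longrightarrow> x \<in> L \<Longrightarrow> \<sigma> (\<tau> x) = \<tau> (\<sigma> x)"
  using commute[of \<sigma> \<tau>] mult_apply[of \<sigma> \<tau> x] mult_apply[of \<tau> \<sigma> x] by simp

end

section \<open>Finiteness over the base field and over the rationals\<close>

lemma span_mult_subset:
  assumes V: "QV.subspace V" and D: "\<And>a b. a \<in> D \<Longrightarrow> b \<in> D' \<Longrightarrow> a * b \<in> V"
    and x: "x \<in> QV.span D" and y: "y \<in> QV.span D'"
  shows "x * y \<in> V"
proof -
  have 1: "a * y \<in> V" if a: "a \<in> D" for a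
    using y
  proof (induction rule: QV.span_induct_alt)
    case base
    then show ?case using QV.subspace_0[OF V] by simp
  next
    case (step c b z)
    have "of_rat c * (a * b) + a * z \<in> V"
      using QV.subspace_add[OF V QV.subspace_scale[OF V D[OF a step(1)]] step(2)] .
    then show ?case by (simp add: algebra_simps)
  qed
  show ?thesis
    using x
  proof (induction rule: QV.span_induct_alt)
    case base
    then show ?case using QV.subspace_0[OF V] by simp
  next
    case (step c b z)
    have "of_rat c * (b * y) + z * y \<in> V"
      using QV.subspace_add[OF V QV.subspace_scale[OF V 1[OF step(1)]] step(2)] .
    then show ?case by (simp add: algebra_simps)
  qed
qed

text \<open>Tower argument: each \<open>line_extension\<close> step enlarges the rational spanning
  set by the products of a spanning set of \<open>K\<close> with the new vector.\<close>

lemma number_field_of_finite_dimension: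
  assumes K: "number_field K" and L: "cfield L" and fd: "ring.finite_dimension complex_ring K L"
  shows "number_field L"
proof -
  interpret K: number_field K by fact
  interpret L: cfield L by fact
  obtain C where C: "finite C" "K \<subseteq> QV.span C" using K.finite_over_Q by blast
  have ind: "K' \<subseteq> QV.span C \<Longrightarrow> \<exists>B. finite B \<and> E \<subseteq> QV.span B" if "CR.dimension n K' E" for n K' E
    using that
  proof (induction n K' E rule: CR.dimension.induct)
    case (zero_dim K')
    then show ?case by (intro exI[of _ "{}"]) simp
  next
    case (Suc_dim v E n K')
    then obtain B where B: "finite B" "E \<subseteq> QV.span B" by blast
    let ?B = "B \<union> (\<lambda>c. c * v) ` C"
    have "u \<in> QV.span ?B" if u: "u \<in> CR.line_extension K' v E" for u
    proof -
      obtain k e where ke: "k \<in> K'" "e \<in> E" "u = k * v + e"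
        using u unfolding CR.line_extension_mem_iff by auto
      have "k * v \<in> QV.span ?B"
      proof (rule span_mult_subset[where D = C and D' = "{v}"])
        show "a * b \<in> QV.span ?B" if "a \<in> C" "b \<in> {v}" for a b
          using that by (intro QV.span_base) auto
      qed (use ke Suc_dim.prems in \<open>auto intro: QV.span_base\<close>)
      moreover have "e \<in> QV.span ?B" using ke B QV.span_mono[of B ?B] by blast
      ultimately show ?thesis using ke QV.span_add by blast
    qed
    moreover have "finite ?B" using B C by blast
    ultimately show ?case by blast
  qed
  obtain n where "CR.dimension n K L" using fd by (auto simp: CR.finite_dimension_def)
  then have "\<exists>B. finite B \<and> L \<subseteq> QV.span B" using ind C by blast
  then show ?thesis by unfold_locales
qed

lemma finite_dimension_of_number_field:
  assumes "cfield K" "number_field L" "K \<subseteq> L"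
  shows "ring.finite_dimension complex_ring K L"
proof -
  interpret K: cfield K by fact
  interpret L: number_field L by fact
  obtain B where B: "finite B" "B \<subseteq> L" "QV.independent B" "QV.span B = L" using L.exists_basis .
  obtain Us where Us: "set Us = B" using B(1) finite_list by blast
  note sp = CR.Span_subgroup_props[OF K.subfield, of Us, simplified]
  have "CR.Span K Us \<subseteq> L"
  proof (rule CR.Span_min[OF K.subfield])
    show "subgroup L (add_monoid complex_ring)"
      using subring.axioms(1)[OF subfieldE(1)[OF L.subfield]] .
    show "K <#>\<^bsub>complex_ring\<^esub> set Us \<subseteq> L"
    proof
      fix z assume "z \<in> K <#>\<^bsub>complex_ring\<^esub> set Us"
      then obtain k u where "k \<in> K" "u \<in> set Us" "z = k * u" by (auto simp: set_mult_def)
      then show "z \<in> L" using assms(3) B(2) Us L.mult_in by blast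
    qed
  qed simp
  moreover have "L \<subseteq> CR.Span K Us"
    unfolding B(4)[symmetric]
  proof (rule QV.span_minimal)
    show "B \<subseteq> CR.Span K Us" using CR.Span_base_incl[OF K.subfield, of Us] Us by simp
    show "QV.subspace (CR.Span K Us)"
      using CR.Span_smult_closed[OF K.subfield, of Us] sp
      by (intro QV.subspaceI) auto
  qed
  ultimately show ?thesis
    using CR.Span_finite_dimension[OF K.subfield, of Us] by simp
qed

text \<open>Bridge from the given notion to the locales; finite dimension over \<open>K\<close> and
  finite generation over the rationals agree because \<open>K\<close> is itself a number
  field.\<close>

lemma abelian_extension_iff:
  assumes "number_field K"
  shows "abelian_extension K L \<longleftrightarrow> abelian_ext K L"
proof
  assume a: "abelian_extension K L"
  interpret K: number_field K by fact
  interpret L: cfield L by (rule cfield.intro) (use a in \<open>simp add: abelian_extension_def\<close>)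
  interpret L: number_field L
    using number_field_of_finite_dimension[OF assms L.cfield_axioms] a by (simp add: abelian_extension_def)
  show "abelian_ext K L"
  proof
    fix \<sigma> \<tau> assume "\<sigma> \<in> carrier (gal_group K L)" "\<tau> \<in> carrier (gal_group K L)"
    then show "\<sigma> \<otimes>\<^bsub>gal_group K L\<^esub> \<tau> = \<tau> \<otimes>\<^bsub>gal_group K L\<^esub> \<sigma>"
      using a comm_monoid.m_comm[of "gal_group K L"] by (auto simp: abelian_extension_def comm_group_def)
  qed (use a in \<open>auto simp: abelian_extension_def\<close>)
next
  assume "abelian_ext K L"
  then interpret abelian_ext K L .
  show "abelian_extension K L"
    unfolding abelian_extension_def
    using K.subfield subfield KL fixed comm_group_gal
      finite_dimension_of_number_field[OF K.cfield_axioms number_field_axioms KL] by simp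
qed

subsection \<open>The compositum\<close>

lemma cfield_compositum: "cfield (compositum L M)"
  unfolding compositum_def
  by (rule cfield.intro) (rule field.generate_field_is_subfield[OF field_complex_ring], simp)

lemma compositum_superset: "L \<subseteq> compositum L M" "M \<subseteq> compositum L M"
  unfolding compositum_def using generate_field.incl by (metis Un_iff subsetI)+

lemma compositum_least:
  assumes "cfield F" "L \<subseteq> F" "M \<subseteq> F" shows "compositum L M \<subseteq> F"
proof -
  interpret F: cfield F by fact
  show ?thesis unfolding compositum_def
    using field.generate_field_min_subfield1[OF field_complex_ring _ F.subfield, of "L \<union> M"] assms by simp
qed

lemma compositum_induct [consumes 3, case_names one incl neg inverse add mult]:
  assumes x: "x \<in> compositum L M" and "cfield L" "cfield M"
    and "P 1" "\<And>x. x \<in> L \<union> M \<Longrightarrow> P x"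
    and "\<And>x. x \<in> compositum L M \<Longrightarrow> P x \<Longrightarrow> P (- x)"
    and "\<And>x. x \<in> compositum L M \<Longrightarrow> P x \<Longrightarrow> P (inverse x)"
    and "\<And>x y. x \<in> compositum L M \<Longrightarrow> y \<in> compositum L M \<Longrightarrow> P x \<Longrightarrow> P y \<Longrightarrow> P (x + y)"
    and "\<And>x y. x \<in> compositum L M \<Longrightarrow> y \<in> compositum L M \<Longrightarrow> P x \<Longrightarrow> P y \<Longrightarrow> P (x * y)"
  shows "P x"
  using x unfolding compositum_def
  by (induction rule: generate_field.induct) (use assms in \<open>auto simp: compositum_def\<close>)

text \<open>The products of basis elements span a ring \<open>V\<close> of algebraic numbers. It is
  therefore a field, and it contains both factors.\<close>

lemma number_field_compositum:
  assumes "number_field L" "number_field M"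
  shows "number_field (compositum L M)"
proof -
  interpret L: number_field L by fact
  interpret M: number_field M by fact
  obtain B where B: "finite B" "B \<subseteq> L" "QV.independent B" "QV.span B = L" using L.exists_basis .
  obtain C where C: "finite C" "C \<subseteq> M" "QV.independent C" "QV.span C = M" using M.exists_basis .
  define D where "D = (\<lambda>(b,c). b * c) ` (B \<times> C)"
  define V where "V = QV.span D"
  have V: "QV.subspace V" by (simp add: V_def)
  have LM: "u * v \<in> V" if "u \<in> L" "v \<in> M" for u v
  proof (rule span_mult_subset[OF V, of B C])
    show "a * b \<in> V" if "a \<in> B" "b \<in> C" for a b
      using that unfolding V_def D_def by (intro QV.span_base) auto
  qed (use that B C in auto)
  have mult: "x * y \<in> V" if xy: "x \<in> V" "y \<in> V" for x y
  proof (rule span_mult_subset[OF V, of D D])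
    fix a b assume "a \<in> D" "b \<in> D"
    obtain u v where uv: "a = u * v" "u \<in> B" "v \<in> C" using \<open>a \<in> D\<close> unfolding D_def by auto
    obtain u' v' where uv': "b = u' * v'" "u' \<in> B" "v' \<in> C" using \<open>b \<in> D\<close> unfolding D_def by auto
    have "u \<in> L" "v \<in> M" "u' \<in> L" "v' \<in> M" using B C uv uv' by blast+
    then have "(u * u') * (v * v') \<in> V" by (intro LM L.mult_in M.mult_in)
    then show "a * b \<in> V" unfolding uv(1) uv'(1) by (simp only: mult_ac)
  qed (use xy in \<open>auto simp: V_def\<close>)
  have one: "1 \<in> V" using LM[of 1 1] by simp
  have fD: "finite D" using B C by (simp add: D_def)
  have "cfield V"
  proof (rule cfield_of_algebraic_ring)
    show "algebraic x" if x: "x \<in> V" for x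
    proof (rule algebraic_of_powers_in_span[OF fD])
      have "x ^ i \<in> V" for i by (induction i) (auto intro: one mult x)
      then show "\<And>i. x ^ i \<in> QV.span D" by (simp add: V_def)
    qed
  qed (use one mult QV.subspace_add[OF V] QV.subspace_scale[OF V] in auto)
  moreover have "L \<subseteq> V" using LM[of _ 1] by auto
  moreover have "M \<subseteq> V" using LM[of 1] by auto
  ultimately have "compositum L M \<subseteq> V" by (rule compositum_least)
  then show ?thesis
    using cfield_compositum fD unfolding number_field_def number_field_axioms_def V_def by blast
qed

text \<open>The fixed field is \<open>K\<close> because any element outside \<open>K\<close> is
  moved by an embedding that fixes \<open>K\<close>, and such an embedding maps \<open>L\<close>,
  \<open>M\<close> and hence the compositum onto themselves. Commutativity is inherited from the
  restrictions to \<open>L\<close> and \<open>M\<close>.\<close>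

lemma abelian_ext_compositum:
  assumes "abelian_ext K L" "abelian_ext K M"
  shows "abelian_ext K (compositum L M)"
proof -
  interpret L: abelian_ext K L by fact
  interpret M: abelian_ext K M by fact
  define F where "F = compositum L M"
  interpret F: number_field F
    unfolding F_def by (rule number_field_compositum[OF L.number_field_axioms M.number_field_axioms])
  have LF: "L \<subseteq> F" and MF: "M \<subseteq> F" unfolding F_def by (rule compositum_superset)+
  interpret F: field_ext K F by unfold_locales (use L.KL LF in blast)
  note ind = compositum_induct[where L = L and M = M, folded F_def, OF _ L.cfield_axioms M.cfield_axioms,
    consumes 1, case_names one incl neg inverse add mult]
  have moving: "\<exists>\<sigma>\<in>carrier (gal_group K F). \<sigma> x \<noteq> x" if x: "x \<in> F" "x \<notin> K" for x
  proof -
    obtain \<tau> where \<tau>: "emb F \<tau>" "\<forall>y\<in>K. \<tau> y = y" "\<tau> x \<noteq> x"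
      using L.K.exists_moving_emb[OF F.number_field_axioms F.KL x] .
    have eL: "emb L \<tau>" and eM: "emb M \<tau>" using \<tau>(1) emb_subset LF MF by blast+
    have imL: "\<tau> ` L = L" by (rule L.emb_image[OF eL]) (use \<tau> in auto)
    have imM: "\<tau> ` M = M" by (rule M.emb_image[OF eM]) (use \<tau> in auto)
    have in1: "\<tau> y \<in> F" if "y \<in> F" for y
      using that
    proof (induction rule: ind)
      case one
      then show ?case using F.emb_one[OF \<tau>(1)] by simp
    next
      case (incl x)
      then show ?case using imL imM LF MF by blast
    qed (simp_all add: F.emb_neg[OF \<tau>(1)] F.emb_inverse_eq[OF \<tau>(1)] F.emb_add[OF \<tau>(1)] F.emb_mult[OF \<tau>(1)]
        F.neg_in F.inverse_in F.add_in F.mult_in)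
    have onto: "\<exists>z\<in>F. y = \<tau> z" if "y \<in> F" for y
      using that
    proof (induction rule: ind)
      case one
      then show ?case using F.emb_one[OF \<tau>(1)] F.one_in by metis
    next
      case (incl x)
      then show ?case using imL imM LF MF by blast
    next
      case (neg x)
      then show ?case using F.emb_neg[OF \<tau>(1)] F.neg_in by metis
    next
      case (inverse x)
      then show ?case using F.emb_inverse_eq[OF \<tau>(1)] F.inverse_in by metis
    next
      case (add x y)
      then show ?case using F.emb_add[OF \<tau>(1)] F.add_in by metis
    next
      case (mult x y)
      then show ?case using F.emb_mult[OF \<tau>(1)] F.mult_in by metis
    qed
    have "bij_betw \<tau> F F"
      using F.emb_inj[OF \<tau>(1)] in1 onto by (auto simp: bij_betw_def inj_on_def image_iff)
    then have "bij_betw (restrict \<tau> F) F F" by (simp cong: bij_betw_cong)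
    moreover have "emb F (restrict \<tau> F)" using \<tau>(1) by (auto simp: emb_def F.add_in F.mult_in)
    ultimately have "restrict \<tau> F \<in> carrier (gal_group K F)"
      unfolding F.gal_iff using \<tau>(2) F.KL by auto
    moreover have "restrict \<tau> F x \<noteq> x" using \<tau>(3) x by simp
    ultimately show ?thesis by blast
  qed
  have "fixed_field F F.G = K"
    using moving F.KL F.gal_fix unfolding fixed_field_def by blast
  then interpret F: galois_ext K F by unfold_locales
  have "abelian_ext K F"
  proof
    fix \<sigma> \<tau> assume st: "\<sigma> \<in> F.G" "\<tau> \<in> F.G"
    show "\<sigma> \<otimes>\<^bsub>gal_group K F\<^esub> \<tau> = \<tau> \<otimes>\<^bsub>gal_group K F\<^esub> \<sigma>"
    proof (rule F.gal_eqI)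
      have comm: "\<sigma> (\<tau> y) = \<tau> (\<sigma> y)" if "y \<in> F" for y
        using that
      proof (induction rule: ind)
        case (incl y)
        then show ?case
        proof
          assume y: "y \<in> L"
          note r = L.restrict_gal[OF F.field_ext_axioms LF]
          have "restrict \<sigma> L y \<in> L" "restrict \<tau> L y \<in> L" using r st L.gal_in y by blast+
          then show ?thesis using L.commute_apply[OF r[OF st(1)] r[OF st(2)] y] y by simp
        next
          assume y: "y \<in> M"
          note r = M.restrict_gal[OF F.field_ext_axioms MF]
          have "restrict \<sigma> M y \<in> M" "restrict \<tau> M y \<in> M" using r st M.gal_in y by blast+
          then show ?thesis using M.commute_apply[OF r[OF st(1)] r[OF st(2)] y] y by simp
        qed
      qed (use st in \<open>simp_all add: F.gal_hom F.gal_in F.emb_inverse_eq[OF F.gal_emb]\<close>)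
      fix x assume "x \<in> F"
      then show "(\<sigma> \<otimes>\<^bsub>gal_group K F\<^esub> \<tau>) x = (\<tau> \<otimes>\<^bsub>gal_group K F\<^esub> \<sigma>) x"
        using st comm by (simp add: F.mult_apply)
    qed (use st in auto)
  qed
  then show ?thesis unfolding F_def .
qed

lemma gal_compositum_eqI:
  assumes L: "cfield L" and M: "cfield M" and F: "field_ext K (compositum L M)"
    and st: "\<sigma> \<in> carrier (gal_group K (compositum L M))" "\<tau> \<in> carrier (gal_group K (compositum L M))"
    and eq: "\<And>x. x \<in> L \<union> M \<Longrightarrow> \<sigma> x = \<tau> x"
  shows "\<sigma> = \<tau>"
proof -
  interpret F: field_ext K "compositum L M" by fact
  show ?thesis
  proof (rule F.gal_eqI[OF st])
    fix x assume "x \<in> compositum L M"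
    then show "\<sigma> x = \<tau> x"
      using L M
    proof (induction rule: compositum_induct)
      case (incl x)
      then show ?case by (rule eq)
    qed (use st in \<open>simp_all add: F.gal_hom F.emb_inverse_eq[OF F.gal_emb]\<close>)
  qed
qed

section \<open>Residue fields\<close>

lemma (in Ring.field) finite_field_pow_card:
  assumes fin: "finite (carrier R)" and x: "x \<in> carrier R" "x \<noteq> \<zero>"
  shows "x [^] (card (carrier R) - 1) = \<one>"
proof -
  have U: "x \<in> Units R" using x field_Units by simp
  have "group (units_of R)" by (rule units_group)
  moreover have "x \<in> carrier (units_of R)" unfolding units_of_carrier by (rule U)
  ultimately have "x [^]\<^bsub>units_of R\<^esub> Coset.order (units_of R) = \<one>\<^bsub>units_of R\<^esub>"
    by (rule group.pow_order_eq_1)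
  moreover have "Coset.order (units_of R) = card (carrier R) - 1"
    unfolding Coset.order_def units_of_carrier field_Units by (rule card_Diff_singleton) simp
  ultimately show ?thesis unfolding units_of_pow[OF U] units_of_one by simp
qed

text \<open>By the order of the unit group the inverse of \<open>k\<close> is a power of
  \<open>k\<close>, so it stays in the subring.\<close>

lemma (in Ring.field) finite_subring_is_subfield:
  assumes fin: "finite (carrier R)" and F: "subring F R"
  shows "subfield F R"
proof (rule subfieldI'[OF F])
  fix k assume k: "k \<in> F - {\<zero>}"
  have kR: "k \<in> carrier R" "k \<noteq> \<zero>" using k subringE(1)[OF F] by auto
  have "card {\<zero>, \<one>} \<le> card (carrier R)" using fin by (intro card_mono) auto
  then have c2: "card (carrier R) \<ge> 2" by simp
  have pow: "k [^] (n::nat) \<in> F" for n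
    by (induction n) (use k subringE[OF F] in auto)
  have "k [^] (card (carrier R) - 2) \<otimes> k = k [^] (card (carrier R) - 1)"
    using c2 by (metis Suc_diff_Suc Suc_1 Suc_le_lessD nat_pow_Suc)
  then have "k [^] (card (carrier R) - 2) \<otimes> k = \<one>" using finite_field_pow_card[OF fin kR] by simp
  then have "inv k = k [^] (card (carrier R) - 2)"
    using kR by (metis comm_inv_char m_comm nat_pow_closed)
  then show "inv k \<in> F" using pow by simp
qed

lemma (in Ring.field) card_of_dimension:
  assumes "dimension n F E" "subfield F R" "finite F"
  shows "finite E \<and> card E = card F ^ n"
  using assms
proof (induction n F E rule: dimension.induct)
  case (zero_dim F)
  then show ?case by simp
next
  case (Suc_dim v E n F)
  have E: "finite E" "card E = card F ^ n" using Suc_dim by auto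
  note sp = space_subgroup_props[OF Suc_dim.prems(1) Suc_dim.hyps(3)]
  note F = subringE[OF subfieldE(1)[OF Suc_dim.prems(1)]]
  let ?f = "\<lambda>(k, e). k \<otimes> v \<oplus> e"
  have img: "line_extension F v E = ?f ` (F \<times> E)"
    using line_extension_mem_iff[of _ F v E] by force
  have "inj_on ?f (F \<times> E)"
  proof (rule inj_onI, clarify)
    fix k e k' e' assume m: "k \<in> F" "e \<in> E" "k' \<in> F" "e' \<in> E" and eq: "k \<otimes> v \<oplus> e = k' \<otimes> v \<oplus> e'"
    have c: "k \<in> carrier R" "k' \<in> carrier R" "e \<in> carrier R" "e' \<in> carrier R" "v \<in> carrier R"
      using m F(1) sp(1) Suc_dim.hyps(1) by auto
    have kk: "k = k'"
    proof (rule ccontr)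
      assume ne: "k \<noteq> k'"
      have "(k \<ominus> k') \<otimes> v = (k \<otimes> v \<oplus> e) \<ominus> (k' \<otimes> v) \<ominus> e"
        using c by algebra
      also have "\<dots> = e' \<ominus> e" unfolding eq using c by algebra
      finally have "(k \<ominus> k') \<otimes> v \<in> E" using m sp(3,4) by (simp add: a_minus_def)
      moreover have "k \<ominus> k' \<in> F" using m F by (simp add: a_minus_def)
      moreover have "k \<ominus> k' \<noteq> \<zero>" using ne c by simp
      ultimately have d: "inv (k \<ominus> k') \<otimes> ((k \<ominus> k') \<otimes> v) \<in> E"
        using sp(5) subfield_m_inv(1)[OF Suc_dim.prems(1), of "k \<ominus> k'"] by blast
      have "inv (k \<ominus> k') \<otimes> (k \<ominus> k') = \<one>"
        using subfield_m_inv(3)[OF Suc_dim.prems(1), of "k \<ominus> k'"] \<open>k \<ominus> k' \<in> F\<close> \<open>k \<ominus> k' \<noteq> \<zero>\<close> by blast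
      moreover have "inv (k \<ominus> k') \<in> carrier R"
        using subfield_m_inv(1)[OF Suc_dim.prems(1), of "k \<ominus> k'"] \<open>k \<ominus> k' \<in> F\<close> \<open>k \<ominus> k' \<noteq> \<zero>\<close> F(1) by blast
      ultimately have "v \<in> E" using d c by (metis l_one m_assoc minus_closed)
      then show False using Suc_dim.hyps(2) by blast
    qed
    then have "e = e'" using eq c by (metis add.l_cancel m_closed)
    then show "k = k' \<and> e = e'" using kk by blast
  qed
  then have "card (line_extension F v E) = card F * card E"
    unfolding img by (simp add: card_image card_cartesian_product)
  moreover have "finite (line_extension F v E)" unfolding img using E Suc_dim.prems by blast
  ultimately show ?case using E by simp
qed

lemma (in Ring.field) finite_field_card_dim:
  assumes fin: "finite (carrier R)" and F: "subring F R"
  shows "card (carrier R) = card F ^ (dim F (carrier R)) \<and> dim F (carrier R) > 0"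
proof -
  have sf: "subfield F R" by (rule finite_subring_is_subfield[OF assms])
  obtain Us where Us: "set Us = carrier R" using fin finite_list by blast
  have "Span F Us = carrier R"
    using Span_base_incl[OF sf, of Us] Span_in_carrier[of F Us] Us subringE(1)[OF F] by auto
  then have "finite_dimension F (carrier R)" using Span_finite_dimension[OF sf, of Us] Us by simp
  then obtain n where n: "dimension n F (carrier R)" by (auto simp: finite_dimension_def)
  have "dim F (carrier R) = n" using dimI[OF sf n] by (simp add: over_def)
  moreover have "finite F" using subringE(1)[OF F] fin finite_subset by blast
  then have card: "card (carrier R) = card F ^ n" using card_of_dimension[OF n sf] by blast
  moreover have "n > 0"
  proof (rule ccontr)
    assume "\<not> n > 0"
    then have "card (carrier R) = 1" using card by simp
    moreover have "card {\<zero>, \<one>} \<le> card (carrier R)" using fin by (intro card_mono) auto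
    ultimately show False by simp
  qed
  ultimately show ?thesis by simp
qed

text \<open>Both images represent the same quotient of \<open>A\<close>. This compares residue rings
  sitting in different quotients without setting up an isomorphism.\<close>

lemma card_image_same_kernel:
  assumes "\<And>x y. x \<in> A \<Longrightarrow> y \<in> A \<Longrightarrow> f x = f y \<longleftrightarrow> g x = g y"
  shows "card (f ` A) = card (g ` A)"
proof -
  have "bij_betw (\<lambda>z. g (inv_into A f z)) (f ` A) (g ` A)"
  proof (rule bij_betw_imageI)
    show "inj_on (\<lambda>z. g (inv_into A f z)) (f ` A)"
    proof (rule inj_onI)
      fix z w assume zw: "z \<in> f ` A" "w \<in> f ` A" "g (inv_into A f z) = g (inv_into A f w)"
      then have "f (inv_into A f z) = f (inv_into A f w)"
        using assms[OF inv_into_into[OF zw(1)] inv_into_into[OF zw(2)]] by simp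
      then show "z = w" using f_inv_into_f[OF zw(1)] f_inv_into_f[OF zw(2)] by simp
    qed
    show "(\<lambda>z. g (inv_into A f z)) ` f ` A = g ` A"
    proof (intro Set.set_eqI iffI)
      fix z assume "z \<in> (\<lambda>z. g (inv_into A f z)) ` f ` A"
      then obtain w where "w \<in> f ` A" "z = g (inv_into A f w)" by blast
      then show "z \<in> g ` A" using imageI[OF inv_into_into[of w f A], of g] by simp
    next
      fix z assume "z \<in> g ` A"
      then obtain a where a: "a \<in> A" "z = g a" by blast
      have "g (inv_into A f (f a)) = g a"
        using assms[OF inv_into_into[of "f a" f A] a(1)] a(1) f_inv_into_f[of "f a" f A] by simp
      then show "z \<in> (\<lambda>z. g (inv_into A f z)) ` f ` A"
        using a by (intro image_eqI[of _ _ "f a"]) auto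
    qed
  qed
  then show ?thesis by (rule bij_betw_same_card)
qed

lemma (in cfield) a_minus_eq:
  assumes "x \<in> OI L" "y \<in> OI L" shows "x \<ominus>\<^bsub>integer_ring L\<^esub> y = x - y"
proof -
  have "\<ominus>\<^bsub>integer_ring L\<^esub> y = - y" by (rule R.minus_equality) (use assms OI_neg in auto)
  then show ?thesis by (simp add: a_minus_def)
qed

lemma power_prime_add:
  fixes x y :: complex
  assumes L: "cfield L" and p: "Factorial_Ring.prime (p::nat)" and xy: "x \<in> OI L" "y \<in> OI L"
  shows "\<exists>z\<in>OI L. (x + y) ^ p = x ^ p + y ^ p + of_nat p * z"
proof -
  interpret cfield L by fact
  have p0: "p > 0" using p prime_gt_0_nat by blast
  have "\<exists>c. p choose k = p * c" if "k \<in> {1..<p}" for k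
    using dvd_choose_prime[of k p] p p0 that by (auto simp: dvd_def)
  then obtain c where c: "\<And>k. k \<in> {1..<p} \<Longrightarrow> p choose k = p * c k" by metis
  have "(x + y) ^ p = (\<Sum>k\<le>p. of_nat (p choose k) * x ^ k * y ^ (p - k))" by (rule binomial_ring)
  also have "{..p} = insert 0 (insert p {1..<p})" using p0 by auto
  also have "(\<Sum>k\<in>insert 0 (insert p {1..<p}). of_nat (p choose k) * x ^ k * y ^ (p - k))
    = y ^ p + (x ^ p + (\<Sum>k\<in>{1..<p}. of_nat (p choose k) * x ^ k * y ^ (p - k)))"
    using p0 by simp
  also have "(\<Sum>k\<in>{1..<p}. of_nat (p choose k) * x ^ k * y ^ (p - k)) = of_nat p * (\<Sum>k\<in>{1..<p}. of_nat (c k) * x ^ k * y ^ (p - k))"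
    unfolding sum_distrib_left by (rule sum.cong) (auto simp: c mult_ac)
  finally have "(x + y) ^ p = x ^ p + y ^ p + of_nat p * (\<Sum>k\<in>{1..<p}. of_nat (c k) * x ^ k * y ^ (p - k))"
    by (simp add: add_ac)
  moreover have "(\<Sum>k\<in>{1..<p}. of_nat (c k) * x ^ k * y ^ (p - k)) \<in> OI L"
    using xy by (intro OI_sum OI_mult OI_power) auto
  ultimately show ?thesis by blast
qed

context number_field_prime
begin

abbreviation "res \<equiv> integer_ring L Quot Q"
abbreviation "h x \<equiv> Q +>\<^bsub>integer_ring L\<^esub> x"

lemma h_eq_iff: "x \<in> OI L \<Longrightarrow> y \<in> OI L \<Longrightarrow> h x = h y \<longleftrightarrow> x - y \<in> Q"
  using R.quotient_eq_iff_same_a_r_cos[OF ideal_Q, of x y] by (simp add: a_minus_eq)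

lemma h_hom: "ring_hom_ring (integer_ring L) res h"
  using ideal.rcos_ring_hom_ring[OF ideal_Q] .

lemma carrier_res: "carrier res = h ` OI L"
  by (auto simp: FactRing_def A_RCOSETS_def')

lemma zero_res: "\<zero>\<^bsub>res\<^esub> = h 0"
  using Ring.ring_hom_zero[OF ideal.rcos_ring_hom[OF ideal_Q] R.ring_axioms ideal.quotient_is_ring[OF ideal_Q]]
  by simp

lemma one_res: "\<one>\<^bsub>res\<^esub> = h 1"
  using Ring.ring_hom_one[OF ideal.rcos_ring_hom[OF ideal_Q]] by simp

lemma mult_res: "x \<in> OI L \<Longrightarrow> y \<in> OI L \<Longrightarrow> h x \<otimes>\<^bsub>res\<^esub> h y = h (x * y)"
  using Ring.ring_hom_mult[OF ideal.rcos_ring_hom[OF ideal_Q], of x y] by simp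

lemma pow_res: "x \<in> OI L \<Longrightarrow> h x [^]\<^bsub>res\<^esub> (n::nat) = h (x ^ n)"
  by (induction n) (simp_all add: one_res mult_res OI_power mult.commute)

lemma finite_res: "finite (carrier res)"
proof -
  obtain p where p: "Factorial_Ring.prime p" "of_nat p \<in> Q" by (rule exists_rational_prime)
  obtain T where T: "finite T" "T \<subseteq> OI L" "\<forall>x\<in>OI L. \<exists>t\<in>T. \<exists>y\<in>OI L. x = t + of_nat p * y"
    using finite_residues_prime[OF p(1)] by blast
  have "h ` OI L \<subseteq> h ` T"
  proof
    fix z assume "z \<in> h ` OI L"
    then obtain x where x: "x \<in> OI L" "z = h x" by blast
    then obtain t y where ty: "t \<in> T" "y \<in> OI L" "x = t + of_nat p * y" using T by blast
    have "x - t = of_nat p * y" using ty by simp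
    then have "x - t \<in> Q" using p(2) ty(2) Q_closed(5) by metis
    then have "z = h t" using h_eq_iff x ty T by blast
    then show "z \<in> h ` T" using ty by blast
  qed
  then show ?thesis unfolding carrier_res using T(1) finite_subset by blast
qed

lemma field_res: "Ring.field res"
proof -
  have cr: "cring res" using ideal.quotient_is_cring[OF ideal_Q cring_integer_ring] .
  show ?thesis
  proof (rule cring.cring_fieldI[OF cr])
    interpret k: cring res by (rule cr)
    have ne: "\<one>\<^bsub>res\<^esub> \<noteq> \<zero>\<^bsub>res\<^esub>" unfolding one_res zero_res using h_eq_iff[of 1 0] one_notin by simp
    show "Units res = carrier res - {\<zero>\<^bsub>res\<^esub>}"
    proof (intro Set.set_eqI iffI)
      fix u assume u: "u \<in> Units res"
      then have "u \<noteq> \<zero>\<^bsub>res\<^esub>" using ne k.Units_r_inv_ex k.l_null by metis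
      then show "u \<in> carrier res - {\<zero>\<^bsub>res\<^esub>}" using u k.Units_closed by simp
    next
      fix u assume "u \<in> carrier res - {\<zero>\<^bsub>res\<^esub>}"
      then obtain x where x: "x \<in> OI L" "u = h x" "h x \<noteq> h 0" by (auto simp: carrier_res zero_res)
      then have "x \<notin> Q" using h_eq_iff[of x 0] by simp
      then obtain y where y: "y \<in> OI L" "x * y - 1 \<in> Q" using unit_mod x by blast
      then have "h x \<otimes>\<^bsub>res\<^esub> h y = \<one>\<^bsub>res\<^esub>"
        using mult_res x h_eq_iff[of "x * y" 1] one_res OI_mult by simp
      moreover from this have "h y \<otimes>\<^bsub>res\<^esub> h x = \<one>\<^bsub>res\<^esub>"
        using k.m_comm[of "h x" "h y"] x y by (simp add: carrier_res)
      ultimately show "u \<in> Units res" unfolding Units_def using x y carrier_res by auto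
    qed
  qed
qed

lemma fermat: assumes x: "x \<in> OI L" shows "x ^ card (carrier res) - x \<in> Q"
proof (cases "x \<in> Q")
  case True
  have "card (carrier res) > 0" using finite_res x by (auto simp: carrier_res card_gt_0_iff)
  then have "x ^ card (carrier res) \<in> Q"
    using Q_closed(5)[OF OI_power[OF x] True] by (cases "card (carrier res)") auto
  then show ?thesis by (rule Q_closed(7)[OF _ True])
next
  case False
  have "h x \<noteq> \<zero>\<^bsub>res\<^esub>" using False h_eq_iff[of x 0] x by (simp add: zero_res)
  then have "h x [^]\<^bsub>res\<^esub> (card (carrier res) - 1) = \<one>\<^bsub>res\<^esub>"
    using field.finite_field_pow_card[OF field_res finite_res, of "h x"] x by (simp add: carrier_res)
  then have "x ^ (card (carrier res) - 1) - 1 \<in> Q"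
    using x h_eq_iff[of "x ^ (card (carrier res) - 1)" 1] by (simp add: pow_res one_res OI_power)
  then have "x * (x ^ (card (carrier res) - 1) - 1) \<in> Q" by (rule Q_closed(4)[OF x])
  moreover have "card (carrier res) > 0" using finite_res x by (auto simp: carrier_res card_gt_0_iff)
  then have "x * (x ^ (card (carrier res) - 1) - 1) = x ^ card (carrier res) - x"
    by (cases "card (carrier res)") (auto simp: algebra_simps)
  ultimately show ?thesis by simp
qed

lemma subring_h_image:
  assumes A: "A \<subseteq> OI L" "1 \<in> A" "\<And>x. x \<in> A \<Longrightarrow> - x \<in> A" "\<And>x y. x \<in> A \<Longrightarrow> y \<in> A \<Longrightarrow> x + y \<in> A"
    "\<And>x y. x \<in> A \<Longrightarrow> y \<in> A \<Longrightarrow> x * y \<in> A"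
  shows "subring (h ` A) res"
proof (rule ring_hom_ring.img_is_subring[OF h_hom])
  show "subring A (integer_ring L)"
  proof (rule R.subringI)
    fix x assume "x \<in> A"
    moreover from this have "\<ominus>\<^bsub>integer_ring L\<^esub> x = - x"
      by (intro R.minus_equality) (use A in auto)
    ultimately show "\<ominus>\<^bsub>integer_ring L\<^esub> x \<in> A" using A by simp
  qed (use A in auto)
qed

lemma of_int_in_Q_iff:
  assumes p: "Factorial_Ring.prime (p::nat)" "of_nat p \<in> Q"
  shows "of_int i \<in> Q \<longleftrightarrow> int p dvd i"
proof
  assume i: "of_int i \<in> Q"
  show "int p dvd i"
  proof (rule ccontr)
    assume "\<not> int p dvd i"
    moreover have "Factorial_Ring.prime (int p)" using p(1) by simp
    ultimately have "coprime (int p) i" by (intro prime_imp_coprime)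
    then have "coprime i (int p)" by (simp only: coprime_commute)
    then obtain a b where "a * i + b * int p = 1" by (metis bezout_int coprime_imp_gcd_eq_1)
    then have "of_int a * of_int i + of_int b * of_nat p = (1::complex)"
      by (metis of_int_1 of_int_add of_int_mult of_int_of_nat_eq)
    moreover have "of_int a * of_int i + of_int b * of_nat p \<in> Q"
      by (rule Q_closed(3)[OF Q_closed(4)[OF OI_of_int i] Q_closed(4)[OF OI_of_int p(2)]])
    ultimately show False using one_notin by simp
  qed
next
  assume "int p dvd i"
  then obtain j where "i = int p * j" by (auto simp: dvd_def)
  then have "of_int i = of_nat p * (of_int j :: complex)" by simp
  then show "of_int i \<in> Q" using Q_closed(5)[OF OI_of_int p(2)] by simp
qed

text \<open>The image of the rational integers has \<open>p\<close> elements, and the residue field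
  is a vector space over it.\<close>

lemma card_res_prime_power:
  assumes p: "Factorial_Ring.prime (p::nat)" "of_nat p \<in> Q"
  obtains n where "card (carrier res) = p ^ n" "n > 0"
proof -
  have sub: "subring (h ` range of_int) res"
    by (rule subring_h_image) (auto simp flip: of_int_add of_int_mult of_int_minus intro: range_eqI[of _ _ 1])
  have "card (h ` range of_int) = card ((\<lambda>i::int. i mod int p) ` UNIV)"
  proof -
    have "card ((\<lambda>i. h (of_int i)) ` (UNIV :: int set)) = card ((\<lambda>i::int. i mod int p) ` UNIV)"
    proof (rule card_image_same_kernel)
      fix i j :: int
      have "h (of_int i) = h (of_int j) \<longleftrightarrow> of_int (i - j) \<in> Q" using h_eq_iff[of "of_int i" "of_int j"] by simp
      also have "\<dots> \<longleftrightarrow> i mod int p = j mod int p" unfolding of_int_in_Q_iff[OF p] by (simp add: mod_eq_dvd_iff)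
      finally show "h (of_int i) = h (of_int j) \<longleftrightarrow> i mod int p = j mod int p" .
    qed
    then show ?thesis by (simp add: image_image)
  qed
  also have "(\<lambda>i::int. i mod int p) ` UNIV = {0..<int p}"
  proof (intro Set.set_eqI iffI)
    fix i assume "i \<in> {0..<int p}"
    then have "i = i mod int p" by simp
    then show "i \<in> (\<lambda>i::int. i mod int p) ` UNIV" by blast
  next
    fix i assume "i \<in> (\<lambda>i::int. i mod int p) ` UNIV"
    moreover have "int p > 0" using p(1) prime_gt_0_nat by simp
    ultimately show "i \<in> {0..<int p}" by auto
  qed
  finally have "card (h ` range of_int) = p" by simp
  then show thesis using field.finite_field_card_dim[OF field_res finite_res sub] that by metis
qed

lemma power_card_add:
  assumes p: "Factorial_Ring.prime (p::nat)" "of_nat p \<in> Q" and xy: "x \<in> OI L" "y \<in> OI L"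
  shows "(x + y) ^ (p ^ n) - (x ^ (p ^ n) + y ^ (p ^ n)) \<in> Q"
proof (induction n)
  case 0
  then show ?case using Q_closed by simp
next
  case (Suc n)
  define u where "u = (x + y) ^ (p ^ n) - (x ^ (p ^ n) + y ^ (p ^ n))"
  define a where "a = x ^ (p ^ n)"
  define b where "b = y ^ (p ^ n)"
  have O: "u \<in> OI L" "a \<in> OI L" "b \<in> OI L" using xy by (auto simp: u_def a_def b_def intro!: OI_closed)
  obtain z where z: "z \<in> OI L" "(u + (a + b)) ^ p = u ^ p + (a + b) ^ p + of_nat p * z"
    using power_prime_add[OF cfield_axioms p(1) O(1) OI_add[OF O(2,3)]] by blast
  obtain w where w: "w \<in> OI L" "(a + b) ^ p = a ^ p + b ^ p + of_nat p * w"
    using power_prime_add[OF cfield_axioms p(1) O(2,3)] by blast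
  have "(x + y) ^ (p ^ n) = u + (a + b)" by (simp add: u_def a_def b_def)
  moreover have pw: "z ^ (p ^ Suc n) = (z ^ (p ^ n)) ^ p" for z :: complex
    by (simp only: power_Suc2 power_mult)
  ultimately have "(x + y) ^ (p ^ Suc n) = (u + (a + b)) ^ p" by simp
  also have "\<dots> = u ^ p + (a ^ p + b ^ p) + of_nat p * (w + z)" unfolding z w by (simp add: algebra_simps)
  finally have "(x + y) ^ (p ^ Suc n) - (x ^ (p ^ Suc n) + y ^ (p ^ Suc n)) = u ^ p + of_nat p * (w + z)"
    unfolding pw[of x] pw[of y] a_def[symmetric] b_def[symmetric] by simp
  moreover have "u ^ p \<in> Q"
  proof -
    have "p > 0" using p prime_gt_0_nat by blast
    then show ?thesis using Suc u_def O Q_closed OI_power by (cases p) auto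
  qed
  moreover have "of_nat p * (w + z) \<in> Q" by (rule Q_closed(5)[OF OI_add[OF w(1) z(1)] p(2)])
  ultimately show ?case using Q_closed(3)[of "u ^ p" "of_nat p * (w + z)"] by simp
qed

lemma power_card_sum:
  assumes p: "Factorial_Ring.prime (p::nat)" "of_nat p \<in> Q" and g: "\<And>i. i \<in> A \<Longrightarrow> g i \<in> OI L"
  shows "(\<Sum>i\<in>A. g i) ^ (p ^ n) - (\<Sum>i\<in>A. g i ^ (p ^ n)) \<in> Q"
  using g
proof (induction A rule: infinite_finite_induct)
  case (infinite A)
  have "p ^ n > 0" using p prime_gt_0_nat by simp
  then show ?case using infinite Q_closed(2) by (simp add: zero_power)
next
  case empty
  have "p ^ n > 0" using p prime_gt_0_nat by simp
  then show ?case using Q_closed(2) by (simp add: zero_power)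
next
  case (insert x F)
  define S where "S = (\<Sum>i\<in>F. g i)"
  have "(g x + S) ^ (p ^ n) - (g x ^ (p ^ n) + S ^ (p ^ n)) \<in> Q"
    using insert by (intro power_card_add p) (auto simp: S_def intro: OI_sum)
  moreover have "S ^ (p ^ n) - (\<Sum>i\<in>F. g i ^ (p ^ n)) \<in> Q" using insert by (simp add: S_def)
  ultimately have "((g x + S) ^ (p ^ n) - (g x ^ (p ^ n) + S ^ (p ^ n))) + (S ^ (p ^ n) - (\<Sum>i\<in>F. g i ^ (p ^ n))) \<in> Q"
    by (rule Q_closed(3))
  then show ?case using insert by (simp add: S_def algebra_simps)
qed

text \<open>Every nonzero residue class is a root of X^(N-1) - 1, and a polynomial over a domain has
  at most as many roots as its degree.\<close>

lemma card_res_le: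
  assumes N: "N > 1" and pw: "\<And>x. x \<in> OI L \<Longrightarrow> x ^ N - x \<in> Q"
  shows "card (carrier res) \<le> N"
proof -
  interpret k: domain res using field.axioms(1)[OF field_res] .
  have "x [^]\<^bsub>res\<^esub> (N - 1) = \<one>\<^bsub>res\<^esub>" if x: "x \<in> carrier res - {\<zero>\<^bsub>res\<^esub>}" for x
  proof -
    obtain z where z: "z \<in> OI L" "x = h z" "h z \<noteq> h 0" using x by (auto simp: carrier_res zero_res)
    then have zQ: "z \<notin> Q" using h_eq_iff[of z 0] by simp
    have "z * (z ^ (N - 1) - 1) = z ^ N - z" using N by (cases N) (auto simp: algebra_simps)
    then have "z * (z ^ (N - 1) - 1) \<in> Q" using pw[OF z(1)] by simp
    then have "z ^ (N - 1) - 1 \<in> Q" using zQ prime_cases z(1) OI_diff OI_power OI_one by blast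
    then show ?thesis using z h_eq_iff[of "z ^ (N - 1)" 1] by (simp add: pow_res one_res OI_power)
  qed
  then have "card (carrier res - {\<zero>\<^bsub>res\<^esub>}) \<le> card {x \<in> carrier res. x [^]\<^bsub>res\<^esub> (N - 1) = \<one>\<^bsub>res\<^esub>}"
    using finite_res by (intro card_mono) auto
  also have "\<dots> \<le> N - 1" using k.num_roots_le_deg[OF finite_res, of "N - 1"] N by simp
  finally show ?thesis using finite_res N by simp
qed

end

section \<open>Primes in extensions\<close>

lemma (in field_ext) number_field_K: "number_field K"
  using K.cfield_axioms finite_over_Q KL unfolding number_field_def number_field_axioms_def by blast

locale ext_prime = field_ext K L + number_field_prime L Q for K L Q
begin

abbreviation "\<qq> \<equiv> Q \<inter> OI K"

lemma prime_qq: "prime_of K \<qq>"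
  unfolding K.prime_of_iff
proof (intro conjI ballI impI)
  show "ideal \<qq> (integer_ring K)"
    unfolding K.ideal_iff
    using Q_closed(2) Q_closed(3) K.OI_add K.OI_mult Q_closed(4)[OF OI_K_subset] by auto
  show "1 \<notin> \<qq>" using one_notin by simp
  obtain p where p: "Factorial_Ring.prime p" "of_nat p \<in> Q" by (rule exists_rational_prime)
  then have "of_nat p \<in> \<qq>" "(of_nat p :: complex) \<noteq> 0" using prime_gt_0_nat[OF p(1)] by simp_all
  then show "\<qq> \<noteq> {0}" by blast
  fix a b assume "a \<in> OI K" "b \<in> OI K" "a * b \<in> \<qq>"
  then show "a \<in> \<qq> \<or> b \<in> \<qq>" using prime_cases[OF OI_K_subset OI_K_subset, of a b] by blast
qed

lemma prime_above_qq: "prime_above K L \<qq> Q"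
  using prime by (simp add: prime_above_def)

lemma number_field_prime_K: "number_field_prime K \<qq>"
  using number_field_K prime_qq by (simp add: number_field_prime_def number_field_prime_axioms_def)

abbreviation "N \<equiv> ideal_norm K \<qq>"

lemma norm_fermat: "t \<in> OI K \<Longrightarrow> t ^ N - t \<in> Q"
  using number_field_prime.fermat[OF number_field_prime_K, of t] by (simp add: ideal_norm_def)

lemma norm_prime_power:
  obtains p n where "Factorial_Ring.prime (p::nat)" "of_nat p \<in> Q" "N = p ^ n" "n > 0"
proof -
  obtain p where p: "Factorial_Ring.prime p" "of_nat p \<in> Q" by (rule exists_rational_prime)
  then have "of_nat p \<in> \<qq>" by simp
  from number_field_prime.card_res_prime_power[OF number_field_prime_K p(1) this] obtain n where "N = p ^ n" "n > 0"
    unfolding ideal_norm_def by blast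
  then show thesis using that p by blast
qed

lemma norm_gt_1: "N > 1"
proof -
  obtain p n where "Factorial_Ring.prime (p::nat)" "of_nat p \<in> Q" "N = p ^ n" "n > 0" by (rule norm_prime_power)
  then show ?thesis by (metis one_less_power prime_gt_1_nat)
qed

text \<open>The dimension in \<open>residue_degree\<close> is taken over the image of the integers
  of \<open>K\<close> in the residue field of \<open>Q\<close>. This image has N elements, since two
  integers of \<open>K\<close> agree modulo \<open>Q\<close> exactly when they agree modulo
  \<open>\<qq>\<close>.\<close>

lemma card_residue_field: "card (carrier res) = N ^ residue_degree K L Q" "residue_degree K L Q > 0"
proof -
  interpret q: number_field_prime K \<qq> by (rule number_field_prime_K)
  have sub: "subring (h ` OI K) res"
    by (rule subring_h_image) (auto simp: OI_K_subset intro: K.OI_neg K.OI_add K.OI_mult)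
  have "card (h ` OI K) = card (q.h ` OI K)"
  proof (rule card_image_same_kernel)
    fix x y assume xy: "x \<in> OI K" "y \<in> OI K"
    then have "h x = h y \<longleftrightarrow> x - y \<in> Q" by (intro h_eq_iff OI_K_subset)
    also have "\<dots> \<longleftrightarrow> x - y \<in> \<qq>" using K.OI_diff[OF xy] by blast
    also have "\<dots> \<longleftrightarrow> q.h x = q.h y" using q.h_eq_iff[OF xy] by blast
    finally show "h x = h y \<longleftrightarrow> q.h x = q.h y" .
  qed
  also have "\<dots> = N" by (simp add: ideal_norm_def q.carrier_res)
  finally have card: "card (h ` OI K) = N" .
  have "residue_degree K L Q = ring.dim res (h ` OI K) (carrier res)"
    unfolding residue_degree_def Let_def by simp
  then show "card (carrier res) = N ^ residue_degree K L Q" "residue_degree K L Q > 0"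
    using field.finite_field_card_dim[OF field_res finite_res sub] card by simp_all
qed

lemma power_norm_residue_degree: "x \<in> OI L \<Longrightarrow> x ^ (N ^ residue_degree K L Q) - x \<in> Q"
  using fermat[of x] card_residue_field(1) by simp

text \<open>With the preceding congruence this describes the residue degree as the least positive m
  such that x^(N^m) = x modulo \<open>Q\<close>, the form in which it is compared with Frobenius
  powers.\<close>

lemma residue_degree_le:
  assumes "m > 0" "\<And>x. x \<in> OI L \<Longrightarrow> x ^ (N ^ m) - x \<in> Q"
  shows "residue_degree K L Q \<le> m"
proof -
  have "N ^ m > 1" by (rule one_less_power[OF norm_gt_1 assms(1)])
  then have "N ^ residue_degree K L Q \<le> N ^ m"
    using card_res_le[OF _ assms(2)] card_residue_field(1) by simp
  then show ?thesis by (rule power_le_imp_le_exp[OF norm_gt_1])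
qed

end

subsection \<open>Lying over\<close>

text \<open>As \<open>p\<close> lies in \<open>I\<close>, an ideal above \<open>I\<close> is
  determined by which of the finitely many representatives modulo \<open>p\<close> it contains. A
  proper one with the most representatives is maximal, hence prime.\<close>

lemma (in number_field) exists_prime_containing:
  assumes I: "ideal I (integer_ring L)" "1 \<notin> I" and p: "Factorial_Ring.prime (p::nat)" "of_nat p \<in> I"
  obtains Q where "prime_of L Q" "I \<subseteq> Q"
proof -
  obtain T where T: "finite T" "T \<subseteq> OI L" "\<forall>x\<in>OI L. \<exists>t\<in>T. \<exists>y\<in>OI L. x = t + of_nat p * y"
    using finite_residues_prime[OF p(1)] by blast
  define C where "C J \<longleftrightarrow> ideal J (integer_ring L) \<and> 1 \<notin> J \<and> I \<subseteq> J" for J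
  have "C I" using I by (simp add: C_def)
  moreover have "\<forall>J. C J \<longrightarrow> card (T \<inter> J) < Suc (card T)"
    using T(1) by (auto simp: less_Suc_eq_le intro: card_mono)
  ultimately obtain Q where Q: "C Q" "\<And>J. C J \<Longrightarrow> card (T \<inter> J) \<le> card (T \<inter> Q)"
    using ex_has_greatest_nat[of C I "\<lambda>J. card (T \<inter> J)" "Suc (card T)"] by blast
  have iQ: "ideal Q (integer_ring L)" and Q1: "1 \<notin> Q" and IQ: "I \<subseteq> Q" using Q(1) by (auto simp: C_def)
  note cl = idealD[OF iQ]
  have pQ: "of_nat p \<in> Q" using p IQ by blast
  have max: "1 \<in> J" if J: "ideal J (integer_ring L)" "Q \<subseteq> J" "a \<in> J" "a \<notin> Q" for J a
  proof (rule ccontr)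
    assume "1 \<notin> J"
    then have "C J" using J IQ by (auto simp: C_def)
    then have le: "card (T \<inter> J) \<le> card (T \<inter> Q)" by (rule Q(2))
    have "T \<inter> Q \<subseteq> T \<inter> J" using J(2) by blast
    then have eq: "T \<inter> Q = T \<inter> J" using le T(1) by (intro card_seteq) auto
    obtain t y where t: "t \<in> T" "y \<in> OI L" "a = t + of_nat p * y" using T(3) idealD(1)[OF J(1,3)] by blast
    have py: "of_nat p * y \<in> Q" by (rule cl(5)[OF t(2) pQ])
    then have "a - of_nat p * y \<in> J" using idealD(7)[OF J(1,3)] J(2) by blast
    then have "t \<in> J" using t(3) by simp
    then have "t \<in> Q" using eq t(1) by blast
    then have "a \<in> Q" using cl(3)[OF _ py] t(3) by simp
    then show False using J(4) by blast
  qed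
  have "prime_of L Q"
    unfolding prime_of_iff
  proof (intro conjI ballI impI)
    show "Q \<noteq> {0}" using pQ prime_gt_0_nat[OF p(1)] by auto
    fix a b assume ab: "a \<in> OI L" "b \<in> OI L" "a * b \<in> Q"
    show "a \<in> Q \<or> b \<in> Q"
    proof (rule disjCI)
      assume bQ: "b \<notin> Q"
      define J where "J = {x + b * r | x r. x \<in> Q \<and> r \<in> OI L}"
      have "ideal J (integer_ring L)"
        unfolding ideal_iff
      proof (intro conjI ballI)
        show "J \<subseteq> OI L" unfolding J_def using ab cl(1) OI_add OI_mult by blast
        show "0 \<in> J" unfolding J_def using cl(2) OI_zero by force
      next
        fix u v assume "u \<in> J" "v \<in> J"
        then obtain x r y s where "u = x + b * r" "v = y + b * s" "x \<in> Q" "y \<in> Q" "r \<in> OI L" "s \<in> OI L"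
          unfolding J_def by blast
        then have "u + v = (x + y) + b * (r + s)" "x + y \<in> Q" "r + s \<in> OI L"
          by (auto simp: algebra_simps cl(3) OI_add)
        then show "u + v \<in> J" unfolding J_def by blast
      next
        fix c u assume c: "c \<in> OI L" and "u \<in> J"
        then obtain x r where "u = x + b * r" "x \<in> Q" "r \<in> OI L" unfolding J_def by blast
        then have "c * u = c * x + b * (c * r)" "c * x \<in> Q" "c * r \<in> OI L"
          using c by (auto simp: algebra_simps cl(4) OI_mult)
        then show "c * u \<in> J" unfolding J_def by blast
      qed
      moreover have "Q \<subseteq> J"
      proof
        fix x assume "x \<in> Q"
        moreover have "x = x + b * 0" by simp
        ultimately show "x \<in> J" unfolding J_def using OI_zero by blast
      qed
      moreover have "b \<in> J"
      proof -
        have "b = 0 + b * 1" by simp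
        then show ?thesis unfolding J_def using OI_one cl(2) by blast
      qed
      ultimately have "1 \<in> J" using bQ by (rule max)
      then obtain x r where x: "1 = x + b * r" "x \<in> Q" "r \<in> OI L" unfolding J_def by blast
      have "a = a * x + r * (a * b)" using arg_cong[OF x(1), of "\<lambda>t. a * t"] by (simp add: algebra_simps)
      moreover have "a * x \<in> Q" "r * (a * b) \<in> Q" using cl(4) x ab by blast+
      ultimately show "a \<in> Q" using cl(3) by metis
    qed
  qed (use iQ Q1 in auto)
  then show thesis using that IQ by blast
qed

text \<open>The point is that \<open>q\<close> generates a proper ideal upstairs. Were 1 in it, the
  local uniformizer would give s = y*w with \<open>w\<close> integral; then w = s/y lies in
  \<open>K\<close>, and \<open>s\<close> would be in \<open>q\<close>.\<close>

lemma (in field_ext) lying_over: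
  assumes q: "prime_of K q"
  obtains Q where "prime_above K L q Q"
proof -
  interpret q: number_field_prime K q
    using number_field_K q by (simp add: number_field_prime_def number_field_prime_axioms_def)
  define I where "I = q \<cdot>\<^bsub>integer_ring L\<^esub> OI L"
  have IO: "I \<subseteq> OI L" unfolding I_def
    by (rule ideal_prod_subsetI) (auto intro: OI_mult OI_add OI_K_subset q.Q_OI)
  have smul: "c * x \<in> I" if c: "c \<in> OI L" and x: "x \<in> I" for c x
    using x unfolding I_def
  proof (induction rule: ideal_prod.induct)
    case (prod i j)
    then have "i * (c * j) \<in> q \<cdot>\<^bsub>integer_ring L\<^esub> OI L" using OI_mult c by (intro ideal_prod_memI) auto
    then show ?case by (simp add: mult.left_commute)
  next
    case (sum s t)
    then show ?case using ideal_prod.sum[of "c * s" "integer_ring L" q "OI L" "c * t"] by (simp add: distrib_left)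
  qed
  have qI: "q \<subseteq> I"
    unfolding I_def using ideal_prod_memI[of _ q 1 "OI L"] by auto
  have "ideal I (integer_ring L)"
    unfolding ideal_iff
  proof (intro conjI ballI)
    show "0 \<in> I" using qI q.Q_closed(2) by blast
    fix a b assume "a \<in> I" "b \<in> I"
    then show "a + b \<in> I" unfolding I_def using ideal_prod.sum[of a "integer_ring L" q "OI L" b] by simp
  qed (use IO smul in auto)
  moreover have "1 \<notin> I"
  proof
    assume "1 \<in> I"
    obtain y s where y: "y \<in> q" "s \<in> OI K" "s \<notin> q" "y \<noteq> 0" "\<forall>z\<in>q. \<exists>w\<in>OI K. s * z = y * w"
      using q.exists_uniformizer .
    have "I \<subseteq> {x. \<exists>w\<in>OI L. s * x = y * w}" unfolding I_def
    proof (rule ideal_prod_subsetI)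
      fix a b assume ab: "a \<in> q" "b \<in> OI L"
      then obtain w where "w \<in> OI K" "s * a = y * w" using y by blast
      then have "s * (a * b) = y * (w * b)" "w * b \<in> OI L" using ab OI_mult[OF OI_K_subset] by (auto simp flip: mult.assoc)
      then show "a * b \<in> {x. \<exists>w\<in>OI L. s * x = y * w}" by blast
    next
      fix a b assume "a \<in> {x. \<exists>w\<in>OI L. s * x = y * w}" "b \<in> {x. \<exists>w\<in>OI L. s * x = y * w}"
      then obtain w v where "w \<in> OI L" "v \<in> OI L" "s * a = y * w" "s * b = y * v" by blast
      then have "s * (a + b) = y * (w + v)" "w + v \<in> OI L" by (auto simp: distrib_left OI_add)
      then show "a + b \<in> {x. \<exists>w\<in>OI L. s * x = y * w}" by blast
    qed
    then obtain w where w: "w \<in> OI L" "s = y * w" using \<open>1 \<in> I\<close> by auto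
    have "w = s / y" using w y(4) by simp
    then have "w \<in> K" using K.divide_in[OF K.OI_subset[OF y(2)] K.OI_subset[OF q.Q_OI[OF y(1)]]] by simp
    then have "w \<in> OI K" using w(1) OI_K_iff by blast
    then have "s \<in> q" unfolding w(2) by (rule q.Q_closed(5)[OF _ y(1)])
    then show False using y(3) by blast
  qed
  moreover obtain p where p: "Factorial_Ring.prime p" "of_nat p \<in> q" by (rule q.exists_rational_prime)
  moreover from this have "of_nat p \<in> I" using qI by blast
  ultimately obtain Q where Q: "prime_of L Q" "I \<subseteq> Q" using exists_prime_containing by metis
  interpret Q: number_field_prime L Q by unfold_locales (rule Q(1))
  \<comment> \<open>The intersection contains \<open>q\<close> and omits 1, and \<open>q\<close> is
    maximal.\<close>
  have "Q \<inter> OI K = q"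
  proof
    show "q \<subseteq> Q \<inter> OI K" using qI Q(2) q.Q_OI by blast
    show "Q \<inter> OI K \<subseteq> q"
    proof (rule ccontr)
      assume "\<not> Q \<inter> OI K \<subseteq> q"
      then obtain x where x: "x \<in> Q" "x \<in> OI K" "x \<notin> q" by blast
      then obtain y where y: "y \<in> OI K" "x * y - 1 \<in> q" using q.unit_mod by blast
      have "x * y - 1 \<in> Q" using y qI Q(2) by blast
      moreover have "x * y \<in> Q" by (rule Q.Q_closed(5)[OF OI_K_subset[OF y(1)] x(1)])
      ultimately have "x * y - (x * y - 1) \<in> Q" using Q.Q_closed(7) by blast
      then show False using Q.one_notin by simp
    qed
  qed
  then show thesis using that Q(1) by (simp add: prime_above_def)
qed

subsection \<open>Decomposition and inertia\<close>

locale galois_prime = galois_ext K L + ext_prime K L Q for K L Q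
begin

text \<open>The decomposition group of \<open>Q\<close>, written elementwise so that image ideals do
  not appear.\<close>

definition "decomp = {\<sigma> \<in> G. \<forall>x\<in>OI L. \<sigma> x \<in> Q \<longleftrightarrow> x \<in> Q}"

text \<open>The definition could fail merely because \<sigma> moves some \<open>x\<close> from
  \<open>Q\<close> to the outside. Inverting its image modulo \<open>Q\<close> and pulling the
  inverse back to \<open>z\<close> then makes x*z - 1 an element outside \<open>Q\<close> that is
  moved inside.\<close>

lemma not_decomp:
  assumes \<sigma>: "\<sigma> \<in> G" "\<sigma> \<notin> decomp"
  shows "\<exists>a\<in>OI L. a \<notin> Q \<and> \<sigma> a \<in> Q"
proof (rule ccontr)
  assume no: "\<not> ?thesis"
  then obtain x where x: "x \<in> OI L" "x \<in> Q" "\<sigma> x \<notin> Q" using \<sigma> unfolding decomp_def by blast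
  obtain y where y: "y \<in> OI L" "\<sigma> x * y - 1 \<in> Q" using unit_mod[OF gal_OI[OF \<sigma>(1) x(1)] x(3)] by blast
  define z where "z = (inv\<^bsub>gal_group K L\<^esub> \<sigma>) y"
  have z: "z \<in> OI L" "\<sigma> z = y"
    using gal_OI[OF Gal.inv_closed[OF \<sigma>(1)] y(1)] inv_apply(1)[OF \<sigma>(1) OI_subset[OF y(1)]] by (auto simp: z_def)
  have xz: "x * z \<in> OI L" by (rule OI_mult[OF x(1) z(1)])
  have "\<sigma> (x * z - 1) = \<sigma> x * y - 1"
    using emb_diff[OF gal_emb[OF \<sigma>(1)] OI_subset[OF xz] one_in] emb_mult[OF gal_emb[OF \<sigma>(1)] OI_subset[OF x(1)] OI_subset[OF z(1)]]
      emb_one[OF gal_emb[OF \<sigma>(1)]] z(2) by simp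
  then have "\<sigma> (x * z - 1) \<in> Q" using y(2) by simp
  then have m: "x * z - 1 \<in> Q" using no OI_diff[OF xz OI_one] by blast
  have "x * z \<in> Q" by (rule Q_closed(5)[OF z(1) x(2)])
  from Q_closed(7)[OF this m] show False using one_notin by simp
qed

text \<open>A product with one witness for each automorphism outside \<open>decomp\<close>. The
  witnesses are squared so that these conjugates vanish even modulo the second power of
  \<open>Q\<close>, as the ramification argument requires.\<close>

lemma exists_separator:
  obtains e where "e \<in> OI L" "e \<notin> Q" "\<And>\<sigma>. \<sigma> \<in> G \<Longrightarrow> \<sigma> \<notin> decomp \<Longrightarrow> \<sigma> e \<in> P 2"
proof -
  have "\<forall>\<sigma>\<in>G - decomp. \<exists>a. a \<in> OI L \<and> a \<notin> Q \<and> \<sigma> a \<in> Q" using not_decomp by blast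
  then obtain a where a: "\<And>\<sigma>. \<sigma> \<in> G - decomp \<Longrightarrow> a \<sigma> \<in> OI L" "\<And>\<sigma>. \<sigma> \<in> G - decomp \<Longrightarrow> a \<sigma> \<notin> Q"
    "\<And>\<sigma>. \<sigma> \<in> G - decomp \<Longrightarrow> \<sigma> (a \<sigma>) \<in> Q" by metis
  define e where "e = (\<Prod>\<sigma>\<in>G - decomp. a \<sigma> ^ 2)"
  have fin: "finite (G - decomp)" using finite_gal by simp
  have a2: "a \<sigma> ^ 2 \<in> OI L" if "\<sigma> \<in> G - decomp" for \<sigma> by (rule OI_power[OF a(1)[OF that]])
  have "e \<in> OI L" unfolding e_def by (rule OI_prod) (rule a2)
  moreover have "e \<notin> Q"
  proof
    assume "e \<in> Q"
    have "\<exists>\<sigma>\<in>G - decomp. a \<sigma> ^ 2 \<in> Q"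
      by (rule prime_prod[OF fin]) (use a2 \<open>e \<in> Q\<close> e_def in auto)
    then obtain \<sigma> where s: "\<sigma> \<in> G - decomp" "a \<sigma> ^ 2 \<in> Q" by blast
    then show False using prime_power[OF a(1)[OF s(1)] s(2)] a(2) by blast
  qed
  moreover have "\<sigma> e \<in> P 2" if \<sigma>: "\<sigma> \<in> G" "\<sigma> \<notin> decomp" for \<sigma>
  proof -
    have s: "\<sigma> \<in> G - decomp" using \<sigma> by simp
    define r where "r = (\<Prod>\<tau>\<in>G - decomp - {\<sigma>}. a \<tau> ^ 2)"
    have r: "r \<in> OI L" unfolding r_def by (rule OI_prod) (use a2 in auto)
    have "e = a \<sigma> ^ 2 * r" unfolding e_def r_def by (rule prod.remove[OF fin s])
    then have "\<sigma> e = \<sigma> (a \<sigma>) ^ 2 * \<sigma> r"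
      using emb_mult[OF gal_emb[OF \<sigma>(1)] OI_subset[OF a2[OF s]] OI_subset[OF r]]
        emb_power[OF gal_emb[OF \<sigma>(1)] OI_subset[OF a(1)[OF s]]] by simp
    then show ?thesis using P_closed(5)[OF gal_OI[OF \<sigma>(1) r] P_power[OF a(3)[OF s], of 2]] by simp
  qed
  ultimately show thesis by (rule that)
qed

definition "trivial_inertia \<longleftrightarrow> (\<forall>\<sigma>\<in>inertia_group K L Q. \<sigma> = \<one>\<^bsub>gal_group K L\<^esub>)"

lemma inertia_iff: "\<sigma> \<in> inertia_group K L Q \<longleftrightarrow> \<sigma> \<in> G \<and> (\<forall>x\<in>OI L. \<sigma> x - x \<in> Q)"
  by (simp add: inertia_group_def)

text \<open>If \<sigma> and \<tau> agree modulo \<open>Q\<close>, then the inverse of \<tau> after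
  \<sigma> acts trivially modulo \<open>Q\<close>, because \<tau> preserves \<open>Q\<close>. This
  supplies the distinctness required for independence of characters.\<close>

lemma decomp_distinct:
  assumes ti: "trivial_inertia" and st: "\<sigma> \<in> decomp" "\<tau> \<in> decomp" "\<sigma> \<noteq> \<tau>"
  shows "\<exists>y\<in>OI L. \<sigma> y - \<tau> y \<notin> Q"
proof (rule ccontr)
  assume no: "\<not> ?thesis"
  have G: "\<sigma> \<in> G" "\<tau> \<in> G" using st by (auto simp: decomp_def)
  define \<mu> where "\<mu> = inv\<^bsub>gal_group K L\<^esub> \<tau> \<otimes>\<^bsub>gal_group K L\<^esub> \<sigma>"
  have \<mu>: "\<mu> \<in> G" unfolding \<mu>_def using G by simp
  have \<tau>\<mu>: "\<tau> (\<mu> y) = \<sigma> y" if "y \<in> L" for y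
    unfolding \<mu>_def using mult_apply[OF Gal.inv_closed[OF G(2)] G(1) that] inv_apply(1)[OF G(2) gal_in[OF G(1) that]] by simp
  have "\<mu> y - y \<in> Q" if y: "y \<in> OI L" for y
  proof -
    have "\<tau> (\<mu> y - y) = \<sigma> y - \<tau> y"
      using emb_diff[OF gal_emb[OF G(2)] gal_in[OF \<mu> OI_subset[OF y]] OI_subset[OF y]] \<tau>\<mu>[OF OI_subset[OF y]] by simp
    then have "\<tau> (\<mu> y - y) \<in> Q" using no y by simp
    then show ?thesis using st(2) OI_diff[OF gal_OI[OF \<mu> y] y] unfolding decomp_def by blast
  qed
  then have "\<mu> \<in> inertia_group K L Q" unfolding inertia_iff using \<mu> by blast
  then have "\<mu> = \<one>\<^bsub>gal_group K L\<^esub>" using ti unfolding trivial_inertia_def by blast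
  then have "\<tau> = \<sigma>"
    using \<tau>\<mu> one_apply by (intro gal_eqI G) simp
  then show False using st(3) by blast
qed

text \<open>A trace of the form \<open>tr (\<pi> * e * x)\<close> lies in \<open>Q\<close>, but not always in its square.\<close>

lemma trivial_inertia_imp_unramified:
  assumes ti: "trivial_inertia"
  shows "\<not> \<qq> \<subseteq> P 2"
proof
  assume sub: "\<qq> \<subseteq> P 2"
  obtain \<pi> where \<pi>: "\<pi> \<in> Q" "\<pi> \<notin> P 2" using P_strict[of 1] P_1 by (metis Suc_1)
  obtain e where e: "e \<in> OI L" "e \<notin> Q" "\<And>\<sigma>. \<sigma> \<in> G \<Longrightarrow> \<sigma> \<notin> decomp \<Longrightarrow> \<sigma> e \<in> P 2"
    using exists_separator by blast
  have \<pi>O: "\<pi> \<in> OI L" using \<pi>(1) by (rule Q_OI)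
  \<comment> \<open>The factor \<open>e\<close> kills the conjugates outside \<open>decomp\<close>
    modulo \<open>P 2\<close>, and \<open>\<pi>\<close> brings the remaining ones into
    \<open>Q\<close>. So traces of multiples of \<open>a\<close> lie in \<open>\<qq>\<close> and, by
    assumption, in \<open>P 2\<close>: a relation whose coefficients are the conjugates of
    \<open>a\<close>.\<close>
  define a where "a = e * \<pi>"
  have aO: "a \<in> OI L" unfolding a_def by (rule OI_mult[OF e(1) \<pi>O])
  have a2: "a \<notin> P 2" unfolding a_def using P_primary[OF e(1,2) \<pi>O, of 2] \<pi>(2) by blast
  have \<sigma>a: "\<sigma> a = \<sigma> e * \<sigma> \<pi>" if "\<sigma> \<in> G" for \<sigma>
    unfolding a_def by (rule emb_mult[OF gal_emb[OF that] OI_subset[OF e(1)] OI_subset[OF \<pi>O]])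
  have out: "\<sigma> a \<in> P 2" if "\<sigma> \<in> G" "\<sigma> \<notin> decomp" for \<sigma>
    unfolding \<sigma>a[OF that(1)] by (rule P_closed(5)[OF gal_OI[OF that(1) \<pi>O] e(3)[OF that]])
  have inQ: "\<sigma> a \<in> Q" if "\<sigma> \<in> G" for \<sigma>
  proof (cases "\<sigma> \<in> decomp")
    case True
    then have "\<sigma> \<pi> \<in> Q" using \<pi>(1) \<pi>O unfolding decomp_def by blast
    then show ?thesis unfolding \<sigma>a[OF that] by (rule Q_closed(4)[OF gal_OI[OF that e(1)]])
  next
    case False
    then show ?thesis using out[OF that] P_subset_Q[of 2] by auto
  qed
  have "\<one>\<^bsub>gal_group K L\<^esub> a \<in> P 2"
  proof (rule independence_of_characters[where I = G and A = "OI L" and S = "OI L" and q = Q and b = "P 2"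
        and \<chi> = "\<lambda>\<sigma>. \<sigma>" and a = "\<lambda>\<sigma>. \<sigma> a"])
    show "finite G" by (rule finite_gal)
    show "1 \<in> OI L" by simp
    show "x * y \<in> OI L" if "x \<in> OI L" "y \<in> OI L" for x y using that by (rule OI_mult)
    show "x * y \<in> OI L" if "x \<in> OI L" "y \<in> OI L" for x y using that by (rule OI_mult)
    show "x - y \<in> OI L" if "x \<in> OI L" "y \<in> OI L" for x y using that by (rule OI_diff)
    show "i x \<in> OI L" if "i \<in> G" "x \<in> OI L" for i x using that by (rule gal_OI)
    show "i (x * y) = i x * i y" if "i \<in> G" "x \<in> OI L" "y \<in> OI L" for i x y
      using emb_mult[OF gal_emb[OF that(1)] OI_subset[OF that(2)] OI_subset[OF that(3)]] .
    show "i 1 = 1" if "i \<in> G" for i using emb_one[OF gal_emb[OF that]] .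
    show "0 \<in> P 2" by (rule P_closed(2))
    show "x + y \<in> P 2" if "x \<in> P 2" "y \<in> P 2" for x y using that by (rule P_closed(3))
    show "x - y \<in> P 2" if "x \<in> P 2" "y \<in> P 2" for x y using that by (rule P_closed(7))
    show "c * x \<in> P 2" if "c \<in> OI L" "x \<in> P 2" for c x using that by (rule P_closed(4))
    show "x \<in> P 2" if "c \<in> OI L" "c \<notin> Q" "x \<in> OI L" "c * x \<in> P 2" for c x using that by (rule P_primary)
    show "\<exists>y\<in>OI L. i y - j y \<notin> Q" if "i \<in> G" "j \<in> G" "i \<noteq> j" "i a \<notin> P 2" "j a \<notin> P 2" for i j
      using decomp_distinct[OF ti _ _ that(3)] out that by blast
    show "i a \<in> OI L" if "i \<in> G" for i using gal_OI[OF that aO] .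
    show "\<one>\<^bsub>gal_group K L\<^esub> \<in> G" by simp
    fix x assume x: "x \<in> OI L"
    have ax: "a * x \<in> OI L" by (rule OI_mult[OF aO x])
    have eq: "(\<Sum>i\<in>G. i a * i x) = tr (a * x)"
      unfolding tr_def
      by (rule sum.cong[OF refl]) (rule emb_mult[OF gal_emb OI_subset[OF aO] OI_subset[OF x], symmetric])
    have "(\<Sum>i\<in>G. i a * i x) \<in> Q"
      by (rule Q_sum) (rule Q_closed(5)[OF gal_OI[OF _ x] inQ])
    then have "tr (a * x) \<in> \<qq>" using tr_OI_K[OF ax] eq by simp
    then show "(\<Sum>i\<in>G. i a * i x) \<in> P 2" unfolding eq using sub by blast
  qed
  then show False using a2 one_apply[OF OI_subset[OF aO]] by simp
qed

text \<open>With a uniformizer in \<open>K\<close> and exponent \<open>q\<close> the size of the residue field,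
  \<open>\<sigma> x - x \<in> Q ^ k\<close> improves to \<open>Q ^ (k + 1)\<close> because \<open>x - x ^ q\<close> is locally divisible
  by the uniformizer and \<open>\<sigma> x \<mapsto> (\<sigma> x) ^ q\<close> is contracting.\<close>

lemma unramified_imp_trivial_inertia:
  assumes ur: "\<not> \<qq> \<subseteq> P 2"
  shows "trivial_inertia"
  unfolding trivial_inertia_def
proof
  fix \<sigma> assume "\<sigma> \<in> inertia_group K L Q"
  then have \<sigma>: "\<sigma> \<in> G" and in1: "\<And>x. x \<in> OI L \<Longrightarrow> \<sigma> x - x \<in> Q" unfolding inertia_iff by auto
  obtain \<pi> where \<pi>: "\<pi> \<in> Q" "\<pi> \<in> OI K" "\<pi> \<notin> P 2" using ur by blast
  have \<pi>O: "\<pi> \<in> OI L" using \<pi>(1) by (rule Q_OI)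
  have \<sigma>\<pi>: "\<sigma> \<pi> = \<pi>" using gal_fix[OF \<sigma> K.OI_subset[OF \<pi>(2)]] .
  define q where "q = card (carrier res)"
  obtain p where p: "Factorial_Ring.prime p" "of_nat p \<in> Q" by (rule exists_rational_prime)
  obtain n where n: "q = p ^ n" "n > 0" using card_res_prime_power[OF p] unfolding q_def by blast
  have qQ: "of_nat q \<in> Q"
  proof -
    obtain m where "n = Suc m" using n(2) by (cases n) auto
    then have "of_nat q = of_nat (p ^ m) * (of_nat p :: complex)" using n(1) by simp
    then show ?thesis using Q_closed(4)[OF OI_of_nat p(2), of "p ^ m"] by simp
  qed
  \<comment> \<open>With c = a - b the difference is q * b^(q-1) * c plus a multiple of c^2. The
    first term gains a step because \<open>q\<close> lies in \<open>Q\<close>, the second because k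
    + k is at least k + 1.\<close>
  have contract: "a ^ q - b ^ q \<in> P (Suc k)" if ab: "a \<in> OI L" "b \<in> OI L" "a - b \<in> P k" and k: "k > 0" for a b k
  proof -
    define c where "c = a - b"
    have c: "c \<in> P k" "a = b + c" using ab by (auto simp: c_def)
    have cO: "c \<in> OI L" using c(1) by (rule P_closed(1))
    have "\<exists>w\<in>OI L. (b + c) ^ m - b ^ m = of_nat m * (b ^ (m - 1) * c) + c * c * w" for m
    proof (induction m)
      case 0
      then show ?case using OI_zero by force
    next
      case (Suc m)
      then obtain w where w: "w \<in> OI L" "(b + c) ^ m - b ^ m = of_nat m * (b ^ (m - 1) * c) + c * c * w" by blast
      have "(b + c) ^ Suc m - b ^ Suc m = (b + c) * ((b + c) ^ m - b ^ m) + c * b ^ m"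
        by (simp add: algebra_simps)
      also have "\<dots> = of_nat (Suc m) * (b ^ (Suc m - 1) * c) + c * c * (of_nat m * b ^ (m - 1) + (b + c) * w)"
        unfolding w(2) by (cases m) (simp_all add: algebra_simps)
      finally have "(b + c) ^ Suc m - b ^ Suc m = of_nat (Suc m) * (b ^ (Suc m - 1) * c) + c * c * (of_nat m * b ^ (m - 1) + (b + c) * w)" .
      moreover have "of_nat m * b ^ (m - 1) + (b + c) * w \<in> OI L"
        using ab(2) cO w(1) by (intro OI_add OI_mult OI_power OI_of_nat)
      ultimately show ?case by blast
    qed
    then obtain w where w: "w \<in> OI L" "(b + c) ^ q - b ^ q = of_nat q * (b ^ (q - 1) * c) + c * c * w" by blast
    have "b ^ (q - 1) * c \<in> P k" by (rule P_closed(4)[OF OI_power[OF ab(2)] c(1)])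
    then have 1: "of_nat q * (b ^ (q - 1) * c) \<in> P (Suc k)"
      using P_Suc_memI[OF _ qQ, of "b ^ (q - 1) * c" k] by (simp only: mult.commute)
    have "c * c \<in> P (k + k)" by (rule P_mult[OF c(1) c(1)])
    then have "c * c \<in> P (Suc k)" using P_antimono[of "Suc k" "k + k"] k by auto
    then have 2: "c * c * w \<in> P (Suc k)" by (rule P_closed(5)[OF w(1)])
    show ?thesis unfolding c(2) w(2) by (rule P_closed(3)[OF 1 2])
  qed
  have step: "\<forall>x\<in>OI L. \<sigma> x - x \<in> P (Suc k)" for k
  proof (induction k)
    case 0
    then show ?case using in1 P_1 by simp
  next
    case (Suc k)
    show ?case
    proof
      fix x assume x: "x \<in> OI L"
      define z where "z = x - x ^ q"
      have zO: "z \<in> OI L" unfolding z_def by (rule OI_diff[OF x OI_power[OF x]])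
      have zQ: "z \<in> Q" using Q_closed(6)[OF fermat[OF x]] by (simp add: z_def q_def)
      obtain s w where sw: "s \<in> OI L" "s \<notin> Q" "w \<in> OI L" "s * z = \<pi> * w"
        using uniformizer_divides[OF \<pi>(1,3) zQ] .
      have \<sigma>sO: "\<sigma> s \<in> OI L" by (rule gal_OI[OF \<sigma> sw(1)])
      have \<sigma>zO: "\<sigma> z \<in> OI L" by (rule gal_OI[OF \<sigma> zO])
      have "\<sigma> s * \<sigma> z = \<pi> * \<sigma> w"
        using emb_mult[OF gal_emb[OF \<sigma>] OI_subset[OF sw(1)] OI_subset[OF zO]]
          emb_mult[OF gal_emb[OF \<sigma>] OI_subset[OF \<pi>O] OI_subset[OF sw(3)]] \<sigma>\<pi> sw(4) by simp
      \<comment> \<open>As \<sigma> fixes \<open>\<pi>\<close>, subtracting s*z = \<pi>*w from its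
        image trades the difference at \<open>z\<close> for the differences at \<open>w\<close> and
        \<open>s\<close>, each with an extra factor in \<open>Q\<close>.\<close>
      then have "\<sigma> s * (\<sigma> z - z) = (\<sigma> w - w) * \<pi> - (\<sigma> s - s) * z"
        using sw(4) by (simp add: algebra_simps)
      moreover have "(\<sigma> w - w) * \<pi> - (\<sigma> s - s) * z \<in> P (Suc (Suc k))"
        by (rule P_closed(7)[OF P_Suc_memI[OF bspec[OF Suc sw(3)] \<pi>(1)] P_Suc_memI[OF bspec[OF Suc sw(1)] zQ]])
      ultimately have "\<sigma> s * (\<sigma> z - z) \<in> P (Suc (Suc k))" by simp
      moreover have "\<sigma> s \<notin> Q" using ideal_diff_iff[OF ideal_Q in1[OF sw(1)]] sw(2) by simp
      ultimately have 1: "\<sigma> z - z \<in> P (Suc (Suc k))"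
        by (intro P_primary[OF \<sigma>sO _ OI_diff[OF \<sigma>zO zO]])
      have 2: "\<sigma> x ^ q - x ^ q \<in> P (Suc (Suc k))"
        by (rule contract[OF gal_OI[OF \<sigma> x] x]) (use Suc x in auto)
      have "\<sigma> z = \<sigma> x - \<sigma> x ^ q"
        unfolding z_def using emb_diff[OF gal_emb[OF \<sigma>] OI_subset[OF x] OI_subset[OF OI_power[OF x]]]
          emb_power[OF gal_emb[OF \<sigma>] OI_subset[OF x]] by simp
      then have "\<sigma> x - x = (\<sigma> z - z) + (\<sigma> x ^ q - x ^ q)" by (simp add: z_def)
      then show "\<sigma> x - x \<in> P (Suc (Suc k))" using P_closed(3)[OF 1 2] by simp
    qed
  qed
  have fixO: "\<sigma> x = x" if x: "x \<in> OI L" for x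
  proof -
    have "\<sigma> x - x \<in> P k" for k
      by (rule subsetD[OF P_Suc_subset bspec[OF step x]])
    then have "\<sigma> x - x = 0" by (rule P_Inter)
    then show ?thesis by simp
  qed
  show "\<sigma> = \<one>\<^bsub>gal_group K L\<^esub>"
  proof (rule gal_eqI[OF \<sigma>])
    fix x assume x: "x \<in> L"
    obtain M :: int where M: "M \<noteq> 0" "of_int M * x \<in> OI L" using L_multiple_in_OI[OF x] .
    have "of_int M * \<sigma> x = of_int M * x"
      using fixO[OF M(2)] emb_mult[OF gal_emb[OF \<sigma>] of_int_in x] emb_of_int[OF gal_emb[OF \<sigma>]] by simp
    then show "\<sigma> x = \<one>\<^bsub>gal_group K L\<^esub> x" using M(1) one_apply[OF x] by simp
  qed simp
qed

text \<open>The trace of e*x lies in \<open>K\<close>, where the N-th power is the identity modulo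
  \<open>Q\<close>. Since N-th powers are additive modulo \<open>Q\<close>, this is a linear
  relation between the automorphisms and their N-th powers. If no automorphism were a Frobenius,
  those with nonzero coefficients would be distinct modulo \<open>Q\<close>, and the coefficient -e
  of the identity would lie in \<open>Q\<close>.\<close>

lemma exists_frobenius_at:
  assumes ti: "trivial_inertia"
  shows "\<exists>\<sigma>\<in>G. \<forall>x\<in>OI L. \<sigma> x - x ^ N \<in> Q"
proof (rule ccontr)
  assume no: "\<not> ?thesis"
  obtain e where e: "e \<in> OI L" "e \<notin> Q" "\<And>\<sigma>. \<sigma> \<in> G \<Longrightarrow> \<sigma> \<notin> decomp \<Longrightarrow> \<sigma> e \<in> P 2"
    using exists_separator by blast
  obtain p n where p: "Factorial_Ring.prime (p::nat)" "of_nat p \<in> Q" and n: "N = p ^ n" "n > 0"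
    by (rule norm_prime_power)
  have eD: "\<sigma> \<in> decomp" if "\<sigma> \<in> G" "\<sigma> e \<notin> Q" for \<sigma>
    using e(3)[OF that(1)] that(2) P_subset_Q[of 2] by auto
  define \<chi> where "\<chi> i x = (if fst i then snd i x ^ N else snd i x)" for i :: "bool \<times> (complex \<Rightarrow> complex)" and x
  define a :: "bool \<times> (complex \<Rightarrow> complex) \<Rightarrow> complex" where "a i = (if fst i then snd i e ^ N else - snd i e)" for i
  define J where "J = (UNIV :: bool set) \<times> G"
  have J: "snd i \<in> G" if "i \<in> J" for i using that by (auto simp: J_def)
  have aD: "snd i \<in> decomp" if i: "i \<in> J" "a i \<notin> Q" for i
  proof (rule eD[OF J[OF i(1)]])
    show "snd i e \<notin> Q"
    proof
      assume m: "snd i e \<in> Q"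
      have "snd i e ^ N \<in> Q" using Q_closed(5)[OF OI_power[OF Q_OI[OF m]] m, of "N - 1"] norm_gt_1 by (cases N) auto
      then show False using i(2) m Q_closed(6)[OF m] by (auto simp: a_def split: if_splits)
    qed
  qed
  \<comment> \<open>If the N-th power of \<sigma> coincided with \<tau> modulo \<open>Q\<close>,
    then \<tau> after the inverse of \<sigma> would be a Frobenius, contrary to
    \<open>no\<close>.\<close>
  have mixed: "\<exists>y\<in>OI L. \<sigma> y ^ N - \<tau> y \<notin> Q" if st: "\<sigma> \<in> G" "\<tau> \<in> G" for \<sigma> \<tau>
  proof -
    define \<mu> where "\<mu> = \<tau> \<otimes>\<^bsub>gal_group K L\<^esub> inv\<^bsub>gal_group K L\<^esub> \<sigma>"
    have "\<mu> \<in> G" using st by (simp add: \<mu>_def)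
    then obtain x where x: "x \<in> OI L" "\<mu> x - x ^ N \<notin> Q" using no by blast
    let ?y = "(inv\<^bsub>gal_group K L\<^esub> \<sigma>) x"
    have y: "?y \<in> OI L" "\<sigma> ?y = x"
      using gal_OI[OF Gal.inv_closed[OF st(1)] x(1)] inv_apply(1)[OF st(1) OI_subset[OF x(1)]] by auto
    have "\<mu> x = \<tau> ?y" unfolding \<mu>_def using mult_apply[OF st(2) Gal.inv_closed[OF st(1)] OI_subset[OF x(1)]] .
    then have "\<tau> ?y - \<sigma> ?y ^ N \<notin> Q" using x(2) y(2) by simp
    then have "\<sigma> ?y ^ N - \<tau> ?y \<notin> Q" using Q_closed(6)[of "\<sigma> ?y ^ N - \<tau> ?y"] by auto
    then show ?thesis using y(1) by blast
  qed
  have dist: "\<exists>y\<in>OI L. \<chi> i y - \<chi> j y \<notin> Q" if ij: "i \<in> J" "j \<in> J" "i \<noteq> j" "a i \<notin> Q" "a j \<notin> Q" for i j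
  proof -
    obtain u \<sigma> v \<tau> where [simp]: "i = (u,\<sigma>)" "j = (v,\<tau>)" by (cases i, cases j)
    have D: "\<sigma> \<in> decomp" "\<tau> \<in> decomp" using aD ij by fastforce+
    have G: "\<sigma> \<in> G" "\<tau> \<in> G" using ij by (auto simp: J_def)
    consider "u" "v" | "\<not> u" "\<not> v" | "u" "\<not> v" | "\<not> u" "v" by blast
    then show ?thesis
    proof cases
      case 1
      then have "\<sigma> \<noteq> \<tau>" using ij by auto
      then obtain y where y: "y \<in> OI L" "\<sigma> y - \<tau> y \<notin> Q" using decomp_distinct[OF ti D] by blast
      have O: "\<sigma> y \<in> OI L" "\<tau> y \<in> OI L" using gal_OI[OF G(1) y(1)] gal_OI[OF G(2) y(1)] .
      \<comment> \<open>Additivity turns the difference of the N-th powers into the N-th power of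
        the difference, so a separating \<open>y\<close> keeps separating.\<close>
      have "((\<sigma> y - \<tau> y) + \<tau> y) ^ N - ((\<sigma> y - \<tau> y) ^ N + \<tau> y ^ N) \<in> Q"
        unfolding n(1) by (rule power_card_add[OF p OI_diff[OF O] O(2)])
      then have d: "(\<sigma> y ^ N - \<tau> y ^ N) - (\<sigma> y - \<tau> y) ^ N \<in> Q" by (simp add: algebra_simps)
      have "\<sigma> y ^ N - \<tau> y ^ N \<notin> Q"
      proof
        assume "\<sigma> y ^ N - \<tau> y ^ N \<in> Q"
        then have "(\<sigma> y - \<tau> y) ^ N \<in> Q" using ideal_diff_iff[OF ideal_Q d] by blast
        then show False using prime_power[OF OI_diff[OF O]] y(2) by blast
      qed
      then show ?thesis using 1 y(1) by (auto simp: \<chi>_def)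
    next
      case 2
      then have "\<sigma> \<noteq> \<tau>" using ij by auto
      then show ?thesis using 2 decomp_distinct[OF ti D] by (auto simp: \<chi>_def)
    next
      case 3
      then show ?thesis using mixed[OF G] by (auto simp: \<chi>_def)
    next
      case 4
      obtain y where y: "y \<in> OI L" "\<tau> y ^ N - \<sigma> y \<notin> Q" using mixed[OF G(2,1)] by blast
      then have "\<sigma> y - \<tau> y ^ N \<notin> Q" using Q_closed(6)[of "\<sigma> y - \<tau> y ^ N"] by auto
      then show ?thesis using 4 y(1) by (auto simp: \<chi>_def)
    qed
  qed
  have rel: "(\<Sum>i\<in>J. a i * \<chi> i x) \<in> Q" if x: "x \<in> OI L" for x
  proof -
    have ex: "e * x \<in> OI L" by (rule OI_mult[OF e(1) x])
    have \<sigma>ex: "\<sigma> (e * x) = \<sigma> e * \<sigma> x" if "\<sigma> \<in> G" for \<sigma>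
      by (rule emb_mult[OF gal_emb[OF that] OI_subset[OF e(1)] OI_subset[OF x]])
    have "(\<Sum>i\<in>J. a i * \<chi> i x) = (\<Sum>u\<in>UNIV. \<Sum>\<sigma>\<in>G. a (u,\<sigma>) * \<chi> (u,\<sigma>) x)"
      unfolding J_def by (simp add: sum.cartesian_product)
    also have "\<dots> = (\<Sum>\<sigma>\<in>G. \<sigma> e ^ N * \<sigma> x ^ N) - (\<Sum>\<sigma>\<in>G. \<sigma> e * \<sigma> x)"
      by (simp add: UNIV_bool a_def \<chi>_def sum_negf)
    also have "(\<Sum>\<sigma>\<in>G. \<sigma> e ^ N * \<sigma> x ^ N) = (\<Sum>\<sigma>\<in>G. \<sigma> (e * x) ^ N)"
      by (rule sum.cong[OF refl]) (simp only: \<sigma>ex power_mult_distrib)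
    also have "(\<Sum>\<sigma>\<in>G. \<sigma> e * \<sigma> x) = tr (e * x)"
      unfolding tr_def by (rule sum.cong[OF refl]) (simp only: \<sigma>ex)
    finally have eq: "(\<Sum>i\<in>J. a i * \<chi> i x) = (\<Sum>\<sigma>\<in>G. \<sigma> (e * x) ^ N) - tr (e * x)" .
    have 1: "tr (e * x) ^ N - (\<Sum>\<sigma>\<in>G. \<sigma> (e * x) ^ N) \<in> Q"
      unfolding tr_def n(1) by (rule power_card_sum[OF p]) (rule gal_OI[OF _ ex])
    have 2: "tr (e * x) ^ N - tr (e * x) \<in> Q" by (rule norm_fermat[OF tr_OI_K[OF ex]])
    have "(tr (e * x) ^ N - tr (e * x)) - (tr (e * x) ^ N - (\<Sum>\<sigma>\<in>G. \<sigma> (e * x) ^ N)) \<in> Q"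
      by (rule Q_closed(7)[OF 2 1])
    then show ?thesis unfolding eq by simp
  qed
  have "a (False, \<one>\<^bsub>gal_group K L\<^esub>) \<in> Q"
  proof (rule independence_of_characters[where I = J and A = "OI L" and S = "OI L" and q = Q and b = Q and \<chi> = \<chi> and a = a])
    show "finite J" by (simp add: J_def finite_gal)
    show "1 \<in> OI L" by simp
    show "x * y \<in> OI L" if "x \<in> OI L" "y \<in> OI L" for x y using that by (rule OI_mult)
    show "x * y \<in> OI L" if "x \<in> OI L" "y \<in> OI L" for x y using that by (rule OI_mult)
    show "x - y \<in> OI L" if "x \<in> OI L" "y \<in> OI L" for x y using that by (rule OI_diff)
    show "\<chi> i x \<in> OI L" if "i \<in> J" "x \<in> OI L" for i x
      using gal_OI[OF J[OF that(1)] that(2)] OI_power by (simp add: \<chi>_def)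
    show "\<chi> i (x * y) = \<chi> i x * \<chi> i y" if "i \<in> J" "x \<in> OI L" "y \<in> OI L" for i x y
      using emb_mult[OF gal_emb[OF J[OF that(1)]] OI_subset[OF that(2)] OI_subset[OF that(3)]]
      by (simp add: \<chi>_def power_mult_distrib)
    show "\<chi> i 1 = 1" if "i \<in> J" for i using emb_one[OF gal_emb[OF J[OF that]]] by (simp add: \<chi>_def)
    show "0 \<in> Q" by (rule Q_closed(2))
    show "x + y \<in> Q" if "x \<in> Q" "y \<in> Q" for x y using that by (rule Q_closed(3))
    show "x - y \<in> Q" if "x \<in> Q" "y \<in> Q" for x y using that by (rule Q_closed(7))
    show "c * x \<in> Q" if "c \<in> OI L" "x \<in> Q" for c x using that by (rule Q_closed(4))
    show "x \<in> Q" if "c \<in> OI L" "c \<notin> Q" "x \<in> OI L" "c * x \<in> Q" for c x using prime_cases[OF that(1,3,4)] that(2) by blast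
    show "\<exists>y\<in>OI L. \<chi> i y - \<chi> j y \<notin> Q" if "i \<in> J" "j \<in> J" "i \<noteq> j" "a i \<notin> Q" "a j \<notin> Q" for i j
      using dist[OF that] .
    show "a i \<in> OI L" if "i \<in> J" for i
      using gal_OI[OF J[OF that] e(1)] OI_power OI_neg by (simp add: a_def)
    show "(\<Sum>i\<in>J. a i * \<chi> i x) \<in> Q" if "x \<in> OI L" for x using rel[OF that] .
    show "(False, \<one>\<^bsub>gal_group K L\<^esub>) \<in> J" by (simp add: J_def)
  qed
  then have "- e \<in> Q" using one_apply[OF OI_subset[OF e(1)]] by (simp add: a_def)
  then show False using Q_closed(6)[of "- e"] e(2) by simp
qed

text \<open>If no automorphism carried \<open>Q'\<close> into \<open>Q\<close>, some element of
  \<open>Q'\<close> would have all its conjugates outside \<open>Q\<close>. Its norm, however, lies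
  in \<open>Q'\<close> and in \<open>K\<close>, hence in \<open>Q\<close>.\<close>

lemma transitive_on_primes:
  assumes Q': "prime_above K L \<qq> Q'"
  shows "\<exists>\<tau>\<in>G. \<forall>x\<in>OI L. x \<in> Q' \<longleftrightarrow> \<tau> x \<in> Q"
proof -
  interpret Q': number_field_prime L Q' by unfold_locales (use Q' in \<open>simp add: prime_above_def\<close>)
  have "\<exists>\<tau>\<in>G. \<forall>x\<in>Q'. \<tau> x \<in> Q"
  proof (rule ccontr)
    assume no: "\<not> ?thesis"
    have "\<exists>a. a \<in> Q' \<and> \<tau> a - 1 \<in> Q" if \<tau>: "\<tau> \<in> G" for \<tau>
    proof -
      obtain a where a: "a \<in> Q'" "\<tau> a \<notin> Q" using no \<tau> by blast
      have aO: "a \<in> OI L" using a(1) by (rule Q'.Q_OI)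
      obtain c where c: "c \<in> OI L" "\<tau> a * c - 1 \<in> Q" using unit_mod[OF gal_OI[OF \<tau> aO] a(2)] by blast
      define d where "d = (inv\<^bsub>gal_group K L\<^esub> \<tau>) c"
      have d: "d \<in> OI L" "\<tau> d = c"
        using gal_OI[OF Gal.inv_closed[OF \<tau>] c(1)] inv_apply(1)[OF \<tau> OI_subset[OF c(1)]] by (auto simp: d_def)
      have "a * d \<in> Q'" by (rule Q'.Q_closed(5)[OF d(1) a(1)])
      moreover have "\<tau> (a * d) - 1 \<in> Q"
        using emb_mult[OF gal_emb[OF \<tau>] OI_subset[OF aO] OI_subset[OF d(1)]] d(2) c(2) by simp
      ultimately show ?thesis by blast
    qed
    then obtain a where a: "\<And>\<tau>. \<tau> \<in> G \<Longrightarrow> a \<tau> \<in> Q'" "\<And>\<tau>. \<tau> \<in> G \<Longrightarrow> \<tau> (a \<tau>) - 1 \<in> Q" by metis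
    have aO: "1 - a \<tau> \<in> OI L" if "\<tau> \<in> G" for \<tau> using Q'.Q_OI[OF a(1)[OF that]] by (rule OI_diff[OF OI_one])
    \<comment> \<open>A Chinese remainder element by hand: each \<open>a \<tau>\<close> is in
      \<open>Q'\<close>, hence so is \<open>x\<close>; and \<tau> sends the factor 1 - a \<tau> into
      \<open>Q\<close>, so every conjugate of \<open>x\<close> is 1 modulo \<open>Q\<close>.\<close>
    define x where "x = 1 - (\<Prod>\<tau>\<in>G. 1 - a \<tau>)"
    have prodQ': "1 - (\<Prod>\<tau>\<in>A. 1 - a \<tau>) \<in> Q'" if "finite A" "A \<subseteq> G" for A
      using that
    proof (induction A rule: finite_induct)
      case empty
      then show ?case using Q'.Q_closed(2) by simp
    next
      case (insert \<tau> A)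
      have "1 - (1 - a \<tau>) * (\<Prod>\<tau>\<in>A. 1 - a \<tau>) = a \<tau> + (1 - a \<tau>) * (1 - (\<Prod>\<tau>\<in>A. 1 - a \<tau>))" by (simp add: algebra_simps)
      moreover have "(1 - a \<tau>) * (1 - (\<Prod>\<tau>\<in>A. 1 - a \<tau>)) \<in> Q'"
        using insert by (intro Q'.Q_closed(4)[OF aO]) auto
      ultimately show ?case using insert Q'.Q_closed(3)[OF a(1)] by simp
    qed
    have xQ': "x \<in> Q'" unfolding x_def by (rule prodQ'[OF finite_gal]) simp
    have xO: "x \<in> OI L" using xQ' by (rule Q'.Q_OI)
    have nx: "\<tau> x \<notin> Q" if \<tau>: "\<tau> \<in> G" for \<tau>
    proof
      assume m: "\<tau> x \<in> Q"
      define r where "r = (\<Prod>\<sigma>\<in>G - {\<tau>}. 1 - a \<sigma>)"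
      have r: "r \<in> OI L" unfolding r_def by (rule OI_prod) (use aO in auto)
      have "x = 1 - (1 - a \<tau>) * r" unfolding x_def r_def using prod.remove[OF finite_gal \<tau>, of "\<lambda>\<sigma>. 1 - a \<sigma>"] by simp
      then have "\<tau> x = 1 - (1 - \<tau> (a \<tau>)) * \<tau> r"
        using emb_diff[OF gal_emb[OF \<tau>] one_in OI_subset[OF OI_mult[OF aO[OF \<tau>] r]]]
          emb_mult[OF gal_emb[OF \<tau>] OI_subset[OF aO[OF \<tau>]] OI_subset[OF r]]
          emb_diff[OF gal_emb[OF \<tau>] one_in OI_subset[OF Q'.Q_OI[OF a(1)[OF \<tau>]]]] emb_one[OF gal_emb[OF \<tau>]] by simp
      moreover have "(1 - \<tau> (a \<tau>)) * \<tau> r \<in> Q"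
      proof -
        have "1 - \<tau> (a \<tau>) \<in> Q" using Q_closed(6)[OF a(2)[OF \<tau>]] by simp
        then show ?thesis by (rule Q_closed(5)[OF gal_OI[OF \<tau> r]])
      qed
      ultimately have "1 \<in> Q" using m Q_closed(3)[of "\<tau> x" "(1 - \<tau> (a \<tau>)) * \<tau> r"] by simp
      then show False using one_notin by blast
    qed
    have "nm x \<in> Q'"
    proof -
      have "nm x = x * (\<Prod>\<sigma>\<in>G - {\<one>\<^bsub>gal_group K L\<^esub>}. \<sigma> x)"
        unfolding nm_def using prod.remove[OF finite_gal, of "\<one>\<^bsub>gal_group K L\<^esub>" "\<lambda>\<sigma>. \<sigma> x"] one_apply[OF OI_subset[OF xO]] by simp
      moreover have "(\<Prod>\<sigma>\<in>G - {\<one>\<^bsub>gal_group K L\<^esub>}. \<sigma> x) \<in> OI L" by (rule OI_prod) (use gal_OI[OF _ xO] in auto)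
      ultimately show ?thesis using Q'.Q_closed(5)[OF _ xQ'] by simp
    qed
    then have "nm x \<in> Q' \<inter> OI K" using nm_OI_K[OF xO] by simp
    then have "nm x \<in> Q" using Q' by (auto simp: prime_above_def)
    then have "\<exists>\<tau>\<in>G. \<tau> x \<in> Q"
      by (intro prime_prod[OF finite_gal, of "\<lambda>\<sigma>. \<sigma> x"]) (use gal_OI[OF _ xO] in \<open>auto simp: nm_def\<close>)
    then show False using nx by blast
  qed
  then obtain \<tau> where \<tau>: "\<tau> \<in> G" "\<And>x. x \<in> Q' \<Longrightarrow> \<tau> x \<in> Q" by blast
  \<comment> \<open>Maximality of \<open>Q'\<close> upgrades the inclusion to an
    equivalence.\<close>
  have "x \<in> Q'" if x: "x \<in> OI L" "\<tau> x \<in> Q" for x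
  proof (rule ccontr)
    assume "x \<notin> Q'"
    then obtain y where y: "y \<in> OI L" "x * y - 1 \<in> Q'" using Q'.unit_mod[OF x(1)] by blast
    have "\<tau> (x * y - 1) = \<tau> x * \<tau> y - 1"
      using emb_diff[OF gal_emb[OF \<tau>(1)] OI_subset[OF OI_mult[OF x(1) y(1)]] one_in]
        emb_mult[OF gal_emb[OF \<tau>(1)] OI_subset[OF x(1)] OI_subset[OF y(1)]] emb_one[OF gal_emb[OF \<tau>(1)]] by simp
    then have "\<tau> x * \<tau> y - 1 \<in> Q" using \<tau>(2)[OF y(2)] by simp
    from Q_closed(7)[OF Q_closed(5)[OF gal_OI[OF \<tau>(1) y(1)] x(2)] this] show False using one_notin by simp
  qed
  then show ?thesis using \<tau> by blast
qed

end

section \<open>Frobenius automorphisms and Artin symbols\<close>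

lemma galois_primeI:
  assumes "galois_ext K L" "prime_above K L q Q"
  shows "galois_prime K L Q" "Q \<inter> OI K = q"
proof -
  interpret galois_ext K L by fact
  have "number_field_prime L Q" by unfold_locales (use assms in \<open>simp add: prime_above_def\<close>)
  then have "ext_prime K L Q" using field_ext_axioms by (simp add: ext_prime_def)
  then show "galois_prime K L Q" using galois_ext_axioms by (simp add: galois_prime_def)
  show "Q \<inter> OI K = q" using assms by (simp add: prime_above_def)
qed

lemma prime_above_restrict:
  assumes L: "field_ext K L" and F: "field_ext K F" and LF: "L \<subseteq> F" and Q: "prime_above K F q Q"
  shows "prime_above K L q (Q \<inter> OI L)"
proof -
  interpret L: field_ext K L by fact
  interpret F: field_ext K F by fact
  interpret E: ext_prime L F Q
    by unfold_locales (use LF Q in \<open>auto simp: prime_above_def\<close>)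
  have "prime_of L (Q \<inter> OI L)" by (rule E.prime_qq)
  moreover have "Q \<inter> OI L \<inter> OI K = q" using Q L.OI_K_subset by (auto simp: prime_above_def)
  ultimately show ?thesis by (simp add: prime_above_def)
qed

lemma (in galois_prime) unramified_trivial_inertia: "unramified K L \<qq> \<Longrightarrow> trivial_inertia"
  using unramified_imp_trivial_inertia prime_above_qq by (auto simp: unramified_def)

text \<open>An automorphism congruent to a positive power map preserves \<open>Q\<close>. Two of
  them with the same exponent are congruent to each other, which forces equality when inertia is
  trivial.\<close>

lemma (in galois_prime) congruent_imp_eq:
  assumes ti: "trivial_inertia" and st: "\<sigma> \<in> G" "\<tau> \<in> G"
    and c: "\<And>x. x \<in> OI L \<Longrightarrow> \<sigma> x - x ^ M \<in> Q" "\<And>x. x \<in> OI L \<Longrightarrow> \<tau> x - x ^ M \<in> Q" and M: "M > 0"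
  shows "\<sigma> = \<tau>"
proof (rule ccontr)
  assume ne: "\<sigma> \<noteq> \<tau>"
  have D: "\<mu> \<in> decomp" if \<mu>: "\<mu> \<in> G" "\<And>x. x \<in> OI L \<Longrightarrow> \<mu> x - x ^ M \<in> Q" for \<mu>
  proof -
    have "\<mu> x \<in> Q \<longleftrightarrow> x \<in> Q" if x: "x \<in> OI L" for x
    proof -
      have "\<mu> x \<in> Q \<longleftrightarrow> x ^ M \<in> Q" by (rule ideal_diff_iff[OF ideal_Q \<mu>(2)[OF x]])
      also have "\<dots> \<longleftrightarrow> x \<in> Q"
      proof
        assume "x ^ M \<in> Q"
        then show "x \<in> Q" by (rule prime_power[OF x])
      next
        assume "x \<in> Q"
        then show "x ^ M \<in> Q" using Q_closed(5)[OF OI_power[OF x], of x "M - 1"] M by (cases M) auto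
      qed
      finally show ?thesis .
    qed
    then show ?thesis using \<mu>(1) by (auto simp: decomp_def)
  qed
  obtain y where y: "y \<in> OI L" "\<sigma> y - \<tau> y \<notin> Q"
    using decomp_distinct[OF ti D[OF st(1) c(1)] D[OF st(2) c(2)] ne] by blast
  have "(\<sigma> y - y ^ M) - (\<tau> y - y ^ M) \<in> Q" by (rule Q_closed(7)[OF c(1)[OF y(1)] c(2)[OF y(1)]])
  then show False using y(2) by simp
qed

context abelian_ext
begin

text \<open>\<open>frobenius\<close> is a \<open>THE\<close> over all primes above \<open>q\<close>
  at once. Existence at one prime is transported to the others by transitivity, and commutativity
  lets the same automorphism serve everywhere.\<close>

lemma frobenius_unique_existence:
  assumes q: "prime_of K q" and ur: "unramified K L q"
  shows "\<exists>!\<sigma>. \<sigma> \<in> G \<and> (\<forall>Q. prime_above K L q Q \<longrightarrow> (\<forall>x\<in>OI L. \<sigma> x - x ^ ideal_norm K q \<in> Q))"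
proof -
  obtain Q0 where Q0: "prime_above K L q Q0" using lying_over[OF q] .
  interpret Q0: galois_prime K L Q0 by (rule galois_primeI[OF galois_ext_axioms Q0])
  have qq: "Q0 \<inter> OI K = q" by (rule galois_primeI[OF galois_ext_axioms Q0])
  have ti: "Q0.trivial_inertia" using Q0.unramified_trivial_inertia ur qq by simp
  obtain \<sigma> where \<sigma>: "\<sigma> \<in> G" "\<And>x. x \<in> OI L \<Longrightarrow> \<sigma> x - x ^ ideal_norm K q \<in> Q0"
    using Q0.exists_frobenius_at[OF ti] unfolding qq by blast
  have all: "\<sigma> x - x ^ ideal_norm K q \<in> Q" if Q: "prime_above K L q Q" and x: "x \<in> OI L" for Q x
  proof -
    obtain \<tau> where \<tau>: "\<tau> \<in> G" "\<forall>x\<in>OI L. x \<in> Q \<longleftrightarrow> \<tau> x \<in> Q0"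
      using Q0.transitive_on_primes[unfolded qq, OF Q] by blast
    have \<tau>x: "\<tau> x \<in> OI L" by (rule gal_OI[OF \<tau>(1) x])
    have "\<tau> (\<sigma> x - x ^ ideal_norm K q) = \<tau> (\<sigma> x) - (\<tau> x) ^ ideal_norm K q"
      using emb_diff[OF gal_emb[OF \<tau>(1)] gal_in[OF \<sigma>(1) OI_subset[OF x]] OI_subset[OF OI_power[OF x]]]
        emb_power[OF gal_emb[OF \<tau>(1)] OI_subset[OF x]] by simp
    also have "\<dots> = \<sigma> (\<tau> x) - (\<tau> x) ^ ideal_norm K q" using commute_apply[OF \<tau>(1) \<sigma>(1) OI_subset[OF x]] by simp
    also have "\<dots> \<in> Q0" by (rule \<sigma>(2)[OF \<tau>x])
    finally show ?thesis using \<tau>(2) OI_diff[OF gal_OI[OF \<sigma>(1) x] OI_power[OF x]] by blast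
  qed
  show ?thesis
  proof (rule ex1I[of _ \<sigma>])
    show "\<sigma> \<in> G \<and> (\<forall>Q. prime_above K L q Q \<longrightarrow> (\<forall>x\<in>OI L. \<sigma> x - x ^ ideal_norm K q \<in> Q))" using \<sigma>(1) all by simp
    fix \<tau> assume \<tau>: "\<tau> \<in> G \<and> (\<forall>Q. prime_above K L q Q \<longrightarrow> (\<forall>x\<in>OI L. \<tau> x - x ^ ideal_norm K q \<in> Q))"
    then have t: "\<tau> \<in> G" "\<And>x. x \<in> OI L \<Longrightarrow> \<tau> x - x ^ ideal_norm K q \<in> Q0" using Q0 by simp_all
    show "\<tau> = \<sigma>"
      by (rule Q0.congruent_imp_eq[OF ti t(1) \<sigma>(1) t(2) \<sigma>(2)]) (use Q0.norm_gt_1 qq in auto)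
  qed
qed

lemma frobenius_gal: "prime_of K q \<Longrightarrow> unramified K L q \<Longrightarrow> frobenius K L q \<in> G"
  and frobenius_cong: "prime_of K q \<Longrightarrow> unramified K L q \<Longrightarrow> prime_above K L q Q \<Longrightarrow> x \<in> OI L \<Longrightarrow>
    frobenius K L q x - x ^ ideal_norm K q \<in> Q"
  using theI'[OF frobenius_unique_existence[of q]] unfolding frobenius_def by simp_all

lemma frobenius_eqI:
  assumes q: "prime_of K q" and ur: "unramified K L q" and Q: "prime_above K L q Q"
    and \<tau>: "\<tau> \<in> G" "\<And>x. x \<in> OI L \<Longrightarrow> \<tau> x - x ^ ideal_norm K q \<in> Q"
  shows "\<tau> = frobenius K L q"
proof -
  interpret Q: galois_prime K L Q by (rule galois_primeI[OF galois_ext_axioms Q])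
  have qq: "Q \<inter> OI K = q" by (rule galois_primeI[OF galois_ext_axioms Q])
  have ti: "Q.trivial_inertia" using Q.unramified_trivial_inertia ur qq by simp
  show ?thesis
    by (rule Q.congruent_imp_eq[OF ti \<tau>(1) frobenius_gal[OF q ur] \<tau>(2) frobenius_cong[OF q ur Q]])
       (use Q.norm_gt_1 qq in auto)
qed

lemma frobenius_pow_cong:
  assumes q: "prime_of K q" and ur: "unramified K L q" and Q: "prime_above K L q Q" and x: "x \<in> OI L"
  shows "(frobenius K L q [^]\<^bsub>gal_group K L\<^esub> (m::nat)) x \<in> OI L \<and>
    (frobenius K L q [^]\<^bsub>gal_group K L\<^esub> m) x - x ^ (ideal_norm K q ^ m) \<in> Q"
  using x
proof (induction m arbitrary: x)
  case 0
  interpret Q: galois_prime K L Q by (rule galois_primeI[OF galois_ext_axioms Q])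
  show ?case using 0 one_apply[OF OI_subset[OF 0]] Q.Q_closed(2) by simp
next
  case (Suc m)
  interpret Q: galois_prime K L Q by (rule galois_primeI[OF galois_ext_axioms Q])
  let ?F = "frobenius K L q" and ?N = "ideal_norm K q"
  note F = frobenius_gal[OF q ur]
  have pw: "?F [^]\<^bsub>gal_group K L\<^esub> m \<in> G" using F by simp
  have Fx: "?F x \<in> OI L" by (rule gal_OI[OF F Suc.prems])
  have app: "(?F [^]\<^bsub>gal_group K L\<^esub> (Suc m)) x = (?F [^]\<^bsub>gal_group K L\<^esub> m) (?F x)"
    using mult_apply[OF pw F OI_subset[OF Suc.prems]] by simp
  note IH = Suc.IH[OF Fx]
  \<comment> \<open>Raises the Frobenius congruence to the power N^m by factoring a - b out of a^k -
    b^k.\<close>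
  have dvd: "\<exists>w\<in>OI L. (?F x) ^ k - (x ^ ?N) ^ k = (?F x - x ^ ?N) * w" for k
  proof (induction k)
    case 0
    then show ?case using OI_zero by force
  next
    case (Suc k)
    then obtain w where w: "w \<in> OI L" "(?F x) ^ k - (x ^ ?N) ^ k = (?F x - x ^ ?N) * w" by blast
    have "(?F x) ^ Suc k - (x ^ ?N) ^ Suc k = ?F x * ((?F x) ^ k - (x ^ ?N) ^ k) + (?F x - x ^ ?N) * (x ^ ?N) ^ k"
      by (simp add: algebra_simps)
    also have "\<dots> = (?F x - x ^ ?N) * (?F x * w + (x ^ ?N) ^ k)" unfolding w(2) by (simp add: algebra_simps)
    finally show ?case using OI_add[OF OI_mult[OF Fx w(1)] OI_power[OF OI_power[OF \<open>x \<in> OI L\<close>]]] by blast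
  qed
  obtain w where w: "w \<in> OI L" "(?F x) ^ (?N ^ m) - (x ^ ?N) ^ (?N ^ m) = (?F x - x ^ ?N) * w" using dvd by blast
  have "(?F x) ^ (?N ^ m) - (x ^ ?N) ^ (?N ^ m) \<in> Q"
    unfolding w(2) by (rule Q.Q_closed(5)[OF w(1) frobenius_cong[OF q ur Q Suc.prems]])
  then have "((?F [^]\<^bsub>gal_group K L\<^esub> m) (?F x) - (?F x) ^ (?N ^ m)) + ((?F x) ^ (?N ^ m) - (x ^ ?N) ^ (?N ^ m)) \<in> Q"
    by (intro Q.Q_closed(3) conjunct2[OF IH])
  moreover have "(x ^ ?N) ^ (?N ^ m) = x ^ (?N ^ Suc m)" by (simp add: power_mult)
  ultimately show ?case unfolding app using IH by simp
qed

text \<open>The Frobenius power sends \<open>x\<close> to something congruent to x^(N^m), hence to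
  \<open>x\<close>; it is an inertia element of an unramified extension. The next lemma is the
  converse.\<close>

lemma frobenius_pow_eq_one:
  assumes q: "prime_of K q" and ur: "unramified K L q" and Q: "prime_above K L q Q"
    and c: "\<And>x. x \<in> OI L \<Longrightarrow> x ^ (ideal_norm K q ^ m) - x \<in> Q"
  shows "frobenius K L q [^]\<^bsub>gal_group K L\<^esub> (m::nat) = \<one>\<^bsub>gal_group K L\<^esub>"
proof -
  interpret Q: galois_prime K L Q by (rule galois_primeI[OF galois_ext_axioms Q])
  have qq: "Q \<inter> OI K = q" by (rule galois_primeI[OF galois_ext_axioms Q])
  have ti: "Q.trivial_inertia" using Q.unramified_trivial_inertia ur qq by simp
  let ?\<sigma> = "frobenius K L q [^]\<^bsub>gal_group K L\<^esub> m"
  have "?\<sigma> x - x \<in> Q" if x: "x \<in> OI L" for x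
    using Q.Q_closed(3)[OF conjunct2[OF frobenius_pow_cong[OF q ur Q x, of m]] c[OF x]] by simp
  moreover have "?\<sigma> \<in> G" using frobenius_gal[OF q ur] by simp
  ultimately have "?\<sigma> \<in> inertia_group K L Q" unfolding Q.inertia_iff by blast
  then show ?thesis using ti unfolding Q.trivial_inertia_def by blast
qed

lemma frobenius_pow_one_imp_cong:
  assumes q: "prime_of K q" and ur: "unramified K L q" and Q: "prime_above K L q Q"
    and one: "frobenius K L q [^]\<^bsub>gal_group K L\<^esub> (m::nat) = \<one>\<^bsub>gal_group K L\<^esub>" and x: "x \<in> OI L"
  shows "x ^ (ideal_norm K q ^ m) - x \<in> Q"
proof -
  interpret Q: galois_prime K L Q by (rule galois_primeI[OF galois_ext_axioms Q])
  have "x - x ^ (ideal_norm K q ^ m) \<in> Q"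
    using conjunct2[OF frobenius_pow_cong[OF q ur Q x, of m]] one one_apply[OF OI_subset[OF x]] by simp
  then show ?thesis using Q.Q_closed(6)[of "x - x ^ (ideal_norm K q ^ m)"] by simp
qed

text \<open>Restriction maps the inertia group of the larger field into that of \<open>L\<close>,
  which is trivial. Unramifiedness of composita and inclusion in the inertia field both rest on
  this.\<close>

lemma inertia_restrict_trivial:
  assumes F: "galois_ext K F" and LF: "L \<subseteq> F" and ur: "unramified K L q" and Q: "prime_above K F q Q"
    and \<sigma>: "\<sigma> \<in> inertia_group K F Q" and x: "x \<in> L"
  shows "\<sigma> x = x"
proof -
  interpret F: galois_prime K F Q by (rule galois_primeI[OF F Q])
  have Q': "prime_above K L q (Q \<inter> OI L)" by (rule prime_above_restrict[OF field_ext_axioms F.field_ext_axioms LF Q])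
  interpret Q': galois_prime K L "Q \<inter> OI L" by (rule galois_primeI[OF galois_ext_axioms Q'])
  have qq: "Q \<inter> OI L \<inter> OI K = q" by (rule galois_primeI[OF galois_ext_axioms Q'])
  have ti: "Q'.trivial_inertia" using Q'.unramified_trivial_inertia ur qq by simp
  have \<sigma>F: "\<sigma> \<in> carrier (gal_group K F)" "\<And>y. y \<in> OI F \<Longrightarrow> \<sigma> y - y \<in> Q" using \<sigma> by (auto simp: F.inertia_iff)
  have r: "restrict \<sigma> L \<in> G" by (rule restrict_gal[OF F.field_ext_axioms LF \<sigma>F(1)])
  have "restrict \<sigma> L y - y \<in> Q \<inter> OI L" if y: "y \<in> OI L" for y
  proof -
    have "y \<in> OI F" using y LF by (auto simp: OI_def)
    then have "restrict \<sigma> L y - y \<in> Q" using \<sigma>F(2)[of y] OI_subset[OF y] by simp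
    moreover have "restrict \<sigma> L y - y \<in> OI L" by (rule OI_diff[OF gal_OI[OF r y] y])
    ultimately show ?thesis by blast
  qed
  then have "restrict \<sigma> L \<in> inertia_group K L (Q \<inter> OI L)" unfolding Q'.inertia_iff using r by blast
  then have "restrict \<sigma> L = \<one>\<^bsub>gal_group K L\<^esub>" using ti unfolding Q'.trivial_inertia_def by blast
  then have "restrict \<sigma> L x = x" using one_apply[OF x] by simp
  then show ?thesis using x by simp
qed

text \<open>The Frobenius congruence modulo \<open>Q\<close> intersects down to \<open>L\<close>,
  and the congruence at one prime already identifies the Frobenius there.\<close>

lemma frobenius_restrict:
  assumes F: "abelian_ext K F" and LF: "L \<subseteq> F" and q: "prime_of K q"
    and ur: "unramified K L q" "unramified K F q"
  shows "restrict (frobenius K F q) L = frobenius K L q"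
proof -
  interpret F: abelian_ext K F by fact
  obtain Q where Q: "prime_above K F q Q" using F.lying_over[OF q] .
  have Q': "prime_above K L q (Q \<inter> OI L)" by (rule prime_above_restrict[OF field_ext_axioms F.field_ext_axioms LF Q])
  have r: "restrict (frobenius K F q) L \<in> G"
    by (rule restrict_gal[OF F.field_ext_axioms LF F.frobenius_gal[OF q ur(2)]])
  show ?thesis
  proof (rule frobenius_eqI[OF q ur(1) Q' r])
    fix x assume x: "x \<in> OI L"
    then have "x \<in> OI F" using LF by (auto simp: OI_def)
    then have "restrict (frobenius K F q) L x - x ^ ideal_norm K q \<in> Q"
      using F.frobenius_cong[OF q ur(2) Q, of x] OI_subset[OF x] by simp
    then show "restrict (frobenius K F q) L x - x ^ ideal_norm K q \<in> Q \<inter> OI L"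
      using OI_diff[OF gal_OI[OF r x] OI_power[OF x]] by blast
  qed
qed

lemma restrict_hom:
  assumes F: "abelian_ext K F" and LF: "L \<subseteq> F"
    and st: "\<sigma> \<in> carrier (gal_group K F)" "\<tau> \<in> carrier (gal_group K F)"
  shows "restrict (\<sigma> \<otimes>\<^bsub>gal_group K F\<^esub> \<tau>) L = restrict \<sigma> L \<otimes>\<^bsub>gal_group K L\<^esub> restrict \<tau> L"
proof -
  interpret F: abelian_ext K F by fact
  note r = restrict_gal[OF F.field_ext_axioms LF]
  show ?thesis
  proof (rule gal_eqI)
    show "restrict (\<sigma> \<otimes>\<^bsub>gal_group K F\<^esub> \<tau>) L \<in> G" by (rule r) (use st in simp)
    show "restrict \<sigma> L \<otimes>\<^bsub>gal_group K L\<^esub> restrict \<tau> L \<in> G" using r[OF st(1)] r[OF st(2)] by simp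
    fix x assume x: "x \<in> L"
    then have "x \<in> F" using LF by blast
    moreover have "restrict \<tau> L x \<in> L" by (rule gal_in[OF r[OF st(2)] x])
    ultimately show "restrict (\<sigma> \<otimes>\<^bsub>gal_group K F\<^esub> \<tau>) L x = (restrict \<sigma> L \<otimes>\<^bsub>gal_group K L\<^esub> restrict \<tau> L) x"
      using x F.mult_apply[OF st] mult_apply[OF r[OF st(1)] r[OF st(2)] x] by simp
  qed
qed

lemma restrict_one:
  assumes F: "abelian_ext K F" and LF: "L \<subseteq> F"
  shows "restrict \<one>\<^bsub>gal_group K F\<^esub> L = \<one>\<^bsub>gal_group K L\<^esub>"
proof -
  interpret F: abelian_ext K F by fact
  show ?thesis using LF unfolding gal_group_one F.gal_group_one by (auto simp: restrict_def fun_eq_iff)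
qed

lemma restrict_pow:
  assumes F: "abelian_ext K F" and LF: "L \<subseteq> F" and s: "\<sigma> \<in> carrier (gal_group K F)"
  shows "restrict (\<sigma> [^]\<^bsub>gal_group K F\<^esub> (n::nat)) L = restrict \<sigma> L [^]\<^bsub>gal_group K L\<^esub> n"
proof -
  interpret F: abelian_ext K F by fact
  have pw: "\<sigma> [^]\<^bsub>gal_group K F\<^esub> n \<in> F.G" for n :: nat using s by simp
  show ?thesis
  proof (induction n)
    case 0
    show ?case unfolding F.Gal.nat_pow_0 Gal.nat_pow_0 by (rule restrict_one[OF F LF])
  next
    case (Suc n)
    show ?case unfolding F.Gal.nat_pow_Suc Gal.nat_pow_Suc restrict_hom[OF F LF pw s] Suc.IH ..
  qed
qed

lemma restrict_finprod:
  assumes F: "abelian_ext K F" and LF: "L \<subseteq> F" and g: "\<And>i. i \<in> A \<Longrightarrow> g i \<in> carrier (gal_group K F)"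
  shows "finprod (gal_group K F) g A \<in> carrier (gal_group K F) \<and>
    restrict (finprod (gal_group K F) g A) L = finprod (gal_group K L) (\<lambda>i. restrict (g i) L) A"
proof -
  interpret F: abelian_ext K F by fact
  interpret CF: comm_group "gal_group K F" by (rule F.comm_group_gal)
  interpret CL: comm_group "gal_group K L" by (rule comm_group_gal)
  note r = restrict_gal[OF F.field_ext_axioms LF]
  show ?thesis
    using g
  proof (induction A rule: infinite_finite_induct)
    \<comment> \<open>Over an infinite index set \<open>finprod\<close> defaults to the unit in both
      groups, and the unit restricts to the unit. This covers index sets of primes whose finiteness
      has not been established.\<close>
    case (infinite A)
    then show ?case using restrict_one[OF F LF] by simp
  next
    case empty
    then show ?case using restrict_one[OF F LF] by simp
  next
    case (insert x A)
    have gx: "g x \<in> F.G" and gA: "g \<in> A \<rightarrow> F.G" using insert.prems by auto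
    have rx: "restrict (g x) L \<in> G" and rA: "(\<lambda>i. restrict (g i) L) \<in> A \<rightarrow> G" using insert.prems r by auto
    have "finprod (gal_group K F) g A \<in> F.G \<and>
      restrict (finprod (gal_group K F) g A) L = finprod (gal_group K L) (\<lambda>i. restrict (g i) L) A"
      by (rule insert.IH) (use insert.prems in blast)
    then have IH: "finprod (gal_group K F) g A \<in> F.G"
      "restrict (finprod (gal_group K F) g A) L = finprod (gal_group K L) (\<lambda>i. restrict (g i) L) A" by blast+
    show ?case
      unfolding CF.finprod_insert[OF insert.hyps gA gx] CL.finprod_insert[OF insert.hyps rA rx]
        restrict_hom[OF F LF gx IH(1)] IH(2)
      using F.Gal.m_closed[OF gx IH(1)] by blast
  qed
qed

lemma restrict_artin_symbol:
  assumes F: "abelian_ext K F" and LF: "L \<subseteq> F"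
    and ur: "\<And>q. prime_of K q \<Longrightarrow> \<aa> \<subseteq> q \<Longrightarrow> unramified K L q \<and> unramified K F q"
  shows "artin_symbol K F \<aa> \<in> carrier (gal_group K F)"
    "restrict (artin_symbol K F \<aa>) L = artin_symbol K L \<aa>"
proof -
  interpret F: abelian_ext K F by fact
  interpret CL: comm_group "gal_group K L" by (rule comm_group_gal)
  define A where "A = {q. prime_of K q \<and> \<aa> \<subseteq> q}"
  have fr: "frobenius K F q \<in> F.G" if "q \<in> A" for q
    using F.frobenius_gal ur that by (auto simp: A_def)
  have g: "frobenius K F q [^]\<^bsub>gal_group K F\<^esub> ideal_valuation K q \<aa> \<in> F.G" if "q \<in> A" for q
    using fr[OF that] by simp
  have rf: "finprod (gal_group K F) (\<lambda>q. frobenius K F q [^]\<^bsub>gal_group K F\<^esub> ideal_valuation K q \<aa>) A \<in> F.G"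
    "restrict (finprod (gal_group K F) (\<lambda>q. frobenius K F q [^]\<^bsub>gal_group K F\<^esub> ideal_valuation K q \<aa>) A) L =
     finprod (gal_group K L) (\<lambda>q. restrict (frobenius K F q [^]\<^bsub>gal_group K F\<^esub> ideal_valuation K q \<aa>) L) A"
    using restrict_finprod[OF F LF, of A "\<lambda>q. frobenius K F q [^]\<^bsub>gal_group K F\<^esub> ideal_valuation K q \<aa>"] g by blast+
  show "artin_symbol K F \<aa> \<in> carrier (gal_group K F)"
    using rf(1) unfolding artin_symbol_def A_def .
  have eq: "restrict (frobenius K F q [^]\<^bsub>gal_group K F\<^esub> ideal_valuation K q \<aa>) L =
    frobenius K L q [^]\<^bsub>gal_group K L\<^esub> ideal_valuation K q \<aa>" if "q \<in> A" for q
    unfolding restrict_pow[OF F LF fr[OF that]]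
    using frobenius_restrict[OF F LF, of q] ur[of q] that by (simp only: A_def mem_Collect_eq)
  have "finprod (gal_group K L) (\<lambda>q. restrict (frobenius K F q [^]\<^bsub>gal_group K F\<^esub> ideal_valuation K q \<aa>) L) A
    = finprod (gal_group K L) (\<lambda>q. frobenius K L q [^]\<^bsub>gal_group K L\<^esub> ideal_valuation K q \<aa>) A"
  proof (rule CL.finprod_cong')
    show "(\<lambda>q. frobenius K L q [^]\<^bsub>gal_group K L\<^esub> ideal_valuation K q \<aa>) \<in> A \<rightarrow> G"
      using frobenius_gal ur by (auto simp: A_def)
  qed (use eq in auto)
  then show "restrict (artin_symbol K F \<aa>) L = artin_symbol K L \<aa>"
    using rf(2) unfolding artin_symbol_def A_def by (rule trans[rotated])
qed

end

text \<open>An inertia element of the compositum fixes both factors and is therefore the identity;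
  trivial inertia then gives the exponent condition.\<close>

lemma unramified_compositum:
  assumes L: "abelian_ext K L" and M: "abelian_ext K M" and ur: "unramified K L q" "unramified K M q"
  shows "unramified K (compositum L M) q"
  unfolding unramified_def
proof (intro allI impI)
  fix Q assume Q: "prime_above K (compositum L M) q Q"
  interpret L: abelian_ext K L by fact
  interpret M: abelian_ext K M by fact
  interpret F: abelian_ext K "compositum L M" by (rule abelian_ext_compositum[OF L M])
  interpret FQ: galois_prime K "compositum L M" Q by (rule galois_primeI[OF F.galois_ext_axioms Q])
  have qq: "Q \<inter> OI K = q" by (rule galois_primeI[OF F.galois_ext_axioms Q])
  have "FQ.trivial_inertia"
    unfolding FQ.trivial_inertia_def
  proof
    fix \<sigma> assume \<sigma>: "\<sigma> \<in> inertia_group K (compositum L M) Q"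
    have \<sigma>G: "\<sigma> \<in> F.G" using \<sigma> FQ.inertia_iff by blast
    show "\<sigma> = \<one>\<^bsub>gal_group K (compositum L M)\<^esub>"
    proof (rule gal_compositum_eqI[OF L.cfield_axioms M.cfield_axioms F.field_ext_axioms \<sigma>G])
      fix x assume "x \<in> L \<union> M"
      then have "\<sigma> x = x"
        using L.inertia_restrict_trivial[OF F.galois_ext_axioms compositum_superset(1) ur(1) Q \<sigma>]
          M.inertia_restrict_trivial[OF F.galois_ext_axioms compositum_superset(2) ur(2) Q \<sigma>] by blast
      moreover have "x \<in> compositum L M" using \<open>x \<in> L \<union> M\<close> compositum_superset by blast
      ultimately show "\<sigma> x = \<one>\<^bsub>gal_group K (compositum L M)\<^esub> x" using F.one_apply by simp
    qed simp
  qed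
  then show "\<not> q \<subseteq> ideal_power (compositum L M) Q 2"
    using FQ.trivial_inertia_imp_unramified qq by simp
qed

section \<open>Class fields\<close>

lemma coprime_ideal_not_subset:
  assumes K: "cfield K" and "coprime_ideal K \<mm> \<aa>" "prime_of K q" "\<aa> \<subseteq> q"
  shows "\<not> \<mm> \<subseteq> q"
proof
  interpret cfield K by fact
  assume "\<mm> \<subseteq> q"
  have q: "ideal q (integer_ring K)" "1 \<notin> q" using assms(3) by (auto simp: prime_of_iff)
  have "1 \<in> \<aa> <+>\<^bsub>integer_ring K\<^esub> \<mm>" using assms(2) by (simp add: coprime_ideal_def)
  then obtain a m where "a \<in> \<aa>" "m \<in> \<mm>" "1 = a + m" by (auto simp: set_add_def')
  then have "1 \<in> q" using idealD(3)[OF q(1), of a m] assms(4) \<open>\<mm> \<subseteq> q\<close> by auto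
  then show False using q(2) by blast
qed

lemma coprime_ideal_iff:
  assumes "cfield K" "ideal \<mm> (integer_ring K)"
  shows "coprime_ideal K \<mm> \<aa> \<longleftrightarrow> ideal \<aa> (integer_ring K) \<and> \<aa> \<noteq> {0} \<and> (\<exists>a\<in>\<aa>. \<exists>m\<in>\<mm>. a + m = 1)"
proof -
  interpret cfield K by fact
  have "\<aa> <+>\<^bsub>integer_ring K\<^esub> \<mm> = OI K \<longleftrightarrow> (\<exists>a\<in>\<aa>. \<exists>m\<in>\<mm>. a + m = 1)" if \<aa>: "ideal \<aa> (integer_ring K)"
  proof
    assume "\<aa> <+>\<^bsub>integer_ring K\<^esub> \<mm> = OI K"
    then have "1 \<in> \<aa> <+>\<^bsub>integer_ring K\<^esub> \<mm>" by simp
    then show "\<exists>a\<in>\<aa>. \<exists>m\<in>\<mm>. a + m = 1" by (auto simp: set_add_def')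
  next
    assume "\<exists>a\<in>\<aa>. \<exists>m\<in>\<mm>. a + m = 1"
    then obtain a m where am: "a \<in> \<aa>" "m \<in> \<mm>" "a + m = 1" by blast
    show "\<aa> <+>\<^bsub>integer_ring K\<^esub> \<mm> = OI K"
    proof
      show "\<aa> <+>\<^bsub>integer_ring K\<^esub> \<mm> \<subseteq> OI K"
        using idealD(1)[OF \<aa>] idealD(1)[OF assms(2)] OI_add by (auto simp: set_add_def')
      show "OI K \<subseteq> \<aa> <+>\<^bsub>integer_ring K\<^esub> \<mm>"
      proof
        fix x assume x: "x \<in> OI K"
        have "x = x * a + x * m" using arg_cong[OF am(3), of "\<lambda>t. x * t"] by (simp add: distrib_left)
        moreover have "x * a \<in> \<aa>" "x * m \<in> \<mm>" using idealD(4)[OF \<aa> x am(1)] idealD(4)[OF assms(2) x am(2)] .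
        ultimately show "x \<in> \<aa> <+>\<^bsub>integer_ring K\<^esub> \<mm>" by (auto simp: set_add_def')
      qed
    qed
  qed
  then show ?thesis unfolding coprime_ideal_def by auto
qed

text \<open>An automorphism of the compositum is determined by its two restrictions, so the Artin
  kernel is the intersection of the two kernels. As \<open>S\<^sub>2\<close> is contained in
  \<open>S\<^sub>1\<close>, that is the kernel belonging to \<open>S\<^sub>2\<close>.\<close>

lemma artin_kernel_field_compositum:
  assumes K: "number_field K"
    and 1: "artin_kernel_field K \<mm>\<^sub>1 S\<^sub>1 L" and 2: "artin_kernel_field K \<mm>\<^sub>2 S\<^sub>2 M"
    and \<mm>: "ideal \<mm>\<^sub>1 (integer_ring K)" "ideal \<mm>\<^sub>2 (integer_ring K)" "\<mm>\<^sub>2 \<subseteq> \<mm>\<^sub>1" and S: "S\<^sub>2 \<subseteq> S\<^sub>1"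
  shows "artin_kernel_field K \<mm>\<^sub>2 S\<^sub>2 (compositum L M)"
proof -
  interpret K: number_field K by fact
  have aL: "abelian_ext K L" and aM: "abelian_ext K M"
    using 1 2 abelian_extension_iff[OF K] by (auto simp: artin_kernel_field_def)
  interpret L: abelian_ext K L by fact
  interpret M: abelian_ext K M by fact
  have aF: "abelian_ext K (compositum L M)" by (rule abelian_ext_compositum[OF aL aM])
  interpret F: abelian_ext K "compositum L M" by (rule aF)
  have urL: "unramified K L q" if "prime_of K q" "\<not> \<mm>\<^sub>2 \<subseteq> q" for q
    using 1 that \<mm>(3) by (auto simp: artin_kernel_field_def)
  have urM: "unramified K M q" if "prime_of K q" "\<not> \<mm>\<^sub>2 \<subseteq> q" for q
    using 2 that by (auto simp: artin_kernel_field_def)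
  have urF: "unramified K (compositum L M) q" if "prime_of K q" "\<not> \<mm>\<^sub>2 \<subseteq> q" for q
    by (rule unramified_compositum[OF aL aM urL[OF that] urM[OF that]])
  have "artin_symbol K (compositum L M) \<aa> = artin_symbol K (compositum L M) \<bb> \<longleftrightarrow>
      (\<exists>\<alpha>\<in>S\<^sub>2. \<exists>\<beta>\<in>S\<^sub>2. (PIdl\<^bsub>integer_ring K\<^esub> \<beta>) \<cdot>\<^bsub>integer_ring K\<^esub> \<aa> = (PIdl\<^bsub>integer_ring K\<^esub> \<alpha>) \<cdot>\<^bsub>integer_ring K\<^esub> \<bb>)"
    if ab: "coprime_ideal K \<mm>\<^sub>2 \<aa>" "coprime_ideal K \<mm>\<^sub>2 \<bb>" for \<aa> \<bb>
  proof -
    have co1: "coprime_ideal K \<mm>\<^sub>1 \<aa>" "coprime_ideal K \<mm>\<^sub>1 \<bb>"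
      using ab \<mm>(3) unfolding coprime_ideal_iff[OF K.cfield_axioms \<mm>(1)] coprime_ideal_iff[OF K.cfield_axioms \<mm>(2)] by auto
    note ns = coprime_ideal_not_subset[OF K.cfield_axioms]
    note rL = L.restrict_artin_symbol[OF aF compositum_superset(1)]
    note rM = M.restrict_artin_symbol[OF aF compositum_superset(2)]
    have a: "artin_symbol K (compositum L M) \<aa> \<in> F.G"
      "restrict (artin_symbol K (compositum L M) \<aa>) L = artin_symbol K L \<aa>"
      "restrict (artin_symbol K (compositum L M) \<aa>) M = artin_symbol K M \<aa>"
      using rL[of \<aa>] rM[of \<aa>] urL urM urF ns[OF ab(1)] by auto
    have b: "artin_symbol K (compositum L M) \<bb> \<in> F.G"
      "restrict (artin_symbol K (compositum L M) \<bb>) L = artin_symbol K L \<bb>"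
      "restrict (artin_symbol K (compositum L M) \<bb>) M = artin_symbol K M \<bb>"
      using rL[of \<bb>] rM[of \<bb>] urL urM urF ns[OF ab(2)] by auto
    have "artin_symbol K (compositum L M) \<aa> = artin_symbol K (compositum L M) \<bb> \<longleftrightarrow>
      artin_symbol K L \<aa> = artin_symbol K L \<bb> \<and> artin_symbol K M \<aa> = artin_symbol K M \<bb>"
    proof
      assume "artin_symbol K L \<aa> = artin_symbol K L \<bb> \<and> artin_symbol K M \<aa> = artin_symbol K M \<bb>"
      then have eq: "restrict (artin_symbol K (compositum L M) \<aa>) L = restrict (artin_symbol K (compositum L M) \<bb>) L"
        "restrict (artin_symbol K (compositum L M) \<aa>) M = restrict (artin_symbol K (compositum L M) \<bb>) M"
        using a b by simp_all
      show "artin_symbol K (compositum L M) \<aa> = artin_symbol K (compositum L M) \<bb>"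
      proof (rule gal_compositum_eqI[OF L.cfield_axioms M.cfield_axioms F.field_ext_axioms a(1) b(1)])
        fix x assume "x \<in> L \<union> M"
        then show "artin_symbol K (compositum L M) \<aa> x = artin_symbol K (compositum L M) \<bb> x"
          using fun_cong[OF eq(1), of x] fun_cong[OF eq(2), of x] by auto
      qed
    qed (use a b in metis)
    moreover have "artin_symbol K L \<aa> = artin_symbol K L \<bb> \<longleftrightarrow>
      (\<exists>\<alpha>\<in>S\<^sub>1. \<exists>\<beta>\<in>S\<^sub>1. (PIdl\<^bsub>integer_ring K\<^esub> \<beta>) \<cdot>\<^bsub>integer_ring K\<^esub> \<aa> = (PIdl\<^bsub>integer_ring K\<^esub> \<alpha>) \<cdot>\<^bsub>integer_ring K\<^esub> \<bb>)"
      using 1 co1 by (simp add: artin_kernel_field_def)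
    moreover have "artin_symbol K M \<aa> = artin_symbol K M \<bb> \<longleftrightarrow>
      (\<exists>\<alpha>\<in>S\<^sub>2. \<exists>\<beta>\<in>S\<^sub>2. (PIdl\<^bsub>integer_ring K\<^esub> \<beta>) \<cdot>\<^bsub>integer_ring K\<^esub> \<aa> = (PIdl\<^bsub>integer_ring K\<^esub> \<alpha>) \<cdot>\<^bsub>integer_ring K\<^esub> \<bb>)"
      using 2 ab by (simp add: artin_kernel_field_def)
    ultimately show ?thesis using S by (metis subsetD)
  qed
  moreover have "abelian_extension K (compositum L M)" using aF abelian_extension_iff[OF K] by blast
  ultimately show ?thesis unfolding artin_kernel_field_def using urF by blast
qed

lemma class_field_subset:
  assumes K: "number_field K"
    and 1: "class_field K \<mm>\<^sub>1 S\<^sub>1 L" and 2: "class_field K \<mm>\<^sub>2 S\<^sub>2 M"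
    and \<mm>: "ideal \<mm>\<^sub>1 (integer_ring K)" "ideal \<mm>\<^sub>2 (integer_ring K)" "\<mm>\<^sub>2 \<subseteq> \<mm>\<^sub>1" and S: "S\<^sub>2 \<subseteq> S\<^sub>1"
  shows "L \<subseteq> M"
proof -
  have "artin_kernel_field K \<mm>\<^sub>2 S\<^sub>2 (compositum L M)"
    using 1 2 by (intro artin_kernel_field_compositum[OF K _ _ \<mm> S]) (auto simp: class_field_def)
  then have "compositum L M = M" using 2 unfolding class_field_def by blast
  then show ?thesis using compositum_superset(1)[of L M] by simp
qed

text \<open>The kernel condition is applied to q^n and the unit ideal, whose Artin symbols are the
  n-th Frobenius power and the identity. Products with principal ideals are written out as sets of
  multiples.\<close>

lemma frobenius_pow_iff_principal:
  assumes K: "number_field K" and L: "artin_kernel_field K \<mm> S L" and \<mm>: "ideal \<mm> (integer_ring K)"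
    and q: "prime_of K q" "\<not> \<mm> \<subseteq> q" and n: "n > 0"
  shows "frobenius K L q [^]\<^bsub>gal_group K L\<^esub> (n::nat) = \<one>\<^bsub>gal_group K L\<^esub> \<longleftrightarrow>
    (\<exists>\<alpha>\<in>S. \<exists>\<beta>\<in>S. {\<beta> * z | z. z \<in> ideal_power K q n} = {\<alpha> * z | z. z \<in> OI K})"
proof -
  interpret q: number_field_prime K q
    using K q(1) by (simp add: number_field_prime_def number_field_prime_axioms_def)
  have "abelian_ext K L" using L abelian_extension_iff[OF K] by (auto simp: artin_kernel_field_def)
  then interpret L: abelian_ext K L .
  interpret CL: comm_group "gal_group K L" by (rule L.comm_group_gal)
  have ur: "unramified K L q" using L q by (auto simp: artin_kernel_field_def)
  have fr: "frobenius K L q \<in> L.G" by (rule L.frobenius_gal[OF q(1) ur])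
  \<comment> \<open>Coprimality of q^n and the modulus: take \<open>u\<close> in the modulus with an
    inverse \<open>v\<close> modulo \<open>q\<close>. Then (1 - u*v)^n lies in q^n and differs from
    1 by a multiple of \<open>u\<close>.\<close>
  obtain u where u: "u \<in> \<mm>" "u \<notin> q" using q(2) by blast
  have uO: "u \<in> OI K" by (rule q.idealD(1)[OF \<mm> u(1)])
  obtain v where v: "v \<in> OI K" "u * v - 1 \<in> q" using q.unit_mod[OF uO u(2)] by blast
  have v': "1 - u * v \<in> q" using q.Q_closed(6)[OF v(2)] by simp
  have "\<exists>w\<in>OI K. 1 - (1 - u * v) ^ k = u * w" for k
  proof (induction k)
    case 0
    then show ?case using q.OI_zero by force
  next
    case (Suc k)
    then obtain w where w: "w \<in> OI K" "1 - (1 - u * v) ^ k = u * w" by blast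
    have "1 - (1 - u * v) ^ Suc k = u * v + (1 - u * v) * (1 - (1 - u * v) ^ k)" by (simp add: algebra_simps)
    also have "\<dots> = u * (v + (1 - u * v) * w)" unfolding w(2) by (simp add: algebra_simps)
    finally show ?case using q.OI_add[OF v(1) q.OI_mult[OF q.Q_OI[OF v'] w(1)]] by blast
  qed
  then obtain w where w: "w \<in> OI K" "1 - (1 - u * v) ^ n = u * w" by blast
  have "(1 - u * v) ^ n + u * w = 1" using w(2) by (simp add: algebra_simps)
  moreover have "u * w \<in> \<mm>" by (rule q.idealD(5)[OF \<mm> w(1) u(1)])
  moreover have "(1 - u * v) ^ n \<in> q.P n" by (rule q.P_power[OF v'])
  ultimately have ex: "\<exists>a\<in>q.P n. \<exists>m\<in>\<mm>. a + m = 1" by blast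
  have nz: "q.P n \<noteq> {0}"
  proof -
    obtain x where "x \<in> q.P n" "x \<notin> q.P (Suc n)" using q.P_strict .
    then show ?thesis using q.P_closed(2)[of "Suc n"] by (metis singletonD)
  qed
  have co: "coprime_ideal K \<mm> (q.P n)"
    unfolding coprime_ideal_iff[OF q.cfield_axioms \<mm>] using q.ideal_P nz ex by blast
  have co1: "coprime_ideal K \<mm> (OI K)"
    unfolding coprime_ideal_iff[OF q.cfield_axioms \<mm>]
  proof (intro conjI)
    show "ideal (OI K) (integer_ring K)" by (rule q.ideal_OI)
    show "OI K \<noteq> {0}" using q.OI_one by (metis singletonD zero_neq_one)
    show "\<exists>a\<in>OI K. \<exists>m\<in>\<mm>. a + m = 1" using q.OI_one q.idealD(2)[OF \<mm>] by force
  qed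
  \<comment> \<open>A prime containing q^n contains \<open>q\<close>, and \<open>q\<close> is
    maximal; so only \<open>q\<close> contributes to the Artin symbol.\<close>
  have prime_set: "{q'. prime_of K q' \<and> q.P n \<subseteq> q'} = {q}"
  proof (intro Set.set_eqI iffI)
    fix q' assume "q' \<in> {q'. prime_of K q' \<and> q.P n \<subseteq> q'}"
    then have q': "prime_of K q'" "q.P n \<subseteq> q'" by auto
    interpret q': number_field_prime K q'
      using K q'(1) by (simp add: number_field_prime_def number_field_prime_axioms_def)
    have sub: "q \<subseteq> q'"
    proof
      fix x assume x: "x \<in> q"
      then have "x ^ n \<in> q'" using q.P_power[OF x] q'(2) by blast
      then show "x \<in> q'" by (rule q'.prime_power[OF q.Q_OI[OF x]])
    qed
    have "q' \<subseteq> q"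
    proof (rule ccontr)
      assume "\<not> q' \<subseteq> q"
      then obtain x where x: "x \<in> q'" "x \<notin> q" by blast
      obtain y where y: "y \<in> OI K" "x * y - 1 \<in> q" using q.unit_mod[OF q'.Q_OI[OF x(1)] x(2)] by blast
      have "x * y - (x * y - 1) \<in> q'"
        using q'.Q_closed(7)[OF q'.Q_closed(5)[OF y(1) x(1)], of "x * y - 1"] y(2) sub by blast
      then show False using q'.one_notin by simp
    qed
    then show "q' \<in> {q}" using sub by blast
  next
    fix q' assume "q' \<in> {q}"
    then show "q' \<in> {q'. prime_of K q' \<and> q.P n \<subseteq> q'}" using q(1) q.P_subset_Q[OF n] by simp
  qed
  have val: "ideal_valuation K q (q.P n) = n"
    unfolding ideal_valuation_def q.P_subset_iff by (rule Greatest_equality) auto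
  have "artin_symbol K L (q.P n) = frobenius K L q [^]\<^bsub>gal_group K L\<^esub> n"
    unfolding artin_symbol_def prime_set
    using CL.finprod_singleton_swap[of q "{q}" "\<lambda>q'. frobenius K L q' [^]\<^bsub>gal_group K L\<^esub> ideal_valuation K q' (q.P n)"] fr val
    by simp
  moreover have "artin_symbol K L (OI K) = \<one>\<^bsub>gal_group K L\<^esub>"
  proof -
    have empty: "{q'. prime_of K q' \<and> OI K \<subseteq> q'} = {}" using q.prime_of_iff q.OI_one by blast
    show ?thesis unfolding artin_symbol_def empty by simp
  qed
  ultimately have "frobenius K L q [^]\<^bsub>gal_group K L\<^esub> n = \<one>\<^bsub>gal_group K L\<^esub> \<longleftrightarrow>
      artin_symbol K L (q.P n) = artin_symbol K L (OI K)" by simp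
  also have "\<dots> \<longleftrightarrow> (\<exists>\<alpha>\<in>S. \<exists>\<beta>\<in>S. (PIdl\<^bsub>integer_ring K\<^esub> \<beta>) \<cdot>\<^bsub>integer_ring K\<^esub> q.P n = (PIdl\<^bsub>integer_ring K\<^esub> \<alpha>) \<cdot>\<^bsub>integer_ring K\<^esub> OI K)"
    using L co co1 by (simp add: artin_kernel_field_def)
  finally show ?thesis unfolding q.PIdl_prod[OF q.ideal_P] q.PIdl_prod[OF q.ideal_OI] .
qed

section \<open>Residue degrees\<close>

text \<open>A Frobenius power of the compositum is trivial exactly when its restrictions to both
  factors are, and the congruence x^(N^m) = x translates its triviality into a statement about the
  residue field.\<close>

lemma residue_degree_compositum:
  assumes L: "abelian_ext K L" and M: "abelian_ext K M" and q: "prime_of K q"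
    and ur: "unramified K L q" "unramified K M q" and Q: "prime_above K (compositum L M) q Q"
  defines "n \<equiv> residue_degree K (compositum L M) Q"
  shows "n > 0"
    and "frobenius K L q [^]\<^bsub>gal_group K L\<^esub> n = \<one>\<^bsub>gal_group K L\<^esub>"
    and "frobenius K M q [^]\<^bsub>gal_group K M\<^esub> n = \<one>\<^bsub>gal_group K M\<^esub>"
    and "m > 0 \<Longrightarrow> frobenius K L q [^]\<^bsub>gal_group K L\<^esub> (m::nat) = \<one>\<^bsub>gal_group K L\<^esub> \<Longrightarrow>
      frobenius K M q [^]\<^bsub>gal_group K M\<^esub> m = \<one>\<^bsub>gal_group K M\<^esub> \<Longrightarrow> n \<le> m"
proof -
  interpret L: abelian_ext K L by fact
  interpret M: abelian_ext K M by fact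
  have aF: "abelian_ext K (compositum L M)" by (rule abelian_ext_compositum[OF L M])
  interpret F: abelian_ext K "compositum L M" by (rule aF)
  interpret FQ: galois_prime K "compositum L M" Q by (rule galois_primeI[OF F.galois_ext_axioms Q])
  have qq: "Q \<inter> OI K = q" by (rule galois_primeI[OF F.galois_ext_axioms Q])
  have urF: "unramified K (compositum L M) q" by (rule unramified_compositum[OF L M ur])
  note fr = F.frobenius_gal[OF q urF]
  show "n > 0" unfolding n_def by (rule FQ.card_residue_field(2))
  have Fn: "frobenius K (compositum L M) q [^]\<^bsub>gal_group K (compositum L M)\<^esub> n = \<one>\<^bsub>gal_group K (compositum L M)\<^esub>"
    by (rule F.frobenius_pow_eq_one[OF q urF Q]) (use FQ.power_norm_residue_degree qq n_def in simp)
  have rL: "restrict (frobenius K (compositum L M) q [^]\<^bsub>gal_group K (compositum L M)\<^esub> m) L = frobenius K L q [^]\<^bsub>gal_group K L\<^esub> m" for m :: nat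
    using L.restrict_pow[OF aF compositum_superset(1) fr] L.frobenius_restrict[OF aF compositum_superset(1) q ur(1) urF] by simp
  have rM: "restrict (frobenius K (compositum L M) q [^]\<^bsub>gal_group K (compositum L M)\<^esub> m) M = frobenius K M q [^]\<^bsub>gal_group K M\<^esub> m" for m :: nat
    using M.restrict_pow[OF aF compositum_superset(2) fr] M.frobenius_restrict[OF aF compositum_superset(2) q ur(2) urF] by simp
  show "frobenius K L q [^]\<^bsub>gal_group K L\<^esub> n = \<one>\<^bsub>gal_group K L\<^esub>"
    using rL[of n] Fn L.restrict_one[OF aF compositum_superset(1)] by simp
  show "frobenius K M q [^]\<^bsub>gal_group K M\<^esub> n = \<one>\<^bsub>gal_group K M\<^esub>"
    using rM[of n] Fn M.restrict_one[OF aF compositum_superset(2)] by simp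
  assume m: "m > 0" "frobenius K L q [^]\<^bsub>gal_group K L\<^esub> m = \<one>\<^bsub>gal_group K L\<^esub>"
    "frobenius K M q [^]\<^bsub>gal_group K M\<^esub> m = \<one>\<^bsub>gal_group K M\<^esub>"
  have "frobenius K (compositum L M) q [^]\<^bsub>gal_group K (compositum L M)\<^esub> m = \<one>\<^bsub>gal_group K (compositum L M)\<^esub>" (is "?\<sigma> = _")
  proof (rule gal_compositum_eqI[OF L.cfield_axioms M.cfield_axioms F.field_ext_axioms])
    fix x assume x: "x \<in> L \<union> M"
    have "?\<sigma> x = x" if "x \<in> L" using fun_cong[OF rL[of m], of x] m(2) L.one_apply[OF that] that by simp
    moreover have "?\<sigma> x = x" if "x \<in> M" using fun_cong[OF rM[of m], of x] m(3) M.one_apply[OF that] that by simp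
    moreover have "x \<in> compositum L M" using x compositum_superset by blast
    ultimately show "?\<sigma> x = \<one>\<^bsub>gal_group K (compositum L M)\<^esub> x" using F.one_apply x by auto
  qed (use fr in auto)
  then have "x ^ (ideal_norm K q ^ m) - x \<in> Q" if "x \<in> OI (compositum L M)" for x
    using F.frobenius_pow_one_imp_cong[OF q urF Q _ that] by blast
  then show "n \<le> m" unfolding n_def using FQ.residue_degree_le[OF m(1)] qq by simp
qed

text \<open>The congruence satisfied by the residue degree of \<open>E\<close> is restricted to the
  integers of \<open>L\<close>. In this form it applies to the inertia field.\<close>

lemma frobenius_pow_residue_degree:
  assumes L: "abelian_ext K L" and E: "field_ext K E" "L \<subseteq> E" and q: "prime_of K q"
    and ur: "unramified K L q" and Q: "prime_above K E q Q"
  shows "frobenius K L q [^]\<^bsub>gal_group K L\<^esub> residue_degree K E Q = \<one>\<^bsub>gal_group K L\<^esub>"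
proof -
  interpret L: abelian_ext K L by fact
  interpret E: field_ext K E by fact
  interpret EQ: ext_prime K E Q by unfold_locales (use Q in \<open>simp add: prime_above_def\<close>)
  have qq: "Q \<inter> OI K = q" using Q by (simp add: prime_above_def)
  show ?thesis
  proof (rule L.frobenius_pow_eq_one[OF q ur prime_above_restrict[OF L.field_ext_axioms E Q]])
    fix x assume x: "x \<in> OI L"
    then have "x \<in> OI E" using E(2) by (auto simp: OI_def)
    then have "x ^ (ideal_norm K q ^ residue_degree K E Q) - x \<in> Q" using EQ.power_norm_residue_degree qq by simp
    then show "x ^ (ideal_norm K q ^ residue_degree K E Q) - x \<in> Q \<inter> OI L"
      using L.OI_diff[OF L.OI_power[OF x] x] by blast
  qed
qed

lemma field_ext_inertia_field:
  assumes F: "galois_ext K F" and Q: "prime_above K F q Q"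
  shows "field_ext K (inertia_field K F Q)"
proof -
  interpret F: galois_prime K F Q by (rule galois_primeI[OF F Q])
  define E where "E = inertia_field K F Q"
  have E: "x \<in> E \<longleftrightarrow> x \<in> F \<and> (\<forall>\<sigma>\<in>inertia_group K F Q. \<sigma> x = x)" for x
    by (simp add: E_def inertia_field_def fixed_field_def)
  have e: "emb F \<sigma>" if "\<sigma> \<in> inertia_group K F Q" for \<sigma> using that F.inertia_iff F.gal_emb by blast
  have "cfield E"
  proof (rule cfieldI)
    have EF: "x \<in> F" and inv: "\<sigma> \<in> inertia_group K F Q \<Longrightarrow> \<sigma> x = x" if "x \<in> E" for x \<sigma>
      using that unfolding E by blast+
    show "1 \<in> E" unfolding E by (intro conjI ballI F.one_in F.emb_one[OF e])
    show "- x \<in> E" if x: "x \<in> E" for x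
      unfolding E by (intro conjI ballI F.neg_in EF[OF x]) (simp only: F.emb_neg[OF e EF[OF x]] inv[OF x])
    show "x * y \<in> E" if x: "x \<in> E" and y: "y \<in> E" for x y
      unfolding E by (intro conjI ballI F.mult_in EF[OF x] EF[OF y])
        (simp only: F.emb_mult[OF e EF[OF x] EF[OF y]] inv[OF x] inv[OF y])
    show "x + y \<in> E" if x: "x \<in> E" and y: "y \<in> E" for x y
      unfolding E by (intro conjI ballI F.add_in EF[OF x] EF[OF y])
        (simp only: F.emb_add[OF e EF[OF x] EF[OF y]] inv[OF x] inv[OF y])
    show "inverse x \<in> E" if x: "x \<in> E" for x
      unfolding E by (intro conjI ballI F.inverse_in EF[OF x]) (simp only: F.emb_inverse_eq[OF e EF[OF x]] inv[OF x])
  qed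
  moreover have "E \<subseteq> F" using E by blast
  then have "\<exists>B. finite B \<and> E \<subseteq> QV.span B" using F.finite_over_Q by (meson subset_trans)
  ultimately have "number_field E" by (simp add: number_field_def number_field_axioms_def)
  moreover have "K \<subseteq> E"
  proof
    fix x assume x: "x \<in> K"
    have "\<sigma> x = x" if "\<sigma> \<in> inertia_group K F Q" for \<sigma> using that x F.inertia_iff F.gal_fix[of \<sigma> x] by blast
    then show "x \<in> E" unfolding E using x F.KL by blast
  qed
  ultimately show ?thesis using F.K.cfield_axioms unfolding E_def by (simp add: field_ext_def field_ext_axioms_def)
qed

lemma subset_inertia_field:
  assumes L: "abelian_ext K L" and F: "galois_ext K F" and LF: "L \<subseteq> F" and ur: "unramified K L q"
    and Q: "prime_above K F q Q"
  shows "L \<subseteq> inertia_field K F Q"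
  using abelian_ext.inertia_restrict_trivial[OF L F LF ur Q] LF
  unfolding inertia_field_def fixed_field_def by blast

section \<open>Imaginary quadratic fields\<close>

lemma csqrt_neg_int: "D < 0 \<Longrightarrow> csqrt (of_int D) = \<i> * of_real (sqrt (- of_int D))"
  using csqrt_of_real_nonpos[of "of_int D"] by simp

lemma csqrt_neg_nat: "csqrt (- of_nat d) = \<i> * of_real (sqrt (of_nat d))"
  using csqrt_of_real_nonpos[of "- of_nat d"] by simp

lemma cnj_csqrt_neg_int: "D < 0 \<Longrightarrow> cnj (csqrt (of_int D)) = - csqrt (of_int D)"
  by (simp add: csqrt_neg_int)

text \<open>The ring is itself a finitely generated module stable under each of its
  elements.\<close>

lemma int_basis_ring_algebraic_int:
  assumes basis: "int_basis a b M" and mult: "\<forall>x\<in>M. \<forall>y\<in>M. x * y \<in> M" and z: "z \<in> M"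
  shows "algebraic_int z"
proof -
  have M: "M = {of_int m * a + of_int n * b | m n. True}"
    and ind: "\<And>m n. of_int m * a + of_int n * b = 0 \<Longrightarrow> m = 0 \<and> n = 0"
    using basis unfolding int_basis_def by auto
  have "a \<noteq> 0" using ind[of 1 0] by auto
  have MS: "x \<in> ZM.span {a, b}" if x: "x \<in> M" for x
  proof -
    obtain m n where "x = of_int m * a + of_int n * b" using x M by blast
    moreover have "a \<in> ZM.span {a, b}" "b \<in> ZM.span {a, b}" by (auto intro: ZM.span_base)
    ultimately show ?thesis using ZM.span_add[OF ZM.span_scale ZM.span_scale] by blast
  qed
  have "of_int 1 * a + of_int 0 * b \<in> M" "of_int 0 * a + of_int 1 * b \<in> M" unfolding M by blast+
  then have ab: "a \<in> M" "b \<in> M" by simp_all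
  show ?thesis
    by (rule algebraic_int_of_stable_module[of "{a, b}" a]) (use \<open>a \<noteq> 0\<close> ab mult z MS in auto)
qed

text \<open>The coordinates of 1 are coprime, since 1/g for their gcd \<open>g\<close> is an
  algebraic integer in \<open>M\<close> and hence a rational integer. They form the first row of a
  matrix of determinant 1, and such a change of basis keeps the discriminant.\<close>

lemma quadratic_ring_basis:
  assumes basis: "int_basis a b M" and disc: "(a * cnj b - b * cnj a)\<^sup>2 = of_int D"
    and one: "1 \<in> M" and mult: "\<forall>x\<in>M. \<forall>y\<in>M. x * y \<in> M"
  obtains \<omega> where "M = {of_int m + of_int n * \<omega> | m n. True}" "(\<omega> - cnj \<omega>)\<^sup>2 = of_int D"
proof -
  have M: "M = {of_int m * a + of_int n * b | m n. True}" using basis unfolding int_basis_def by blast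
  obtain s t where st: "1 = of_int s * a + of_int t * b" using one M by blast
  define g where "g = gcd s t"
  have g0: "g \<noteq> 0" using st by (auto simp: g_def)
  have "of_int (s div g) * a + of_int (t div g) * b \<in> M" unfolding M by blast
  then have "algebraic_int (of_int (s div g) * a + of_int (t div g) * b)"
    by (rule int_basis_ring_algebraic_int[OF basis mult])
  moreover have "of_int (s div g) * a + of_int (t div g) * b = 1 / of_int g"
  proof -
    have "s = g * (s div g)" "t = g * (t div g)" by (simp_all add: g_def)
    then have "1 = of_int (g * (s div g)) * a + of_int (g * (t div g)) * b" using st by simp
    then have "1 = of_int g * (of_int (s div g) * a + of_int (t div g) * b)" by (simp add: algebra_simps)
    then show ?thesis using g0 by (simp add: field_simps)
  qed
  ultimately have "algebraic_int (1 / of_int g :: complex)" by simp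
  then have "(1 / of_int g :: complex) \<in> \<int>"
    by (rule rational_algebraic_int_is_int) simp
  then obtain k where "1 / of_int g = (of_int k :: complex)" by (auto elim: Ints_cases)
  then have "of_int (k * g) = (1 :: complex)" using g0 by (simp add: field_simps)
  then have "k * g = 1" by (metis of_int_eq_1_iff)
  then have "is_unit g" by (metis dvd_triv_right)
  then have "g = 1" by (simp add: g_def)
  then obtain u v where uv: "u * s + v * t = 1" using bezout_int[of s t] unfolding g_def by metis
  have uv': "of_int u * of_int s + of_int v * of_int t = (1 :: complex)"
    using uv by (metis of_int_1 of_int_add of_int_mult)
  \<comment> \<open>The row (-v, u) completes (s, t) to determinant u*s + v*t = 1.\<close>
  define \<omega> where "\<omega> = of_int (- v) * a + of_int u * b"
  have a: "a = of_int u - of_int t * \<omega>"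
  proof -
    have "of_int u * (of_int s * a + of_int t * b) - of_int t * \<omega> = (of_int u * of_int s + of_int v * of_int t) * a"
      by (simp add: \<omega>_def algebra_simps)
    then show ?thesis unfolding st[symmetric] uv' by simp
  qed
  have b: "b = of_int v + of_int s * \<omega>"
  proof -
    have "of_int v * (of_int s * a + of_int t * b) + of_int s * \<omega> = (of_int u * of_int s + of_int v * of_int t) * b"
      by (simp add: \<omega>_def algebra_simps)
    then show ?thesis unfolding st[symmetric] uv' by simp
  qed
  have "M = {of_int m + of_int n * \<omega> | m n. True}"
  proof (intro Set.set_eqI iffI)
    fix x assume "x \<in> M"
    then obtain m n where "x = of_int m * a + of_int n * b" unfolding M by blast
    then have "x = of_int (m * u + n * v) + of_int (n * s - m * t) * \<omega>"
      unfolding a b by (simp add: algebra_simps)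
    then show "x \<in> {of_int m + of_int n * \<omega> | m n. True}" by blast
  next
    fix x assume "x \<in> {of_int m + of_int n * \<omega> | m n. True}"
    then obtain m n where "x = of_int m + of_int n * \<omega>" by blast
    then have "x = of_int m * (of_int s * a + of_int t * b) + of_int n * \<omega>" unfolding st[symmetric] by simp
    then have "x = of_int (m * s - n * v) * a + of_int (m * t + n * u) * b"
      by (simp add: \<omega>_def algebra_simps)
    then show "x \<in> M" unfolding M by blast
  qed
  moreover have "(\<omega> - cnj \<omega>)\<^sup>2 = of_int D"
  proof -
    have "a * cnj b - b * cnj a = (of_int u * of_int s + of_int v * of_int t) * (cnj \<omega> - \<omega>)"
      unfolding a b by (simp add: algebra_simps)
    then have "(cnj \<omega> - \<omega>)\<^sup>2 = of_int D" using disc uv' by simp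
    then show ?thesis by (simp add: power2_commute)
  qed
  ultimately show thesis by (rule that)
qed

text \<open>From \<omega>^2 = m + n*\<omega> and its conjugate the trace of \<omega> is
  \<open>n\<close>. So D = n^2 + 4*m and \<omega> = (n + \<delta>)/2 with \<delta> a square root of
  \<open>D\<close>; the parity condition and the residue of \<open>D\<close> modulo 4 can be read
  off.\<close>

lemma quadratic_ring_form:
  assumes basis: "int_basis a b M" and disc: "(a * cnj b - b * cnj a)\<^sup>2 = of_int D" and D: "D < 0"
    and one: "1 \<in> M" and mult: "\<forall>x\<in>M. \<forall>y\<in>M. x * y \<in> M"
  shows "M = {(of_int x + of_int y * csqrt (of_int D)) / 2 | x y. even (x - y * D)}" "D mod 4 = 0 \<or> D mod 4 = 1"
proof -
  obtain \<omega> where M: "M = {of_int m + of_int n * \<omega> | m n. True}" and \<omega>: "(\<omega> - cnj \<omega>)\<^sup>2 = of_int D"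
    using quadratic_ring_basis[OF basis disc one mult] .
  have "of_int 0 + of_int 1 * \<omega> \<in> M" unfolding M by blast
  then have "\<omega> * \<omega> \<in> M" using mult by simp
  then obtain m n where mn: "\<omega> * \<omega> = of_int m + of_int n * \<omega>" unfolding M by blast
  have cmn: "cnj \<omega> * cnj \<omega> = of_int m + of_int n * cnj \<omega>"
    using arg_cong[OF mn, of cnj] by simp
  define \<delta> where "\<delta> = \<omega> - cnj \<omega>"
  have \<delta>0: "\<delta> \<noteq> 0" using \<omega> D by (auto simp: \<delta>_def)
  have "\<delta> * (\<omega> + cnj \<omega>) = \<delta> * of_int n"
    unfolding \<delta>_def using mn cmn by (simp add: algebra_simps)
  then have tr: "\<omega> + cnj \<omega> = of_int n" using \<delta>0 by simp
  then have \<omega>2: "\<omega> = (of_int n + \<delta>) / 2" by (simp add: \<delta>_def field_simps)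
  have c: "cnj \<omega> = of_int n - \<omega>" using tr by (simp add: algebra_simps)
  have "of_int D = (of_int (n * n + 4 * m) :: complex)"
  proof -
    have "(\<omega> - (of_int n - \<omega>)) * (\<omega> - (of_int n - \<omega>)) = 4 * (\<omega> * \<omega>) - 4 * of_int n * \<omega> + of_int n * of_int n"
      by (simp add: algebra_simps)
    then show ?thesis unfolding \<omega>[symmetric] c power2_eq_square mn by simp
  qed
  then have Dn: "D = n * n + 4 * m" by (simp only: of_int_eq_iff)
  have par: "even (n - D)" unfolding Dn by simp
  show "D mod 4 = 0 \<or> D mod 4 = 1"
  proof (cases "even n")
    case True
    then obtain k where "n = 2 * k" by blast
    then have "D = 4 * (k * k + m)" unfolding Dn by (simp add: algebra_simps)
    then show ?thesis by simp
  next
    case False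
    then obtain k where "n = 2 * k + 1" by (auto elim: oddE)
    then have "D = 1 + 4 * (k * k + k + m)" unfolding Dn by (simp add: algebra_simps)
    then have "D mod 4 = 1 mod 4" by (simp only: mod_mult_self2)
    then show ?thesis by simp
  qed
  have "\<delta>\<^sup>2 = (csqrt (of_int D))\<^sup>2" using \<omega> by (simp add: \<delta>_def)
  then have "\<delta> = csqrt (of_int D) \<or> \<delta> = - csqrt (of_int D)" by (simp only: power2_eq_iff)
  \<comment> \<open>The root \<delta> may be the negative of \<open>csqrt\<close>; the sign is
    absorbed into the integer coordinates in both inclusions.\<close>
  then obtain \<epsilon> :: int where \<epsilon>: "\<epsilon> = 1 \<or> \<epsilon> = -1" "\<delta> = of_int \<epsilon> * csqrt (of_int D)"
    by (metis mult_1 mult_minus1 of_int_1 of_int_minus)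
  have half: "a + b * ((c + e * s) / 2) = (2 * a + c * b + b * e * s) / 2" for a b c e s :: complex
    by (simp add: field_simps)
  show "M = {(of_int x + of_int y * csqrt (of_int D)) / 2 | x y. even (x - y * D)}"
  proof (intro Set.set_eqI iffI)
    fix z assume "z \<in> M"
    then obtain k l where kl: "z = of_int k + of_int l * \<omega>" unfolding M by blast
    have "z = (of_int (2 * k + n * l) + of_int (l * \<epsilon>) * csqrt (of_int D)) / 2"
      unfolding kl \<omega>2 \<epsilon>(2) half by (simp only: of_int_add of_int_mult of_int_numeral)
    moreover have "even (2 * k + n * l - l * \<epsilon> * D)" using par \<epsilon>(1) by auto
    ultimately show "z \<in> {(of_int x + of_int y * csqrt (of_int D)) / 2 | x y. even (x - y * D)}" by blast
  next
    fix z assume "z \<in> {(of_int x + of_int y * csqrt (of_int D)) / 2 | x y. even (x - y * D)}"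
    then obtain x y where xy: "z = (of_int x + of_int y * csqrt (of_int D)) / 2" "even (x - y * D)" by blast
    have "even (x - n * (\<epsilon> * y))" using xy(2) par \<epsilon>(1) by auto
    then obtain k where k: "x = 2 * k + n * (\<epsilon> * y)" by (metis diff_add_cancel dvdE)
    have "\<epsilon> * y * \<epsilon> = y" using \<epsilon>(1) by auto
    then have e2: "of_int (\<epsilon> * y) * of_int \<epsilon> = (of_int y :: complex)" by (metis of_int_mult)
    have "of_int k + of_int (\<epsilon> * y) * \<omega> = z"
      unfolding \<omega>2 \<epsilon>(2) half e2 xy(1) k by (simp only: of_int_add of_int_mult of_int_numeral)
    then show "z \<in> M" unfolding M by blast
  qed
qed

lemma imag_quadratic_field_props:
  assumes d: "d > 0"
  shows "number_field (imag_quadratic_field d)" "csqrt (- of_nat d) \<in> imag_quadratic_field d"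
    "x \<in> imag_quadratic_field d \<Longrightarrow> cnj x \<in> imag_quadratic_field d"
    "x \<in> imag_quadratic_field d \<Longrightarrow> x + cnj x \<in> \<rat> \<and> x * cnj x \<in> \<rat>"
proof -
  define s where "s = csqrt (- of_nat d :: complex)"
  have ss: "s * s = - of_nat d" using power2_csqrt[of "- of_nat d"] unfolding s_def power2_eq_square .
  have cs: "cnj s = - s" by (simp add: s_def csqrt_neg_nat)
  define F where "F = imag_quadratic_field d"
  have F: "F = generate_field complex_ring {s}" by (simp add: F_def imag_quadratic_field_def s_def)
  interpret F: cfield F unfolding F
    by (rule cfield.intro) (rule field.generate_field_is_subfield[OF field_complex_ring], simp)
  have sF: "s \<in> F" unfolding F by (rule generate_field.incl) simp
  \<comment> \<open>The explicit form Q + Q*s of the generated field, from which conjugation, trace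
    and norm are read off.\<close>
  define E where "E = {of_rat a + of_rat b * s | a b. True}"
  have mult: "x * y \<in> E" if xy: "x \<in> E" "y \<in> E" for x y
  proof -
    obtain a b c e where "x = of_rat a + of_rat b * s" "y = of_rat c + of_rat e * s" using xy unfolding E_def by blast
    then have "x * y = of_rat a * of_rat c + of_rat b * of_rat e * (s * s) + (of_rat a * of_rat e + of_rat b * of_rat c) * s"
      by (simp add: algebra_simps)
    also have "\<dots> = of_rat (a * c - b * e * of_nat d) + of_rat (a * e + b * c) * s"
      unfolding ss by (simp add: of_rat_add of_rat_diff of_rat_mult)
    finally show ?thesis unfolding E_def by blast
  qed
  have "1 = of_rat 1 + of_rat 0 * s" by simp
  then have one: "1 \<in> E" unfolding E_def by blast
  have Esp: "E \<subseteq> QV.span {1, s}"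
  proof
    fix x assume "x \<in> E"
    then obtain a b where "x = of_rat a * 1 + of_rat b * s" unfolding E_def by auto
    then show "x \<in> QV.span {1, s}"
      using QV.span_add[OF QV.span_scale QV.span_scale, of 1 "{1, s}" s a b] QV.span_base[of _ "{1, s}"] by simp
  qed
  have "cfield E"
  proof (rule cfield_of_algebraic_ring)
    show "x + y \<in> E" if xy: "x \<in> E" "y \<in> E" for x y
    proof -
      obtain a b c e where "x = of_rat a + of_rat b * s" "y = of_rat c + of_rat e * s" using xy unfolding E_def by blast
      then have "x + y = of_rat (a + c) + of_rat (b + e) * s" by (simp add: of_rat_add algebra_simps)
      then show ?thesis unfolding E_def by blast
    qed
    show "of_rat q * x \<in> E" if x: "x \<in> E" for q x
    proof -
      obtain a b where "x = of_rat a + of_rat b * s" using x unfolding E_def by blast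
      then have "of_rat q * x = of_rat (q * a) + of_rat (q * b) * s" by (simp add: of_rat_mult algebra_simps)
      then show ?thesis unfolding E_def by blast
    qed
    show "algebraic x" if x: "x \<in> E" for x
    proof (rule algebraic_of_powers_in_span[of "{1, s}"])
      have "x ^ i \<in> E" for i by (induction i) (auto intro: one mult x)
      then show "\<And>i. x ^ i \<in> QV.span {1, s}" using Esp by blast
    qed simp
  qed (use one mult in auto)
  then interpret E: cfield E .
  have "s = of_rat 0 + of_rat 1 * s" by simp
  then have "s \<in> E" unfolding E_def by blast
  then have "F \<subseteq> E"
    unfolding F using field.generate_field_min_subfield1[OF field_complex_ring _ E.subfield, of "{s}"] by simp
  moreover have "E \<subseteq> F" unfolding E_def using sF F.add_in F.mult_in F.of_rat_in by blast
  ultimately have FE: "F = E" by blast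
  have "\<exists>B. finite B \<and> F \<subseteq> QV.span B" using Esp FE by (intro exI[of _ "{1, s}"]) simp
  then show "number_field (imag_quadratic_field d)"
    using F.cfield_axioms unfolding F_def by (simp add: number_field_def number_field_axioms_def)
  show "csqrt (- of_nat d) \<in> imag_quadratic_field d" using sF by (simp add: F_def s_def)
  have rat: "x + cnj x \<in> \<rat> \<and> x * cnj x \<in> \<rat> \<and> cnj x \<in> E" if x: "x \<in> E" for x
  proof -
    obtain a b where ab: "x = of_rat a + of_rat b * s" using x unfolding E_def by blast
    have cr: "cnj (of_rat q) = of_rat q" for q by (cases q) (simp add: of_rat_rat)
    have c: "cnj x = of_rat a + of_rat (- b) * s" unfolding ab by (simp add: cr cs of_rat_minus)
    have "x + cnj x = of_rat (a + a)" unfolding c unfolding ab by (simp add: of_rat_mult of_rat_minus)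
    moreover have "x * cnj x = of_rat (a * a + b * b * of_nat d)"
    proof -
      have "x * cnj x = of_rat a * of_rat a - of_rat b * of_rat b * (s * s)"
        unfolding c unfolding ab by (simp add: of_rat_minus algebra_simps)
      then show ?thesis unfolding ss by (simp add: of_rat_add of_rat_mult)
    qed
    moreover have "cnj x \<in> E" unfolding c E_def by blast
    ultimately show ?thesis by simp
  qed
  show "cnj x \<in> imag_quadratic_field d" if "x \<in> imag_quadratic_field d"
    using rat[of x] that FE by (simp add: F_def)
  show "x + cnj x \<in> \<rat> \<and> x * cnj x \<in> \<rat>" if "x \<in> imag_quadratic_field d"
    using rat[of x] that FE by (simp add: F_def)
qed

section \<open>The order, the split prime and complex conjugation\<close>

locale split_prime =
  fixes d f p :: nat and d\<^sub>K :: int and K R \<pp> \<pp>' :: "complex set"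
  assumes K: "K = imag_quadratic_field d"
    and d\<^sub>K: "has_discriminant (carrier (integer_ring K)) d\<^sub>K"
    and d: "- int d = d\<^sub>K * (int f)\<^sup>2"
    and R: "quadratic_order K R" "has_discriminant R (- int d)"
    and p: "Factorial_Ring.prime p" "odd p" "\<not> p dvd d"
    and split: "prime_of K \<pp>" "prime_of K \<pp>'" "\<pp> \<noteq> \<pp>'"
      "PIdl\<^bsub>integer_ring K\<^esub> (of_nat p) = \<pp> \<cdot>\<^bsub>integer_ring K\<^esub> \<pp>'"
begin

lemma d_pos: "d > 0" using p(3) by (cases d) auto

lemma dK_neg: "d\<^sub>K < 0"
proof (rule ccontr)
  assume "\<not> d\<^sub>K < 0"
  then have "d\<^sub>K * (int f)\<^sup>2 \<ge> 0" by simp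
  then show False using d d_pos by linarith
qed

lemma f_pos: "f > 0" using d d_pos by (cases f) auto

lemma p_not_dvd_f: "\<not> p dvd f"
proof
  assume "p dvd f"
  then have "int p dvd d\<^sub>K * (int f)\<^sup>2" by (simp add: power2_eq_square)
  then have "int p dvd int d" using d by (metis dvd_minus_iff)
  then show False using p(3) by simp
qed

sublocale K: number_field K unfolding K by (rule imag_quadratic_field_props[OF d_pos])
sublocale \<pp>: number_field_prime K \<pp> by unfold_locales (rule split)
sublocale \<pp>': number_field_prime K \<pp>' by unfold_locales (rule split)

lemma cnj_OI: "x \<in> OI K \<Longrightarrow> cnj x \<in> OI K"
  using imag_quadratic_field_props(3)[OF d_pos] by (auto simp: OI_def K)

lemma trace_norm_int:
  assumes "x \<in> OI K"
  obtains t n where "x + cnj x = of_int t" "x * cnj x = of_int n"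
proof -
  have "x + cnj x \<in> \<rat>" "x * cnj x \<in> \<rat>" using imag_quadratic_field_props(4)[OF d_pos, of x] assms by (auto simp: OI_def K)
  moreover have "algebraic_int (x + cnj x)" "algebraic_int (x * cnj x)"
    using K.OI_add[OF assms cnj_OI[OF assms]] K.OI_mult[OF assms cnj_OI[OF assms]] by (auto simp: OI_def)
  ultimately have "x + cnj x \<in> \<int>" "x * cnj x \<in> \<int>" using rational_algebraic_int_is_int by blast+
  then show thesis using that by (auto elim!: Ints_cases)
qed

lemma OI_form: "OI K = {(of_int x + of_int y * csqrt (of_int d\<^sub>K)) / 2 | x y. even (x - y * d\<^sub>K)}"
  and dK_mod_4: "d\<^sub>K mod 4 = 0 \<or> d\<^sub>K mod 4 = 1"
proof -
  obtain a b where ab: "int_basis a b (OI K)" "(a * cnj b - b * cnj a)\<^sup>2 = of_int d\<^sub>K"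
    using d\<^sub>K by (auto simp: has_discriminant_def)
  show "OI K = {(of_int x + of_int y * csqrt (of_int d\<^sub>K)) / 2 | x y. even (x - y * d\<^sub>K)}" "d\<^sub>K mod 4 = 0 \<or> d\<^sub>K mod 4 = 1"
    using quadratic_ring_form[OF ab dK_neg K.OI_one] K.OI_mult by auto
qed

lemma R_form: "R = {half_elem d x y | x y. even (x - y * (- int d))}"
proof -
  have sub: "subring R complex_ring" using R by (simp add: quadratic_order_def)
  obtain a b where ab: "int_basis a b R" "(a * cnj b - b * cnj a)\<^sup>2 = of_int (- int d)"
    using R by (auto simp: has_discriminant_def)
  have one: "1 \<in> R" and mult: "\<forall>x\<in>R. \<forall>y\<in>R. x * y \<in> R"
    using subringE(3,6)[OF sub] by simp_all
  have neg: "- int d < 0" using d_pos by simp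
  show ?thesis using quadratic_ring_form(1)[OF ab neg one mult] by (simp add: half_elem_def)
qed

lemma csqrt_d: "csqrt (- of_nat d) = of_nat f * csqrt (of_int d\<^sub>K)"
proof -
  have "real d = - of_int d\<^sub>K * (real f)\<^sup>2"
    using arg_cong[OF d, of "of_int :: int \<Rightarrow> real"] by simp
  then have "sqrt (real d) = sqrt (- of_int d\<^sub>K) * sqrt ((real f)\<^sup>2)" by (simp only: real_sqrt_mult)
  then have "sqrt (real d) = real f * sqrt (- of_int d\<^sub>K)" by simp
  then show ?thesis by (simp add: csqrt_neg_nat csqrt_neg_int[OF dK_neg])
qed

text \<open>Links the order to the congruence modulo \<open>f\<close> by which
  \<open>ring_class_field\<close> selects its generators; there the integer is in addition prime to
  \<open>f\<close>.\<close>

lemma R_iff: "\<gamma> \<in> R \<longleftrightarrow> (\<exists>a::int. \<exists>t\<in>OI K. \<gamma> = of_int a + of_nat f * t)"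
proof
  assume "\<gamma> \<in> R"
  then obtain x y where xy: "\<gamma> = half_elem d x y" "even (x - y * (- int d))" unfolding R_form by blast
  \<comment> \<open>This is \<open>y\<close> times the second generator of the maximal order. The
    rest of \<gamma> is a rational integer because \<open>x\<close> has the parity of y * d\<K>,
    where \<K> stands for the factor f * (y-coefficient), namely that of
    \<open>int f * (y * d\<^sub>K)\<close>: \<open>f\<close> and its square have the same
    parity.\<close>
  define t where "t = (of_int (y * d\<^sub>K) + of_int y * csqrt (of_int d\<^sub>K)) / 2"
  have t: "t \<in> OI K" unfolding OI_form t_def by (intro CollectI exI[of _ "y * d\<^sub>K"] exI[of _ y]) simp
  have "even (x - int f * (y * d\<^sub>K))" using xy(2) unfolding d by auto
  then obtain a where a: "x = 2 * a + int f * (y * d\<^sub>K)" by (metis diff_add_cancel dvdE)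
  have "\<gamma> = of_int a + of_nat f * t"
    unfolding xy(1) half_elem_def t_def csqrt_d a by (simp add: add_divide_distrib distrib_left mult.left_commute)
  then show "\<exists>a::int. \<exists>t\<in>OI K. \<gamma> = of_int a + of_nat f * t" using t by blast
next
  assume "\<exists>a::int. \<exists>t\<in>OI K. \<gamma> = of_int a + of_nat f * t"
  then obtain a :: int and t where at: "t \<in> OI K" "\<gamma> = of_int a + of_nat f * t" by blast
  then obtain u v where uv: "t = (of_int u + of_int v * csqrt (of_int d\<^sub>K)) / 2" "even (u - v * d\<^sub>K)" unfolding OI_form by blast
  have "\<gamma> = half_elem d (2 * a + int f * u) v"
    unfolding at(2) uv(1) half_elem_def csqrt_d by (simp add: add_divide_distrib distrib_left mult.left_commute)
  moreover have "even (2 * a + int f * u - v * (- int d))" using uv(2) unfolding d by auto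
  ultimately show "\<gamma> \<in> R" unfolding R_form by blast
qed

lemma half_elem_trace: "half_elem d x y + cnj (half_elem d x y) = of_int x"
  by (simp add: half_elem_def csqrt_neg_nat field_simps)

lemma p_in: "of_nat p \<in> \<pp>" "of_nat p \<in> \<pp>'"
proof -
  have m: "of_nat p \<in> \<pp> \<cdot>\<^bsub>integer_ring K\<^esub> \<pp>'" using K.mem_PIdl_self[of "of_nat p"] split(4) by simp
  have "\<pp> \<cdot>\<^bsub>integer_ring K\<^esub> \<pp>' \<subseteq> \<pp>"
    by (rule K.ideal_prod_subsetI) (use \<pp>.Q_closed(3,5) \<pp>'.Q_OI in auto)
  then show "of_nat p \<in> \<pp>" using m by blast
  have "\<pp> \<cdot>\<^bsub>integer_ring K\<^esub> \<pp>' \<subseteq> \<pp>'"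
    by (rule K.ideal_prod_subsetI) (use \<pp>'.Q_closed(3,4) \<pp>.Q_OI in auto)
  then show "of_nat p \<in> \<pp>'" using m by blast
qed

lemmas int_in_pp = \<pp>.of_int_in_Q_iff[OF p(1) p_in(1)]
lemmas int_in_pp' = \<pp>'.of_int_in_Q_iff[OF p(1) p_in(2)]

text \<open>Nonzero primes are maximal. The second part says that \<open>\<pp>\<close> is prime to
  the modulus \<open>\<pp>'\<close> of the ray class field.\<close>

lemma not_subset: "\<not> \<pp> \<subseteq> \<pp>'" "\<not> \<pp>' \<subseteq> \<pp>"
proof -
  have *: False if ne: "A \<noteq> B" and A: "number_field_prime K A" and B: "number_field_prime K B" and sub: "A \<subseteq> B" for A B
  proof -
    interpret A: number_field_prime K A by fact
    interpret B: number_field_prime K B by fact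
    obtain x where x: "x \<in> B" "x \<notin> A" using ne sub by blast
    obtain y where y: "y \<in> OI K" "x * y - 1 \<in> A" using A.unit_mod[OF B.Q_OI[OF x(1)] x(2)] by blast
    have "x * y - (x * y - 1) \<in> B" using B.Q_closed(7)[OF B.Q_closed(5)[OF y(1) x(1)]] y(2) sub by blast
    then show False using B.one_notin by simp
  qed
  show "\<not> \<pp> \<subseteq> \<pp>'" using *[OF split(3) \<pp>.number_field_prime_axioms \<pp>'.number_field_prime_axioms] by blast
  show "\<not> \<pp>' \<subseteq> \<pp>" using *[OF split(3)[symmetric] \<pp>'.number_field_prime_axioms \<pp>.number_field_prime_axioms] by blast
qed

text \<open>Conjugation swaps the two primes. If it preserved \<open>\<pp>\<close>, an element of
  \<open>\<pp>\<close> outside \<open>\<pp>'\<close> would have its trace and norm in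
  \<open>\<pp>\<close>, hence divisible by \<open>p\<close> and in \<open>\<pp>'\<close>, which
  forces the element itself into \<open>\<pp>'\<close>. So some \<open>a\<close> in
  \<open>\<pp>\<close> has its conjugate outside \<open>\<pp>\<close>, and conjugating a*b, a
  multiple of \<open>p\<close> for every \<open>b\<close> in \<open>\<pp>'\<close>, shows that
  \<open>\<pp>'\<close> goes into \<open>\<pp>\<close>.\<close>

lemma cnj_in_pp': assumes x: "x \<in> \<pp>" shows "cnj x \<in> \<pp>'"
proof -
  have not1: "\<not> (\<forall>a\<in>\<pp>. cnj a \<in> \<pp>)"
  proof
    assume all: "\<forall>a\<in>\<pp>. cnj a \<in> \<pp>"
    obtain a where a: "a \<in> \<pp>" "a \<notin> \<pp>'" using not_subset(1) by blast
    have aO: "a \<in> OI K" by (rule \<pp>.Q_OI[OF a(1)])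
    obtain t n where tn: "a + cnj a = of_int t" "a * cnj a = of_int n" using trace_norm_int[OF aO] .
    have ca: "cnj a \<in> \<pp>" using all a(1) by blast
    have "of_int t \<in> \<pp>" unfolding tn(1)[symmetric] by (rule \<pp>.Q_closed(3)[OF a(1) ca])
    then have t: "a + cnj a \<in> \<pp>'" unfolding tn(1) using int_in_pp int_in_pp' by blast
    have "of_int n \<in> \<pp>" unfolding tn(2)[symmetric] by (rule \<pp>.Q_closed(4)[OF aO ca])
    then have "a * cnj a \<in> \<pp>'" unfolding tn(2) using int_in_pp int_in_pp' by blast
    then have "cnj a \<in> \<pp>'" using \<pp>'.prime_cases[OF aO cnj_OI[OF aO]] a(2) by blast
    then have "a + cnj a - cnj a \<in> \<pp>'" by (rule \<pp>'.Q_closed(7)[OF t])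
    then show False using a(2) by simp
  qed
  then obtain a where a: "a \<in> \<pp>" "cnj a \<notin> \<pp>" by blast
  have sub: "cnj b \<in> \<pp>" if b: "b \<in> \<pp>'" for b
  proof -
    have "a * b \<in> PIdl\<^bsub>integer_ring K\<^esub> (of_nat p)" unfolding split(4) by (rule K.ideal_prod_memI[OF a(1) b])
    then obtain r where r: "r \<in> OI K" "a * b = r * of_nat p" by (auto simp: K.PIdl_eq)
    have "cnj a * cnj b = cnj r * of_nat p" using arg_cong[OF r(2), of cnj] by simp
    then have "cnj a * cnj b \<in> \<pp>" using \<pp>.Q_closed(4)[OF cnj_OI[OF r(1)] p_in(1)] by simp
    then show ?thesis
      using \<pp>.prime_cases[OF cnj_OI[OF \<pp>.Q_OI[OF a(1)]] cnj_OI[OF \<pp>'.Q_OI[OF b]]] a(2) by blast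
  qed
  \<comment> \<open>So far conjugation maps \<open>\<pp>'\<close> into \<open>\<pp>\<close>; the
    opposite direction follows from an inverse modulo \<open>\<pp>'\<close>.\<close>
  show ?thesis
  proof (rule ccontr)
    assume nx: "cnj x \<notin> \<pp>'"
    have xO: "x \<in> OI K" by (rule \<pp>.Q_OI[OF x])
    obtain y where y: "y \<in> OI K" "cnj x * y - 1 \<in> \<pp>'" using \<pp>'.unit_mod[OF cnj_OI[OF xO] nx] by blast
    have "x * cnj y - 1 \<in> \<pp>" using sub[OF y(2)] by simp
    from \<pp>.Q_closed(7)[OF \<pp>.Q_closed(5)[OF cnj_OI[OF y(1)] x] this] show False using \<pp>.one_notin by simp
  qed
qed

text \<open>The norm of a unit is a nonnegative integer dividing 1, hence 1. The 4 comes from the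
  denominator 2 in \<open>OI_form\<close>.\<close>

lemma unit_form:
  assumes u: "\<epsilon> \<in> OI K" "\<epsilon>' \<in> OI K" "\<epsilon> * \<epsilon>' = 1"
  obtains x y where "\<epsilon> = (of_int x + of_int y * csqrt (of_int d\<^sub>K)) / 2" "x * x - d\<^sub>K * (y * y) = 4"
proof -
  obtain x y where xy: "\<epsilon> = (of_int x + of_int y * csqrt (of_int d\<^sub>K)) / 2" using u(1) unfolding OI_form by blast
  obtain t n where n: "\<epsilon> * cnj \<epsilon> = of_int n" using trace_norm_int[OF u(1)] by metis
  obtain t' n' where n': "\<epsilon>' * cnj \<epsilon>' = of_int n'" using trace_norm_int[OF u(2)] by metis
  have "of_int (n * n') = (\<epsilon> * \<epsilon>') * cnj (\<epsilon> * \<epsilon>')" using n n' by (simp add: mult_ac)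
  then have "of_int (n * n') = (1 :: complex)" using u(3) by simp
  then have nn: "n * n' = 1" by (metis of_int_eq_1_iff)
  have "of_int n = complex_of_real ((cmod \<epsilon>)\<^sup>2)" unfolding n[symmetric] by (rule complex_norm_square[symmetric])
  then have "real_of_int n = (cmod \<epsilon>)\<^sup>2" by (metis of_real_eq_iff of_real_of_int_eq)
  then have "n \<ge> 0" by (metis of_int_0_le_iff zero_le_power2)
  then have "n = 1" using nn by (simp add: zmult_eq_1_iff)
  then have 1: "\<epsilon> * cnj \<epsilon> = 1" using n by simp
  have sq: "csqrt (of_int d\<^sub>K) * csqrt (of_int d\<^sub>K) = of_int d\<^sub>K"
    using power2_csqrt[of "of_int d\<^sub>K"] unfolding power2_eq_square .
  have half: "4 * ((a + b * s) / 2 * ((a + b * - s) / 2)) = a * a - b * b * (s * s)" for a b s :: complex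
    by (simp add: algebra_simps)
  have "4 * (\<epsilon> * cnj \<epsilon>) = of_int x * of_int x - of_int y * of_int y * (csqrt (of_int d\<^sub>K) * csqrt (of_int d\<^sub>K))"
    unfolding xy complex_cnj_divide complex_cnj_add complex_cnj_mult cnj_csqrt_neg_int[OF dK_neg]
      complex_cnj_of_int complex_cnj_numeral half ..
  then have "(of_int (x * x - d\<^sub>K * (y * y)) :: complex) = of_int 4"
    unfolding 1 sq of_int_diff of_int_mult of_int_numeral mult_1_right by (metis mult.commute)
  then have "x * x - d\<^sub>K * (y * y) = 4" by (simp only: of_int_eq_iff)
  then show thesis using that xy by blast
qed

section \<open>Principal generators and trivial Frobenius powers\<close>

lemma ideal_power_nonzero: "ideal_power K \<pp> n \<noteq> {0}"
proof -
  obtain x where "x \<in> ideal_power K \<pp> n" "x \<notin> ideal_power K \<pp> (Suc n)" using \<pp>.P_strict .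
  then show ?thesis using \<pp>.P_closed(2)[of "Suc n"] by (metis singletonD)
qed

text \<open>Turns a fractional generator into an integral one: \<alpha> is \<beta> times an element
  of the ideal power, and that element generates it.\<close>

lemma principal_quotient:
  assumes "\<beta> \<in> OI K" "\<beta> \<noteq> 0" "{\<beta> * z | z. z \<in> ideal_power K \<pp> n} = {\<alpha> * z | z. z \<in> OI K}"
  obtains \<gamma> where "\<gamma> \<in> OI K" "ideal_power K \<pp> n = PIdl\<^bsub>integer_ring K\<^esub> \<gamma>" "\<alpha> = \<beta> * \<gamma>"
proof -
  have "\<alpha> * 1 \<in> {\<alpha> * z | z. z \<in> OI K}" using K.OI_one by blast
  then have "\<alpha> \<in> {\<beta> * z | z. z \<in> ideal_power K \<pp> n}" using assms(3) by simp
  then obtain \<gamma> where g: "\<gamma> \<in> ideal_power K \<pp> n" "\<alpha> = \<beta> * \<gamma>" by blast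
  have "ideal_power K \<pp> n = PIdl\<^bsub>integer_ring K\<^esub> \<gamma>"
  proof
    show "PIdl\<^bsub>integer_ring K\<^esub> \<gamma> \<subseteq> ideal_power K \<pp> n"
      unfolding K.PIdl_eq using \<pp>.P_closed(4)[OF _ g(1)] by blast
    show "ideal_power K \<pp> n \<subseteq> PIdl\<^bsub>integer_ring K\<^esub> \<gamma>"
    proof
      fix z assume "z \<in> ideal_power K \<pp> n"
      then have "\<beta> * z \<in> {\<alpha> * z | z. z \<in> OI K}" using assms(3) by blast
      then obtain w where w: "w \<in> OI K" "\<beta> * z = \<alpha> * w" by blast
      then have "z = w * \<gamma>" using assms(2) g(2) by (simp add: mult_ac)
      then show "z \<in> PIdl\<^bsub>integer_ring K\<^esub> \<gamma>" unfolding K.PIdl_eq using w(1) by blast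
    qed
  qed
  then show thesis using that g \<pp>.P_closed(1) by blast
qed

lemma principal_one:
  assumes "ideal_power K \<pp> n = PIdl\<^bsub>integer_ring K\<^esub> \<gamma>"
  shows "{1 * z | z. z \<in> ideal_power K \<pp> n} = {\<gamma> * z | z. z \<in> OI K}" "\<gamma> \<noteq> 0" "\<gamma> \<in> ideal_power K \<pp> n" "\<gamma> \<in> OI K"
proof -
  show "{1 * z | z. z \<in> ideal_power K \<pp> n} = {\<gamma> * z | z. z \<in> OI K}"
    unfolding assms K.PIdl_eq by (auto simp: mult.commute)
  show "\<gamma> \<noteq> 0"
  proof
    assume "\<gamma> = 0"
    moreover have "PIdl\<^bsub>integer_ring K\<^esub> 0 = {0}" unfolding K.PIdl_eq mult_zero_right using K.OI_zero by blast
    ultimately have "ideal_power K \<pp> n = {0}" using assms by simp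
    then show False using ideal_power_nonzero by blast
  qed
  show g: "\<gamma> \<in> ideal_power K \<pp> n" unfolding assms by (rule K.mem_PIdl_self)
  show "\<gamma> \<in> OI K" by (rule \<pp>.P_closed(1)[OF g])
qed

text \<open>A quotient \<gamma> of two elements congruent to 1 is again congruent to 1, by \<gamma>
  - 1 = (\<alpha> - 1) - (\<beta> - 1) * \<gamma>. Conversely \<beta> = 1 serves as
  denominator.\<close>

lemma ray_frobenius_iff:
  assumes \<Sigma>: "ray_class_field K \<pp>' \<Sigma>" and n: "n > 0"
  shows "frobenius K \<Sigma> \<pp> [^]\<^bsub>gal_group K \<Sigma>\<^esub> (n::nat) = \<one>\<^bsub>gal_group K \<Sigma>\<^esub> \<longleftrightarrow>
    (\<exists>\<gamma>. ideal_power K \<pp> n = PIdl\<^bsub>integer_ring K\<^esub> \<gamma> \<and> \<gamma> - 1 \<in> \<pp>')"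
proof -
  define S where "S = {\<alpha> \<in> OI K. \<alpha> \<noteq> 0 \<and> \<alpha> - 1 \<in> \<pp>'}"
  have ak: "artin_kernel_field K \<pp>' S \<Sigma>"
    using \<Sigma> by (simp add: ray_class_field_def class_field_def S_def)
  have "(\<exists>\<alpha>\<in>S. \<exists>\<beta>\<in>S. {\<beta> * z | z. z \<in> ideal_power K \<pp> n} = {\<alpha> * z | z. z \<in> OI K}) \<longleftrightarrow>
    (\<exists>\<gamma>. ideal_power K \<pp> n = PIdl\<^bsub>integer_ring K\<^esub> \<gamma> \<and> \<gamma> - 1 \<in> \<pp>')"
  proof
    assume "\<exists>\<alpha>\<in>S. \<exists>\<beta>\<in>S. {\<beta> * z | z. z \<in> ideal_power K \<pp> n} = {\<alpha> * z | z. z \<in> OI K}"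
    then obtain \<alpha> \<beta> where ab: "\<alpha> \<in> S" "\<beta> \<in> S" "{\<beta> * z | z. z \<in> ideal_power K \<pp> n} = {\<alpha> * z | z. z \<in> OI K}" by blast
    have b: "\<beta> \<in> OI K" "\<beta> \<noteq> 0" "\<beta> - 1 \<in> \<pp>'" and a: "\<alpha> - 1 \<in> \<pp>'" using ab by (auto simp: S_def)
    obtain \<gamma> where g: "\<gamma> \<in> OI K" "ideal_power K \<pp> n = PIdl\<^bsub>integer_ring K\<^esub> \<gamma>" "\<alpha> = \<beta> * \<gamma>"
      using principal_quotient[OF b(1,2) ab(3)] .
    have eq: "\<gamma> - 1 = (\<alpha> - 1) - (\<beta> - 1) * \<gamma>" unfolding g(3) by (simp add: algebra_simps)
    have "\<gamma> - 1 \<in> \<pp>'" unfolding eq by (rule \<pp>'.Q_closed(7)[OF a \<pp>'.Q_closed(5)[OF g(1) b(3)]])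
    then show "\<exists>\<gamma>. ideal_power K \<pp> n = PIdl\<^bsub>integer_ring K\<^esub> \<gamma> \<and> \<gamma> - 1 \<in> \<pp>'" using g(2) by blast
  next
    assume "\<exists>\<gamma>. ideal_power K \<pp> n = PIdl\<^bsub>integer_ring K\<^esub> \<gamma> \<and> \<gamma> - 1 \<in> \<pp>'"
    then obtain \<gamma> where g: "ideal_power K \<pp> n = PIdl\<^bsub>integer_ring K\<^esub> \<gamma>" "\<gamma> - 1 \<in> \<pp>'" by blast
    have "\<gamma> \<in> S" using principal_one(2,4)[OF g(1)] g(2) by (simp add: S_def)
    moreover have "1 \<in> S" using \<pp>'.Q_closed(2) by (simp add: S_def)
    ultimately show "\<exists>\<alpha>\<in>S. \<exists>\<beta>\<in>S. {\<beta> * z | z. z \<in> ideal_power K \<pp> n} = {\<alpha> * z | z. z \<in> OI K}"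
      using principal_one(1)[OF g(1)] by blast
  qed
  then show ?thesis
    using frobenius_pow_iff_principal[OF K.number_field_axioms ak \<pp>'.ideal_Q split(1) not_subset(2) n] by blast
qed

lemma ideal_f: "ideal (PIdl\<^bsub>integer_ring K\<^esub> (of_nat m)) (integer_ring K)"
  by (rule K.ideal_PIdl) simp

lemma f_not_subset: "\<not> PIdl\<^bsub>integer_ring K\<^esub> (of_nat f) \<subseteq> \<pp>"
proof
  assume "PIdl\<^bsub>integer_ring K\<^esub> (of_nat f) \<subseteq> \<pp>"
  then have "of_int (int f) \<in> \<pp>" using K.mem_PIdl_self[of "of_nat f"] by auto
  then show False unfolding int_in_pp using p_not_dvd_f by simp
qed

text \<open>A quotient of two elements congruent modulo \<open>f\<close> to integers prime to
  \<open>f\<close> is congruent to an integer, hence lies in \<open>R\<close>. The converse has to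
  recover that the integer is prime to \<open>f\<close>.\<close>

lemma ring_frobenius_iff:
  assumes \<Omega>: "ring_class_field K f \<Omega>" and n: "n > 0"
  shows "frobenius K \<Omega> \<pp> [^]\<^bsub>gal_group K \<Omega>\<^esub> (n::nat) = \<one>\<^bsub>gal_group K \<Omega>\<^esub> \<longleftrightarrow>
    (\<exists>\<gamma>\<in>R. ideal_power K \<pp> n = PIdl\<^bsub>integer_ring K\<^esub> \<gamma>)"
proof -
  define S where "S = {\<alpha> \<in> OI K. \<alpha> \<noteq> 0 \<and> (\<exists>a::int. coprime a (int f) \<and> \<alpha> - of_int a \<in> PIdl\<^bsub>integer_ring K\<^esub> (of_nat f))}"
  have ak: "artin_kernel_field K (PIdl\<^bsub>integer_ring K\<^esub> (of_nat f)) S \<Omega>"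
    using \<Omega> by (simp add: ring_class_field_def class_field_def S_def)
  note fcl = K.idealD[OF ideal_f[of f]]
  have "(\<exists>\<alpha>\<in>S. \<exists>\<beta>\<in>S. {\<beta> * z | z. z \<in> ideal_power K \<pp> n} = {\<alpha> * z | z. z \<in> OI K}) \<longleftrightarrow>
    (\<exists>\<gamma>\<in>R. ideal_power K \<pp> n = PIdl\<^bsub>integer_ring K\<^esub> \<gamma>)"
  proof
    assume "\<exists>\<alpha>\<in>S. \<exists>\<beta>\<in>S. {\<beta> * z | z. z \<in> ideal_power K \<pp> n} = {\<alpha> * z | z. z \<in> OI K}"
    then obtain \<alpha> \<beta> where ab: "\<alpha> \<in> S" "\<beta> \<in> S" "{\<beta> * z | z. z \<in> ideal_power K \<pp> n} = {\<alpha> * z | z. z \<in> OI K}" by blast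
    obtain a b :: int where b: "\<beta> \<in> OI K" "\<beta> \<noteq> 0" "coprime b (int f)" "\<beta> - of_int b \<in> PIdl\<^bsub>integer_ring K\<^esub> (of_nat f)"
      and a: "\<alpha> - of_int a \<in> PIdl\<^bsub>integer_ring K\<^esub> (of_nat f)" using ab by (auto simp: S_def)
    obtain \<gamma> where g: "\<gamma> \<in> OI K" "ideal_power K \<pp> n = PIdl\<^bsub>integer_ring K\<^esub> \<gamma>" "\<alpha> = \<beta> * \<gamma>"
      using principal_quotient[OF b(1,2) ab(3)] .
    \<comment> \<open>\<open>u\<close> inverts \<open>b\<close> modulo \<open>f\<close>, so \<gamma>
      is congruent to the integer u*a.\<close>
    obtain u v where uv: "u * b + v * int f = 1" using b(3) by (metis bezout_int coprime_imp_gcd_eq_1)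
    have uv': "of_int u * of_int b + of_int v * of_nat f = (1 :: complex)"
      using uv by (metis of_int_1 of_int_add of_int_mult of_int_of_nat_eq)
    have "\<gamma> - of_int (u * a) = of_int u * ((\<alpha> - of_int a) - (\<beta> - of_int b) * \<gamma>) + of_int v * \<gamma> * of_nat f"
    proof -
      have "\<gamma> = (of_int u * of_int b + of_int v * of_nat f) * \<gamma>" unfolding uv' by simp
      then show ?thesis unfolding g(3) by (simp add: algebra_simps)
    qed
    moreover have "of_int u * ((\<alpha> - of_int a) - (\<beta> - of_int b) * \<gamma>) + of_int v * \<gamma> * of_nat f \<in> PIdl\<^bsub>integer_ring K\<^esub> (of_nat f)"
      by (rule fcl(3)[OF fcl(4)[OF K.OI_of_int fcl(7)[OF a fcl(5)[OF g(1) b(4)]]]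
            fcl(4)[OF K.OI_mult[OF K.OI_of_int g(1)] K.mem_PIdl_self]])
    ultimately have "\<gamma> - of_int (u * a) \<in> PIdl\<^bsub>integer_ring K\<^esub> (of_nat f)" by simp
    then obtain t where t: "t \<in> OI K" "\<gamma> - of_int (u * a) = t * of_nat f" by (auto simp: K.PIdl_eq)
    then have "\<gamma> = of_int (u * a) + of_nat f * t" by (simp add: algebra_simps)
    then have "\<gamma> \<in> R" unfolding R_iff using t(1) by blast
    then show "\<exists>\<gamma>\<in>R. ideal_power K \<pp> n = PIdl\<^bsub>integer_ring K\<^esub> \<gamma>" using g(2) by blast
  next
    assume "\<exists>\<gamma>\<in>R. ideal_power K \<pp> n = PIdl\<^bsub>integer_ring K\<^esub> \<gamma>"
    then obtain \<gamma> where g: "\<gamma> \<in> R" "ideal_power K \<pp> n = PIdl\<^bsub>integer_ring K\<^esub> \<gamma>" by blast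
    obtain a :: int and t where t: "t \<in> OI K" "\<gamma> = of_int a + of_nat f * t" using g(1) unfolding R_iff by blast
    have "of_nat p ^ n \<in> ideal_power K \<pp> n" by (rule \<pp>.P_power[OF p_in(1)])
    then obtain w where w: "w \<in> OI K" "of_nat p ^ n = w * \<gamma>" unfolding g(2) by (auto simp: K.PIdl_eq)
    \<comment> \<open>A common prime \<open>l\<close> of \<open>a\<close> and \<open>f\<close> would
      divide \<gamma> and therefore its multiple p^n. Then l = p, although \<open>p\<close> does not
      divide \<open>f\<close>.\<close>
    have "coprime a (int f)"
    proof (rule ccontr)
      assume "\<not> coprime a (int f)"
      then have "\<not> is_unit (gcd a (int f))" by (simp add: coprime_iff_gcd_eq_1)
      moreover have "gcd a (int f) \<noteq> 0" using f_pos by simp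
      ultimately obtain l where l: "Factorial_Ring.prime l" "l dvd gcd a (int f)" using prime_divisorE by blast
      then obtain a' f' where af: "a = l * a'" "int f = l * f'" by (meson dvdE gcd_dvd1 gcd_dvd2 dvd_trans)
      have "of_nat p ^ n = of_int l * (w * (of_int a' + of_int f' * t))"
      proof -
        have "of_nat f = (of_int l * of_int f' :: complex)" using af(2) by (metis of_int_mult of_int_of_nat_eq)
        then show ?thesis unfolding w(2) t(2) af(1) by (simp add: algebra_simps)
      qed
      then have "of_nat p ^ n / of_int l = w * (of_int a' + of_int f' * t)" using l(1) by auto
      moreover have "w * (of_int a' + of_int f' * t) \<in> OI K"
        using w(1) t(1) by (intro K.OI_mult K.OI_add K.OI_of_int)
      ultimately have "algebraic_int (of_nat p ^ n / of_int l :: complex)" by (simp add: OI_def)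
      then have "(of_nat p ^ n / of_int l :: complex) \<in> \<int>" by (rule rational_algebraic_int_is_int) simp
      then obtain k where "of_nat p ^ n / of_int l = (of_int k :: complex)" by (auto elim: Ints_cases)
      then have "of_int (int p ^ n) = (of_int (k * l) :: complex)" using l(1) by (auto simp: field_simps)
      then have "int p ^ n = k * l" by (simp only: of_int_eq_iff)
      then have "l dvd int p ^ n" by simp
      then have "l dvd int p" using l(1) prime_dvd_power by blast
      then have "l = int p" using l(1) p(1) primes_dvd_imp_eq[of l "int p"] by simp
      then have "int p dvd int f" using af(2) by simp
      then show False using p_not_dvd_f by simp
    qed
    moreover have "\<gamma> - of_int a \<in> PIdl\<^bsub>integer_ring K\<^esub> (of_nat f)"
      unfolding K.PIdl_eq t(2) using t(1) by (auto simp: mult.commute)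
    ultimately have "\<gamma> \<in> S" using principal_one(2,4)[OF g(2)] by (auto simp: S_def)
    moreover have "1 \<in> S" using fcl(2) by (auto simp: S_def intro!: exI[of _ 1])
    ultimately show "\<exists>\<alpha>\<in>S. \<exists>\<beta>\<in>S. {\<beta> * z | z. z \<in> ideal_power K \<pp> n} = {\<alpha> * z | z. z \<in> OI K}"
      using principal_one(1)[OF g(2)] by blast
  qed
  then show ?thesis
    using frobenius_pow_iff_principal[OF K.number_field_axioms ak ideal_f split(1) f_not_subset n] by blast
qed

lemma same_generator:
  assumes "PIdl\<^bsub>integer_ring K\<^esub> \<gamma> = PIdl\<^bsub>integer_ring K\<^esub> \<delta>" "\<gamma> \<noteq> 0"
  obtains \<epsilon> \<epsilon>' where "\<epsilon> \<in> OI K" "\<epsilon>' \<in> OI K" "\<epsilon> * \<epsilon>' = 1" "\<delta> = \<epsilon> * \<gamma>"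
proof -
  have "\<delta> \<in> PIdl\<^bsub>integer_ring K\<^esub> \<gamma>" "\<gamma> \<in> PIdl\<^bsub>integer_ring K\<^esub> \<delta>" using K.mem_PIdl_self assms(1) by auto
  then have "\<exists>\<epsilon>. \<delta> = \<epsilon> * \<gamma> \<and> \<epsilon> \<in> OI K" "\<exists>\<epsilon>. \<gamma> = \<epsilon> * \<delta> \<and> \<epsilon> \<in> OI K" unfolding K.PIdl_eq by blast+
  then obtain \<epsilon> \<epsilon>' where e: "\<epsilon> \<in> OI K" "\<delta> = \<epsilon> * \<gamma>" "\<epsilon>' \<in> OI K" "\<gamma> = \<epsilon>' * \<delta>" by blast
  have "\<gamma> = \<epsilon>' * \<epsilon> * \<gamma>" using e(4) unfolding e(2) mult.assoc .
  then have "\<epsilon> * \<epsilon>' = 1" using assms(2) by (simp add: mult.commute)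
  then show thesis using that e by blast
qed

lemma abelian_class_field: "class_field K \<mm> S L \<Longrightarrow> abelian_ext K L"
  using abelian_extension_iff[OF K.number_field_axioms] by (simp add: class_field_def artin_kernel_field_def)

lemma unramified_class_field: "class_field K \<mm> S L \<Longrightarrow> \<not> \<mm> \<subseteq> \<pp> \<Longrightarrow> unramified K L \<pp>"
  using split(1) by (simp add: class_field_def artin_kernel_field_def)

text \<open>The generator \<open>\<delta>\<close> from the ring class field and the generator \<open>\<gamma>\<close> from the ray class field
  differ by a unit \<open>\<zeta>\<close>, and \<open>x = \<delta> + cnj \<delta>\<close> is congruent to \<open>\<delta>\<close>.\<close>

lemma generator_of_trivial_frobenius:
  assumes \<Sigma>: "ray_class_field K \<pp>' \<Sigma>" and \<Omega>: "ring_class_field K f \<Omega>" and n: "n > 0"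
    and 1: "frobenius K \<Sigma> \<pp> [^]\<^bsub>gal_group K \<Sigma>\<^esub> (n::nat) = \<one>\<^bsub>gal_group K \<Sigma>\<^esub>"
      "frobenius K \<Omega> \<pp> [^]\<^bsub>gal_group K \<Omega>\<^esub> n = \<one>\<^bsub>gal_group K \<Omega>\<^esub>"
  obtains x y \<zeta> u v where "ideal_power K \<pp> n = PIdl\<^bsub>integer_ring K\<^esub> (half_elem d x y)" "half_elem d x y \<in> R"
    "of_int x - \<zeta> \<in> \<pp>'" "\<zeta> = (of_int u + of_int v * csqrt (of_int d\<^sub>K)) / 2" "u * u - d\<^sub>K * (v * v) = 4"
proof -
  obtain \<gamma> where g: "ideal_power K \<pp> n = PIdl\<^bsub>integer_ring K\<^esub> \<gamma>" "\<gamma> - 1 \<in> \<pp>'"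
    using 1(1) ray_frobenius_iff[OF \<Sigma> n] by blast
  obtain \<delta> where h: "\<delta> \<in> R" "ideal_power K \<pp> n = PIdl\<^bsub>integer_ring K\<^esub> \<delta>"
    using 1(2) ring_frobenius_iff[OF \<Omega> n] by blast
  obtain x y where xy: "\<delta> = half_elem d x y" using h(1) unfolding R_form by blast
  have "PIdl\<^bsub>integer_ring K\<^esub> \<gamma> = PIdl\<^bsub>integer_ring K\<^esub> \<delta>" using g(1) h(2) by simp
  then obtain \<zeta> \<zeta>' where z: "\<zeta> \<in> OI K" "\<zeta>' \<in> OI K" "\<zeta> * \<zeta>' = 1" "\<delta> = \<zeta> * \<gamma>"
    using same_generator[OF _ principal_one(2)[OF g(1)]] by blast
  obtain u v where uv: "\<zeta> = (of_int u + of_int v * csqrt (of_int d\<^sub>K)) / 2" "u * u - d\<^sub>K * (v * v) = 4"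
    using unit_form[OF z(1-3)] .
  have "\<delta> \<in> \<pp>" using principal_one(3)[OF h(2)] \<pp>.P_subset_Q[OF n] by blast
  then have c: "cnj \<delta> \<in> \<pp>'" by (rule cnj_in_pp')
  have "of_int x - \<zeta> = \<zeta> * (\<gamma> - 1) + cnj \<delta>"
    unfolding half_elem_trace[of x y, symmetric] xy[symmetric] using z(4) by (simp add: algebra_simps)
  then have "of_int x - \<zeta> \<in> \<pp>'" using \<pp>'.Q_closed(3)[OF \<pp>'.Q_closed(4)[OF z(1) g(2)] c] by simp
  then show thesis using that h uv xy by blast
qed

text \<open>Discriminants are 0 or 1 modulo 4, so a negative one other than -3 and -4 is at most -5,
  and a nonzero \<open>v\<close> would already contribute more than 4.\<close>

lemma generic_units:
  assumes "d\<^sub>K \<noteq> -3" "d\<^sub>K \<noteq> -4" "u * u - d\<^sub>K * (v * v) = 4"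
  shows "v = 0 \<and> (u = 2 \<or> u = -2)"
proof -
  have "d\<^sub>K \<noteq> -1" "d\<^sub>K \<noteq> -2" using dK_mod_4 by (fastforce, fastforce)
  then have "d\<^sub>K \<le> -5" using dK_neg assms by linarith
  have v: "v = 0"
  proof (rule ccontr)
    assume "v \<noteq> 0"
    then have "v * v \<ge> 1" by (metis int_one_le_iff_zero_less not_real_square_gt_zero zero_less_mult_iff linorder_neqE_linordered_idom)
    then have "- d\<^sub>K * (v * v) \<ge> 5 * 1" using \<open>d\<^sub>K \<le> -5\<close> by (intro mult_mono) auto
    moreover have "u * u \<ge> 0" by simp
    ultimately show False using assms(3) by simp
  qed
  then have "u * u = 2 * 2" using assms(3) by simp
  then have "u = 2 \<or> u = -2" by (simp only: square_eq_iff)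
  then show ?thesis using v by blast
qed

text \<open>The generator and its trace \<open>x\<close> differ by the conjugate, which lies in
  \<open>\<pp>'\<close>.\<close>

lemma generator_cong_trace:
  assumes "m > 0" "ideal_power K \<pp> m = PIdl\<^bsub>integer_ring K\<^esub> (half_elem d x y)"
  shows "half_elem d x y - of_int x \<in> \<pp>'"
proof -
  have "half_elem d x y \<in> \<pp>" using principal_one(3)[OF assms(2)] \<pp>.P_subset_Q[OF assms(1)] by blast
  then have "- cnj (half_elem d x y) \<in> \<pp>'" by (rule \<pp>'.Q_closed(6)[OF cnj_in_pp'])
  moreover have "half_elem d x y - of_int x = - cnj (half_elem d x y)"
    unfolding half_elem_trace[of x y, symmetric] by simp
  ultimately show ?thesis by simp
qed

lemma generator_cong_sign:
  assumes "m > 0" "ideal_power K \<pp> m = PIdl\<^bsub>integer_ring K\<^esub> (half_elem d x y)"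
    and "[x = s] (mod int p)"
  shows "half_elem d x y - of_int s \<in> \<pp>'"
proof -
  have "int p dvd x - s" using assms(3) by (simp add: cong_iff_dvd_diff)
  then have "of_int (x - s) \<in> \<pp>'" unfolding int_in_pp' .
  from \<pp>'.Q_closed(3)[OF generator_cong_trace[OF assms(1,2)] this] show ?thesis by simp
qed

text \<open>The only units are 1 and -1, so the sign in the congruence for \<open>x\<close> is the
  unit relating the generators from the ray and the ring class field. For minimality, a generator
  congruent to -1 is replaced by its negative, which generates the same ideal and meets the ray
  condition.\<close>

lemma residue_degree_generic:
  assumes dK: "d\<^sub>K \<noteq> -3" "d\<^sub>K \<noteq> -4"
    and \<Sigma>: "ray_class_field K \<pp>' \<Sigma>" and \<Omega>: "ring_class_field K f \<Omega>"
    and P: "prime_above K (compositum \<Sigma> \<Omega>) \<pp> \<PP>"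
  defines "n \<equiv> residue_degree K (compositum \<Sigma> \<Omega>) \<PP>"
    and "good \<equiv> \<lambda>m x y. ideal_power K \<pp> m = PIdl\<^bsub>integer_ring K\<^esub> (half_elem d x y) \<and> half_elem d x y \<in> R \<and>
      ([x = 1] (mod int p) \<or> [x = -1] (mod int p))"
  shows "n > 0" "\<exists>x y. good n x y" "m > 0 \<Longrightarrow> good m x y \<Longrightarrow> n \<le> m"
    "m > 0 \<Longrightarrow> good m x y \<Longrightarrow> half_elem d x y - 1 \<in> \<pp>' \<or> half_elem d x y + 1 \<in> \<pp>'"
proof -
  have a: "abelian_ext K \<Sigma>" "abelian_ext K \<Omega>"
    using \<Sigma> \<Omega> by (auto simp only: ray_class_field_def ring_class_field_def intro: abelian_class_field)
  have "unramified K \<Sigma> \<pp>"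
    using unramified_class_field[OF _ not_subset(2)] \<Sigma> unfolding ray_class_field_def by blast
  moreover have "unramified K \<Omega> \<pp>"
    using unramified_class_field[OF _ f_not_subset] \<Omega> unfolding ring_class_field_def by blast
  ultimately have deg: "n > 0" "frobenius K \<Sigma> \<pp> [^]\<^bsub>gal_group K \<Sigma>\<^esub> n = \<one>\<^bsub>gal_group K \<Sigma>\<^esub>"
      "frobenius K \<Omega> \<pp> [^]\<^bsub>gal_group K \<Omega>\<^esub> n = \<one>\<^bsub>gal_group K \<Omega>\<^esub>"
    and min: "\<And>m::nat. m > 0 \<Longrightarrow> frobenius K \<Sigma> \<pp> [^]\<^bsub>gal_group K \<Sigma>\<^esub> m = \<one>\<^bsub>gal_group K \<Sigma>\<^esub> \<Longrightarrow>
      frobenius K \<Omega> \<pp> [^]\<^bsub>gal_group K \<Omega>\<^esub> m = \<one>\<^bsub>gal_group K \<Omega>\<^esub> \<Longrightarrow> n \<le> m"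
    unfolding n_def using residue_degree_compositum[OF a split(1) _ _ P] by blast+
  show "n > 0" by (rule deg(1))
  show "\<exists>x y. good n x y"
  proof -
    obtain x y \<zeta> u v where xy: "ideal_power K \<pp> n = PIdl\<^bsub>integer_ring K\<^esub> (half_elem d x y)" "half_elem d x y \<in> R"
      "of_int x - \<zeta> \<in> \<pp>'" and z: "\<zeta> = (of_int u + of_int v * csqrt (of_int d\<^sub>K)) / 2" "u * u - d\<^sub>K * (v * v) = 4"
      using generator_of_trivial_frobenius[OF \<Sigma> \<Omega> deg] .
    have uv: "v = 0" "u = 2 \<or> u = -2" using generic_units[OF dK z(2)] by blast+
    obtain s :: int where s: "s = 1 \<or> s = -1" "\<zeta> = of_int s"
      using uv(2)
    proof
      assume "u = 2"
      then have "\<zeta> = of_int 1" unfolding z(1) uv(1) by simp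
      then show thesis using that by blast
    next
      assume "u = -2"
      then have "\<zeta> = of_int (-1)" unfolding z(1) uv(1) by simp
      then show thesis using that by blast
    qed
    have "of_int (x - s) \<in> \<pp>'" using xy(3) unfolding s(2) by simp
    then have "[x = s] (mod int p)" unfolding int_in_pp' cong_iff_dvd_diff .
    then show ?thesis unfolding good_def using xy(1,2) s(1) by blast
  qed
  assume m: "m > 0" and g: "good m x y"
  have h: "ideal_power K \<pp> m = PIdl\<^bsub>integer_ring K\<^esub> (half_elem d x y)" "half_elem d x y \<in> R"
    "[x = 1] (mod int p) \<or> [x = -1] (mod int p)" using g unfolding good_def by blast+
  show sign: "half_elem d x y - 1 \<in> \<pp>' \<or> half_elem d x y + 1 \<in> \<pp>'"
    using h(3) generator_cong_sign[OF m h(1), of 1] generator_cong_sign[OF m h(1), of "-1"] by auto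
  have "\<exists>\<gamma>. ideal_power K \<pp> m = PIdl\<^bsub>integer_ring K\<^esub> \<gamma> \<and> \<gamma> - 1 \<in> \<pp>'"
    using sign
  proof
    assume "half_elem d x y + 1 \<in> \<pp>'"
    then have "- (half_elem d x y + 1) \<in> \<pp>'" by (rule \<pp>'.Q_closed(6))
    moreover have "PIdl\<^bsub>integer_ring K\<^esub> (- \<gamma>) = PIdl\<^bsub>integer_ring K\<^esub> \<gamma>" for \<gamma>
    proof -
      have "PIdl\<^bsub>integer_ring K\<^esub> (- \<gamma>) \<subseteq> PIdl\<^bsub>integer_ring K\<^esub> \<gamma>" for \<gamma>
      proof
        fix z assume "z \<in> PIdl\<^bsub>integer_ring K\<^esub> (- \<gamma>)"
        then obtain r where r: "r \<in> OI K" "z = r * - \<gamma>" unfolding K.PIdl_eq by blast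
        then have "z = - r * \<gamma>" "- r \<in> OI K" using K.OI_neg by simp_all
        then show "z \<in> PIdl\<^bsub>integer_ring K\<^esub> \<gamma>" unfolding K.PIdl_eq by blast
      qed
      from this[of \<gamma>] this[of "- \<gamma>"] show ?thesis by simp
    qed
    ultimately show ?thesis using h(1) by (intro exI[of _ "- half_elem d x y"]) simp
  qed (use h(1) in blast)
  then show "n \<le> m"
    using min[OF m] ray_frobenius_iff[OF \<Sigma> m] ring_frobenius_iff[OF \<Omega> m] h(1,2) by blast
qed

lemma ray_class_field_mono:
  assumes "ray_class_field K \<mm>\<^sub>1 L" "ray_class_field K \<mm>\<^sub>2 M" "ideal \<mm>\<^sub>1 (integer_ring K)" "ideal \<mm>\<^sub>2 (integer_ring K)" "\<mm>\<^sub>2 \<subseteq> \<mm>\<^sub>1"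
  shows "L \<subseteq> M"
  by (rule class_field_subset[OF K.number_field_axioms assms(1,2)[unfolded ray_class_field_def] assms(3-5)]) (use assms(5) in blast)

lemma ring_class_field_mono:
  assumes "ring_class_field K f\<^sub>1 L" "ring_class_field K (k * f\<^sub>1) M"
  shows "L \<subseteq> M"
proof -
  have sub: "PIdl\<^bsub>integer_ring K\<^esub> (of_nat (k * f\<^sub>1)) \<subseteq> PIdl\<^bsub>integer_ring K\<^esub> (of_nat f\<^sub>1)"
  proof
    fix z assume "z \<in> PIdl\<^bsub>integer_ring K\<^esub> (of_nat (k * f\<^sub>1))"
    then obtain r where r: "r \<in> OI K" "z = r * of_nat (k * f\<^sub>1)" unfolding K.PIdl_eq by blast
    then have "z = (r * of_nat k) * of_nat f\<^sub>1" "r * of_nat k \<in> OI K" using K.OI_mult[OF r(1) K.OI_of_nat] by simp_all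
    then show "z \<in> PIdl\<^bsub>integer_ring K\<^esub> (of_nat f\<^sub>1)" unfolding K.PIdl_eq by blast
  qed
  have "coprime a (int f\<^sub>1)" if "coprime a (int (k * f\<^sub>1))" for a using that by simp
  then show ?thesis
    by (intro class_field_subset[OF K.number_field_axioms assms[unfolded ring_class_field_def] ideal_f ideal_f sub]) (use sub in blast)
qed

lemma residue_degree_inertia_field:
  assumes \<Sigma>: "ray_class_field K \<pp>' \<Sigma>" "ray_class_field K (PIdl\<^bsub>integer_ring K\<^esub> (of_nat p)) \<Sigma>\<^sub>p"
    and \<Omega>: "ring_class_field K f \<Omega>" "ring_class_field K (p * f) \<Omega>\<^sub>p"
    and P: "prime_above K (compositum \<Sigma>\<^sub>p \<Omega>\<^sub>p) \<pp> \<PP>"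
    and Q: "prime_above K (inertia_field K (compositum \<Sigma>\<^sub>p \<Omega>\<^sub>p) \<PP>) \<pp> \<QQ>"
  defines "n \<equiv> residue_degree K (inertia_field K (compositum \<Sigma>\<^sub>p \<Omega>\<^sub>p) \<PP>) \<QQ>"
  shows "n > 0" "frobenius K \<Sigma> \<pp> [^]\<^bsub>gal_group K \<Sigma>\<^esub> n = \<one>\<^bsub>gal_group K \<Sigma>\<^esub>"
    "frobenius K \<Omega> \<pp> [^]\<^bsub>gal_group K \<Omega>\<^esub> n = \<one>\<^bsub>gal_group K \<Omega>\<^esub>"
proof -
  have a: "abelian_ext K \<Sigma>" "abelian_ext K \<Omega>" "abelian_ext K \<Sigma>\<^sub>p" "abelian_ext K \<Omega>\<^sub>p"
    using \<Sigma> \<Omega> by (auto simp only: ray_class_field_def ring_class_field_def intro: abelian_class_field)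
  have ur: "unramified K \<Sigma> \<pp>" "unramified K \<Omega> \<pp>"
    using unramified_class_field[OF _ not_subset(2)] unramified_class_field[OF _ f_not_subset] \<Sigma>(1) \<Omega>(1)
    unfolding ray_class_field_def ring_class_field_def by blast+
  define F where "F = compositum \<Sigma>\<^sub>p \<Omega>\<^sub>p"
  interpret F: abelian_ext K F unfolding F_def by (rule abelian_ext_compositum[OF a(3,4)])
  \<comment> \<open>Inclusion of the moduli: (p) is contained in \<open>\<pp>'\<close>, and p*f is a
    multiple of \<open>f\<close>. So the class fields of \<open>\<pp>'\<close> and of conductor
    \<open>f\<close> lie in the extended field.\<close>
  have "PIdl\<^bsub>integer_ring K\<^esub> (of_nat p) \<subseteq> \<pp>'"
    unfolding K.PIdl_eq using \<pp>'.Q_closed(4)[OF _ p_in(2)] by blast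
  then have "\<Sigma> \<subseteq> \<Sigma>\<^sub>p" by (rule ray_class_field_mono[OF \<Sigma> \<pp>'.ideal_Q ideal_f])
  then have \<Sigma>F: "\<Sigma> \<subseteq> F" unfolding F_def using compositum_superset(1) by blast
  have "\<Omega> \<subseteq> \<Omega>\<^sub>p" by (rule ring_class_field_mono[OF \<Omega>])
  then have \<Omega>F: "\<Omega> \<subseteq> F" unfolding F_def using compositum_superset(2) by blast
  define E where "E = inertia_field K F \<PP>"
  have PF: "prime_above K F \<pp> \<PP>" using P unfolding F_def .
  have QE: "prime_above K E \<pp> \<QQ>" using Q unfolding E_def F_def .
  have n: "n = residue_degree K E \<QQ>" unfolding n_def E_def F_def ..
  interpret E: field_ext K E unfolding E_def by (rule field_ext_inertia_field[OF F.galois_ext_axioms PF])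
  interpret EQ: ext_prime K E \<QQ> by unfold_locales (use QE in \<open>simp add: prime_above_def\<close>)
  show "n > 0" unfolding n by (rule EQ.card_residue_field(2))
  show "frobenius K \<Sigma> \<pp> [^]\<^bsub>gal_group K \<Sigma>\<^esub> n = \<one>\<^bsub>gal_group K \<Sigma>\<^esub>"
    unfolding n using subset_inertia_field[OF a(1) F.galois_ext_axioms \<Sigma>F ur(1) PF]
    by (intro frobenius_pow_residue_degree[OF a(1) E.field_ext_axioms _ split(1) ur(1) QE]) (simp add: E_def)
  show "frobenius K \<Omega> \<pp> [^]\<^bsub>gal_group K \<Omega>\<^esub> n = \<one>\<^bsub>gal_group K \<Omega>\<^esub>"
    unfolding n using subset_inertia_field[OF a(2) F.galois_ext_axioms \<Omega>F ur(2) PF]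
    by (intro frobenius_pow_residue_degree[OF a(2) E.field_ext_axioms _ split(1) ur(2) QE]) (simp add: E_def)
qed

end

section \<open>Units for discriminants -3 and -4\<close>

lemma small_solutions:
  fixes u v :: int
  assumes "u * u + k * (v * v) = 4" "k \<ge> 3"
  shows "u = -2 \<or> u = -1 \<or> u = 0 \<or> u = 1 \<or> u = 2" "v = -1 \<or> v = 0 \<or> v = 1"
proof -
  have kv: "k * (v * v) \<ge> 0" using assms(2) by simp
  have "\<not> \<bar>u\<bar> \<ge> 3"
  proof
    assume "\<bar>u\<bar> \<ge> 3"
    then have "\<bar>u\<bar> * \<bar>u\<bar> \<ge> 3 * 3" by (intro mult_mono) auto
    then show False using assms(1) kv by simp
  qed
  then show "u = -2 \<or> u = -1 \<or> u = 0 \<or> u = 1 \<or> u = 2" by arith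
  have "\<not> \<bar>v\<bar> \<ge> 2"
  proof
    assume "\<bar>v\<bar> \<ge> 2"
    then have "\<bar>v\<bar> * \<bar>v\<bar> \<ge> 2 * 2" by (intro mult_mono) auto
    then have "k * (v * v) \<ge> 3 * 4" using assms(2) by (intro mult_mono) auto
    moreover have "u * u \<ge> 0" by simp
    ultimately show False using assms(1) by linarith
  qed
  then show "v = -1 \<or> v = 0 \<or> v = 1" by arith
qed

text \<open>The equation u^2 + 3*v^2 = 4 has six solutions; they give 1, \<rho>, \<rho>^2 and their
  negatives.\<close>

lemma eisenstein_units:
  assumes "u * u - (-3) * (v * v) = (4::int)"
  shows "\<exists>r::int. (of_int u + of_int v * csqrt (of_int (-3))) / 2 = \<rho> powi r \<or>
    (of_int u + of_int v * csqrt (of_int (-3))) / 2 = - (\<rho> powi r)"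
proof -
  define s where "s = csqrt (-3 :: complex)"
  have ss: "s * s = -3" using power2_csqrt[of "-3"] unfolding s_def power2_eq_square .
  have r: "\<rho> = (- 1 + s) / 2" by (simp add: \<rho>_def s_def)
  have s: "csqrt (of_int (-3)) = s" by (simp add: s_def)
  have "(- 1 + s) * (- 1 + s) = 2 * (- 1 - s)" using ss by (simp add: algebra_simps)
  then have "(- 1 + s) / 2 * ((- 1 + s) / 2) = (- 1 - s) / 2" unfolding times_divide_times_eq by simp
  then have r2: "\<rho> powi 2 = (- 1 - s) / 2" by (simp add: power_int_def power2_eq_square r)
  have sol: "u * u + 3 * (v * v) = 4" using assms by simp
  have "u = -2 \<or> u = -1 \<or> u = 0 \<or> u = 1 \<or> u = 2" "v = -1 \<or> v = 0 \<or> v = 1"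
    using small_solutions[OF sol] by simp_all
  then consider "u = 2" "v = 0" | "u = -2" "v = 0" | "u = -1" "v = 1" | "u = 1" "v = -1" | "u = -1" "v = -1" | "u = 1" "v = 1"
    using sol by auto
  then show ?thesis
  proof cases
    case 1 then show ?thesis by (intro exI[of _ 0]) simp
  next
    case 2 then show ?thesis by (intro exI[of _ 0]) simp
  next
    case 3 then show ?thesis by (intro exI[of _ 1] disjI1) (simp add: r s_def)
  next
    case 4 then show ?thesis by (intro exI[of _ 1] disjI2) (simp add: r s_def minus_divide_left)
  next
    case 5 then show ?thesis unfolding s by (intro exI[of _ 2] disjI1, unfold r2) simp
  next
    case 6 then show ?thesis unfolding s by (intro exI[of _ 2] disjI2, unfold r2) (simp add: minus_divide_left)
  qed
qed

text \<open>The square root of -4 is 2*\<i>, and u^2 + 4*v^2 = 4 has four solutions; they give 1,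
  -1, \<i> and -\<i>, the last as the power with exponent -1.\<close>

lemma gaussian_units:
  assumes "u * u - (-4) * (v * v) = (4::int)"
  shows "\<exists>r::int. (of_int u + of_int v * csqrt (of_int (-4))) / 2 = \<i> powi r"
proof -
  have s: "csqrt (of_int (-4)) = 2 * \<i>"
    by (rule csqrt_unique) (simp_all add: power_mult_distrib)
  have sol: "u * u + 4 * (v * v) = 4" using assms by simp
  have "u = -2 \<or> u = -1 \<or> u = 0 \<or> u = 1 \<or> u = 2" "v = -1 \<or> v = 0 \<or> v = 1"
    using small_solutions[OF sol] by simp_all
  then consider "u = 2" "v = 0" | "u = -2" "v = 0" | "u = 0" "v = 1" | "u = 0" "v = -1"
    using sol by auto
  then show ?thesis unfolding s
  proof cases
    case 1 then show "\<exists>r::int. (of_int u + of_int v * (2 * \<i>)) / 2 = \<i> powi r" by (intro exI[of _ 0]) simp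
  next
    case 2 then show "\<exists>r::int. (of_int u + of_int v * (2 * \<i>)) / 2 = \<i> powi r" by (intro exI[of _ 2]) simp
  next
    case 3 then show "\<exists>r::int. (of_int u + of_int v * (2 * \<i>)) / 2 = \<i> powi r" by (intro exI[of _ 1]) simp
  next
    case 4 then show "\<exists>r::int. (of_int u + of_int v * (2 * \<i>)) / 2 = \<i> powi r"
      by (intro exI[of _ "-1"]) (simp add: power_int_minus)
  qed
qed

theorem theorem7:
  fixes d f p :: nat and d\<^sub>K :: int
    and K R \<pp> \<pp>' \<Sigma>\<^sub>\<pp>\<^sub>' \<Sigma>\<^sub>p \<Omega>\<^sub>f \<Omega>\<^sub>p\<^sub>f :: "complex set"
  assumes K: "K = imag_quadratic_field d"
    and d\<^sub>K: "has_discriminant (carrier (integer_ring K)) d\<^sub>K"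
    and d: "- int d = d\<^sub>K * (int f)\<^sup>2"
    and R: "quadratic_order K R" "has_discriminant R (- int d)"
    and p: "Factorial_Ring.prime p" "odd p" "\<not> p dvd d"
    and split: "prime_of K \<pp>" "prime_of K \<pp>'" "\<pp> \<noteq> \<pp>'"
      "PIdl\<^bsub>integer_ring K\<^esub> (of_nat p) = \<pp> \<cdot>\<^bsub>integer_ring K\<^esub> \<pp>'"
    and ray: "ray_class_field K \<pp>' \<Sigma>\<^sub>\<pp>\<^sub>'" "ray_class_field K (PIdl\<^bsub>integer_ring K\<^esub> (of_nat p)) \<Sigma>\<^sub>p"
    and ring: "ring_class_field K f \<Omega>\<^sub>f" "ring_class_field K (p * f) \<Omega>\<^sub>p\<^sub>f"
  shows
    "(d\<^sub>K \<noteq> -3 \<and> d\<^sub>K \<noteq> -4 \<longrightarrow>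
       (\<forall>\<PP> n. prime_above K (compositum \<Sigma>\<^sub>\<pp>\<^sub>' \<Omega>\<^sub>f) \<pp> \<PP> \<and>
               n = residue_degree K (compositum \<Sigma>\<^sub>\<pp>\<^sub>' \<Omega>\<^sub>f) \<PP> \<longrightarrow>
          (let good = (\<lambda>m x y. ideal_power K \<pp> m = PIdl\<^bsub>integer_ring K\<^esub> (half_elem d x y) \<and>
                          half_elem d x y \<in> R \<and>
                          ([x = 1] (mod int p) \<or> [x = -1] (mod int p)))
           in 0 < n \<and> (\<exists>x y. good n x y) \<and>
              (\<forall>m. 0 < m \<and> (\<exists>x y. good m x y) \<longrightarrow> n \<le> m) \<and>
              (\<forall>x y. good n x y \<longrightarrow> half_elem d x y - 1 \<in> \<pp>' \<or> half_elem d x y + 1 \<in> \<pp>'))))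
     \<and>
     (d\<^sub>K = -3 \<or> d\<^sub>K = -4 \<longrightarrow>
       (\<forall>\<PP> K\<^sub>T \<QQ> n. prime_above K (compositum \<Sigma>\<^sub>p \<Omega>\<^sub>p\<^sub>f) \<pp> \<PP> \<and>
               K\<^sub>T = inertia_field K (compositum \<Sigma>\<^sub>p \<Omega>\<^sub>p\<^sub>f) \<PP> \<and>
               prime_above K K\<^sub>T \<pp> \<QQ> \<and> n = residue_degree K K\<^sub>T \<QQ> \<longrightarrow>
          (\<exists>x y \<zeta>. ideal_power K \<pp> n = PIdl\<^bsub>integer_ring K\<^esub> (half_elem d x y) \<and>
              half_elem d x y \<in> R \<and>
              of_int x - \<zeta> \<in> \<pp>' \<and>
              (d\<^sub>K = -3 \<longrightarrow> (\<exists>r::int. \<zeta> = \<rho> powi r \<or> \<zeta> = - (\<rho> powi r))) \<and>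
              (d\<^sub>K = -4 \<longrightarrow> (\<exists>r::int. \<zeta> = \<i> powi r)))))"
proof -
  interpret split_prime d f p d\<^sub>K K R \<pp> \<pp>'
    by (rule split_prime.intro) (fact assms)+
  show ?thesis
  proof (intro conjI impI allI)
    fix \<PP> n
    assume dK: "d\<^sub>K \<noteq> -3 \<and> d\<^sub>K \<noteq> -4"
      and P: "prime_above K (compositum \<Sigma>\<^sub>\<pp>\<^sub>' \<Omega>\<^sub>f) \<pp> \<PP> \<and> n = residue_degree K (compositum \<Sigma>\<^sub>\<pp>\<^sub>' \<Omega>\<^sub>f) \<PP>"
    note * = residue_degree_generic[OF conjunct1[OF dK] conjunct2[OF dK] ray(1) ring(1) conjunct1[OF P], folded conjunct2[OF P]]
    show "let good = (\<lambda>m x y. ideal_power K \<pp> m = PIdl\<^bsub>integer_ring K\<^esub> (half_elem d x y) \<and> half_elem d x y \<in> R \<and>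
            ([x = 1] (mod int p) \<or> [x = -1] (mod int p)))
      in 0 < n \<and> (\<exists>x y. good n x y) \<and> (\<forall>m. 0 < m \<and> (\<exists>x y. good m x y) \<longrightarrow> n \<le> m) \<and>
         (\<forall>x y. good n x y \<longrightarrow> half_elem d x y - 1 \<in> \<pp>' \<or> half_elem d x y + 1 \<in> \<pp>')"
      unfolding Let_def using *(1,2) *(3) *(4)[OF *(1)] by blast
  next
    fix \<PP> K\<^sub>T \<QQ> n
    assume dK: "d\<^sub>K = -3 \<or> d\<^sub>K = -4"
      and P: "prime_above K (compositum \<Sigma>\<^sub>p \<Omega>\<^sub>p\<^sub>f) \<pp> \<PP> \<and> K\<^sub>T = inertia_field K (compositum \<Sigma>\<^sub>p \<Omega>\<^sub>p\<^sub>f) \<PP> \<and>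
        prime_above K K\<^sub>T \<pp> \<QQ> \<and> n = residue_degree K K\<^sub>T \<QQ>"
    then have P': "prime_above K (compositum \<Sigma>\<^sub>p \<Omega>\<^sub>p\<^sub>f) \<pp> \<PP>"
      "prime_above K (inertia_field K (compositum \<Sigma>\<^sub>p \<Omega>\<^sub>p\<^sub>f) \<PP>) \<pp> \<QQ>"
      and n: "n = residue_degree K (inertia_field K (compositum \<Sigma>\<^sub>p \<Omega>\<^sub>p\<^sub>f) \<PP>) \<QQ>" by blast+
    obtain x y \<zeta> u v where xy: "ideal_power K \<pp> n = PIdl\<^bsub>integer_ring K\<^esub> (half_elem d x y)" "half_elem d x y \<in> R"
      "of_int x - \<zeta> \<in> \<pp>'" and z: "\<zeta> = (of_int u + of_int v * csqrt (of_int d\<^sub>K)) / 2" "u * u - d\<^sub>K * (v * v) = 4"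
      using generator_of_trivial_frobenius[OF ray(1) ring(1) residue_degree_inertia_field[OF ray ring P', folded n]] .
    have "d\<^sub>K = -3 \<longrightarrow> (\<exists>r::int. \<zeta> = \<rho> powi r \<or> \<zeta> = - (\<rho> powi r))"
      using eisenstein_units[of u v] z by blast
    moreover have "d\<^sub>K = -4 \<longrightarrow> (\<exists>r::int. \<zeta> = \<i> powi r)" using gaussian_units[of u v] z by blast
    ultimately show "\<exists>x y \<zeta>. ideal_power K \<pp> n = PIdl\<^bsub>integer_ring K\<^esub> (half_elem d x y) \<and> half_elem d x y \<in> R \<and>
        of_int x - \<zeta> \<in> \<pp>' \<and> (d\<^sub>K = -3 \<longrightarrow> (\<exists>r::int. \<zeta> = \<rho> powi r \<or> \<zeta> = - (\<rho> powi r))) \<and>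
        (d\<^sub>K = -4 \<longrightarrow> (\<exists>r::int. \<zeta> = \<i> powi r))"
      using xy by blast
  qed
qed

end
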